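(* Let $K$ be a field, $q\in K$ a primitive $n$'th root of unity with $n\ge2$, and $\mathcal{B}=K[h^{\pm1}][x^{\pm1};\sigma]$ with $\sigma(h)=qh$. 1. $\mathrm{Prim}(\mathcal{B})=\mathrm{Max}(\mathcal{B})=\{\mathcal{B}\mathfrak{m}\mid\mathfrak{m}\in\mathrm{Max}(Z(\mathcal{B}))\}$. 2. For each $\mathfrak{m}\in\mathrm{Max}(Z(\mathcal{B}))$, the factor algebra $$\mathcal{B}/\mathcal{B}\mathfrak{m}=Q(\mathcal{B}/\mathcal{B}\mathfrak{m})=\bigoplus_{i,j=0}^{n-1}k(\mathfrak{m})h^ix^j\simeq k(\mathfrak{m})\otimes_{Z(\mathcal{B})}\mathcal{B}$$ is a central simple $n^2$-dimensional algebra over the field $k(\mathfrak{m})=Z(\mathcal{B})/\mathfrak{m}$. The algebra $\mathcal{B}/\mathcal{B}\mathfrak{m}$ is isomorphic to the algebra $\mathcal{E}(\mathfrak{m})=(E(s,\mathfrak{m}),\sigma,a)$, where $E(s,\mathfrak{m})=k(\mathfrak{m})[h]/(h^n-s)\simeq k(\mathfrak{m})[h,h^{-1}]/(h^n-s)$, $\sigma(h)=qh$, and $a$ is the image of $t=x^n$ in $k(\mathfrak{m})$. Let $U(\mathfrak{m})$ be a unique (up to isomorphism) simple $\mathcal{E}(\mathfrak{m})$-module. 3. $\widehat{\mathcal{B}}=\{U(\mathfrak{m})\mid\mathfrak{m}\in\mathrm{Max}(Z(\mathcal{B}))\}$. All simple $\mathcal{B}$-modules are finite dimensional (over $K$). 4.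 The map $\widehat{\mathcal{B}}\to\mathrm{Prim}(\mathcal{B})=\mathrm{Max}(\mathcal{B})$, $U\mapsto\mathrm{ann}_{\mathcal{B}}(U)$, is a bijection with inverse $\mathcal{B}\mathfrak{m}\mapsto U(\mathfrak{m})$. 5. For $\mathfrak{m}\in\mathrm{Max}(Z(\mathcal{B}))$, $\mathrm{End}_{\mathcal{B}}(U(\mathfrak{m}))\simeq D(\mathfrak{m})$, where $\mathcal{E}(\mathfrak{m})\simeq M_{n(\mathfrak{m})}(D(\mathfrak{m}))$ for some natural number $n(\mathfrak{m})$ and a division ring $D(\mathfrak{m})$ (endomorphisms are written on the right).
   Context: $\mathcal{B}$ is the skew Laurent polynomial algebra: the $K$-algebra generated by $h^{\pm1},x^{\pm1}$ with $xh=qhx$. Its centre is $Z(\mathcal{B})=K[s^{\pm1},t^{\pm1}]$, $s=h^n$, $t=x^n$. Modules are left modules; $\widehat{\mathcal{B}}$ is the set of isomorphism classes of simple $\mathcal{B}$-modules; $\mathrm{Prim}$ and $\mathrm{Max}$ are the sets of primitive ideals (annihilators of simple modules) and maximal two-sided ideals. $Q(R)$ is the localization of $R$ at the set of its regular elements. For a field $F$ containing $q$ and $s,a\in F$, $(E(s),\sigma,a)$ denotes the $F$-algebra generated by $h,x$ with $xh=qhx$, $h^n=s$, $x^n=a$; in $\mathcal{E}(\mathfrak{m})$, $s$ stands for its image in $k(\mathfrak{m})$. $U(\mathfrak{m})$ is viewed as a $\mathcal{B}$-module via $\mathcal{B}\to\mathcal{B}/\mathcal{B}\mathfrak{m}\simeq\mathcal{E}(\mathfrak{m})$.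 *)

theory Defs
  imports "HOL-Algebra.Algebra"
begin

section \<open>Modules over noncommutative rings\<close>

text \<open>The locale \<^locale>\<open>module\<close> of the library insists on a commutative base ring. Here the
  record type and \<^locale>\<open>submodule\<close> of the library are reused; the fields \<open>mult\<close> and \<open>one\<close> of a
  module record play no role.\<close>

locale left_module = R?: ring R + M?: abelian_group M
  for R :: "('r, 'b) ring_scheme" (structure) and M :: "('r, 'u, 'c) module_scheme" (structure) +
  assumes smult_closed:
      "\<lbrakk>a \<in> carrier R; x \<in> carrier M\<rbrakk> \<Longrightarrow> a \<odot>\<^bsub>M\<^esub> x \<in> carrier M"
    and smult_l_distr:
      "\<lbrakk>a \<in> carrier R; b \<in> carrier R; x \<in> carrier M\<rbrakk> \<Longrightarrow>
        (a \<oplus>\<^bsub>R\<^esub> b) \<odot>\<^bsub>M\<^esub> x = a \<odot>\<^bsub>M\<^esub> x \<oplus>\<^bsub>M\<^esub> b \<odot>\<^bsub>M\<^esub> x"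
    and smult_r_distr:
      "\<lbrakk>a \<in> carrier R; x \<in> carrier M; y \<in> carrier M\<rbrakk> \<Longrightarrow>
        a \<odot>\<^bsub>M\<^esub> (x \<oplus>\<^bsub>M\<^esub> y) = a \<odot>\<^bsub>M\<^esub> x \<oplus>\<^bsub>M\<^esub> a \<odot>\<^bsub>M\<^esub> y"
    and smult_assoc1:
      "\<lbrakk>a \<in> carrier R; b \<in> carrier R; x \<in> carrier M\<rbrakk> \<Longrightarrow>
        (a \<otimes>\<^bsub>R\<^esub> b) \<odot>\<^bsub>M\<^esub> x = a \<odot>\<^bsub>M\<^esub> (b \<odot>\<^bsub>M\<^esub> x)"
    and smult_one:
      "x \<in> carrier M \<Longrightarrow> \<one>\<^bsub>R\<^esub> \<odot>\<^bsub>M\<^esub> x = x"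

definition simple_module :: "('r, 'b) ring_scheme \<Rightarrow> ('r, 'u, 'c) module_scheme \<Rightarrow> bool" where
  "simple_module R M \<longleftrightarrow> left_module R M \<and> carrier M \<noteq> {\<zero>\<^bsub>M\<^esub>} \<and>
     (\<forall>H. submodule H R M \<longrightarrow> H = {\<zero>\<^bsub>M\<^esub>} \<or> H = carrier M)"

definition module_hom ::
  "('r, 'b) ring_scheme \<Rightarrow> ('r, 'u, 'c) module_scheme \<Rightarrow> ('r, 'v, 'd) module_scheme \<Rightarrow> ('u \<Rightarrow> 'v) set"
where
  "module_hom R M N = {f. f \<in> carrier M \<rightarrow> carrier N \<and>
     (\<forall>u\<in>carrier M. \<forall>v\<in>carrier M. f (u \<oplus>\<^bsub>M\<^esub> v) = f u \<oplus>\<^bsub>N\<^esub> f v) \<and>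
     (\<forall>r\<in>carrier R. \<forall>u\<in>carrier M. f (r \<odot>\<^bsub>M\<^esub> u) = r \<odot>\<^bsub>N\<^esub> f u)}"

definition module_isomorphic ::
  "('r, 'b) ring_scheme \<Rightarrow> ('r, 'u, 'c) module_scheme \<Rightarrow> ('r, 'v, 'd) module_scheme \<Rightarrow> bool"
where
  "module_isomorphic R M N \<longleftrightarrow> (\<exists>f\<in>module_hom R M N. bij_betw f (carrier M) (carrier N))"

definition annihilator :: "('r, 'b) ring_scheme \<Rightarrow> ('r, 'u, 'c) module_scheme \<Rightarrow> 'r set" where
  "annihilator R M = {r \<in> carrier R. \<forall>u\<in>carrier M. r \<odot>\<^bsub>M\<^esub> u = \<zero>\<^bsub>M\<^esub>}"

definition restrict_scalars ::
  "('s \<Rightarrow> 'r) \<Rightarrow> ('r, 'u, 'c) module_scheme \<Rightarrow> ('s, 'u) module"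
where
  "restrict_scalars f M = \<lparr>carrier = carrier M, monoid.mult = monoid.mult M, one = \<one>\<^bsub>M\<^esub>,
     ring.zero = \<zero>\<^bsub>M\<^esub>, ring.add = ring.add M, smult = (\<lambda>s u. f s \<odot>\<^bsub>M\<^esub> u)\<rparr>"

definition finite_dimensional :: "('r, 'b) ring_scheme \<Rightarrow> ('r, 'u, 'c) module_scheme \<Rightarrow> bool" where
  "finite_dimensional F M \<longleftrightarrow> (\<exists>S. finite S \<and> S \<subseteq> carrier M \<and>
     (\<forall>u\<in>carrier M. \<exists>c\<in>S \<rightarrow> carrier F. u = (\<Oplus>\<^bsub>M\<^esub>v\<in>S. c v \<odot>\<^bsub>M\<^esub> v)))"

text \<open>Endomorphisms are written on the right: the product of \<open>f\<close> and \<open>g\<close> is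
  ``first \<open>f\<close>, then \<open>g\<close>''.\<close>

definition module_End :: "('r, 'b) ring_scheme \<Rightarrow> ('r, 'u, 'c) module_scheme \<Rightarrow> ('u \<Rightarrow> 'u) ring" where
  "module_End R M = \<lparr>carrier = module_hom R M M \<inter> extensional (carrier M),
     monoid.mult = (\<lambda>f g. compose (carrier M) g f),
     one = (\<lambda>u\<in>carrier M. u),
     ring.zero = (\<lambda>u\<in>carrier M. \<zero>\<^bsub>M\<^esub>),
     ring.add = (\<lambda>f g. \<lambda>u\<in>carrier M. f u \<oplus>\<^bsub>M\<^esub> g u)\<rparr>"

text \<open>Isomorphism classes need a fixed universe of modules. Every simple left \<open>R\<close>-module is
  isomorphic to some \<open>R/L\<close> with \<open>L\<close> a maximal left ideal, whose elements are subsets of \<open>R\<close>;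
  so modules with carrier in \<open>'r set\<close> represent all of them. The class of a module \<open>M\<close> over any
  type is the set of its isomorphic copies in this universe.\<close>

definition iso_class ::
  "('r, 'b) ring_scheme \<Rightarrow> ('r, 'u, 'c) module_scheme \<Rightarrow> ('r, 'r set) module set"
where
  "iso_class R M = {N. left_module R N \<and> module_isomorphic R M N}"

definition simple_classes :: "('r, 'b) ring_scheme \<Rightarrow> ('r, 'r set) module set set" where
  "simple_classes R = {iso_class R M | M :: ('r, 'r set) module. simple_module R M}"

definition class_annihilator :: "('r, 'b) ring_scheme \<Rightarrow> ('r, 'r set) module set \<Rightarrow> 'r set" where
  "class_annihilator R C = (THE I. \<forall>M\<in>C. annihilator R M = I)"

definition Prim :: "('r, 'b) ring_scheme \<Rightarrow> 'r set set" where
  "Prim R = {annihilator R M | M :: ('r, 'r set) module. simple_module R M}"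

text \<open>\<^locale>\<open>ideal\<close> and \<^locale>\<open>maximalideal\<close> are two-sided.\<close>

definition MaxIdeals :: "('r, 'b) ring_scheme \<Rightarrow> 'r set set" where
  "MaxIdeals R = {I. maximalideal I R}"


section \<open>Rings and algebras\<close>

definition ring_center :: "('r, 'b) ring_scheme \<Rightarrow> 'r set" where
  "ring_center R = {z \<in> carrier R. \<forall>r\<in>carrier R. z \<otimes>\<^bsub>R\<^esub> r = r \<otimes>\<^bsub>R\<^esub> z}"

definition simple_ring :: "('r, 'b) ring_scheme \<Rightarrow> bool" where
  "simple_ring R \<longleftrightarrow> ring R \<and> carrier R \<noteq> {\<zero>\<^bsub>R\<^esub>} \<and>
     (\<forall>I. ideal I R \<longrightarrow> I = {\<zero>\<^bsub>R\<^esub>} \<or> I = carrier R)"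

definition is_division_ring :: "('r, 'b) ring_scheme \<Rightarrow> bool" where
  "is_division_ring D \<longleftrightarrow> ring D \<and> \<one>\<^bsub>D\<^esub> \<noteq> \<zero>\<^bsub>D\<^esub> \<and> carrier D - {\<zero>\<^bsub>D\<^esub>} \<subseteq> Units D"

text \<open>An algebra over \<open>F\<close> is a ring \<open>A\<close> together with a structure homomorphism
  \<open>\<phi> : F \<rightarrow> A\<close> with central image.\<close>

definition central_simple_algebra ::
  "('f, 'b) ring_scheme \<Rightarrow> ('f \<Rightarrow> 'r) \<Rightarrow> ('r, 'c) ring_scheme \<Rightarrow> nat \<Rightarrow> bool"
where
  "central_simple_algebra F \<phi> A d \<longleftrightarrow> field F \<and> simple_ring A \<and> \<phi> \<in> ring_hom F A \<and>
     \<phi> ` carrier F = ring_center A \<and> ring.dimension A d (\<phi> ` carrier F) (carrier A)"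

definition alg_iso ::
  "('f, 'b) ring_scheme \<Rightarrow> ('r, 'c) ring_scheme \<Rightarrow> ('f \<Rightarrow> 'r) \<Rightarrow>
   ('s, 'd) ring_scheme \<Rightarrow> ('f \<Rightarrow> 's) \<Rightarrow> ('r \<Rightarrow> 's) set"
where
  "alg_iso F A \<phi> A' \<phi>' = {f \<in> ring_iso A A'. \<forall>c\<in>carrier F. f (\<phi> c) = \<phi>' c}"

definition regular_elements :: "('r, 'b) ring_scheme \<Rightarrow> 'r set" where
  "regular_elements R = {c \<in> carrier R. \<forall>r\<in>carrier R.
     (c \<otimes>\<^bsub>R\<^esub> r = \<zero>\<^bsub>R\<^esub> \<longrightarrow> r = \<zero>\<^bsub>R\<^esub>) \<and> (r \<otimes>\<^bsub>R\<^esub> c = \<zero>\<^bsub>R\<^esub> \<longrightarrow> r = \<zero>\<^bsub>R\<^esub>)}"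

text \<open>\<open>Q\<close> is the (two-sided, Ore) localization of \<open>R\<close> at \<open>S\<close> via the map \<open>loc\<close>. The localization
  is determined up to unique isomorphism; \<open>R = Q(R)\<close> means that \<open>R\<close> with the identity map is the
  localization of \<open>R\<close> at its regular elements.\<close>

definition is_localization ::
  "('r, 'b) ring_scheme \<Rightarrow> 'r set \<Rightarrow> ('s, 'c) ring_scheme \<Rightarrow> ('r \<Rightarrow> 's) \<Rightarrow> bool"
where
  "is_localization R S Q loc \<longleftrightarrow> ring R \<and> ring Q \<and> S \<subseteq> carrier R \<and> loc \<in> ring_hom R Q \<and>
     (\<forall>s\<in>S. loc s \<in> Units Q) \<and>
     (\<forall>y\<in>carrier Q. \<exists>s\<in>S. \<exists>r\<in>carrier R. y = inv\<^bsub>Q\<^esub> (loc s) \<otimes>\<^bsub>Q\<^esub> loc r) \<and>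
     (\<forall>y\<in>carrier Q. \<exists>s\<in>S. \<exists>r\<in>carrier R. y = loc r \<otimes>\<^bsub>Q\<^esub> inv\<^bsub>Q\<^esub> (loc s)) \<and>
     (\<forall>r\<in>carrier R. loc r = \<zero>\<^bsub>Q\<^esub> \<longleftrightarrow> (\<exists>s\<in>S. s \<otimes>\<^bsub>R\<^esub> r = \<zero>\<^bsub>R\<^esub>)) \<and>
     (\<forall>r\<in>carrier R. loc r = \<zero>\<^bsub>Q\<^esub> \<longleftrightarrow> (\<exists>s\<in>S. r \<otimes>\<^bsub>R\<^esub> s = \<zero>\<^bsub>R\<^esub>))"

text \<open>\<open>d \<times> d\<close> matrices, indexed from \<open>0\<close>, with entries outside the index range set to zero.\<close>

definition matrix_ring :: "nat \<Rightarrow> ('r, 'b) ring_scheme \<Rightarrow> (nat \<Rightarrow> nat \<Rightarrow> 'r) ring" where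
  "matrix_ring d D = \<lparr>
     carrier = {A. \<forall>i j. (i < d \<and> j < d \<longrightarrow> A i j \<in> carrier D) \<and>
                         (\<not> (i < d \<and> j < d) \<longrightarrow> A i j = \<zero>\<^bsub>D\<^esub>)},
     monoid.mult = (\<lambda>A B i j. if i < d \<and> j < d then (\<Oplus>\<^bsub>D\<^esub>k\<in>{..<d}. A i k \<otimes>\<^bsub>D\<^esub> B k j) else \<zero>\<^bsub>D\<^esub>),
     one = (\<lambda>i j. if i < d \<and> j = i then \<one>\<^bsub>D\<^esub> else \<zero>\<^bsub>D\<^esub>),
     ring.zero = (\<lambda>i j. \<zero>\<^bsub>D\<^esub>),
     ring.add = (\<lambda>A B i j. if i < d \<and> j < d then A i j \<oplus>\<^bsub>D\<^esub> B i j else \<zero>\<^bsub>D\<^esub>)\<rparr>"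


section \<open>Skew monoid rings\<close>

text \<open>Finite formal sums \<open>\<Sum> r\<^sub>g g\<close> with \<open>g\<close> in a monoid \<open>G\<close>, multiplied by
  \<open>(a g) (b h) = a \<alpha>\<^sub>g(b) gh\<close>. Laurent and skew Laurent polynomials, free algebras and integral monoid
  rings are instances.\<close>

definition skew_monoid_ring ::
  "('r, 'b) ring_scheme \<Rightarrow> ('m, 'c) monoid_scheme \<Rightarrow> ('m \<Rightarrow> 'r \<Rightarrow> 'r) \<Rightarrow> ('m \<Rightarrow> 'r) ring"
where
  "skew_monoid_ring R G \<alpha> = \<lparr>
     carrier = {f. f \<in> carrier G \<rightarrow> carrier R \<and> (\<forall>g. g \<notin> carrier G \<longrightarrow> f g = \<zero>\<^bsub>R\<^esub>) \<and>
                   finite {g. f g \<noteq> \<zero>\<^bsub>R\<^esub>}},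
     monoid.mult = (\<lambda>f f' k.
       \<Oplus>\<^bsub>R\<^esub>p\<in>{(g, h). f g \<noteq> \<zero>\<^bsub>R\<^esub> \<and> f' h \<noteq> \<zero>\<^bsub>R\<^esub> \<and> g \<otimes>\<^bsub>G\<^esub> h = k}.
         f (fst p) \<otimes>\<^bsub>R\<^esub> \<alpha> (fst p) (f' (snd p))),
     one = (\<lambda>g. if g = \<one>\<^bsub>G\<^esub> then \<one>\<^bsub>R\<^esub> else \<zero>\<^bsub>R\<^esub>),
     ring.zero = (\<lambda>g. \<zero>\<^bsub>R\<^esub>),
     ring.add = (\<lambda>f f' g. f g \<oplus>\<^bsub>R\<^esub> f' g)\<rparr>"

abbreviation monoid_ring ::
  "('r, 'b) ring_scheme \<Rightarrow> ('m, 'c) monoid_scheme \<Rightarrow> ('m \<Rightarrow> 'r) ring"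
where
  "monoid_ring R G \<equiv> skew_monoid_ring R G (\<lambda>g r. r)"

definition term_of :: "('r, 'b) ring_scheme \<Rightarrow> 'r \<Rightarrow> 'm \<Rightarrow> 'm \<Rightarrow> 'r" where
  "term_of R r g = (\<lambda>g'. if g' = g then r else \<zero>\<^bsub>R\<^esub>)"

definition laurent :: "('r, 'b) ring_scheme \<Rightarrow> (int \<Rightarrow> 'r) ring" where
  "laurent R = monoid_ring R integer_group"

text \<open>Integer powers of an automorphism \<open>\<sigma>\<close> of the ring \<open>D\<close>.\<close>

definition aut_power :: "('r, 'b) ring_scheme \<Rightarrow> ('r \<Rightarrow> 'r) \<Rightarrow> int \<Rightarrow> 'r \<Rightarrow> 'r" where
  "aut_power D \<sigma> i = (if 0 \<le> i then \<sigma> ^^ nat i else inv_into (carrier D) \<sigma> ^^ nat (- i))"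

text \<open>\<open>D[x\<^sup>\<plusminus>\<^sup>1; \<sigma>]\<close>, with \<open>x d = \<sigma>(d) x\<close>.\<close>

definition skew_laurent :: "('r, 'b) ring_scheme \<Rightarrow> ('r \<Rightarrow> 'r) \<Rightarrow> (int \<Rightarrow> 'r) ring" where
  "skew_laurent D \<sigma> = skew_monoid_ring D integer_group (aut_power D \<sigma>)"

text \<open>The tensor product \<open>A \<otimes>\<^sub>Z A'\<close> of \<open>Z\<close>-algebras with structure maps \<open>\<alpha>\<close> and \<open>\<alpha>'\<close>: the integral
  monoid ring of \<open>A \<times> A'\<close> modulo the usual relations. The additive subgroup spanned by these is
  already an ideal, so additively this is the usual quotient of a free abelian group.\<close>

definition tensor_ideal ::
  "('z, 'b) ring_scheme \<Rightarrow> ('r, 'c) ring_scheme \<Rightarrow> ('z \<Rightarrow> 'r) \<Rightarrow>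
   ('s, 'd) ring_scheme \<Rightarrow> ('z \<Rightarrow> 's) \<Rightarrow> ('r \<times> 's \<Rightarrow> int) set"
where
  "tensor_ideal Z A \<alpha> A' \<alpha>' =
    (let P = monoid_ring \<Z> (A \<times>\<times> A'); e = (\<lambda>a b. term_of \<Z> 1 (a, b)) in
     genideal P
      ({e (a \<oplus>\<^bsub>A\<^esub> a') b \<ominus>\<^bsub>P\<^esub> (e a b \<oplus>\<^bsub>P\<^esub> e a' b) |
          a a' b. a \<in> carrier A \<and> a' \<in> carrier A \<and> b \<in> carrier A'} \<union>
       {e a (b \<oplus>\<^bsub>A'\<^esub> b') \<ominus>\<^bsub>P\<^esub> (e a b \<oplus>\<^bsub>P\<^esub> e a b') |
          a b b'. a \<in> carrier A \<and> b \<in> carrier A' \<and> b' \<in> carrier A'} \<union>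
       {e (a \<otimes>\<^bsub>A\<^esub> \<alpha> z) b \<ominus>\<^bsub>P\<^esub> e a (\<alpha>' z \<otimes>\<^bsub>A'\<^esub> b) |
          a b z. a \<in> carrier A \<and> b \<in> carrier A' \<and> z \<in> carrier Z}))"

definition tensor_algebra ::
  "('z, 'b) ring_scheme \<Rightarrow> ('r, 'c) ring_scheme \<Rightarrow> ('z \<Rightarrow> 'r) \<Rightarrow>
   ('s, 'd) ring_scheme \<Rightarrow> ('z \<Rightarrow> 's) \<Rightarrow> ('r \<times> 's \<Rightarrow> int) set ring"
where
  "tensor_algebra Z A \<alpha> A' \<alpha>' = monoid_ring \<Z> (A \<times>\<times> A') Quot tensor_ideal Z A \<alpha> A' \<alpha>'"

definition pure_tensor ::
  "('z, 'b) ring_scheme \<Rightarrow> ('r, 'c) ring_scheme \<Rightarrow> ('z \<Rightarrow> 'r) \<Rightarrow>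
   ('s, 'd) ring_scheme \<Rightarrow> ('z \<Rightarrow> 's) \<Rightarrow> 'r \<Rightarrow> 's \<Rightarrow> ('r \<times> 's \<Rightarrow> int) set"
where
  "pure_tensor Z A \<alpha> A' \<alpha>' a b =
     tensor_ideal Z A \<alpha> A' \<alpha>' +>\<^bsub>monoid_ring \<Z> (A \<times>\<times> A')\<^esub> term_of \<Z> 1 (a, b)"


section \<open>The algebras \<open>E(s)\<close> and \<open>(E(s), \<sigma>, a)\<close>\<close>

text \<open>\<open>E(s) = F[h]/(h\<^sup>n - s)\<close>\<close>

definition radical_ideal :: "('f, 'b) ring_scheme \<Rightarrow> nat \<Rightarrow> 'f \<Rightarrow> (nat \<Rightarrow> 'f) set" where
  "radical_ideal F n s = genideal (UP F)
     {up_ring.monom (UP F) \<one>\<^bsub>F\<^esub> n \<ominus>\<^bsub>UP F\<^esub> up_ring.monom (UP F) s 0}"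

definition radical_algebra :: "('f, 'b) ring_scheme \<Rightarrow> nat \<Rightarrow> 'f \<Rightarrow> (nat \<Rightarrow> 'f) set ring" where
  "radical_algebra F n s = UP F Quot radical_ideal F n s"

definition radical_scalar :: "('f, 'b) ring_scheme \<Rightarrow> nat \<Rightarrow> 'f \<Rightarrow> 'f \<Rightarrow> (nat \<Rightarrow> 'f) set" where
  "radical_scalar F n s c = radical_ideal F n s +>\<^bsub>UP F\<^esub> up_ring.monom (UP F) c 0"

definition radical_h :: "('f, 'b) ring_scheme \<Rightarrow> nat \<Rightarrow> 'f \<Rightarrow> (nat \<Rightarrow> 'f) set" where
  "radical_h F n s = radical_ideal F n s +>\<^bsub>UP F\<^esub> up_ring.monom (UP F) \<one>\<^bsub>F\<^esub> 1"

text \<open>\<open>F[h, h\<^sup>-\<^sup>1]/(h\<^sup>n - s)\<close>\<close>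

definition laurent_radical_ideal :: "('f, 'b) ring_scheme \<Rightarrow> nat \<Rightarrow> 'f \<Rightarrow> (int \<Rightarrow> 'f) set" where
  "laurent_radical_ideal F n s = genideal (laurent F)
     {term_of F \<one>\<^bsub>F\<^esub> (int n) \<ominus>\<^bsub>laurent F\<^esub> term_of F s 0}"

definition laurent_radical_algebra ::
  "('f, 'b) ring_scheme \<Rightarrow> nat \<Rightarrow> 'f \<Rightarrow> (int \<Rightarrow> 'f) set ring"
where
  "laurent_radical_algebra F n s = laurent F Quot laurent_radical_ideal F n s"

definition laurent_radical_scalar ::
  "('f, 'b) ring_scheme \<Rightarrow> nat \<Rightarrow> 'f \<Rightarrow> 'f \<Rightarrow> (int \<Rightarrow> 'f) set"
where
  "laurent_radical_scalar F n s c = laurent_radical_ideal F n s +>\<^bsub>laurent F\<^esub> term_of F c 0"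

definition laurent_radical_h :: "('f, 'b) ring_scheme \<Rightarrow> nat \<Rightarrow> 'f \<Rightarrow> (int \<Rightarrow> 'f) set" where
  "laurent_radical_h F n s = laurent_radical_ideal F n s +>\<^bsub>laurent F\<^esub> term_of F \<one>\<^bsub>F\<^esub> 1"

text \<open>\<open>(E(s), \<sigma>, a)\<close> by generators and relations: the free \<open>F\<close>-algebra on \<open>h\<close>, \<open>x\<close> modulo
  \<open>xh = qhx\<close>, \<open>h\<^sup>n = s\<close>, \<open>x\<^sup>n = a\<close>.\<close>

datatype gen = Gen_h | Gen_x

definition word_monoid :: "gen list monoid" where
  "word_monoid = \<lparr>carrier = UNIV, monoid.mult = (@), one = []\<rparr>"

definition free_algebra :: "('f, 'b) ring_scheme \<Rightarrow> (gen list \<Rightarrow> 'f) ring" where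
  "free_algebra F = monoid_ring F word_monoid"

definition cyclic_ideal :: "('f, 'b) ring_scheme \<Rightarrow> nat \<Rightarrow> 'f \<Rightarrow> 'f \<Rightarrow> 'f \<Rightarrow> (gen list \<Rightarrow> 'f) set" where
  "cyclic_ideal F n q s a = genideal (free_algebra F)
     {term_of F \<one>\<^bsub>F\<^esub> [Gen_x, Gen_h] \<ominus>\<^bsub>free_algebra F\<^esub> term_of F q [Gen_h, Gen_x],
      term_of F \<one>\<^bsub>F\<^esub> (replicate n Gen_h) \<ominus>\<^bsub>free_algebra F\<^esub> term_of F s [],
      term_of F \<one>\<^bsub>F\<^esub> (replicate n Gen_x) \<ominus>\<^bsub>free_algebra F\<^esub> term_of F a []}"

definition cyclic_algebra ::
  "('f, 'b) ring_scheme \<Rightarrow> nat \<Rightarrow> 'f \<Rightarrow> 'f \<Rightarrow> 'f \<Rightarrow> (gen list \<Rightarrow> 'f) set ring"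
where
  "cyclic_algebra F n q s a = free_algebra F Quot cyclic_ideal F n q s a"

definition cyclic_scalar ::
  "('f, 'b) ring_scheme \<Rightarrow> nat \<Rightarrow> 'f \<Rightarrow> 'f \<Rightarrow> 'f \<Rightarrow> 'f \<Rightarrow> (gen list \<Rightarrow> 'f) set"
where
  "cyclic_scalar F n q s a c = cyclic_ideal F n q s a +>\<^bsub>free_algebra F\<^esub> term_of F c []"

definition cyclic_gen ::
  "('f, 'b) ring_scheme \<Rightarrow> nat \<Rightarrow> 'f \<Rightarrow> 'f \<Rightarrow> 'f \<Rightarrow> gen \<Rightarrow> (gen list \<Rightarrow> 'f) set"
where
  "cyclic_gen F n q s a g = cyclic_ideal F n q s a +>\<^bsub>free_algebra F\<^esub> term_of F \<one>\<^bsub>F\<^esub> [g]"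

text \<open>What the notation \<open>(E(s), \<sigma>, a)\<close> expresses about the algebra \<open>A\<close> above: \<open>\<sigma>\<close> is the
  \<open>F\<close>-automorphism of \<open>E(s)\<close> with \<open>\<sigma>(h) = qh\<close>, and \<open>A = E(s) \<oplus> E(s) x \<oplus> \<dots> \<oplus> E(s) x\<^sup>n\<^sup>-\<^sup>1\<close> with
  \<open>x e = \<sigma>(e) x\<close>, \<open>x\<^sup>n = a\<close>.\<close>

definition is_cyclic_over_radical :: "('f, 'b) ring_scheme \<Rightarrow> nat \<Rightarrow> 'f \<Rightarrow> 'f \<Rightarrow> 'f \<Rightarrow> bool" where
  "is_cyclic_over_radical F n q s a \<longleftrightarrow>
    (let E = radical_algebra F n s; A = cyclic_algebra F n q s a;
         x = cyclic_gen F n q s a Gen_x in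
     \<exists>\<sigma> \<iota>. \<sigma> \<in> alg_iso F E (radical_scalar F n s) E (radical_scalar F n s) \<and>
       \<sigma> (radical_h F n s) = radical_scalar F n s q \<otimes>\<^bsub>E\<^esub> radical_h F n s \<and>
       \<iota> \<in> ring_hom E A \<and> inj_on \<iota> (carrier E) \<and>
       (\<forall>c\<in>carrier F. \<iota> (radical_scalar F n s c) = cyclic_scalar F n q s a c) \<and>
       \<iota> (radical_h F n s) = cyclic_gen F n q s a Gen_h \<and>
       (\<forall>e\<in>carrier E. x \<otimes>\<^bsub>A\<^esub> \<iota> e = \<iota> (\<sigma> e) \<otimes>\<^bsub>A\<^esub> x) \<and>
       x [^]\<^bsub>A\<^esub> n = cyclic_scalar F n q s a a \<and>
       (\<forall>y\<in>carrier A. \<exists>!e. e \<in> {..<n} \<rightarrow>\<^sub>E carrier E \<and>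
          y = (\<Oplus>\<^bsub>A\<^esub>j\<in>{..<n}. \<iota> (e j) \<otimes>\<^bsub>A\<^esub> x [^]\<^bsub>A\<^esub> j)))"


section \<open>The algebra \<open>B = K[h\<^sup>\<plusminus>\<^sup>1][x\<^sup>\<plusminus>\<^sup>1; \<sigma>]\<close>\<close>

definition primitive_root_of_unity :: "('a, 'z) ring_scheme \<Rightarrow> nat \<Rightarrow> 'a \<Rightarrow> bool" where
  "primitive_root_of_unity K n q \<longleftrightarrow> q \<in> carrier K \<and> 0 < n \<and> q [^]\<^bsub>K\<^esub> n = \<one>\<^bsub>K\<^esub> \<and>
     (\<forall>i. 0 < i \<and> i < n \<longrightarrow> q [^]\<^bsub>K\<^esub> i \<noteq> \<one>\<^bsub>K\<^esub>)"

text \<open>The \<open>K\<close>-automorphism \<open>h \<mapsto> qh\<close> of \<open>K[h\<^sup>\<plusminus>\<^sup>1]\<close>, that is, \<open>\<Sum> c\<^sub>j h\<^sup>j \<mapsto> \<Sum> q\<^sup>j c\<^sub>j h\<^sup>j\<close>.\<close>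

definition laurent_sigma :: "('a, 'z) ring_scheme \<Rightarrow> 'a \<Rightarrow> (int \<Rightarrow> 'a) \<Rightarrow> int \<Rightarrow> 'a" where
  "laurent_sigma K q f = (\<lambda>j. q [^]\<^bsub>K\<^esub> j \<otimes>\<^bsub>K\<^esub> f j)"

type_synonym 'a qt = "int \<Rightarrow> int \<Rightarrow> 'a"

definition qt :: "('a, 'z) ring_scheme \<Rightarrow> 'a \<Rightarrow> 'a qt ring" where
  "qt K q = skew_laurent (laurent K) (laurent_sigma K q)"

definition qt_scalar :: "('a, 'z) ring_scheme \<Rightarrow> 'a \<Rightarrow> 'a qt" where
  "qt_scalar K c = term_of (laurent K) (term_of K c 0) 0"

definition qt_h :: "('a, 'z) ring_scheme \<Rightarrow> 'a qt" where
  "qt_h K = term_of (laurent K) (term_of K \<one>\<^bsub>K\<^esub> 1) 0"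

definition qt_x :: "('a, 'z) ring_scheme \<Rightarrow> 'a qt" where
  "qt_x K = term_of (laurent K) \<one>\<^bsub>laurent K\<^esub> 1"

definition qtZ :: "('a, 'z) ring_scheme \<Rightarrow> 'a \<Rightarrow> 'a qt ring" where
  "qtZ K q = (qt K q) \<lparr>carrier := ring_center (qt K q)\<rparr>"

text \<open>\<open>k(m) = Z(B)/m\<close>\<close>

definition residue_field :: "('a, 'z) ring_scheme \<Rightarrow> 'a \<Rightarrow> 'a qt set \<Rightarrow> 'a qt set ring" where
  "residue_field K q m = qtZ K q Quot m"

definition residue :: "('a, 'z) ring_scheme \<Rightarrow> 'a \<Rightarrow> 'a qt set \<Rightarrow> 'a qt \<Rightarrow> 'a qt set" where
  "residue K q m z = m +>\<^bsub>qtZ K q\<^esub> z"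

text \<open>\<open>B m\<close>: the finite sums of products \<open>b z\<close> with \<open>b \<in> B\<close> and \<open>z \<in> m\<close>.\<close>

definition qtBm :: "('a, 'z) ring_scheme \<Rightarrow> 'a \<Rightarrow> 'a qt set \<Rightarrow> 'a qt set" where
  "qtBm K q m = ideal_prod (qt K q) (carrier (qt K q)) m"

definition qt_factor :: "('a, 'z) ring_scheme \<Rightarrow> 'a \<Rightarrow> 'a qt set \<Rightarrow> 'a qt set ring" where
  "qt_factor K q m = qt K q Quot qtBm K q m"

definition qt_proj :: "('a, 'z) ring_scheme \<Rightarrow> 'a \<Rightarrow> 'a qt set \<Rightarrow> 'a qt \<Rightarrow> 'a qt set" where
  "qt_proj K q m b = qtBm K q m +>\<^bsub>qt K q\<^esub> b"

text \<open>The structure map \<open>k(m) \<rightarrow> B/Bm\<close>: as a sum of subsets of \<open>B\<close>, \<open>Bm + (z + m)\<close> is the coset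
  \<open>z + Bm\<close>.\<close>

definition factor_scalar :: "('a, 'z) ring_scheme \<Rightarrow> 'a \<Rightarrow> 'a qt set \<Rightarrow> 'a qt set \<Rightarrow> 'a qt set" where
  "factor_scalar K q m c = qtBm K q m <+>\<^bsub>qt K q\<^esub> c"

abbreviation residue_q :: "('a, 'z) ring_scheme \<Rightarrow> 'a \<Rightarrow> 'a qt set \<Rightarrow> 'a qt set" where
  "residue_q K q m \<equiv> residue K q m (qt_scalar K q)"

abbreviation residue_s :: "('a, 'z) ring_scheme \<Rightarrow> 'a \<Rightarrow> nat \<Rightarrow> 'a qt set \<Rightarrow> 'a qt set" where
  "residue_s K q n m \<equiv> residue K q m (qt_h K [^]\<^bsub>qt K q\<^esub> n)"

abbreviation residue_t :: "('a, 'z) ring_scheme \<Rightarrow> 'a \<Rightarrow> nat \<Rightarrow> 'a qt set \<Rightarrow> 'a qt set" where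
  "residue_t K q n m \<equiv> residue K q m (qt_x K [^]\<^bsub>qt K q\<^esub> n)"

definition qtE ::
  "('a, 'z) ring_scheme \<Rightarrow> 'a \<Rightarrow> nat \<Rightarrow> 'a qt set \<Rightarrow> (gen list \<Rightarrow> 'a qt set) set ring"
where
  "qtE K q n m = cyclic_algebra (residue_field K q m) n
     (residue_q K q m) (residue_s K q n m) (residue_t K q n m)"

definition qtE_scalar ::
  "('a, 'z) ring_scheme \<Rightarrow> 'a \<Rightarrow> nat \<Rightarrow> 'a qt set \<Rightarrow> 'a qt set \<Rightarrow> (gen list \<Rightarrow> 'a qt set) set"
where
  "qtE_scalar K q n m = cyclic_scalar (residue_field K q m) n
     (residue_q K q m) (residue_s K q n m) (residue_t K q n m)"

definition qtE_gen ::
  "('a, 'z) ring_scheme \<Rightarrow> 'a \<Rightarrow> nat \<Rightarrow> 'a qt set \<Rightarrow> gen \<Rightarrow> (gen list \<Rightarrow> 'a qt set) set"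
where
  "qtE_gen K q n m = cyclic_gen (residue_field K q m) n
     (residue_q K q m) (residue_s K q n m) (residue_t K q n m)"

text \<open>The isomorphisms \<open>B/Bm \<simeq> E(m)\<close> of \<open>k(m)\<close>-algebras with \<open>h \<mapsto> h\<close> and \<open>x \<mapsto> x\<close>.\<close>

definition canonical_isos ::
  "('a, 'z) ring_scheme \<Rightarrow> 'a \<Rightarrow> nat \<Rightarrow> 'a qt set \<Rightarrow> ('a qt set \<Rightarrow> (gen list \<Rightarrow> 'a qt set) set) set"
where
  "canonical_isos K q n m = {\<psi> \<in> alg_iso (residue_field K q m)
       (qt_factor K q m) (factor_scalar K q m) (qtE K q n m) (qtE_scalar K q n m).
     \<psi> (qt_proj K q m (qt_h K)) = qtE_gen K q n m Gen_h \<and>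
     \<psi> (qt_proj K q m (qt_x K)) = qtE_gen K q n m Gen_x}"

text \<open>An \<open>E(m)\<close>-module viewed as a \<open>B\<close>-module via \<open>B \<rightarrow> B/Bm \<simeq> E(m)\<close>.\<close>

definition as_qt_module ::
  "('a, 'z) ring_scheme \<Rightarrow> 'a \<Rightarrow> 'a qt set \<Rightarrow> ('a qt set \<Rightarrow> 'e) \<Rightarrow>
   ('e, 'u, 'c) module_scheme \<Rightarrow> ('a qt, 'u) module"
where
  "as_qt_module K q m \<psi> U = restrict_scalars (\<lambda>b. \<psi> (qt_proj K q m b)) U"

end

theory Submission
  imports Defs
begin

text \<open>Conjugation by \<open>h\<close> and \<open>x\<close> multiplies the monomials \<open>h\<^sup>i x\<^sup>j\<close> by powers of \<open>q\<close>, so a two-sided ideal of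
  \<open>B\<close> contains the central components of its elements; hence \<open>J \<mapsto> BJ\<close> is a bijection from the ideals of
  the centre \<open>Z\<close> to those of \<open>B\<close>. The factor \<open>B/Bm\<close> is therefore simple, and it is Artinian, having the
  basis \<open>h\<^sup>i x\<^sup>j\<close> with \<open>i, j < n\<close> over \<open>k(m)\<close>; the Wedderburn theory of simple Artinian rings describes its
  modules.

  Let \<open>M\<close> be a simple \<open>B\<close>-module and \<open>p = ann(M) \<inter> Z\<close>. An element of \<open>Z - p\<close> maps \<open>M\<close> onto \<open>M\<close>, and \<open>M\<close> is
  finitely generated over \<open>Z\<close>, so \<open>p\<close> is maximal by Nakayama's lemma, and nonzero. That \<open>M\<close> is finite
  dimensional is proved in the style of Noether normalization. If a linear form \<open>ki + j\<close> is injective on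
  the exponents of a nonzero \<open>P \<in> p\<close>, then \<open>P\<close> rewrites every monomial into a strip \<open>0 \<le> ki + j < N\<close>, and
  \<open>M\<close> is finitely generated over \<open>K[y\<^sup>\<plusminus>\<^sup>1]\<close>, where \<open>y = h\<^sup>n x\<^sup>-\<^sup>n\<^sup>k\<close>. By Nakayama's lemma, applied to the nonunit
  \<open>1 + y\<close>, some nonzero Laurent polynomial in \<open>y\<close> lies in \<open>p\<close>; it rewrites the strip into a finite set.\<close>

section \<open>Skew monoid rings\<close>

text \<open>As K need not be algebraically closed, eigenvectors of h and x are not at hand, and the
  finiteness of k(m) over K has to be proved; the rewriting argument does the work of the
  Nullstellensatz. The element 1 + y is fed to Nakayama's lemma because a relation 1 + az is
  worthless if it can be zero: this happens for a monomial z, which is a unit, but not for the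
  nonunit 1 + y. Rings given by generators and relations (E(m), the tensor product, the two forms of
  k(m)[h]/(h^n - s)) pose another obstacle: the relations only show that the expected monomials
  span. Independence is proved once, in B/Bm, by projecting B onto its centre. Each presented ring
  is then mapped to B/Bm, directly or through another one, by its universal property. Its spanning
  set goes to independent elements, which makes the map injective and the spanning set a
  basis.\<close>

locale skew_monoid = R?: ring R + G: monoid G
  for R :: "('r, 'b) ring_scheme" (structure) and G :: "('m, 'c) monoid_scheme" +
  fixes \<alpha> :: "'m \<Rightarrow> 'r \<Rightarrow> 'r"
  assumes act_hom: "g \<in> carrier G \<Longrightarrow> \<alpha> g \<in> ring_hom R R"
    and act_one: "r \<in> carrier R \<Longrightarrow> \<alpha> \<one>\<^bsub>G\<^esub> r = r"
    and act_mult: "\<lbrakk>g \<in> carrier G; h \<in> carrier G; r \<in> carrier R\<rbrakk> \<Longrightarrow> \<alpha> (g \<otimes>\<^bsub>G\<^esub> h) r = \<alpha> g (\<alpha> h r)"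
begin

abbreviation "S \<equiv> skew_monoid_ring R G \<alpha>"
abbreviation "T \<equiv> term_of R"

lemma S_carrier: "f \<in> carrier S \<longleftrightarrow> f \<in> carrier G \<rightarrow> carrier R \<and> (\<forall>g. g \<notin> carrier G \<longrightarrow> f g = \<zero>)
    \<and> finite {g. f g \<noteq> \<zero>}"
  by (simp add: skew_monoid_ring_def)

lemma S_zero: "\<zero>\<^bsub>S\<^esub> = (\<lambda>g. \<zero>)"
  and S_add: "f \<oplus>\<^bsub>S\<^esub> f' = (\<lambda>g. f g \<oplus> f' g)"
  and S_one: "\<one>\<^bsub>S\<^esub> = T \<one> \<one>\<^bsub>G\<^esub>"
  by (auto simp: skew_monoid_ring_def term_of_def)

lemma S_coeff [simp]: "f \<in> carrier S \<Longrightarrow> f g \<in> carrier R"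
  by (cases "g \<in> carrier G") (auto simp: S_carrier)

lemma S_supp: "f \<in> carrier S \<Longrightarrow> {g. f g \<noteq> \<zero>} \<subseteq> carrier G"
  by (auto simp: S_carrier)

lemma S_finite: "f \<in> carrier S \<Longrightarrow> finite {g. f g \<noteq> \<zero>}"
  by (simp add: S_carrier)

lemma T_closed [simp]: "r \<in> carrier R \<Longrightarrow> g \<in> carrier G \<Longrightarrow> T r g \<in> carrier S"
  by (auto simp: S_carrier term_of_def intro: finite_subset[of _ "{g}"])

lemma S_add_closed:
  assumes "f \<in> carrier S" "f' \<in> carrier S" shows "f \<oplus>\<^bsub>S\<^esub> f' \<in> carrier S"
proof -
  have "finite {g. f g \<oplus> f' g \<noteq> \<zero>}"
    by (rule finite_subset[OF _ finite_UnI[OF S_finite[OF assms(1)] S_finite[OF assms(2)]]]) auto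
  then show ?thesis using assms by (auto simp: S_carrier S_add)
qed

lemma S_abelian_group: "abelian_group S"
proof (rule abelian_groupI)
  fix f assume f: "f \<in> carrier S"
  have "(\<lambda>g. \<ominus> f g) \<in> carrier S"
    using f by (auto simp: S_carrier elim!: rev_finite_subset)
  moreover have "(\<lambda>g. \<ominus> f g) \<oplus>\<^bsub>S\<^esub> f = \<zero>\<^bsub>S\<^esub>"
    using f by (auto simp: S_add S_zero R.l_neg)
  ultimately show "\<exists>y\<in>carrier S. y \<oplus>\<^bsub>S\<^esub> f = \<zero>\<^bsub>S\<^esub>" by blast
qed (auto simp: S_add_closed, auto simp: S_add S_zero R.a_ac S_carrier[of "\<lambda>g. \<zero>"])

text \<open>Induction on the finite support: clearing one coefficient leaves a smaller one. The
  premise \<open>f g = \<zero>\<close> records that the added term meets nothing in f, so nothing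
  cancels and conditions on the support of the sum pass to f.\<close>

lemma S_term_induct [consumes 1, case_names zero add]:
  assumes "f \<in> carrier S" and "P \<zero>\<^bsub>S\<^esub>"
    and step: "\<And>r g f. \<lbrakk>r \<in> carrier R; r \<noteq> \<zero>; g \<in> carrier G; f \<in> carrier S; f g = \<zero>; P f\<rbrakk> \<Longrightarrow> P (T r g \<oplus>\<^bsub>S\<^esub> f)"
  shows "P f"
proof -
  have "\<forall>f. f \<in> carrier S \<and> {g. f g \<noteq> \<zero>} = A \<longrightarrow> P f" if "finite A" for A using that
  proof (induction A)
    case empty
    then show ?case using assms(2) by (auto simp: S_zero fun_eq_iff[symmetric])
  next
    case (insert a A)
    show ?case
    proof (intro allI impI, elim conjE)
      fix f assume f: "f \<in> carrier S" "{g. f g \<noteq> \<zero>} = insert a A"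
      let ?f = "f(a := \<zero>)"
      have a: "a \<in> carrier G" "f a \<noteq> \<zero>" using f S_supp by blast+
      have "{g. ?f g \<noteq> \<zero>} = A" using f(2) insert(2) by auto
      moreover have "?f \<in> carrier S" using f(1) insert(1) calculation by (auto simp: S_carrier)
      ultimately have "P (T (f a) a \<oplus>\<^bsub>S\<^esub> ?f)"
        using insert.IH f(1) a by (intro step) auto
      moreover have "T (f a) a \<oplus>\<^bsub>S\<^esub> ?f = f"
        using f(1) by (auto simp: S_add term_of_def)
      ultimately show "P f" by simp
    qed
  qed
  then show ?thesis using assms(1) S_finite by blast
qed

text \<open>The product is defined by a sum over those pairs in the supports that multiply to k, an
  index set that varies with both factors. Over a fixed rectangle A x B, with zero for the other
  pairs, sums for different factors share their index set and distributivity becomes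
  termwise.\<close>

lemma S_mult:
  assumes f: "f \<in> carrier S" "f' \<in> carrier S"
    and A: "finite A" "{g. f g \<noteq> \<zero>} \<subseteq> A" "A \<subseteq> carrier G"
    and B: "finite B" "{g. f' g \<noteq> \<zero>} \<subseteq> B" "B \<subseteq> carrier G"
  shows "(f \<otimes>\<^bsub>S\<^esub> f') k =
    (\<Oplus>p\<in>A \<times> B. if fst p \<otimes>\<^bsub>G\<^esub> snd p = k then f (fst p) \<otimes> \<alpha> (fst p) (f' (snd p)) else \<zero>)"
proof -
  have act: "\<alpha> g r \<in> carrier R" if "g \<in> A" "r \<in> carrier R" for g r
    using act_hom that A by (auto intro: ring_hom_closed)
  have act0: "\<alpha> g \<zero> = \<zero>" if "g \<in> A" for g
    using ring_hom_zero[OF act_hom R.ring_axioms R.ring_axioms] that A by blast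
  have "(f \<otimes>\<^bsub>S\<^esub> f') k = (\<Oplus>p\<in>{(g, h). f g \<noteq> \<zero> \<and> f' h \<noteq> \<zero> \<and> g \<otimes>\<^bsub>G\<^esub> h = k}.
         f (fst p) \<otimes> \<alpha> (fst p) (f' (snd p)))"
    unfolding skew_monoid_ring_def monoid.select_convs ..
  also have "\<dots> = (\<Oplus>p\<in>A \<times> B. if fst p \<otimes>\<^bsub>G\<^esub> snd p = k then f (fst p) \<otimes> \<alpha> (fst p) (f' (snd p)) else \<zero>)"
  proof (rule R.add.finprod_mono_neutral_cong_left)
    have c: "f (fst p) \<otimes> \<alpha> (fst p) (f' (snd p)) \<in> carrier R" if "p \<in> A \<times> B" for p
      using that act f by auto
    then show "(\<lambda>p. if fst p \<otimes>\<^bsub>G\<^esub> snd p = k then f (fst p) \<otimes> \<alpha> (fst p) (f' (snd p)) else \<zero>) \<in> A \<times> B \<rightarrow> carrier R"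
      by simp
    have "f (fst p) \<otimes> \<alpha> (fst p) (f' (snd p)) = \<zero>" if "p \<in> A \<times> B" "f (fst p) = \<zero> \<or> f' (snd p) = \<zero>" for p
      using that act f act0 by (metis R.l_null R.r_null S_coeff mem_Times_iff)
    then show "(if fst p \<otimes>\<^bsub>G\<^esub> snd p = k then f (fst p) \<otimes> \<alpha> (fst p) (f' (snd p)) else \<zero>) = \<zero>"
      if "p \<in> A \<times> B - {(g, h). f g \<noteq> \<zero> \<and> f' h \<noteq> \<zero> \<and> g \<otimes>\<^bsub>G\<^esub> h = k}" for p
      using that by (auto simp: f act act0)
  qed (use A B in auto)
  finally show ?thesis .
qed

lemma S_mult_closed:
  assumes f: "f \<in> carrier S" "f' \<in> carrier S" shows "f \<otimes>\<^bsub>S\<^esub> f' \<in> carrier S"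
proof -
  let ?A = "{g. f g \<noteq> \<zero>}" and ?B = "{g. f' g \<noteq> \<zero>}"
  have act: "\<alpha> g r \<in> carrier R" if "g \<in> ?A" "r \<in> carrier R" for g r
    using act_hom that S_supp[OF f(1)] by (blast intro: ring_hom_closed)
  have eq: "(f \<otimes>\<^bsub>S\<^esub> f') k = (\<Oplus>p\<in>?A \<times> ?B. if fst p \<otimes>\<^bsub>G\<^esub> snd p = k then f (fst p) \<otimes> \<alpha> (fst p) (f' (snd p)) else \<zero>)" for k
    using f by (intro S_mult) (auto simp: S_finite S_supp)
  have 1: "(f \<otimes>\<^bsub>S\<^esub> f') k \<in> carrier R" for k
    unfolding eq using f act by (intro R.finsum_closed) auto
  have 2: "(f \<otimes>\<^bsub>S\<^esub> f') k = \<zero>" if "k \<notin> (\<lambda>p. fst p \<otimes>\<^bsub>G\<^esub> snd p) ` (?A \<times> ?B)" for k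
    unfolding eq using that by (intro R.add.finprod_one_eqI) auto
  have 3: "(\<lambda>p. fst p \<otimes>\<^bsub>G\<^esub> snd p) ` (?A \<times> ?B) \<subseteq> carrier G"
    using S_supp[OF f(1)] S_supp[OF f(2)] by force
  have "finite ((\<lambda>p. fst p \<otimes>\<^bsub>G\<^esub> snd p) ` (?A \<times> ?B))"
    using S_finite[OF f(1)] S_finite[OF f(2)] by simp
  then have "finite {k. (f \<otimes>\<^bsub>S\<^esub> f') k \<noteq> \<zero>}" by (rule rev_finite_subset) (use 2 in blast)
  then show ?thesis unfolding S_carrier using 1 2 3 by blast
qed

lemma T_mult:
  assumes "r \<in> carrier R" "s \<in> carrier R" "g \<in> carrier G" "h \<in> carrier G"
  shows "T r g \<otimes>\<^bsub>S\<^esub> T s h = T (r \<otimes> \<alpha> g s) (g \<otimes>\<^bsub>G\<^esub> h)"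
proof
  fix k
  have "\<alpha> g s \<in> carrier R" using assms act_hom by (blast intro: ring_hom_closed)
  then show "(T r g \<otimes>\<^bsub>S\<^esub> T s h) k = T (r \<otimes> \<alpha> g s) (g \<otimes>\<^bsub>G\<^esub> h) k"
    using assms by (subst S_mult[where A = "{g}" and B = "{h}", OF T_closed T_closed])
      (auto simp: term_of_def)
qed

lemma S_distr:
  assumes f: "f \<in> carrier S" "f' \<in> carrier S" "f'' \<in> carrier S"
  shows "(f \<oplus>\<^bsub>S\<^esub> f') \<otimes>\<^bsub>S\<^esub> f'' = f \<otimes>\<^bsub>S\<^esub> f'' \<oplus>\<^bsub>S\<^esub> f' \<otimes>\<^bsub>S\<^esub> f''"
    and "f'' \<otimes>\<^bsub>S\<^esub> (f \<oplus>\<^bsub>S\<^esub> f') = f'' \<otimes>\<^bsub>S\<^esub> f \<oplus>\<^bsub>S\<^esub> f'' \<otimes>\<^bsub>S\<^esub> f'"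
proof -
  let ?A = "{g. f g \<noteq> \<zero>} \<union> {g. f' g \<noteq> \<zero>}" and ?B = "{g. f'' g \<noteq> \<zero>}"
  have A: "finite ?A" "?A \<subseteq> carrier G" "{g. (f \<oplus>\<^bsub>S\<^esub> f') g \<noteq> \<zero>} \<subseteq> ?A" "{g. f g \<noteq> \<zero>} \<subseteq> ?A" "{g. f' g \<noteq> \<zero>} \<subseteq> ?A"
    using f S_supp S_finite by (auto simp: S_add)
  have B: "finite ?B" "?B \<subseteq> carrier G" using f S_supp S_finite by auto
  have act: "\<alpha> g r \<in> carrier R" if "g \<in> carrier G" "r \<in> carrier R" for g r
    using act_hom that by (auto intro: ring_hom_closed)
  show "(f \<oplus>\<^bsub>S\<^esub> f') \<otimes>\<^bsub>S\<^esub> f'' = f \<otimes>\<^bsub>S\<^esub> f'' \<oplus>\<^bsub>S\<^esub> f' \<otimes>\<^bsub>S\<^esub> f''"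
  proof
    fix k
    have c: "(\<lambda>p. if fst p \<otimes>\<^bsub>G\<^esub> snd p = k then u (fst p) \<otimes> \<alpha> (fst p) (f'' (snd p)) else \<zero>)
        \<in> ?A \<times> ?B \<rightarrow> carrier R" if "u \<in> carrier S" for u
      using that f A(2) by (intro funcsetI) (auto intro!: R.m_closed act)
    have "((f \<oplus>\<^bsub>S\<^esub> f') \<otimes>\<^bsub>S\<^esub> f'') k = (\<Oplus>p\<in>?A \<times> ?B. (if fst p \<otimes>\<^bsub>G\<^esub> snd p = k then f (fst p) \<otimes> \<alpha> (fst p) (f'' (snd p)) else \<zero>)
      \<oplus> (if fst p \<otimes>\<^bsub>G\<^esub> snd p = k then f' (fst p) \<otimes> \<alpha> (fst p) (f'' (snd p)) else \<zero>))"
      unfolding S_mult[OF S_add_closed[OF f(1,2)] f(3) A(1,3,2) B(1) order.refl B(2)]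
      using f act A(2) by (intro R.finsum_cong') (auto simp: S_add R.l_distr subset_iff)
    also have "\<dots> = (f \<otimes>\<^bsub>S\<^esub> f'' \<oplus>\<^bsub>S\<^esub> f' \<otimes>\<^bsub>S\<^esub> f'') k"
      unfolding R.finsum_addf[OF c[OF f(1)] c[OF f(2)]] S_add
        S_mult[OF f(1,3) A(1,4,2) B(1) order.refl B(2)] S_mult[OF f(2,3) A(1,5,2) B(1) order.refl B(2)] ..
    finally show "((f \<oplus>\<^bsub>S\<^esub> f') \<otimes>\<^bsub>S\<^esub> f'') k = (f \<otimes>\<^bsub>S\<^esub> f'' \<oplus>\<^bsub>S\<^esub> f' \<otimes>\<^bsub>S\<^esub> f'') k" .
  qed
  show "f'' \<otimes>\<^bsub>S\<^esub> (f \<oplus>\<^bsub>S\<^esub> f') = f'' \<otimes>\<^bsub>S\<^esub> f \<oplus>\<^bsub>S\<^esub> f'' \<otimes>\<^bsub>S\<^esub> f'"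
  proof
    fix k
    have c: "(\<lambda>p. if fst p \<otimes>\<^bsub>G\<^esub> snd p = k then f'' (fst p) \<otimes> \<alpha> (fst p) (u (snd p)) else \<zero>)
        \<in> ?B \<times> ?A \<rightarrow> carrier R" if "u \<in> carrier S" for u
      using that f B(2) by (intro funcsetI) (auto intro!: R.m_closed act)
    have add: "\<alpha> g (r \<oplus> s) = \<alpha> g r \<oplus> \<alpha> g s" if "g \<in> ?B" "r \<in> carrier R" "s \<in> carrier R" for g r s
      using ring_hom_add[OF act_hom] that B(2) by auto
    have "(f'' \<otimes>\<^bsub>S\<^esub> (f \<oplus>\<^bsub>S\<^esub> f')) k = (\<Oplus>p\<in>?B \<times> ?A. (if fst p \<otimes>\<^bsub>G\<^esub> snd p = k then f'' (fst p) \<otimes> \<alpha> (fst p) (f (snd p)) else \<zero>)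
      \<oplus> (if fst p \<otimes>\<^bsub>G\<^esub> snd p = k then f'' (fst p) \<otimes> \<alpha> (fst p) (f' (snd p)) else \<zero>))"
      unfolding S_mult[OF f(3) S_add_closed[OF f(1,2)] B(1) order.refl B(2) A(1,3,2)]
      using f act B(2) by (intro R.finsum_cong') (auto simp: S_add R.r_distr subset_iff add)
    also have "\<dots> = (f'' \<otimes>\<^bsub>S\<^esub> f \<oplus>\<^bsub>S\<^esub> f'' \<otimes>\<^bsub>S\<^esub> f') k"
      unfolding R.finsum_addf[OF c[OF f(1)] c[OF f(2)]] S_add
        S_mult[OF f(3,1) B(1) order.refl B(2) A(1,4,2)] S_mult[OF f(3,2) B(1) order.refl B(2) A(1,5,2)] ..
    finally show "(f'' \<otimes>\<^bsub>S\<^esub> (f \<oplus>\<^bsub>S\<^esub> f')) k = (f'' \<otimes>\<^bsub>S\<^esub> f \<oplus>\<^bsub>S\<^esub> f'' \<otimes>\<^bsub>S\<^esub> f') k" .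
  qed
qed

lemma S_null:
  assumes "f \<in> carrier S"
  shows "\<zero>\<^bsub>S\<^esub> \<otimes>\<^bsub>S\<^esub> f = \<zero>\<^bsub>S\<^esub>" "f \<otimes>\<^bsub>S\<^esub> \<zero>\<^bsub>S\<^esub> = \<zero>\<^bsub>S\<^esub>"
proof -
  have 0: "\<zero>\<^bsub>S\<^esub> \<in> carrier S" by (auto simp: S_carrier S_zero)
  note f = S_finite[OF assms] order.refl S_supp[OF assms]
  show "\<zero>\<^bsub>S\<^esub> \<otimes>\<^bsub>S\<^esub> f = \<zero>\<^bsub>S\<^esub>"
    by (intro ext, subst S_mult[OF 0 assms finite.emptyI _ empty_subsetI f]) (simp_all add: S_zero)
  show "f \<otimes>\<^bsub>S\<^esub> \<zero>\<^bsub>S\<^esub> = \<zero>\<^bsub>S\<^esub>"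
    by (intro ext, subst S_mult[OF assms 0 f finite.emptyI _ empty_subsetI]) (simp_all add: S_zero)
qed

text \<open>Both sides are additive in each argument, so three nested inductions reduce the claim to
  single terms. There it combines associativity in R and in G with the action being by ring
  homomorphisms and multiplicative in G.\<close>

lemma S_assoc:
  assumes "f \<in> carrier S" "f' \<in> carrier S" "f'' \<in> carrier S"
  shows "(f \<otimes>\<^bsub>S\<^esub> f') \<otimes>\<^bsub>S\<^esub> f'' = f \<otimes>\<^bsub>S\<^esub> (f' \<otimes>\<^bsub>S\<^esub> f'')"
  using assms(1)
proof (induction f rule: S_term_induct)
  case zero
  then show ?case using assms by (simp add: S_null S_mult_closed)
next
  case (add r g f)
  have "(T r g \<otimes>\<^bsub>S\<^esub> f') \<otimes>\<^bsub>S\<^esub> f'' = T r g \<otimes>\<^bsub>S\<^esub> (f' \<otimes>\<^bsub>S\<^esub> f'')"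
    using assms(2)
  proof (induction f' rule: S_term_induct)
    case zero
    then show ?case using add(1-3) assms by (simp add: S_null S_mult_closed)
  next
    case a2: (add s h f')
    have "(T r g \<otimes>\<^bsub>S\<^esub> T s h) \<otimes>\<^bsub>S\<^esub> f'' = T r g \<otimes>\<^bsub>S\<^esub> (T s h \<otimes>\<^bsub>S\<^esub> f'')"
      using assms(3)
    proof (induction f'' rule: S_term_induct)
      case zero
      then show ?case using add(1-3) a2(1-3) assms by (simp add: S_null S_mult_closed)
    next
      case a3: (add t k f'')
      have act: "\<alpha> g r \<in> carrier R" if "g \<in> carrier G" "r \<in> carrier R" for g r
        using act_hom that by (auto intro: ring_hom_closed)
      have "(T r g \<otimes>\<^bsub>S\<^esub> T s h) \<otimes>\<^bsub>S\<^esub> T t k = T r g \<otimes>\<^bsub>S\<^esub> (T s h \<otimes>\<^bsub>S\<^esub> T t k)"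
        using add(1-3) a2(1-3) a3(1-3)
        by (simp add: T_mult act R.m_assoc G.m_assoc act_mult ring_hom_mult[OF act_hom])
      then show ?case using add(1-3) a2(1-3) a3 by (simp add: S_distr S_mult_closed)
    qed
    then show ?case using add(1-3) a2 assms by (simp add: S_distr S_mult_closed)
  qed
  then show ?case using add assms by (simp add: S_distr S_mult_closed)
qed

lemma S_ring: "ring S"
proof (rule ringI[OF S_abelian_group _ S_distr])
  have one: "\<one>\<^bsub>S\<^esub> \<in> carrier S" by (simp add: S_one)
  show "monoid S"
  proof (rule monoidI[OF S_mult_closed one S_assoc])
    fix f assume "f \<in> carrier S"
    then show "\<one>\<^bsub>S\<^esub> \<otimes>\<^bsub>S\<^esub> f = f"
    proof (induction f rule: S_term_induct)
      case zero then show ?case by (simp add: S_null one)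
    next
      case (add r g f)
      have "\<one>\<^bsub>S\<^esub> \<otimes>\<^bsub>S\<^esub> T r g = T r g" using add by (simp add: S_one T_mult act_one)
      then show ?case using add by (simp add: S_distr one)
    qed
  next
    fix f assume "f \<in> carrier S"
    then show "f \<otimes>\<^bsub>S\<^esub> \<one>\<^bsub>S\<^esub> = f"
    proof (induction f rule: S_term_induct)
      case zero then show ?case by (simp add: S_null one)
    next
      case (add r g f)
      have "T r g \<otimes>\<^bsub>S\<^esub> \<one>\<^bsub>S\<^esub> = T r g" using add by (simp add: S_one T_mult ring_hom_one[OF act_hom])
      then show ?case using add by (simp add: S_distr one)
    qed
  qed
qed auto

lemma S_cring:
  assumes "cring R" "comm_monoid G" "\<And>g r. g \<in> carrier G \<Longrightarrow> r \<in> carrier R \<Longrightarrow> \<alpha> g r = r"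
  shows "cring S"
proof -
  interpret R: cring R by fact
  interpret G: comm_monoid G by fact
  interpret S: ring S by (rule S_ring)
  show ?thesis
  proof (rule cring.intro[OF S_ring], rule S.monoid_comm_monoidI)
    fix f f' assume f: "f \<in> carrier S" "f' \<in> carrier S"
    from f(1) show "f \<otimes>\<^bsub>S\<^esub> f' = f' \<otimes>\<^bsub>S\<^esub> f"
    proof (induction f rule: S_term_induct)
      case zero then show ?case by (simp add: f)
    next
      case (add r g f)
      from f(2) have "T r g \<otimes>\<^bsub>S\<^esub> f' = f' \<otimes>\<^bsub>S\<^esub> T r g"
      proof (induction f' rule: S_term_induct)
        case zero then show ?case using add by simp
      next
        case a2: (add s h f')
        have "T r g \<otimes>\<^bsub>S\<^esub> T s h = T s h \<otimes>\<^bsub>S\<^esub> T r g"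
          using add a2 by (simp add: T_mult assms(3) R.m_comm G.m_comm)
        then show ?case using add a2 by (simp add: S.l_distr S.r_distr)
      qed
      then show ?case using add f by (simp add: S.l_distr S.r_distr)
    qed
  qed
qed

lemma T_add: "r \<in> carrier R \<Longrightarrow> s \<in> carrier R \<Longrightarrow> T (r \<oplus> s) g = T r g \<oplus>\<^bsub>S\<^esub> T s g"
  by (auto simp: S_add term_of_def)

lemma T_zero: "T \<zero> g = \<zero>\<^bsub>S\<^esub>"
  by (auto simp: S_zero term_of_def)

text \<open>The universal property: images of R and of G that obey the commutation rule of the skew
  ring extend to a homomorphism. It yields the twists of the Laurent ring and the maps out of the
  free algebra, the Laurent ring and the integral monoid ring below the tensor product.\<close>

lemma S_ext:
  assumes "ring Q" and \<phi>: "\<phi> \<in> ring_hom R Q" and \<psi>: "\<And>g. g \<in> carrier G \<Longrightarrow> \<psi> g \<in> carrier Q"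
    and \<psi>1: "\<psi> \<one>\<^bsub>G\<^esub> = \<one>\<^bsub>Q\<^esub>"
    and \<psi>m: "\<And>g h. g \<in> carrier G \<Longrightarrow> h \<in> carrier G \<Longrightarrow> \<psi> (g \<otimes>\<^bsub>G\<^esub> h) = \<psi> g \<otimes>\<^bsub>Q\<^esub> \<psi> h"
    and \<psi>\<phi>: "\<And>g r. g \<in> carrier G \<Longrightarrow> r \<in> carrier R \<Longrightarrow> \<psi> g \<otimes>\<^bsub>Q\<^esub> \<phi> r = \<phi> (\<alpha> g r) \<otimes>\<^bsub>Q\<^esub> \<psi> g"
  obtains F where "F \<in> ring_hom S Q"
    "\<And>r g. r \<in> carrier R \<Longrightarrow> g \<in> carrier G \<Longrightarrow> F (T r g) = \<phi> r \<otimes>\<^bsub>Q\<^esub> \<psi> g"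
proof -
  interpret Q: ring Q by fact
  interpret S: ring S by (rule S_ring)
  define F where "F f = (\<Oplus>\<^bsub>Q\<^esub>g\<in>{g. f g \<noteq> \<zero>}. \<phi> (f g) \<otimes>\<^bsub>Q\<^esub> \<psi> g)" for f
  have \<phi>c: "\<phi> r \<in> carrier Q" if "r \<in> carrier R" for r using \<phi> that by (rule ring_hom_closed)
  have \<phi>0: "\<phi> \<zero> = \<zero>\<^bsub>Q\<^esub>" using ring_hom_zero[OF \<phi>] R.ring_axioms assms(1) by blast
  have act: "\<alpha> g r \<in> carrier R" if "g \<in> carrier G" "r \<in> carrier R" for g r
    using act_hom that by (auto intro: ring_hom_closed)
  have F: "F f = (\<Oplus>\<^bsub>Q\<^esub>g\<in>A. \<phi> (f g) \<otimes>\<^bsub>Q\<^esub> \<psi> g)"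
    if "f \<in> carrier S" "finite A" "{g. f g \<noteq> \<zero>} \<subseteq> A" "A \<subseteq> carrier G" for f A
    unfolding F_def using that
    by (intro Q.add.finprod_mono_neutral_cong_left) (auto simp: \<phi>0 \<phi>c \<psi> subset_iff)
  have FT: "F (T r g) = \<phi> r \<otimes>\<^bsub>Q\<^esub> \<psi> g" if "r \<in> carrier R" "g \<in> carrier G" for r g
    using that by (subst F[OF T_closed[OF that], of "{g}"]) (auto simp: term_of_def \<phi>c \<psi>)
  have Fadd: "F (f \<oplus>\<^bsub>S\<^esub> f') = F f \<oplus>\<^bsub>Q\<^esub> F f'" if f: "f \<in> carrier S" "f' \<in> carrier S" for f f'
  proof -
    let ?A = "{g. f g \<noteq> \<zero>} \<union> {g. f' g \<noteq> \<zero>}"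
    have A: "finite ?A" "?A \<subseteq> carrier G" "{g. (f \<oplus>\<^bsub>S\<^esub> f') g \<noteq> \<zero>} \<subseteq> ?A" "{g. f g \<noteq> \<zero>} \<subseteq> ?A" "{g. f' g \<noteq> \<zero>} \<subseteq> ?A"
      using f S_supp S_finite by (auto simp: S_add)
    have c: "(\<lambda>g. \<phi> (u g) \<otimes>\<^bsub>Q\<^esub> \<psi> g) \<in> ?A \<rightarrow> carrier Q" if "u \<in> carrier S" for u
      using that A(2) by (auto intro!: Q.m_closed \<phi>c \<psi>)
    have "F (f \<oplus>\<^bsub>S\<^esub> f') = (\<Oplus>\<^bsub>Q\<^esub>g\<in>?A. \<phi> (f g) \<otimes>\<^bsub>Q\<^esub> \<psi> g \<oplus>\<^bsub>Q\<^esub> \<phi> (f' g) \<otimes>\<^bsub>Q\<^esub> \<psi> g)"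
      unfolding F[OF S_add_closed[OF f] A(1,3,2)] using A(2) f
      by (intro Q.finsum_cong') (auto simp: S_add ring_hom_add[OF \<phi>] \<phi>c \<psi> Q.l_distr subset_iff)
    then show ?thesis
      by (simp only: Q.finsum_addf[OF c[OF f(1)] c[OF f(2)]] F[OF f(1) A(1,4,2)] F[OF f(2) A(1,5,2)])
  qed
  have Fc: "F f \<in> carrier Q" if "f \<in> carrier S" for f
    unfolding F_def using that S_supp[OF that] by (intro Q.finsum_closed) (auto intro!: Q.m_closed \<phi>c \<psi>)
  have F0: "F \<zero>\<^bsub>S\<^esub> = \<zero>\<^bsub>Q\<^esub>" by (simp add: F_def S_zero)
  have Fm: "F (f \<otimes>\<^bsub>S\<^esub> f') = F f \<otimes>\<^bsub>Q\<^esub> F f'" if f: "f \<in> carrier S" "f' \<in> carrier S" for f f'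
    using f(1)
  proof (induction f rule: S_term_induct)
    case zero then show ?case using f by (simp add: F0 Fc)
  next
    case (add r g f)
    from f(2) have "F (T r g \<otimes>\<^bsub>S\<^esub> f') = F (T r g) \<otimes>\<^bsub>Q\<^esub> F f'"
    proof (induction f' rule: S_term_induct)
      case zero then show ?case using add by (simp add: F0 Fc)
    next
      case a2: (add s h f')
      have "\<phi> r \<otimes>\<^bsub>Q\<^esub> \<psi> g \<otimes>\<^bsub>Q\<^esub> (\<phi> s \<otimes>\<^bsub>Q\<^esub> \<psi> h) = \<phi> r \<otimes>\<^bsub>Q\<^esub> (\<psi> g \<otimes>\<^bsub>Q\<^esub> \<phi> s) \<otimes>\<^bsub>Q\<^esub> \<psi> h"
        using add(1-3) a2(1-3) by (simp add: Q.m_assoc \<phi>c \<psi>)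
      also have "\<dots> = \<phi> (r \<otimes> \<alpha> g s) \<otimes>\<^bsub>Q\<^esub> \<psi> (g \<otimes>\<^bsub>G\<^esub> h)"
        using add(1-3) a2(1-3) by (simp add: \<psi>\<phi> \<psi>m ring_hom_mult[OF \<phi>] act \<phi>c \<psi> Q.m_assoc)
      finally have "F (T r g \<otimes>\<^bsub>S\<^esub> T s h) = F (T r g) \<otimes>\<^bsub>Q\<^esub> F (T s h)"
        using add(1-3) a2(1-3) by (simp add: T_mult FT act)
      then show ?case using add(1-3) a2 by (simp add: S.r_distr Q.r_distr Fadd Fc)
    qed
    then show ?case using add f by (simp add: S.l_distr Q.l_distr Fadd Fc)
  qed
  have "F \<in> ring_hom S Q"
    by (rule ring_hom_memI) (auto simp: Fc Fm Fadd S_one FT \<psi>1 ring_hom_one[OF \<phi>])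
  then show thesis using FT that by blast
qed

end

text \<open>The trivial action covers Laurent polynomials, the free algebra and the integral monoid
  ring below the tensor product; B is the instance with a nontrivial action.\<close>

lemma monoid_ring_locale: "ring R \<Longrightarrow> monoid G \<Longrightarrow> skew_monoid R G (\<lambda>g r. r)"
  by (auto simp: skew_monoid_def skew_monoid_axioms_def ring_hom_def)

section \<open>Modules\<close>

lemma abelian_group_transfer:
  assumes "abelian_group M" "carrier N = carrier M" "add N = add M" "\<zero>\<^bsub>N\<^esub> = \<zero>\<^bsub>M\<^esub>"
  shows "abelian_group N"
  by (rule abelian_groupI) (use abelian_groupE[OF assms(1)] assms(2-) in auto)

lemma (in ring) ideal_of_closed:
  assumes "I \<subseteq> carrier R" "\<zero> \<in> I" "\<And>x y. x \<in> I \<Longrightarrow> y \<in> I \<Longrightarrow> x \<oplus> y \<in> I"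
    "\<And>r x. r \<in> carrier R \<Longrightarrow> x \<in> I \<Longrightarrow> r \<otimes> x \<in> I" "\<And>r x. r \<in> carrier R \<Longrightarrow> x \<in> I \<Longrightarrow> x \<otimes> r \<in> I"
  shows "ideal I R"
proof (rule idealI[OF ring_axioms])
  have "\<ominus> x \<in> I" if "x \<in> I" for x
    using assms(4)[of "\<ominus> \<one>" x] that assms(1) by (auto simp: l_minus)
  then show "subgroup I (add_monoid R)"
    using assms by (intro add.subgroupI) (auto simp flip: a_inv_def)
qed (use assms in auto)

lemma left_moduleI:
  assumes "ring R" "abelian_group M"
    "\<And>a x. \<lbrakk>a \<in> carrier R; x \<in> carrier M\<rbrakk> \<Longrightarrow> a \<odot>\<^bsub>M\<^esub> x \<in> carrier M"
    "\<And>a b x. \<lbrakk>a \<in> carrier R; b \<in> carrier R; x \<in> carrier M\<rbrakk> \<Longrightarrow> (a \<oplus>\<^bsub>R\<^esub> b) \<odot>\<^bsub>M\<^esub> x = a \<odot>\<^bsub>M\<^esub> x \<oplus>\<^bsub>M\<^esub> b \<odot>\<^bsub>M\<^esub> x"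
    "\<And>a x y. \<lbrakk>a \<in> carrier R; x \<in> carrier M; y \<in> carrier M\<rbrakk> \<Longrightarrow> a \<odot>\<^bsub>M\<^esub> (x \<oplus>\<^bsub>M\<^esub> y) = a \<odot>\<^bsub>M\<^esub> x \<oplus>\<^bsub>M\<^esub> a \<odot>\<^bsub>M\<^esub> y"
    "\<And>a b x. \<lbrakk>a \<in> carrier R; b \<in> carrier R; x \<in> carrier M\<rbrakk> \<Longrightarrow> (a \<otimes>\<^bsub>R\<^esub> b) \<odot>\<^bsub>M\<^esub> x = a \<odot>\<^bsub>M\<^esub> (b \<odot>\<^bsub>M\<^esub> x)"
    "\<And>x. x \<in> carrier M \<Longrightarrow> \<one>\<^bsub>R\<^esub> \<odot>\<^bsub>M\<^esub> x = x"
  shows "left_module R M"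
  unfolding left_module_def left_module_axioms_def using assms by blast

context left_module begin

lemma smult_l_null [simp]: "x \<in> carrier M \<Longrightarrow> \<zero> \<odot>\<^bsub>M\<^esub> x = \<zero>\<^bsub>M\<^esub>"
  by (metis M.add.r_cancel_one' R.add.l_one R.zero_closed smult_closed smult_l_distr)

lemma smult_r_null [simp]: "a \<in> carrier R \<Longrightarrow> a \<odot>\<^bsub>M\<^esub> \<zero>\<^bsub>M\<^esub> = \<zero>\<^bsub>M\<^esub>"
  by (metis M.add.r_cancel_one' M.l_zero M.zero_closed smult_closed smult_r_distr)

lemma smult_l_minus: "a \<in> carrier R \<Longrightarrow> x \<in> carrier M \<Longrightarrow> (\<ominus> a) \<odot>\<^bsub>M\<^esub> x = \<ominus>\<^bsub>M\<^esub> (a \<odot>\<^bsub>M\<^esub> x)"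
  by (metis M.minus_equality R.a_inv_closed R.l_neg smult_closed smult_l_distr smult_l_null)

lemma smult_one_minus: "x \<in> carrier M \<Longrightarrow> (\<ominus> \<one>) \<odot>\<^bsub>M\<^esub> x = \<ominus>\<^bsub>M\<^esub> x"
  by (simp add: smult_l_minus smult_one)

lemma submoduleI:
  assumes "H \<subseteq> carrier M" "\<zero>\<^bsub>M\<^esub> \<in> H" "\<And>x y. x \<in> H \<Longrightarrow> y \<in> H \<Longrightarrow> x \<oplus>\<^bsub>M\<^esub> y \<in> H"
    "\<And>r x. r \<in> carrier R \<Longrightarrow> x \<in> H \<Longrightarrow> r \<odot>\<^bsub>M\<^esub> x \<in> H"
  shows "submodule H R M"
proof -
  have "\<ominus>\<^bsub>M\<^esub> x \<in> H" if "x \<in> H" for x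
    using assms(4)[of "\<ominus> \<one>" x] that assms(1) smult_one_minus by auto
  then have "subgroup H (add_monoid M)"
    using assms by (intro M.add.subgroupI) (auto simp flip: a_inv_def)
  then show ?thesis using assms(4) by (simp add: submodule_def submodule_axioms_def)
qed

lemma submoduleD:
  assumes "submodule H R M"
  shows "H \<subseteq> carrier M" "\<zero>\<^bsub>M\<^esub> \<in> H" "\<And>x y. x \<in> H \<Longrightarrow> y \<in> H \<Longrightarrow> x \<oplus>\<^bsub>M\<^esub> y \<in> H"
    "\<And>r x. r \<in> carrier R \<Longrightarrow> x \<in> H \<Longrightarrow> r \<odot>\<^bsub>M\<^esub> x \<in> H"
proof -
  interpret submodule H R M by fact
  show "H \<subseteq> carrier M" "\<zero>\<^bsub>M\<^esub> \<in> H" "\<And>x y. x \<in> H \<Longrightarrow> y \<in> H \<Longrightarrow> x \<oplus>\<^bsub>M\<^esub> y \<in> H"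
    "\<And>r x. r \<in> carrier R \<Longrightarrow> x \<in> H \<Longrightarrow> r \<odot>\<^bsub>M\<^esub> x \<in> H"
    using subset one_closed m_closed by auto
qed

lemma annihilator_ideal: "ideal (annihilator R M) R"
proof (rule R.ideal_of_closed)
  fix r x assume "r \<in> carrier R" "x \<in> annihilator R M"
  then show "r \<otimes> x \<in> annihilator R M" "x \<otimes> r \<in> annihilator R M"
    by (auto simp: annihilator_def smult_assoc1 smult_closed)
qed (auto simp: annihilator_def smult_l_distr)

lemma orbit_submodule:
  assumes "v \<in> carrier M" "H \<subseteq> carrier R" "\<zero> \<in> H" "\<And>x y. x \<in> H \<Longrightarrow> y \<in> H \<Longrightarrow> x \<oplus> y \<in> H"
    "\<And>r x. r \<in> carrier R \<Longrightarrow> x \<in> H \<Longrightarrow> r \<otimes> x \<in> H"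
  shows "submodule ((\<lambda>x. x \<odot>\<^bsub>M\<^esub> v) ` H) R M"
proof (rule submoduleI)
  show "x \<oplus>\<^bsub>M\<^esub> y \<in> (\<lambda>x. x \<odot>\<^bsub>M\<^esub> v) ` H"
    if "x \<in> (\<lambda>x. x \<odot>\<^bsub>M\<^esub> v) ` H" "y \<in> (\<lambda>x. x \<odot>\<^bsub>M\<^esub> v) ` H" for x y
  proof -
    obtain a b where ab: "a \<in> H" "b \<in> H" "x = a \<odot>\<^bsub>M\<^esub> v" "y = b \<odot>\<^bsub>M\<^esub> v" using \<open>x \<in> _\<close> \<open>y \<in> _\<close> by blast
    then have "x \<oplus>\<^bsub>M\<^esub> y = (a \<oplus> b) \<odot>\<^bsub>M\<^esub> v" using assms by (simp add: smult_l_distr subset_iff)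
    then show ?thesis using assms(4) ab by blast
  qed
  show "r \<odot>\<^bsub>M\<^esub> x \<in> (\<lambda>x. x \<odot>\<^bsub>M\<^esub> v) ` H" if r: "r \<in> carrier R" and x: "x \<in> (\<lambda>x. x \<odot>\<^bsub>M\<^esub> v) ` H" for r x
  proof -
    obtain a where a: "a \<in> H" "x = a \<odot>\<^bsub>M\<^esub> v" using x by blast
    then have "r \<odot>\<^bsub>M\<^esub> x = (r \<otimes> a) \<odot>\<^bsub>M\<^esub> v" using assms(1,2) r by (simp add: smult_assoc1 subset_iff)
    then show ?thesis using assms(5) r a by blast
  qed
  show "(\<lambda>x. x \<odot>\<^bsub>M\<^esub> v) ` H \<subseteq> carrier M" using assms(1,2) smult_closed by blast
  show "\<zero>\<^bsub>M\<^esub> \<in> (\<lambda>x. x \<odot>\<^bsub>M\<^esub> v) ` H" using assms(1,3) smult_l_null by (metis imageI)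
qed

end

lemma simple_cyclic:
  assumes "simple_module R M" "v \<in> carrier M" "v \<noteq> \<zero>\<^bsub>M\<^esub>"
  shows "(\<lambda>x. x \<odot>\<^bsub>M\<^esub> v) ` carrier R = carrier M"
proof -
  interpret left_module R M using assms(1) by (simp add: simple_module_def)
  have "submodule ((\<lambda>x. x \<odot>\<^bsub>M\<^esub> v) ` carrier R) R M"
    using assms by (intro orbit_submodule) auto
  moreover have "v \<in> (\<lambda>x. x \<odot>\<^bsub>M\<^esub> v) ` carrier R"
    using assms(2) smult_one by (metis R.one_closed imageI)
  ultimately show ?thesis using assms unfolding simple_module_def by blast
qed

lemma module_homD:
  assumes "f \<in> module_hom R M N"
  shows "\<And>u. u \<in> carrier M \<Longrightarrow> f u \<in> carrier N"
    "\<And>u v. u \<in> carrier M \<Longrightarrow> v \<in> carrier M \<Longrightarrow> f (u \<oplus>\<^bsub>M\<^esub> v) = f u \<oplus>\<^bsub>N\<^esub> f v"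
    "\<And>r u. r \<in> carrier R \<Longrightarrow> u \<in> carrier M \<Longrightarrow> f (r \<odot>\<^bsub>M\<^esub> u) = r \<odot>\<^bsub>N\<^esub> f u"
  using assms by (auto simp: module_hom_def)

lemma module_hom_zero:
  assumes "left_module R M" "left_module R N" "f \<in> module_hom R M N"
  shows "f \<zero>\<^bsub>M\<^esub> = \<zero>\<^bsub>N\<^esub>"
proof -
  interpret M: left_module R M by fact
  interpret N: left_module R N by fact
  have "f (\<zero>\<^bsub>R\<^esub> \<odot>\<^bsub>M\<^esub> \<zero>\<^bsub>M\<^esub>) = \<zero>\<^bsub>R\<^esub> \<odot>\<^bsub>N\<^esub> f \<zero>\<^bsub>M\<^esub>"
    by (rule module_homD(3)[OF assms(3)]) auto
  moreover have "\<zero>\<^bsub>R\<^esub> \<odot>\<^bsub>N\<^esub> f \<zero>\<^bsub>M\<^esub> = \<zero>\<^bsub>N\<^esub>"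
    by (rule N.smult_l_null) (rule module_homD(1)[OF assms(3) M.M.zero_closed])
  ultimately show ?thesis by (simp only: M.smult_l_null[OF M.M.zero_closed])
qed

lemma schur:
  assumes "simple_module R M" "simple_module R N" "f \<in> module_hom R M N"
    and "u \<in> carrier M" "f u \<noteq> \<zero>\<^bsub>N\<^esub>"
  shows "bij_betw f (carrier M) (carrier N)"
proof -
  interpret M: left_module R M using assms by (simp add: simple_module_def)
  interpret N: left_module R N using assms by (simp add: simple_module_def)
  note f = module_homD[OF assms(3)] module_hom_zero[OF M.left_module_axioms N.left_module_axioms assms(3)]
  have "submodule {u \<in> carrier M. f u = \<zero>\<^bsub>N\<^esub>} R M"
    by (rule M.submoduleI) (auto simp: f M.smult_closed)
  then have ker: "{u \<in> carrier M. f u = \<zero>\<^bsub>N\<^esub>} = {\<zero>\<^bsub>M\<^esub>}"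
    using assms unfolding simple_module_def by blast
  have im: "submodule (f ` carrier M) R N"
    by (rule N.submoduleI) (auto simp: f(1) simp flip: f(2-4) intro!: imageI M.smult_closed)
  then have "f ` carrier M = carrier N"
    using assms unfolding simple_module_def by blast
  moreover have "inj_on f (carrier M)"
  proof (rule inj_onI)
    fix x y assume xy: "x \<in> carrier M" "y \<in> carrier M" "f x = f y"
    have "f (x \<oplus>\<^bsub>M\<^esub> (\<ominus>\<^bsub>R\<^esub> \<one>\<^bsub>R\<^esub>) \<odot>\<^bsub>M\<^esub> y) = f x \<oplus>\<^bsub>N\<^esub> (\<ominus>\<^bsub>R\<^esub> \<one>\<^bsub>R\<^esub>) \<odot>\<^bsub>N\<^esub> f y"
      using xy by (simp add: f M.smult_closed)
    also have "\<dots> = \<zero>\<^bsub>N\<^esub>" using xy f(1) by (simp add: N.smult_one_minus N.M.r_neg)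
    finally have "x \<oplus>\<^bsub>M\<^esub> (\<ominus>\<^bsub>M\<^esub> y) \<in> {u \<in> carrier M. f u = \<zero>\<^bsub>N\<^esub>}" using xy by (simp add: M.smult_one_minus)
    then have "x \<oplus>\<^bsub>M\<^esub> (\<ominus>\<^bsub>M\<^esub> y) = \<zero>\<^bsub>M\<^esub>" unfolding ker by simp
    then show "x = y" using xy by (metis M.M.minus_equality M.M.minus_minus M.M.a_inv_closed)
  qed
  ultimately show ?thesis by (simp add: bij_betw_def)
qed

lemma module_isomorphic_trans:
  assumes "module_isomorphic R M N" "module_isomorphic R N P"
  shows "module_isomorphic R M P"
proof -
  obtain f g where f: "f \<in> module_hom R M N" "bij_betw f (carrier M) (carrier N)"
    and g: "g \<in> module_hom R N P" "bij_betw g (carrier N) (carrier P)"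
    using assms unfolding module_isomorphic_def by blast
  have "g \<circ> f \<in> module_hom R M P"
    using f(1) g(1) by (auto simp: module_hom_def Pi_iff)
  then show ?thesis using bij_betw_trans[OF f(2) g(2)] unfolding module_isomorphic_def by blast
qed

lemma inv_module_hom:
  assumes "left_module R M" "f \<in> module_hom R M N" "bij_betw f (carrier M) (carrier N)"
  shows "inv_into (carrier M) f \<in> module_hom R N M"
proof -
  interpret M: left_module R M by fact
  note f = module_homD[OF assms(2)]
  let ?g = "inv_into (carrier M) f"
  have g: "?g v \<in> carrier M" "f (?g v) = v" if "v \<in> carrier N" for v
    using that assms(3) by (auto simp: bij_betw_def inv_into_into f_inv_into_f)
  have eq: "?g v = u" if "u \<in> carrier M" "f u = v" for u v
    using that assms(3) by (auto simp: bij_betw_def inv_into_f_f)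
  show ?thesis unfolding module_hom_def
    using g by (auto intro!: eq simp: f M.smult_closed)
qed

lemma module_isomorphic_sym:
  assumes "left_module R M" "module_isomorphic R M N" shows "module_isomorphic R N M"
  using assms inv_module_hom bij_betw_inv_into unfolding module_isomorphic_def by blast

lemma annihilator_iso:
  assumes "left_module R M" "left_module R N" "module_isomorphic R M N"
  shows "annihilator R M = annihilator R N"
proof -
  obtain f where f: "f \<in> module_hom R M N" "bij_betw f (carrier M) (carrier N)"
    using assms unfolding module_isomorphic_def by blast
  interpret M: left_module R M by fact
  note fh = module_homD[OF f(1)]
  have z: "f u = \<zero>\<^bsub>N\<^esub> \<longleftrightarrow> u = \<zero>\<^bsub>M\<^esub>" if "u \<in> carrier M" for u
    using module_hom_zero[OF assms(1,2) f(1)] f(2) that M.M.zero_closed unfolding bij_betw_def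
    by (metis inj_on_def)
  have N: "carrier N = f ` carrier M" using f(2) by (simp add: bij_betw_def)
  show ?thesis unfolding annihilator_def N
    using z fh M.smult_closed by (auto simp flip: fh(3))
qed

lemma simple_module_iso:
  assumes "simple_module R M" "left_module R N" "module_isomorphic R M N"
  shows "simple_module R N"
proof -
  interpret M: left_module R M using assms(1) by (simp add: simple_module_def)
  interpret N: left_module R N by fact
  obtain f where f: "f \<in> module_hom R M N" "bij_betw f (carrier M) (carrier N)"
    using assms unfolding module_isomorphic_def by blast
  note fh = module_homD[OF f(1)]
  note f0 = module_hom_zero[OF M.left_module_axioms assms(2) f(1)]
  have N: "carrier N = f ` carrier M" and inj: "inj_on f (carrier M)" using f(2) by (auto simp: bij_betw_def)
  have "H = {\<zero>\<^bsub>N\<^esub>} \<or> H = carrier N" if "submodule H R N" for H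
  proof -
    note H = N.submoduleD[OF that]
    let ?H = "{u \<in> carrier M. f u \<in> H}"
    have HH: "H = f ` ?H" using H(1) N by auto
    have "submodule ?H R M"
      by (rule M.submoduleI) (auto simp: fh f0 H M.smult_closed)
    then have "?H = {\<zero>\<^bsub>M\<^esub>} \<or> ?H = carrier M" using assms(1) by (simp add: simple_module_def)
    moreover have "?H = {\<zero>\<^bsub>M\<^esub>} \<Longrightarrow> H = {f \<zero>\<^bsub>M\<^esub>}" by (subst HH) simp
    moreover have "?H = carrier M \<Longrightarrow> H = carrier N" unfolding N by (subst HH) simp
    ultimately show ?thesis unfolding f0 by blast
  qed
  moreover have "carrier N \<noteq> {\<zero>\<^bsub>N\<^esub>}"
  proof
    assume "carrier N = {\<zero>\<^bsub>N\<^esub>}"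
    then have "f u = f \<zero>\<^bsub>M\<^esub>" if "u \<in> carrier M" for u using fh(1)[OF that] f0 by simp
    then have "u = \<zero>\<^bsub>M\<^esub>" if "u \<in> carrier M" for u
      using that inj M.M.zero_closed unfolding inj_on_def by blast
    then show False using assms(1) M.M.zero_closed unfolding simple_module_def by blast
  qed
  ultimately show ?thesis using assms(2) by (simp add: simple_module_def)
qed

lemma iso_class_eq:
  assumes "left_module R M" "left_module R N" "module_isomorphic R M N"
  shows "iso_class R M = iso_class R N"
  unfolding iso_class_def
  using module_isomorphic_trans[OF assms(3)] module_isomorphic_trans[OF module_isomorphic_sym[OF assms(1,3)]]
  by blast

subsection \<open>Transport to the universe of subsets of the base ring\<close>

lemma module_transport:
  fixes M :: "('r, 'u, 'c) module_scheme" and F :: "'u \<Rightarrow> 'v"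
  assumes "left_module R M" "inj_on F (carrier M)"
  shows "\<exists>N :: ('r, 'v) module. left_module R N \<and> module_isomorphic R M N"
proof -
  interpret M: left_module R M by fact
  let ?g = "inv_into (carrier M) F"
  define N :: "('r, 'v) module" where "N = \<lparr>carrier = F ` carrier M, monoid.mult = undefined, one = undefined,
     ring.zero = F \<zero>\<^bsub>M\<^esub>, ring.add = (\<lambda>x y. F (?g x \<oplus>\<^bsub>M\<^esub> ?g y)), smult = (\<lambda>r x. F (r \<odot>\<^bsub>M\<^esub> ?g x))\<rparr>"
  have g: "?g (F x) = x" if "x \<in> carrier M" for x using assms(2) that by simp
  have N: "carrier N = F ` carrier M" "\<zero>\<^bsub>N\<^esub> = F \<zero>\<^bsub>M\<^esub>"
    "\<And>x y. x \<in> carrier M \<Longrightarrow> y \<in> carrier M \<Longrightarrow> F x \<oplus>\<^bsub>N\<^esub> F y = F (x \<oplus>\<^bsub>M\<^esub> y)"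
    "\<And>r x. x \<in> carrier M \<Longrightarrow> r \<odot>\<^bsub>N\<^esub> F x = F (r \<odot>\<^bsub>M\<^esub> x)"
    by (simp_all add: N_def g)
  have "abelian_group N"
  proof (rule abelian_groupI)
    fix x assume "x \<in> carrier N"
    then obtain u where u: "u \<in> carrier M" "x = F u" using N by auto
    then have "F (\<ominus>\<^bsub>M\<^esub> u) \<oplus>\<^bsub>N\<^esub> x = \<zero>\<^bsub>N\<^esub>" by (simp add: N M.M.l_neg)
    then show "\<exists>y\<in>carrier N. y \<oplus>\<^bsub>N\<^esub> x = \<zero>\<^bsub>N\<^esub>" using u N(1) by blast
  qed (auto simp: N M.M.a_ac)
  then have "left_module R N"
    by (rule left_moduleI[OF M.R.ring_axioms])
      (auto simp: N M.smult_closed M.smult_l_distr M.smult_r_distr M.smult_assoc1 M.smult_one)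
  moreover have "module_isomorphic R M N" unfolding module_isomorphic_def
    by (rule bexI[of _ F]) (use assms(2) in \<open>auto simp: module_hom_def N bij_betw_def\<close>)
  ultimately show ?thesis by blast
qed

text \<open>Since M = Rv for any nonzero v, an element u is determined by the set of all r with rv =
  u, a coset of the left annihilator of v. Transporting the structure along this injection places M
  in the universe of subsets of R.\<close>

lemma simple_module_representative:
  fixes M :: "('r, 'u, 'c) module_scheme"
  assumes "simple_module R M"
  obtains N :: "('r, 'r set) module" where "simple_module R N" "module_isomorphic R M N"
proof -
  interpret M: left_module R M using assms by (simp add: simple_module_def)
  obtain v where v: "v \<in> carrier M" "v \<noteq> \<zero>\<^bsub>M\<^esub>"
    using assms M.M.zero_closed unfolding simple_module_def by blast
  have "inj_on (\<lambda>u. {r \<in> carrier R. r \<odot>\<^bsub>M\<^esub> v = u}) (carrier M)"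
  proof (rule inj_onI)
    fix x y assume "x \<in> carrier M" "y \<in> carrier M"
      and eq: "{r \<in> carrier R. r \<odot>\<^bsub>M\<^esub> v = x} = {r \<in> carrier R. r \<odot>\<^bsub>M\<^esub> v = y}"
    have "x \<in> (\<lambda>r. r \<odot>\<^bsub>M\<^esub> v) ` carrier R"
      unfolding simple_cyclic[OF assms v] by fact
    then obtain r where r: "r \<in> carrier R" "r \<odot>\<^bsub>M\<^esub> v = x" by blast
    then have "r \<in> {r \<in> carrier R. r \<odot>\<^bsub>M\<^esub> v = y}" unfolding eq[symmetric] by simp
    then show "x = y" using r by simp
  qed
  from module_transport[OF M.left_module_axioms this] obtain N :: "('r, 'r set) module"
    where "left_module R N" "module_isomorphic R M N" by blast
  then show thesis using that simple_module_iso[OF assms] by blast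
qed

lemma iso_class_nonempty:
  fixes M :: "('r, 'u, 'c) module_scheme"
  assumes "simple_module R M"
  obtains N :: "('r, 'r set) module" where "simple_module R N" "module_isomorphic R M N"
    "iso_class R M = iso_class R N" "N \<in> iso_class R M" "annihilator R M = annihilator R N"
proof -
  obtain N :: "('r, 'r set) module" where N: "simple_module R N" "module_isomorphic R M N"
    using simple_module_representative[OF assms] by blast
  then have l: "left_module R M" "left_module R N" using assms by (auto simp: simple_module_def)
  have "N \<in> iso_class R M" using l N by (simp add: iso_class_def)
  then show thesis using that[OF N iso_class_eq[OF l N(2)] _ annihilator_iso[OF l N(2)]] by blast
qed

text \<open>The annihilator is constant on the class by isomorphism invariance. Nonemptiness of the
  class matters as well: over an empty class every I would satisfy the definite description.\<close>

lemma class_annihilator_eq: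
  assumes "simple_module R M"
  shows "class_annihilator R (iso_class R M) = annihilator R M"
proof -
  have M: "left_module R M" using assms by (simp add: simple_module_def)
  obtain N where N: "N \<in> iso_class R M" using iso_class_nonempty[OF assms] by blast
  have eq: "annihilator R N = annihilator R M" if "N \<in> iso_class R M" for N
    using that annihilator_iso[OF M] by (auto simp: iso_class_def)
  show ?thesis unfolding class_annihilator_def
    using N eq by (intro the_equality) auto
qed

subsection \<open>Restriction of scalars along a surjection\<close>

lemma restrict_scalars_sel [simp]:
  "carrier (restrict_scalars f M) = carrier M" "\<zero>\<^bsub>restrict_scalars f M\<^esub> = \<zero>\<^bsub>M\<^esub>"
  "add (restrict_scalars f M) = add M" "s \<odot>\<^bsub>restrict_scalars f M\<^esub> u = f s \<odot>\<^bsub>M\<^esub> u"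
  by (simp_all add: restrict_scalars_def)

lemma restrict_left_module:
  assumes "ring S" "f \<in> ring_hom S R" "left_module R M"
  shows "left_module S (restrict_scalars f M)"
proof -
  interpret M: left_module R M by fact
  interpret S: ring S by fact
  have fc: "\<And>x. x \<in> carrier S \<Longrightarrow> f x \<in> carrier R" using assms(2) by (rule ring_hom_closed)
  show ?thesis
  proof (rule left_moduleI[OF assms(1)])
    show "abelian_group (restrict_scalars f M)"
      by (rule abelian_group_transfer[OF M.M.abelian_group_axioms]) auto
  qed (auto simp: fc M.smult_closed M.smult_l_distr M.smult_r_distr M.smult_assoc1 M.smult_one
        ring_hom_add[OF assms(2)] ring_hom_mult[OF assms(2)] ring_hom_one[OF assms(2)])
qed

context
  fixes S :: "('s, 'b) ring_scheme" and R :: "('r, 'c) ring_scheme" and f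
  assumes S: "ring S" and f: "f \<in> ring_hom S R" and surj: "f ` carrier S = carrier R"
begin

text \<open>Along a surjection both rings act on M by the same operators, so submodules agree;
  simplicity, homomorphisms and endomorphism rings follow suit.\<close>

lemma restrict_submodule: "submodule H S (restrict_scalars f M) \<longleftrightarrow> submodule H R M"
  by (auto simp: submodule_def submodule_axioms_def subgroup_def m_inv_def simp flip: surj)

lemma restrict_simple: "simple_module R M \<Longrightarrow> simple_module S (restrict_scalars f M)"
  using restrict_left_module[OF S f] by (auto simp: simple_module_def restrict_submodule)

lemma restrict_annihilator:
  "annihilator S (restrict_scalars f M) = {s \<in> carrier S. f s \<in> annihilator R M}"
  using ring_hom_closed[OF f] by (auto simp: annihilator_def)

lemma restrict_module_hom:
  "module_hom S (restrict_scalars f M) (restrict_scalars f N) = module_hom R M N"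
  by (auto simp: module_hom_def simp flip: surj)

lemma restrict_module_End: "module_End S (restrict_scalars f M) = module_End R M"
  by (simp add: module_End_def restrict_module_hom)

text \<open>An element of R acts through any preimage in S. Two preimages differ by an element of
  the kernel, which kills M by assumption, so the choice made by \<open>inv_into\<close> does not
  matter.\<close>

lemma descend_module:
  fixes M :: "('s, 'u, 'e) module_scheme"
  assumes M: "simple_module S M" and ker: "\<And>s. s \<in> carrier S \<Longrightarrow> f s = \<zero>\<^bsub>R\<^esub> \<Longrightarrow> s \<in> annihilator S M"
    and R: "ring R"
  obtains N :: "('r, 'u) module" where "simple_module R N" "module_isomorphic S M (restrict_scalars f N)"
proof -
  interpret M: left_module S M using M by (simp add: simple_module_def)
  interpret R: ring R by fact
  let ?g = "inv_into (carrier S) f"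
  define N :: "('r, 'u) module" where "N = \<lparr>carrier = carrier M, monoid.mult = monoid.mult M, one = \<one>\<^bsub>M\<^esub>,
     ring.zero = \<zero>\<^bsub>M\<^esub>, ring.add = ring.add M, smult = (\<lambda>r u. ?g r \<odot>\<^bsub>M\<^esub> u)\<rparr>"
  have gc: "?g r \<in> carrier S" "f (?g r) = r" if "r \<in> carrier R" for r
    using that surj by (auto simp: inv_into_into f_inv_into_f)
  have well: "s \<odot>\<^bsub>M\<^esub> u = s' \<odot>\<^bsub>M\<^esub> u"
    if s: "s \<in> carrier S" "s' \<in> carrier S" "f s = f s'" and u: "u \<in> carrier M" for s s' u
  proof -
    have "f (s \<ominus>\<^bsub>S\<^esub> s') = f s \<ominus>\<^bsub>R\<^esub> f s'"
    proof -
      interpret ring_hom_ring S R f by (rule ring_hom_ringI2) (use M.R.ring_axioms R f in auto)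
      show ?thesis using s by (simp add: M.R.minus_eq R.minus_eq)
    qed
    then have "f (s \<ominus>\<^bsub>S\<^esub> s') = \<zero>\<^bsub>R\<^esub>" using s ring_hom_closed[OF f] by (simp add: R.r_neg R.minus_eq)
    then have "(s \<ominus>\<^bsub>S\<^esub> s') \<odot>\<^bsub>M\<^esub> u = \<zero>\<^bsub>M\<^esub>" using ker[of "s \<ominus>\<^bsub>S\<^esub> s'"] s u by (auto simp: annihilator_def)
    then have "s \<odot>\<^bsub>M\<^esub> u \<oplus>\<^bsub>M\<^esub> (\<ominus>\<^bsub>M\<^esub> (s' \<odot>\<^bsub>M\<^esub> u)) = \<zero>\<^bsub>M\<^esub>"
      using s u by (simp add: M.R.minus_eq M.smult_l_distr M.smult_l_minus)
    then show ?thesis using s u M.smult_closed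
      by (metis M.M.minus_equality M.M.minus_minus M.M.a_inv_closed)
  qed
  have sm: "f s \<odot>\<^bsub>N\<^esub> u = s \<odot>\<^bsub>M\<^esub> u" if "s \<in> carrier S" "u \<in> carrier M" for s u
  proof -
    have "f s \<in> carrier R" using f that(1) by (rule ring_hom_closed)
    then show ?thesis using that gc by (auto simp: N_def intro: well)
  qed
  have N: "carrier N = carrier M" "\<zero>\<^bsub>N\<^esub> = \<zero>\<^bsub>M\<^esub>" "add N = add M" by (simp_all add: N_def)
  have "left_module R N"
  proof (rule left_moduleI[OF R])
    show "abelian_group N" by (rule abelian_group_transfer[OF M.M.abelian_group_axioms]) (auto simp: N)
    fix a x assume "a \<in> carrier R" and x: "x \<in> carrier N"
    then obtain s where s: "s \<in> carrier S" "a = f s" using surj by blast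
    then show "a \<odot>\<^bsub>N\<^esub> x \<in> carrier N" using x by (simp add: sm N M.smult_closed)
    { fix y assume "y \<in> carrier N"
      then show "a \<odot>\<^bsub>N\<^esub> (x \<oplus>\<^bsub>N\<^esub> y) = a \<odot>\<^bsub>N\<^esub> x \<oplus>\<^bsub>N\<^esub> a \<odot>\<^bsub>N\<^esub> y"
        using x s by (simp add: sm N M.smult_r_distr) }
    { fix b assume "b \<in> carrier R"
      then obtain t where t: "t \<in> carrier S" "b = f t" using surj by blast
      show "(a \<oplus>\<^bsub>R\<^esub> b) \<odot>\<^bsub>N\<^esub> x = a \<odot>\<^bsub>N\<^esub> x \<oplus>\<^bsub>N\<^esub> b \<odot>\<^bsub>N\<^esub> x"
        using s t x by (simp add: sm N M.smult_l_distr flip: ring_hom_add[OF f])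
      show "(a \<otimes>\<^bsub>R\<^esub> b) \<odot>\<^bsub>N\<^esub> x = a \<odot>\<^bsub>N\<^esub> (b \<odot>\<^bsub>N\<^esub> x)"
        using s t x by (simp add: sm N M.smult_assoc1 M.smult_closed flip: ring_hom_mult[OF f]) }
  next
    fix x assume "x \<in> carrier N"
    then show "\<one>\<^bsub>R\<^esub> \<odot>\<^bsub>N\<^esub> x = x" using sm[of "\<one>\<^bsub>S\<^esub>" x] by (simp add: N ring_hom_one[OF f] M.smult_one)
  qed
  have iso: "module_isomorphic S M (restrict_scalars f N)" unfolding module_isomorphic_def
    by (rule bexI[of _ "\<lambda>u. u"]) (auto simp: module_hom_def N sm bij_betw_def)
  have "simple_module S (restrict_scalars f N)"
    using simple_module_iso[OF M restrict_left_module[OF S f \<open>left_module R N\<close>] iso] .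
  then have "simple_module R N"
    using \<open>left_module R N\<close> by (auto simp: simple_module_def restrict_submodule)
  then show thesis using iso that by blast
qed

end

section \<open>Simple Artinian rings\<close>

definition left_ideal :: "('r, 'b) ring_scheme \<Rightarrow> 'r set \<Rightarrow> bool" where
  "left_ideal R L \<longleftrightarrow> L \<subseteq> carrier R \<and> \<zero>\<^bsub>R\<^esub> \<in> L \<and> (\<forall>x\<in>L. \<forall>y\<in>L. x \<oplus>\<^bsub>R\<^esub> y \<in> L) \<and>
     (\<forall>r\<in>carrier R. \<forall>x\<in>L. r \<otimes>\<^bsub>R\<^esub> x \<in> L)"

text \<open>The descending chain condition, witnessed by a length function as a dimension count provides it.\<close>

definition left_artinian :: "('r, 'b) ring_scheme \<Rightarrow> bool" where
  "left_artinian R \<longleftrightarrow> (\<exists>\<mu> :: 'r set \<Rightarrow> nat. \<forall>L L'. left_ideal R L \<longrightarrow> left_ideal R L' \<longrightarrow> L \<subset> L' \<longrightarrow> \<mu> L < \<mu> L')"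

definition lmod :: "('r, 'b) ring_scheme \<Rightarrow> 'r set \<Rightarrow> ('r, 'r) module" where
  "lmod R L = \<lparr>carrier = L, monoid.mult = monoid.mult R, one = \<one>\<^bsub>R\<^esub>, ring.zero = \<zero>\<^bsub>R\<^esub>,
     ring.add = ring.add R, smult = monoid.mult R\<rparr>"

definition principal_left :: "('r, 'b) ring_scheme \<Rightarrow> 'r \<Rightarrow> 'r set" where
  "principal_left R a = (\<lambda>r. r \<otimes>\<^bsub>R\<^esub> a) ` carrier R"

text \<open>For idempotent e this is the Peirce corner eRe, described by the equations ex = x = xe;
  its unit is e.\<close>

definition corner :: "('r, 'b) ring_scheme \<Rightarrow> 'r \<Rightarrow> 'r ring" where
  "corner R e = \<lparr>carrier = {x \<in> carrier R. e \<otimes>\<^bsub>R\<^esub> x = x \<and> x \<otimes>\<^bsub>R\<^esub> e = x}, monoid.mult = monoid.mult R, one = e,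
     ring.zero = \<zero>\<^bsub>R\<^esub>, ring.add = ring.add R\<rparr>"

lemma lmod_sel [simp]: "carrier (lmod R L) = L" "\<zero>\<^bsub>lmod R L\<^esub> = \<zero>\<^bsub>R\<^esub>" "x \<oplus>\<^bsub>lmod R L\<^esub> y = x \<oplus>\<^bsub>R\<^esub> y"
  "r \<odot>\<^bsub>lmod R L\<^esub> x = r \<otimes>\<^bsub>R\<^esub> x"
  by (simp_all add: lmod_def)

lemma corner_sel [simp]: "x \<in> carrier (corner R e) \<longleftrightarrow> x \<in> carrier R \<and> e \<otimes>\<^bsub>R\<^esub> x = x \<and> x \<otimes>\<^bsub>R\<^esub> e = x"
  "\<zero>\<^bsub>corner R e\<^esub> = \<zero>\<^bsub>R\<^esub>" "x \<oplus>\<^bsub>corner R e\<^esub> y = x \<oplus>\<^bsub>R\<^esub> y"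
  "x \<otimes>\<^bsub>corner R e\<^esub> y = x \<otimes>\<^bsub>R\<^esub> y" "\<one>\<^bsub>corner R e\<^esub> = e"
  by (simp_all add: corner_def)

context ring begin

lemma left_idealD:
  assumes "left_ideal R L"
  shows "\<And>x. x \<in> L \<Longrightarrow> x \<in> carrier R" "\<zero> \<in> L" "\<And>x y. x \<in> L \<Longrightarrow> y \<in> L \<Longrightarrow> x \<oplus> y \<in> L"
    "\<And>r x. r \<in> carrier R \<Longrightarrow> x \<in> L \<Longrightarrow> r \<otimes> x \<in> L"
  using assms by (auto simp: left_ideal_def)

lemma left_ideal_minus: "left_ideal R L \<Longrightarrow> x \<in> L \<Longrightarrow> \<ominus> x \<in> L"
  using left_idealD(4)[of L "\<ominus> \<one>" x] left_idealD(1)[of L x] by (simp add: l_minus)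

lemma lmod_left_module:
  assumes "left_ideal R L" shows "left_module R (lmod R L)"
proof -
  note L = left_idealD[OF assms]
  have "abelian_group (lmod R L)"
  proof (rule abelian_groupI)
    fix x assume "x \<in> carrier (lmod R L)"
    then show "\<exists>y\<in>carrier (lmod R L). y \<oplus>\<^bsub>lmod R L\<^esub> x = \<zero>\<^bsub>lmod R L\<^esub>"
      using left_ideal_minus[OF assms] L by (auto intro!: bexI[of _ "\<ominus> x"] simp: l_neg)
  qed (use L in \<open>auto simp: a_ac\<close>)
  then show ?thesis
    by (rule left_moduleI[OF ring_axioms]) (use L in \<open>auto simp: l_distr r_distr m_assoc\<close>)
qed

lemma submodule_lmod: "left_ideal R L \<Longrightarrow> submodule H R (lmod R L) \<longleftrightarrow> H \<subseteq> L \<and> left_ideal R H"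
proof
  assume L: "left_ideal R L"
  interpret M: left_module R "lmod R L" by (rule lmod_left_module[OF L])
  { assume "submodule H R (lmod R L)"
    from M.submoduleD[OF this] left_idealD[OF L] show "H \<subseteq> L \<and> left_ideal R H"
      by (auto simp: left_ideal_def) }
  { assume H: "H \<subseteq> L \<and> left_ideal R H"
    then show "submodule H R (lmod R L)"
      using left_idealD[of H] by (intro M.submoduleI) auto }
qed

lemma simple_lmod: "left_ideal R L \<Longrightarrow> simple_module R (lmod R L) \<longleftrightarrow>
    L \<noteq> {\<zero>} \<and> (\<forall>H. left_ideal R H \<longrightarrow> H \<subseteq> L \<longrightarrow> H = {\<zero>} \<or> H = L)"
  using lmod_left_module by (auto simp: simple_module_def submodule_lmod)

lemma left_ideal_times: 
  assumes "left_ideal R L" "a \<in> carrier R" shows "left_ideal R ((\<lambda>r. r \<otimes> a) ` L)"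
  unfolding left_ideal_def
proof (intro conjI ballI)
  note L = left_idealD[OF assms(1)]
  show "(\<lambda>r. r \<otimes> a) ` L \<subseteq> carrier R" using L assms(2) by auto
  show "\<zero> \<in> (\<lambda>r. r \<otimes> a) ` L" using L assms(2) by (auto intro!: image_eqI[of _ _ \<zero>])
  show "x \<oplus> y \<in> (\<lambda>r. r \<otimes> a) ` L" if xy: "x \<in> (\<lambda>r. r \<otimes> a) ` L" "y \<in> (\<lambda>r. r \<otimes> a) ` L" for x y
  proof -
    obtain b c where "b \<in> L" "c \<in> L" "x = b \<otimes> a" "y = c \<otimes> a" using xy by blast
    then show ?thesis using L assms(2) by (auto intro!: image_eqI[of _ _ "b \<oplus> c"] simp: l_distr)
  qed
  show "r \<otimes> x \<in> (\<lambda>r. r \<otimes> a) ` L" if r: "r \<in> carrier R" and x: "x \<in> (\<lambda>r. r \<otimes> a) ` L" for r x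
  proof -
    obtain b where "b \<in> L" "x = b \<otimes> a" using x by blast
    then show ?thesis using L assms(2) r by (auto intro!: image_eqI[of _ _ "r \<otimes> b"] simp: m_assoc)
  qed
qed

lemma left_ideal_carrier: "left_ideal R (carrier R)"
  by (auto simp: left_ideal_def)

lemma principal_left_ideal: "a \<in> carrier R \<Longrightarrow> left_ideal R (principal_left R a)"
  unfolding principal_left_def by (rule left_ideal_times[OF left_ideal_carrier])

lemma principal_left_self: "a \<in> carrier R \<Longrightarrow> a \<in> principal_left R a"
  unfolding principal_left_def by (auto intro!: image_eqI[of _ _ \<one>])

lemma principal_left_sub: "left_ideal R L \<Longrightarrow> a \<in> L \<Longrightarrow> principal_left R a \<subseteq> L"
  unfolding principal_left_def using left_idealD by blast

lemma idempotent_principal_left: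
  assumes "e \<in> carrier R" "e \<otimes> e = e"
  shows "principal_left R e = {x \<in> carrier R. x \<otimes> e = x}"
  using assms by (auto simp: principal_left_def m_assoc image_iff) metis

lemma corner_ring:
  assumes e: "e \<in> carrier R" "e \<otimes> e = e" shows "ring (corner R e)"
proof (rule ringI)
  show "abelian_group (corner R e)"
  proof (rule abelian_groupI)
    fix x assume "x \<in> carrier (corner R e)"
    then show "\<exists>y\<in>carrier (corner R e). y \<oplus>\<^bsub>corner R e\<^esub> x = \<zero>\<^bsub>corner R e\<^esub>"
      using e by (auto intro!: bexI[of _ "\<ominus> x"] simp: l_neg l_minus r_minus)
  qed (use e in \<open>auto simp: a_ac l_distr r_distr\<close>)
  have "e \<otimes> (x \<otimes> y) = x \<otimes> y" if "x \<in> carrier R" "y \<in> carrier R" "e \<otimes> x = x" for x y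
    using that e by (simp flip: m_assoc)
  then show "monoid (corner R e)"
    by (intro monoidI) (use e in \<open>auto simp: m_assoc\<close>)
qed (auto simp: l_distr r_distr)

text \<open>Left inverses suffice: if sr = e and ts = e, then t = t(sr) = (ts)r = r, so s is a
  two-sided inverse of r.\<close>

lemma division_cornerI:
  assumes e: "e \<in> carrier R" "e \<otimes> e = e" "e \<noteq> \<zero>"
    and inv: "\<And>r. r \<in> carrier (corner R e) \<Longrightarrow> r \<noteq> \<zero> \<Longrightarrow> \<exists>s\<in>carrier (corner R e). s \<otimes> r = e"
  shows "is_division_ring (corner R e)"
proof -
  have "r \<in> Units (corner R e)" if r: "r \<in> carrier (corner R e)" "r \<noteq> \<zero>" for r
  proof -
    obtain s where s: "s \<in> carrier (corner R e)" "s \<otimes> r = e" using inv r by blast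
    then have "s \<noteq> \<zero>" using e r by auto
    then obtain t where t: "t \<in> carrier (corner R e)" "t \<otimes> s = e" using inv s by blast
    have "t = t \<otimes> (s \<otimes> r)" using s t by simp
    also have "\<dots> = r" using s(1) t r by (simp flip: m_assoc)
    finally show ?thesis using r s t by (auto simp: Units_def)
  qed
  then have "carrier (corner R e) - {\<zero>\<^bsub>corner R e\<^esub>} \<subseteq> Units (corner R e)"
    unfolding corner_sel(2) by blast
  then show ?thesis using corner_ring[OF e(1,2)] e by (simp add: is_division_ring_def)
qed

text \<open>Schur's lemma in terms of elements: a nonzero r in eRe generates Re by simplicity, so e
  = br for some b, and ebe is a left inverse of r inside the corner.\<close>

lemma simple_imp_division_corner:
  assumes e: "e \<in> carrier R" "e \<otimes> e = e" and simple: "simple_module R (lmod R (principal_left R e))"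
  shows "e \<noteq> \<zero>" "is_division_ring (corner R e)"
proof -
  note S = simple[unfolded simple_lmod[OF principal_left_ideal[OF e(1)]]]
  have "principal_left R \<zero> = {\<zero>}" by (auto simp: principal_left_def)
  then show e0: "e \<noteq> \<zero>" using S by blast
  show "is_division_ring (corner R e)"
  proof (rule division_cornerI[OF e e0])
    fix r assume r: "r \<in> carrier (corner R e)" "r \<noteq> \<zero>"
    have rc: "r \<in> carrier R" "r \<in> principal_left R e" using r by (auto simp: idempotent_principal_left[OF e])
    have "principal_left R r \<subseteq> principal_left R e"
      by (rule principal_left_sub[OF principal_left_ideal[OF e(1)] rc(2)])
    then have "principal_left R r = principal_left R e"
      using S principal_left_ideal[OF rc(1)] principal_left_self[OF rc(1)] r(2) by blast
    then obtain b where b: "b \<in> carrier R" "e = b \<otimes> r"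
      using principal_left_self[OF e(1)] unfolding principal_left_def by auto
    have "(e \<otimes> b \<otimes> e) \<otimes> r = e \<otimes> (b \<otimes> (e \<otimes> r))" using b(1) e rc(1) by (simp add: m_assoc)
    also have "\<dots> = e" using r b(2) e by simp
    finally have "(e \<otimes> b \<otimes> e) \<otimes> r = e" .
    moreover have "e \<otimes> b \<otimes> e \<in> carrier (corner R e)"
      using b(1) e by (simp add: m_assoc) (simp flip: m_assoc)
    ultimately show "\<exists>s\<in>carrier (corner R e). s \<otimes> r = e" by blast
  qed
qed

text \<open>The elements a with eRa = 0 form a two-sided ideal, which omits 1 because e is
  nonzero.\<close>

lemma simple_idempotent_faithful:
  assumes "simple_ring R" and e: "e \<in> carrier R" "e \<noteq> \<zero>"
    and a: "a \<in> carrier R" "\<And>b. b \<in> carrier R \<Longrightarrow> e \<otimes> b \<otimes> a = \<zero>"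
  shows "a = \<zero>"
proof -
  let ?I = "{a \<in> carrier R. \<forall>b\<in>carrier R. e \<otimes> b \<otimes> a = \<zero>}"
  have "ideal ?I R"
  proof (rule ideal_of_closed)
    fix r x assume r: "r \<in> carrier R" and x: "x \<in> ?I"
    have "e \<otimes> b \<otimes> (r \<otimes> x) = \<zero>" if "b \<in> carrier R" for b
    proof -
      have "e \<otimes> b \<otimes> (r \<otimes> x) = e \<otimes> (b \<otimes> r) \<otimes> x" using e r x that by (simp add: m_assoc)
      then show ?thesis using x r that by simp
    qed
    then show "r \<otimes> x \<in> ?I" using r x by auto
    show "x \<otimes> r \<in> ?I" using r x e by (auto simp flip: m_assoc)
  qed (use e in \<open>auto simp: r_distr\<close>)
  then have "?I = {\<zero>} \<or> ?I = carrier R" using assms(1) by (simp add: simple_ring_def)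
  moreover have "\<one> \<notin> ?I" using e by (auto intro!: bexI[of _ \<one>])
  ultimately show ?thesis using a by blast
qed

text \<open>A nonzero h in a left ideal H inside Re has some ebh nonzero. This lies in eRe and is
  invertible there, so H contains e. The converse direction is required because an idempotent
  obtained from a given matrix decomposition comes with its corner, not with a minimal left
  ideal.\<close>

lemma division_corner_imp_simple:
  assumes R: "simple_ring R" and e: "e \<in> carrier R" "e \<otimes> e = e" and D: "is_division_ring (corner R e)"
  shows "simple_module R (lmod R (principal_left R e))"
  unfolding simple_lmod[OF principal_left_ideal[OF e(1)]]
proof (intro conjI allI impI)
  have e0: "e \<noteq> \<zero>" using D by (simp add: is_division_ring_def)
  then show "principal_left R e \<noteq> {\<zero>}" using principal_left_self[OF e(1)] by blast
  fix H assume H: "left_ideal R H" "H \<subseteq> principal_left R e"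
  show "H = {\<zero>} \<or> H = principal_left R e"
  proof (rule disjCI)
    assume ne: "H \<noteq> principal_left R e"
    have "h = \<zero>" if h: "h \<in> H" for h
    proof (rule ccontr)
      assume "h \<noteq> \<zero>"
      have hc: "h \<in> carrier R" "h \<otimes> e = h" using h H idempotent_principal_left[OF e] by auto
      obtain b where b: "b \<in> carrier R" "e \<otimes> b \<otimes> h \<noteq> \<zero>"
        using simple_idempotent_faithful[OF R e(1) e0 hc(1)] \<open>h \<noteq> \<zero>\<close> by blast
      have "e \<otimes> b \<otimes> h \<in> carrier (corner R e)"
        using e b(1) hc by (simp add: m_assoc) (simp flip: m_assoc add: e)
      then have "e \<otimes> b \<otimes> h \<in> Units (corner R e)" using D b(2) by (auto simp: is_division_ring_def)
      then obtain s where s: "s \<in> carrier R" "s \<otimes> (e \<otimes> b \<otimes> h) = e" by (auto simp: Units_def)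
      have "s \<otimes> (e \<otimes> b \<otimes> h) \<in> H" using left_idealD(4)[OF H(1)] h s(1) e(1) b(1) by simp
      then have "principal_left R e \<subseteq> H" using principal_left_sub[OF H(1)] s(2) by simp
      then show False using ne H(2) by blast
    qed
    then show "H = {\<zero>}" using left_idealD(2)[OF H(1)] by blast
  qed
qed

lemma minimal_left_ideal:
  assumes "left_artinian R" "\<one> \<noteq> \<zero>"
  obtains L where "left_ideal R L" "simple_module R (lmod R L)"
proof -
  obtain \<mu> :: "'a set \<Rightarrow> nat" where \<mu>: "\<And>L L'. left_ideal R L \<Longrightarrow> left_ideal R L' \<Longrightarrow> L \<subset> L' \<Longrightarrow> \<mu> L < \<mu> L'"
    using assms by (auto simp: left_artinian_def)
  have "left_ideal R (carrier R) \<and> carrier R \<noteq> {\<zero>}" using assms(2) left_ideal_carrier by (metis one_closed singletonD)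
  from ex_has_least_nat[of "\<lambda>L. left_ideal R L \<and> L \<noteq> {\<zero>}", OF this, of \<mu>]
  obtain L where L: "left_ideal R L" "L \<noteq> {\<zero>}"
    and min: "\<And>H. left_ideal R H \<Longrightarrow> H \<noteq> {\<zero>} \<Longrightarrow> \<mu> L \<le> \<mu> H" by blast
  have "H = {\<zero>} \<or> H = L" if "left_ideal R H" "H \<subseteq> L" for H
    using \<mu>[OF that(1) L(1)] min[OF that(1)] that(2) by (metis leD psubsetI)
  then show thesis using L that simple_lmod by blast
qed

text \<open>Brauer's argument. A minimal left ideal L has zero annihilator, so ba is nonzero for
  some a, b in L. Minimality gives La = L, whence ea = a for some e in L, and it makes the
  annihilator of a in L trivial. As ee - e lies in that annihilator, e is idempotent, and Re =
  L.\<close>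

lemma primitive_idempotent:
  assumes R: "simple_ring R" and "left_artinian R"
  obtains e where "e \<in> carrier R" "e \<otimes> e = e" "simple_module R (lmod R (principal_left R e))"
proof -
  have "\<one> \<noteq> \<zero>" using R one_zeroD by (auto simp: simple_ring_def)
  then obtain L where L: "left_ideal R L" and simple: "simple_module R (lmod R L)"
    using minimal_left_ideal assms(2) by blast
  note LD = left_idealD[OF L]
  note S = simple[unfolded simple_lmod[OF L]]
  interpret M: left_module R "lmod R L" by (rule lmod_left_module[OF L])
  have "annihilator R (lmod R L) = {\<zero>} \<or> annihilator R (lmod R L) = carrier R"
    using R M.annihilator_ideal by (simp add: simple_ring_def)
  moreover have "\<one> \<notin> annihilator R (lmod R L)"
    using S LD by (auto simp: annihilator_def)
  ultimately have ann: "annihilator R (lmod R L) = {\<zero>}" by auto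
  obtain b where b: "b \<in> L" "b \<noteq> \<zero>" using S LD(2) by blast
  then have "b \<notin> annihilator R (lmod R L)" using ann by simp
  then obtain a where a: "a \<in> L" "b \<otimes> a \<noteq> \<zero>" using b LD(1) by (auto simp: annihilator_def)
  have "(\<lambda>r. r \<otimes> a) ` L \<subseteq> L" using LD a by auto
  then have "(\<lambda>r. r \<otimes> a) ` L = L"
    using S left_ideal_times[OF L LD(1)[OF a(1)]] a(2) b(1) by blast
  then have "a \<in> (\<lambda>r. r \<otimes> a) ` L" using a(1) by simp
  then obtain e where e: "e \<in> L" "e \<otimes> a = a" by auto
  let ?N = "{x \<in> L. x \<otimes> a = \<zero>}"
  have "left_ideal R ?N" using LD a by (auto simp: left_ideal_def l_distr m_assoc)
  moreover have "?N \<noteq> L" using a b by blast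
  ultimately have N: "?N = {\<zero>}" using S by blast
  have "e \<otimes> e \<oplus> \<ominus> e \<in> ?N"
    using e a(1) LD left_ideal_minus[OF L] by (simp add: l_distr m_assoc l_minus r_neg)
  then have "e \<otimes> e \<oplus> \<ominus> e = \<zero>" using N by blast
  then have ee: "e \<otimes> e = e" using e LD(1) by (metis a_inv_closed m_closed minus_equality minus_minus)
  have "e \<noteq> \<zero>" using e a b LD by (metis l_null r_null)
  moreover have "principal_left R e \<subseteq> L" using principal_left_sub[OF L e(1)] .
  ultimately have "principal_left R e = L"
    using S[THEN conjunct2, rule_format, OF principal_left_ideal[OF LD(1)[OF e(1)]]]
      principal_left_self[OF LD(1)[OF e(1)]] by blast
  then show thesis using that[of e] simple e LD(1) ee by simp
qed

end

text \<open>V is faithful because R is simple, so some l in L and v in V have lv nonzero. Then x to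
  xv is a nonzero homomorphism between simple modules, hence bijective.\<close>

lemma simple_ring_unique_simple:
  assumes R: "simple_ring R" and L: "left_ideal R L" "simple_module R (lmod R L)" and V: "simple_module R V"
  shows "module_isomorphic R (lmod R L) V"
proof -
  interpret V: left_module R V using V by (simp add: simple_module_def)
  note LD = V.R.left_idealD[OF L(1)]
  note S = L(2)[unfolded V.R.simple_lmod[OF L(1)]]
  have "annihilator R V = {\<zero>\<^bsub>R\<^esub>} \<or> annihilator R V = carrier R"
    using R V.annihilator_ideal by (simp add: simple_ring_def)
  moreover have "\<one>\<^bsub>R\<^esub> \<notin> annihilator R V"
    using V V.M.zero_closed V.smult_one by (force simp: annihilator_def simple_module_def)
  ultimately have ann: "annihilator R V = {\<zero>\<^bsub>R\<^esub>}" by auto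
  obtain l where l: "l \<in> L" "l \<noteq> \<zero>\<^bsub>R\<^esub>" using S LD(2) by blast
  then have "l \<notin> annihilator R V" using ann by simp
  then obtain v where v: "v \<in> carrier V" "l \<odot>\<^bsub>V\<^esub> v \<noteq> \<zero>\<^bsub>V\<^esub>" using l LD(1) by (auto simp: annihilator_def)
  have hom: "(\<lambda>x. x \<odot>\<^bsub>V\<^esub> v) \<in> module_hom R (lmod R L) V"
    using v LD by (auto simp: module_hom_def V.smult_closed V.smult_l_distr V.smult_assoc1)
  have "bij_betw (\<lambda>x. x \<odot>\<^bsub>V\<^esub> v) (carrier (lmod R L)) (carrier V)"
    using schur[OF L(2) V hom, of l] l v by simp
  then show ?thesis using hom unfolding module_isomorphic_def by blast
qed

lemma simple_modules_isomorphic: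
  assumes R: "simple_ring R" "left_artinian R" and V: "simple_module R V" and W: "simple_module R W"
  shows "module_isomorphic R V W"
proof -
  interpret R: ring R using R by (simp add: simple_ring_def)
  obtain e where e: "e \<in> carrier R" "simple_module R (lmod R (principal_left R e))"
    using R.primitive_idempotent[OF R] by blast
  note L = R.principal_left_ideal[OF e(1)]
  show ?thesis
    by (rule module_isomorphic_trans[OF module_isomorphic_sym[OF R.lmod_left_module[OF L]
      simple_ring_unique_simple[OF R(1) L e(2) V]] simple_ring_unique_simple[OF R(1) L e(2) W]])
qed

text \<open>The endomorphism of \<open>Re\<close> determined by \<open>r \<in> eRe\<close> is right multiplication by \<open>r\<close>; with
  endomorphisms on the right this is multiplicative.\<close>

lemma module_End_corner:
  assumes R: "ring R" and e: "e \<in> carrier R" "e \<otimes>\<^bsub>R\<^esub> e = e" and V: "left_module R V"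
    and iso: "module_isomorphic R (lmod R (principal_left R e)) V"
  shows "corner R e \<simeq> module_End R V"
proof -
  interpret R: ring R by fact
  interpret V: left_module R V by fact
  let ?L = "lmod R (principal_left R e)"
  note Re = R.idempotent_principal_left[OF e]
  note L = R.principal_left_ideal[OF e(1)]
  obtain f where f: "f \<in> module_hom R ?L V" "bij_betw f (carrier ?L) (carrier V)"
    using iso unfolding module_isomorphic_def by blast
  define g where "g = inv_into (carrier ?L) f"
  have g: "g \<in> module_hom R V ?L" unfolding g_def by (rule inv_module_hom[OF R.lmod_left_module[OF L] f])
  note fh = module_homD[OF f(1), simplified Re lmod_sel] and gh = module_homD[OF g, simplified Re lmod_sel]
  have gf: "g (f x) = x" if "x \<in> carrier R" "x \<otimes>\<^bsub>R\<^esub> e = x" for x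
    using that f(2) Re by (auto simp: g_def bij_betw_def)
  have fg: "f (g v) = v" if "v \<in> carrier V" for v
    using that f(2) by (auto simp: g_def bij_betw_def f_inv_into_f)
  define \<theta> where "\<theta> r = (\<lambda>v\<in>carrier V. f (g v \<otimes>\<^bsub>R\<^esub> r))" for r
  have gc: "g v \<in> carrier R" "g v \<otimes>\<^bsub>R\<^esub> e = g v" if "v \<in> carrier V" for v using gh(1)[OF that] by auto
  have mc: "g v \<otimes>\<^bsub>R\<^esub> r \<in> carrier R" "g v \<otimes>\<^bsub>R\<^esub> r \<otimes>\<^bsub>R\<^esub> e = g v \<otimes>\<^bsub>R\<^esub> r"
    if "v \<in> carrier V" "r \<in> carrier R" "r \<otimes>\<^bsub>R\<^esub> e = r" for v r
    using that gc e by (auto simp: R.m_assoc)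
  have \<theta>: "\<theta> r \<in> module_hom R V V \<inter> extensional (carrier V)" if "r \<in> carrier (corner R e)" for r
    using that gc gh(2,3) fh mc
    by (auto simp: \<theta>_def module_hom_def R.l_distr V.smult_closed R.m_assoc)
  have "\<theta> \<in> ring_iso (corner R e) (module_End R V)"
  proof (rule ring_iso_memI)
    fix r assume r: "r \<in> carrier (corner R e)"
    then show "\<theta> r \<in> carrier (module_End R V)" using \<theta> by (simp add: module_End_def)
    fix s assume s: "s \<in> carrier (corner R e)"
    show "\<theta> (r \<otimes>\<^bsub>corner R e\<^esub> s) = \<theta> r \<otimes>\<^bsub>module_End R V\<^esub> \<theta> s"
      using r s gf fh(1) mc gc by (auto simp: module_End_def compose_def \<theta>_def R.m_assoc intro!: restrict_ext)
    show "\<theta> (r \<oplus>\<^bsub>corner R e\<^esub> s) = \<theta> r \<oplus>\<^bsub>module_End R V\<^esub> \<theta> s"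
      using r s fh(2) mc gc by (auto simp: module_End_def \<theta>_def R.r_distr intro!: restrict_ext)
  next
    show "\<theta> \<one>\<^bsub>corner R e\<^esub> = \<one>\<^bsub>module_End R V\<^esub>"
      using gc fg by (auto simp: module_End_def \<theta>_def intro!: restrict_ext)
    show "bij_betw \<theta> (carrier (corner R e)) (carrier (module_End R V))"
      unfolding bij_betw_def
    proof
      \<comment> \<open>An endomorphism of a cyclic module is determined by the image of its
        generator, here f e; evaluating there recovers r, and for surjectivity it supplies the r
        belonging to h.\<close>
      have \<theta>e: "g (\<theta> r (f e)) = r" if "r \<in> carrier (corner R e)" for r
        using that e fh(1)[of e] gf[of e] gf[of r] by (auto simp: \<theta>_def)
      then show "inj_on \<theta> (carrier (corner R e))" by (metis inj_onI)
      have "h \<in> \<theta> ` carrier (corner R e)" if h: "h \<in> module_hom R V V \<inter> extensional (carrier V)" for h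
      proof -
        have h1: "h \<in> module_hom R V V" using h by blast
        note hh = module_homD[OF h1]
        have fe: "f e \<in> carrier V" using e by (intro fh(1)) auto
        let ?r = "g (h (f e))"
        have rc: "?r \<in> carrier R" "?r \<otimes>\<^bsub>R\<^esub> e = ?r" using gc hh(1) fe by auto
        have eq: "x \<otimes>\<^bsub>R\<^esub> ?r = g (h (f (x \<otimes>\<^bsub>R\<^esub> e)))" if "x \<in> carrier R" for x
          using that fh(3)[of x e] hh gh(3)[of x] fe e by simp
        have "e \<otimes>\<^bsub>R\<^esub> ?r = ?r" using eq[OF e(1)] e by simp
        then have r: "?r \<in> carrier (corner R e)" using rc by simp
        have "\<theta> ?r = h"
        proof
          fix v show "\<theta> ?r v = h v"
          proof (cases "v \<in> carrier V")
            case True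
            then show ?thesis using eq[of "g v"] gc[of v] fg[of v] fg[of "h v"] hh(1) by (simp add: \<theta>_def)
          next
            case False
            then show ?thesis using h by (auto simp: \<theta>_def extensional_def)
          qed
        qed
        then show ?thesis using r by (metis imageI)
      qed
      then show "\<theta> ` carrier (corner R e) = carrier (module_End R V)"
        using \<theta> by (auto simp: module_End_def)
    qed
  qed
  then show ?thesis by (auto simp: is_ring_iso_def)
qed

lemma is_division_ring_iso:
  assumes "is_division_ring D" "ring R" "R \<simeq> D" shows "is_division_ring R"
proof -
  interpret R: ring R by fact
  interpret D: ring D using assms by (simp add: is_division_ring_def)
  obtain f where f: "f \<in> ring_iso R D" using assms by (auto simp: is_ring_iso_def)
  note fh = ring_iso_memE[OF f]
  interpret f: ring_hom_ring R D f
    by (rule ring_hom_ringI2) (use f in \<open>auto simp: ring_iso_def R.ring_axioms D.ring_axioms\<close>)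
  have inj: "x = y" if "f x = f y" "x \<in> carrier R" "y \<in> carrier R" for x y
    using that fh(5) by (auto simp: bij_betw_def inj_on_def)
  have "x \<in> Units R" if x: "x \<in> carrier R" "x \<noteq> \<zero>\<^bsub>R\<^esub>" for x
  proof -
    have "f x \<noteq> \<zero>\<^bsub>D\<^esub>" using inj[of x "\<zero>\<^bsub>R\<^esub>"] x by auto
    then have "f x \<in> Units D" using assms(1) fh(1)[OF x(1)] by (auto simp: is_division_ring_def)
    then obtain d where d: "d \<in> carrier D" "d \<otimes>\<^bsub>D\<^esub> f x = \<one>\<^bsub>D\<^esub>" "f x \<otimes>\<^bsub>D\<^esub> d = \<one>\<^bsub>D\<^esub>" by (auto simp: Units_def)
    obtain y where y: "y \<in> carrier R" "d = f y" using d(1) fh(5) by (auto simp: bij_betw_def)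
    have "y \<otimes>\<^bsub>R\<^esub> x = \<one>\<^bsub>R\<^esub>" "x \<otimes>\<^bsub>R\<^esub> y = \<one>\<^bsub>R\<^esub>" using d y x by (auto intro!: inj simp: fh)
    then show ?thesis using x y by (auto simp: Units_def)
  qed
  moreover have "\<one>\<^bsub>R\<^esub> \<noteq> \<zero>\<^bsub>R\<^esub>" using assms(1) fh(4) f.hom_zero unfolding is_division_ring_def by metis
  ultimately show ?thesis using assms(2) by (auto simp: is_division_ring_def)
qed

subsection \<open>Matrix units\<close>

context ring begin

lemma finsum_lessThan_add:
  fixes n m :: nat
  assumes "\<And>i. i < n + m \<Longrightarrow> F i \<in> carrier R"
  shows "finsum R F {..<n + m} = finsum R F {..<n} \<oplus> finsum R (\<lambda>i. F (n + i)) {..<m}"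
  using assms
proof (induction m)
  case 0
  then have "finsum R F {..<n} \<in> carrier R" by (intro finsum_closed) auto
  then show ?case by simp
next
  case (Suc m)
  have "finsum R F {..<n} \<in> carrier R" "finsum R (\<lambda>i. F (n + i)) {..<m} \<in> carrier R"
    using Suc.prems by (auto intro!: finsum_closed)
  moreover have "finsum R F {..<n + Suc m} = F (n + m) \<oplus> finsum R F {..<n + m}"
    using Suc.prems by (simp add: lessThan_Suc Pi_def)
  moreover have "finsum R (\<lambda>i. F (n + i)) {..<Suc m} = F (n + m) \<oplus> finsum R (\<lambda>i. F (n + i)) {..<m}"
    using Suc.prems by (simp add: lessThan_Suc Pi_def)
  ultimately show ?case using Suc by (simp add: a_ac)
qed

lemma finsum_corner:
  assumes e: "e \<in> carrier R" "e \<otimes> e = e" and "finite A" "\<And>x. x \<in> A \<Longrightarrow> f x \<in> carrier (corner R e)"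
  shows "finsum (corner R e) f A = finsum R f A"
proof -
  interpret C: ring "corner R e" by (rule corner_ring[OF e])
  show ?thesis using assms(3,4)
  proof (induction A)
    case empty
    then show ?case by simp
  next
    case (insert a A)
    then have "finsum (corner R e) f A = finsum R f A" by blast
    moreover have "f \<in> A \<rightarrow> carrier R" "f \<in> A \<rightarrow> carrier (corner R e)" "f a \<in> carrier R" "f a \<in> carrier (corner R e)"
      using insert.prems by auto
    ultimately show ?case using insert.hyps by simp
  qed
qed

text \<open>Membership of u_i in Re and of w_i in eR, written as fixed-point equations. The index
  set is a parameter because the minimality argument removes one index.\<close>

definition peirce :: "'a \<Rightarrow> nat set \<Rightarrow> (nat \<Rightarrow> 'a) \<Rightarrow> (nat \<Rightarrow> 'a) \<Rightarrow> bool" where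
  "peirce e I u w \<longleftrightarrow> (\<forall>i\<in>I. u i \<in> carrier R \<and> u i \<otimes> e = u i \<and> w i \<in> carrier R \<and> e \<otimes> w i = w i)"

lemma peirceD:
  assumes "peirce e I u w" "i \<in> I"
  shows "u i \<in> carrier R" "u i \<otimes> e = u i" "w i \<in> carrier R" "e \<otimes> w i = w i"
  using assms by (auto simp: peirce_def)

text \<open>The sums of products u_i w_i form the two-sided ideal ReR, which contains e and is
  therefore all of R; in particular it contains 1.\<close>

lemma peirce_decomposition:
  assumes R: "simple_ring R" and e: "e \<in> carrier R" "e \<otimes> e = e" "e \<noteq> \<zero>"
  obtains n u w where "peirce e {..<n} u w" "(\<Oplus>i\<in>{..<n}. u i \<otimes> w i) = \<one>"
proof -
  let ?J = "{c. \<exists>n u w. peirce e {..<n} u w \<and> c = (\<Oplus>i\<in>{..<n}. u i \<otimes> w i)}"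
  have "ideal ?J R"
  proof (rule ideal_of_closed)
    show "?J \<subseteq> carrier R" using peirceD by (auto intro!: finsum_closed)
    show "\<zero> \<in> ?J" by (auto intro!: exI[of _ 0] simp: peirce_def)
  next
    fix x y assume "x \<in> ?J" "y \<in> ?J"
    then obtain n u w m u' w' where x: "peirce e {..<n} u w" "x = (\<Oplus>i\<in>{..<n}. u i \<otimes> w i)"
      and y: "peirce e {..<m} u' w'" "y = (\<Oplus>i\<in>{..<m}. u' i \<otimes> w' i)" by blast
    define U W where "U i = (if i < n then u i else u' (i - n))" and "W i = (if i < n then w i else w' (i - n))" for i
    have UW: "peirce e {..<n + m} U W" using x(1) y(1) by (auto simp: peirce_def U_def W_def)
    have "(\<Oplus>i\<in>{..<n + m}. U i \<otimes> W i) = (\<Oplus>i\<in>{..<n}. U i \<otimes> W i) \<oplus> (\<Oplus>i\<in>{..<m}. U (n + i) \<otimes> W (n + i))"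
      using peirceD[OF UW] by (intro finsum_lessThan_add) auto
    moreover have "(\<Oplus>i\<in>{..<n}. U i \<otimes> W i) = x" unfolding x(2)
      using peirceD[OF x(1)] by (intro finsum_cong') (auto simp: U_def W_def)
    moreover have "(\<Oplus>i\<in>{..<m}. U (n + i) \<otimes> W (n + i)) = y" unfolding y(2)
      using peirceD[OF y(1)] by (intro finsum_cong') (auto simp: U_def W_def)
    ultimately have "x \<oplus> y = (\<Oplus>i\<in>{..<n + m}. U i \<otimes> W i)" by simp
    then show "x \<oplus> y \<in> ?J" using UW by blast
  next
    fix r x assume r: "r \<in> carrier R" and "x \<in> ?J"
    then obtain n u w where x: "peirce e {..<n} u w" "x = (\<Oplus>i\<in>{..<n}. u i \<otimes> w i)" by blast
    note p = peirceD[OF x(1)]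
    have "r \<otimes> x = (\<Oplus>i\<in>{..<n}. r \<otimes> (u i \<otimes> w i))"
      unfolding x(2) using p r by (intro finsum_rdistr) auto
    also have "\<dots> = (\<Oplus>i\<in>{..<n}. (r \<otimes> u i) \<otimes> w i)"
      using p r by (intro finsum_cong') (auto simp: m_assoc)
    finally have "r \<otimes> x = (\<Oplus>i\<in>{..<n}. (r \<otimes> u i) \<otimes> w i)" .
    moreover have "peirce e {..<n} (\<lambda>i. r \<otimes> u i) w" using p r e by (auto simp: peirce_def m_assoc)
    ultimately show "r \<otimes> x \<in> ?J" by blast
    have "x \<otimes> r = (\<Oplus>i\<in>{..<n}. u i \<otimes> w i \<otimes> r)"
      unfolding x(2) using p r by (intro finsum_ldistr) auto
    also have "\<dots> = (\<Oplus>i\<in>{..<n}. u i \<otimes> (w i \<otimes> r))"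
      using p r by (intro finsum_cong') (auto simp: m_assoc)
    finally have "x \<otimes> r = (\<Oplus>i\<in>{..<n}. u i \<otimes> (w i \<otimes> r))" .
    moreover have "peirce e {..<n} u (\<lambda>i. w i \<otimes> r)" using p r e by (auto simp: peirce_def simp flip: m_assoc)
    ultimately show "x \<otimes> r \<in> ?J" by blast
  qed
  moreover have "e \<in> ?J"
    using e by (auto intro!: exI[of _ 1] exI[of _ "\<lambda>_. e"] simp: peirce_def lessThan_Suc)
  ultimately have "?J = carrier R" using R e(3) unfolding simple_ring_def by blast
  then have "\<one> \<in> ?J" by simp
  then show thesis using that by auto
qed

text \<open>In a decomposition \<open>1 = \<Sum> u\<^sub>i w\<^sub>i\<close> of minimal length the \<open>u\<^sub>i\<close> are right independent over the
  division ring \<open>eRe\<close>, which forces the orthogonality relations.\<close>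

lemma matrix_units:
  assumes R: "simple_ring R" and e: "e \<in> carrier R" "e \<otimes> e = e" and D: "is_division_ring (corner R e)"
  obtains n u w where "peirce e {..<n} u w" "(\<Oplus>i\<in>{..<n}. u i \<otimes> w i) = \<one>"
    "\<And>i j. i < n \<Longrightarrow> j < n \<Longrightarrow> w i \<otimes> u j = (if i = j then e else \<zero>)"
proof -
  have e0: "e \<noteq> \<zero>" using D by (simp add: is_division_ring_def)
  let ?P = "\<lambda>n. \<exists>u w. peirce e {..<n} u w \<and> (\<Oplus>i\<in>{..<n}. u i \<otimes> w i) = \<one>"
  define n where "n = (LEAST n. ?P n)"
  have "\<exists>n. ?P n" using peirce_decomposition[OF R e e0] by metis
  then have "?P n" unfolding n_def by (rule LeastI_ex)
  then obtain u w where uw: "peirce e {..<n} u w" and one: "(\<Oplus>i\<in>{..<n}. u i \<otimes> w i) = \<one>" by blast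
  note p = peirceD[OF uw, unfolded lessThan_iff]
  have min: "n \<le> card I" if I: "finite I" "peirce e I u' w'" "(\<Oplus>i\<in>I. u' i \<otimes> w' i) = \<one>" for I u' w'
  proof -
    obtain h where h: "bij_betw h {..<card I} I"
      using ex_bij_betw_nat_finite[OF I(1)] by (auto simp: atLeast0LessThan)
    then have hI: "h ` {..<card I} = I" "inj_on h {..<card I}" by (auto simp: bij_betw_def)
    have "(\<Oplus>i\<in>h ` {..<card I}. u' i \<otimes> w' i) = (\<Oplus>i\<in>{..<card I}. u' (h i) \<otimes> w' (h i))"
      using peirceD[OF I(2)] hI by (intro finsum_reindex) auto
    then have "?P (card I)" using I(2,3) hI by (intro exI[of _ "u' \<circ> h"] exI[of _ "w' \<circ> h"]) (auto simp: peirce_def)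
    then show ?thesis unfolding n_def by (rule Least_le)
  qed
  have indep: "d k = \<zero>" if d: "\<And>i. i < n \<Longrightarrow> d i \<in> carrier (corner R e)" "(\<Oplus>i\<in>{..<n}. u i \<otimes> d i) = \<zero>" and k: "k < n" for d k
  proof (rule ccontr)
    assume "d k \<noteq> \<zero>"
    then have "d k \<in> Units (corner R e)" using D d(1)[OF k] by (auto simp: is_division_ring_def)
    then obtain d' where d': "d' \<in> carrier R" "d k \<otimes> d' = e" by (auto simp: Units_def)
    let ?I = "{..<n} - {k}"
    have I: "insert k ?I = {..<n}" "finite ?I" "k \<notin> ?I" using k by auto
    \<comment> \<open>With d' inverse to d_k in eRe, the relation gives u_k as minus the sum of u_i
      d_i d' over i \<noteq> k. Inserting this into 1 = sum of u_i w_i eliminates the index k and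
      replaces w_i by w_i + d_i c, which contradicts minimality.\<close>
    define c where "c = \<ominus> (d' \<otimes> w k)"
    have c: "c \<in> carrier R" using d' p k by (simp add: c_def)
    have dc: "d i \<in> carrier R" "e \<otimes> d i = d i" if "i < n" for i using d(1)[OF that] by auto
    have s1: "(\<Oplus>i\<in>?I. u i \<otimes> d i) \<in> carrier R" "(\<Oplus>i\<in>?I. u i \<otimes> w i) \<in> carrier R"
      using p dc by (auto intro!: finsum_closed)
    have "(\<Oplus>i\<in>insert k ?I. u i \<otimes> d i) = u k \<otimes> d k \<oplus> (\<Oplus>i\<in>?I. u i \<otimes> d i)"
      using p dc k by (intro finsum_insert) auto
    then have "u k \<otimes> d k \<oplus> (\<Oplus>i\<in>?I. u i \<otimes> d i) = \<zero>" using d(2) I by simp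
    then have s2: "(\<Oplus>i\<in>?I. u i \<otimes> d i) = \<ominus> (u k \<otimes> d k)"
      using s1 p(1)[OF k] dc(1)[OF k] by (metis a_comm m_closed minus_equality)
    have "(\<Oplus>i\<in>insert k ?I. u i \<otimes> w i) = u k \<otimes> w k \<oplus> (\<Oplus>i\<in>?I. u i \<otimes> w i)"
      using p k by (intro finsum_insert) auto
    then have s3: "u k \<otimes> w k \<oplus> (\<Oplus>i\<in>?I. u i \<otimes> w i) = \<one>" using one I by simp
    have "(\<Oplus>i\<in>?I. u i \<otimes> (w i \<oplus> d i \<otimes> c)) = (\<Oplus>i\<in>?I. u i \<otimes> w i \<oplus> (u i \<otimes> d i) \<otimes> c)"
      using p dc c by (intro finsum_cong') (auto simp: r_distr m_assoc)
    also have "\<dots> = (\<Oplus>i\<in>?I. u i \<otimes> w i) \<oplus> (\<Oplus>i\<in>?I. (u i \<otimes> d i) \<otimes> c)"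
      using p dc c by (intro finsum_addf) auto
    also have "(\<Oplus>i\<in>?I. (u i \<otimes> d i) \<otimes> c) = (\<Oplus>i\<in>?I. u i \<otimes> d i) \<otimes> c"
      using p dc c by (intro finsum_ldistr[symmetric]) auto
    also have "(\<Oplus>i\<in>?I. u i \<otimes> d i) \<otimes> c = u k \<otimes> d k \<otimes> (d' \<otimes> w k)"
      unfolding s2 c_def using p k dc d'(1) by (simp add: l_minus r_minus)
    also have "\<dots> = u k \<otimes> (d k \<otimes> d') \<otimes> w k" using p k dc d'(1) by (simp add: m_assoc)
    also have "\<dots> = u k \<otimes> w k" using d'(2) p k e by simp
    also have "(\<Oplus>i\<in>?I. u i \<otimes> w i) \<oplus> u k \<otimes> w k = \<one>" using s3 s1 p k by (simp add: a_comm)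
    finally have "(\<Oplus>i\<in>?I. u i \<otimes> (w i \<oplus> d i \<otimes> c)) = \<one>" .
    moreover have "peirce e ?I u (\<lambda>i. w i \<oplus> d i \<otimes> c)"
      unfolding peirce_def using p dc c e by (auto simp: r_distr simp flip: m_assoc)
    ultimately have "n \<le> card ?I" using min I(2) by blast
    then show False using k by simp
  qed
  have "w i \<otimes> u j = (if i = j then e else \<zero>)" if i: "i < n" and j: "j < n" for i j
  proof -
    \<comment> \<open>The defect of the orthogonality relation for column j. The sum of u_i d_i is
      (sum of u_i w_i) u_j - u_j = 0, so independence forces every defect to vanish.\<close>
    define d where "d i = w i \<otimes> u j \<oplus> (if i = j then \<ominus> e else \<zero>)" for i
    have dc: "d i \<in> carrier (corner R e)" if "i < n" for i
      using p that j e by (auto simp: d_def l_distr r_distr l_minus r_minus m_assoc simp flip: m_assoc[of e])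
    have uj: "u i \<otimes> (if i = j then \<ominus> e else \<zero>) = (if i = j then \<ominus> u i else \<zero>)" if "i < n" for i
      using p that e by (simp add: r_minus)
    have "(\<Oplus>i\<in>{..<n}. u i \<otimes> d i) = (\<Oplus>i\<in>{..<n}. u i \<otimes> w i \<otimes> u j \<oplus> (if i = j then \<ominus> u i else \<zero>))"
      unfolding d_def using p j e by (intro finsum_cong') (auto simp: r_distr m_assoc r_minus)
    also have "\<dots> = (\<Oplus>i\<in>{..<n}. u i \<otimes> w i \<otimes> u j) \<oplus> (\<Oplus>i\<in>{..<n}. if i = j then \<ominus> u i else \<zero>)"
      using p j by (intro finsum_addf) auto
    also have "(\<Oplus>i\<in>{..<n}. u i \<otimes> w i \<otimes> u j) = u j"
      using p j one by (subst finsum_ldistr[symmetric]) auto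
    also have "(\<Oplus>i\<in>{..<n}. if i = j then \<ominus> u i else \<zero>) = \<ominus> u j"
      using p j by (intro add.finprod_singleton_swap) auto
    finally have "(\<Oplus>i\<in>{..<n}. u i \<otimes> d i) = \<zero>" using p j by (simp add: r_neg)
    then have "d i = \<zero>" using indep dc i by blast
    then show ?thesis unfolding d_def using p i j e
      by (cases "i = j") (auto, metis a_inv_closed m_closed minus_equality minus_minus)
  qed
  then show thesis using that uw one by blast
qed

text \<open>a goes to the matrix with entries w_i a u_j, and a matrix A to the sum of u_i A_ij w_j.
  Inserting 1 = sum of u_k w_k gives multiplicativity and one composite; the relations w_i u_j =
  \<delta>_ij e give the other.\<close>

lemma ring_iso_matrix_corner:
  assumes R: "simple_ring R" and e: "e \<in> carrier R" "e \<otimes> e = e" and D: "is_division_ring (corner R e)"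
  shows "\<exists>d. R \<simeq> matrix_ring d (corner R e)"
proof -
  obtain n u w where uw: "peirce e {..<n} u w" and one: "(\<Oplus>i\<in>{..<n}. u i \<otimes> w i) = \<one>"
    and orth: "\<And>i j. i < n \<Longrightarrow> j < n \<Longrightarrow> w i \<otimes> u j = (if i = j then e else \<zero>)"
    by (rule matrix_units[OF assms], rule that)
  note p = peirceD[OF uw, unfolded lessThan_iff]
  define F where "F a = (\<lambda>i j. if i < n \<and> j < n then w i \<otimes> a \<otimes> u j else \<zero>)" for a
  define G where "G A = (\<Oplus>i\<in>{..<n}. u i \<otimes> (\<Oplus>j\<in>{..<n}. A i j \<otimes> w j))" for A :: "nat \<Rightarrow> nat \<Rightarrow> 'a"
  have wau: "w i \<otimes> a \<otimes> u j \<in> carrier (corner R e)" if "i < n" "j < n" "a \<in> carrier R" for i j a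
    using that p e by (auto simp: m_assoc) (simp flip: m_assoc)
  have Fc: "F a \<in> carrier (matrix_ring n (corner R e))" if "a \<in> carrier R" for a
    using wau that by (simp add: matrix_ring_def F_def)
  have mid: "(\<Oplus>k\<in>{..<n}. x \<otimes> u k \<otimes> (w k \<otimes> y)) = x \<otimes> y" if "x \<in> carrier R" "y \<in> carrier R" for x y
  proof -
    have "(\<Oplus>k\<in>{..<n}. x \<otimes> u k \<otimes> (w k \<otimes> y)) = (\<Oplus>k\<in>{..<n}. x \<otimes> (u k \<otimes> w k) \<otimes> y)"
      using p that by (intro finsum_cong') (auto simp: m_assoc)
    also have "\<dots> = (\<Oplus>k\<in>{..<n}. x \<otimes> (u k \<otimes> w k)) \<otimes> y"
      using p that by (intro finsum_ldistr[symmetric]) auto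
    also have "(\<Oplus>k\<in>{..<n}. x \<otimes> (u k \<otimes> w k)) = x"
      using p that one by (subst finsum_rdistr[symmetric]) auto
    finally show ?thesis .
  qed
  have GF: "G (F a) = a" if a: "a \<in> carrier R" for a
  proof -
    have "(\<Oplus>j\<in>{..<n}. F a i j \<otimes> w j) = w i \<otimes> a" if i: "i < n" for i
    proof -
      have "(\<Oplus>j\<in>{..<n}. F a i j \<otimes> w j) = (\<Oplus>j\<in>{..<n}. (w i \<otimes> a) \<otimes> u j \<otimes> (w j \<otimes> \<one>))"
        using p i a by (intro finsum_cong') (auto simp: F_def)
      then show ?thesis using mid[of "w i \<otimes> a" \<one>] p i a by simp
    qed
    then have "G (F a) = (\<Oplus>i\<in>{..<n}. \<one> \<otimes> u i \<otimes> (w i \<otimes> a))"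
      unfolding G_def using p a by (intro finsum_cong') auto
    then show ?thesis using mid[of \<one> a] a by simp
  qed
  have single: "(\<Oplus>j\<in>{..<n}. if j = k then f j else \<zero>) = f k" if "k < n" "\<And>j. j < n \<Longrightarrow> f j \<in> carrier R" for f k
    using that by (intro add.finprod_singleton_swap) auto
  have FG: "F (G A) = A" and Gc: "G A \<in> carrier R" if A: "A \<in> carrier (matrix_ring n (corner R e))" for A
  proof -
    have Ac: "A i j \<in> carrier R" "e \<otimes> A i j = A i j" "A i j \<otimes> e = A i j" if "i < n" "j < n" for i j
      using A that by (auto simp: matrix_ring_def)
    have A0: "A i j = \<zero>" if "\<not> (i < n \<and> j < n)" for i j
      using A that by (auto simp: matrix_ring_def)
    have inner: "(\<Oplus>j\<in>{..<n}. A i j \<otimes> w j) \<in> carrier R" if "i < n" for i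
      using p Ac that by (auto intro!: finsum_closed)
    then show "G A \<in> carrier R" unfolding G_def using p by (auto intro!: finsum_closed)
    have "w i \<otimes> G A \<otimes> u j = A i j" if i: "i < n" and j: "j < n" for i j
    proof -
      have "w i \<otimes> G A = (\<Oplus>k\<in>{..<n}. w i \<otimes> (u k \<otimes> (\<Oplus>j\<in>{..<n}. A k j \<otimes> w j)))"
        unfolding G_def using p i inner by (intro finsum_rdistr) auto
      also have "\<dots> = (\<Oplus>k\<in>{..<n}. if k = i then e \<otimes> (\<Oplus>j\<in>{..<n}. A k j \<otimes> w j) else \<zero>)"
        using p i inner orth e by (intro finsum_cong') (auto simp flip: m_assoc)
      also have "\<dots> = e \<otimes> (\<Oplus>j\<in>{..<n}. A i j \<otimes> w j)" using i e inner by (intro single) auto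
      also have "\<dots> = (\<Oplus>j\<in>{..<n}. e \<otimes> (A i j \<otimes> w j))"
        using p i e Ac by (intro finsum_rdistr) auto
      also have "\<dots> = (\<Oplus>j\<in>{..<n}. A i j \<otimes> w j)"
        using p i e Ac by (intro finsum_cong') (auto simp flip: m_assoc)
      finally have "w i \<otimes> G A \<otimes> u j = (\<Oplus>k\<in>{..<n}. A i k \<otimes> w k \<otimes> u j)"
        using p i j Ac by (simp add: finsum_ldistr Pi_def)
      also have "\<dots> = (\<Oplus>k\<in>{..<n}. if k = j then A i k else \<zero>)"
        using p i j Ac orth by (intro finsum_cong') (auto simp: m_assoc)
      also have "\<dots> = A i j" using i j Ac by (intro single) auto
      finally show ?thesis .
    qed
    then show "F (G A) = A" using A0 by (auto simp: F_def fun_eq_iff)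
  qed
  have "F \<in> ring_iso R (matrix_ring n (corner R e))"
  proof (rule ring_iso_memI)
    show "bij_betw F (carrier R) (carrier (matrix_ring n (corner R e)))"
      by (rule bij_betw_byWitness[of _ G]) (use GF FG Fc Gc in auto)
    have "F \<one> i j = \<one>\<^bsub>matrix_ring n (corner R e)\<^esub> i j" for i j
      using p orth by (auto simp: F_def matrix_ring_def)
    then show "F \<one> = \<one>\<^bsub>matrix_ring n (corner R e)\<^esub>" by blast
    fix a b assume ab: "a \<in> carrier R" "b \<in> carrier R"
    show "F a \<in> carrier (matrix_ring n (corner R e))" using Fc ab by blast
    show "F (a \<oplus> b) = F a \<oplus>\<^bsub>matrix_ring n (corner R e)\<^esub> F b"
      using p ab by (auto simp: F_def matrix_ring_def fun_eq_iff l_distr r_distr)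
    have "(F a \<otimes>\<^bsub>matrix_ring n (corner R e)\<^esub> F b) i j = F (a \<otimes> b) i j" for i j
    proof (cases "i < n \<and> j < n")
      case True
      have "(F a \<otimes>\<^bsub>matrix_ring n (corner R e)\<^esub> F b) i j = finsum (corner R e) (\<lambda>k. F a i k \<otimes> F b k j) {..<n}"
        using True by (simp add: matrix_ring_def)
      also have "\<dots> = (\<Oplus>k\<in>{..<n}. F a i k \<otimes> F b k j)"
      proof (rule finsum_corner[OF e])
        interpret C: ring "corner R e" by (rule corner_ring[OF e])
        show "F a i k \<otimes> F b k j \<in> carrier (corner R e)" if "k \<in> {..<n}" for k
          using True that C.m_closed[OF wau[of i k a] wau[of k j b]] ab by (simp add: F_def)
      qed auto
      also have "\<dots> = (\<Oplus>k\<in>{..<n}. (w i \<otimes> a) \<otimes> u k \<otimes> (w k \<otimes> (b \<otimes> u j)))"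
        using True p ab by (intro finsum_cong') (auto simp: F_def m_assoc)
      also have "\<dots> = (w i \<otimes> a) \<otimes> (b \<otimes> u j)" using True p ab by (intro mid) auto
      finally show ?thesis using True p ab by (simp add: F_def m_assoc)
    qed (auto simp: F_def matrix_ring_def)
    then show "F (a \<otimes> b) = F a \<otimes>\<^bsub>matrix_ring n (corner R e)\<^esub> F b" by (metis ext)
  qed
  then show ?thesis by (auto simp: is_ring_iso_def)
qed

text \<open>The corner of a matrix ring at the matrix unit in position (0, 0) is D, read off at that
  entry; e is the preimage of this unit. Here D is prescribed, whereas
  \<open>ring_iso_matrix_corner\<close> produces its division ring from R.\<close>

lemma matrix_ring_iso_corner:
  assumes R: "simple_ring R" and D: "is_division_ring D" and iso: "R \<simeq> matrix_ring d D"
  obtains e where "e \<in> carrier R" "e \<otimes> e = e" "corner R e \<simeq> D"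
proof -
  interpret D: ring D using D by (simp add: is_division_ring_def)
  let ?M = "matrix_ring d D"
  obtain f where f: "f \<in> ring_iso R ?M" using iso by (auto simp: is_ring_iso_def)
  note fh = ring_iso_memE[OF f]
  have inj: "x = y" if "f x = f y" "x \<in> carrier R" "y \<in> carrier R" for x y
    using that fh(5) by (auto simp: bij_betw_def inj_on_def)
  have surj: "\<exists>x\<in>carrier R. f x = A" if "A \<in> carrier ?M" for A
    using that bij_betw_imp_surj_on[OF fh(5)] by (metis imageE)
  \<comment> \<open>Matrices of size 0 form the zero ring, which is not simple; without a row there
    would be no matrix unit.\<close>
  have d: "0 < d"
  proof (rule ccontr)
    assume "\<not> 0 < d"
    then have "f x = f \<zero>" if "x \<in> carrier R" for x
      using fh(1)[OF that] fh(1)[OF zero_closed] by (auto simp: matrix_ring_def fun_eq_iff)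
    then have "carrier R = {\<zero>}" using inj by blast
    then show False using R by (simp add: simple_ring_def)
  qed
  define E where "E y = (\<lambda>(i::nat) (j::nat). if i = 0 \<and> j = 0 then y else \<zero>\<^bsub>D\<^esub>)" for y
  have Ec: "E y \<in> carrier ?M" if "y \<in> carrier D" for y using that d by (auto simp: matrix_ring_def E_def)
  have single: "(\<Oplus>\<^bsub>D\<^esub>k\<in>{..<d}. if k = 0 then g k else \<zero>\<^bsub>D\<^esub>) = g 0" if "\<And>k. k < d \<Longrightarrow> g k \<in> carrier D" for g
    using that d by (intro D.add.finprod_singleton_swap) auto
  have Mc: "A i j \<in> carrier D" if "A \<in> carrier ?M" for A i j
    using that by (cases "i < d \<and> j < d") (auto simp: matrix_ring_def)
  have EA: "(E y \<otimes>\<^bsub>?M\<^esub> A) i j = (if i = 0 \<and> j < d then y \<otimes>\<^bsub>D\<^esub> A 0 j else \<zero>\<^bsub>D\<^esub>)"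
    if "y \<in> carrier D" "A \<in> carrier ?M" for y A i j
  proof -
    have "(\<Oplus>\<^bsub>D\<^esub>k\<in>{..<d}. E y i k \<otimes>\<^bsub>D\<^esub> A k j) = (\<Oplus>\<^bsub>D\<^esub>k\<in>{..<d}. if k = 0 then (if i = 0 then y \<otimes>\<^bsub>D\<^esub> A k j else \<zero>\<^bsub>D\<^esub>) else \<zero>\<^bsub>D\<^esub>)"
      using that Mc by (intro D.finsum_cong') (auto simp: E_def)
    also have "\<dots> = (if i = 0 then y \<otimes>\<^bsub>D\<^esub> A 0 j else \<zero>\<^bsub>D\<^esub>)" using that Mc by (intro single) auto
    finally show ?thesis using d by (auto simp: matrix_ring_def)
  qed
  have AE: "(A \<otimes>\<^bsub>?M\<^esub> E y) i j = (if j = 0 \<and> i < d then A i 0 \<otimes>\<^bsub>D\<^esub> y else \<zero>\<^bsub>D\<^esub>)"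
    if "y \<in> carrier D" "A \<in> carrier ?M" for y A i j
  proof -
    have "(\<Oplus>\<^bsub>D\<^esub>k\<in>{..<d}. A i k \<otimes>\<^bsub>D\<^esub> E y k j) = (\<Oplus>\<^bsub>D\<^esub>k\<in>{..<d}. if k = 0 then (if j = 0 then A i k \<otimes>\<^bsub>D\<^esub> y else \<zero>\<^bsub>D\<^esub>) else \<zero>\<^bsub>D\<^esub>)"
      using that Mc by (intro D.finsum_cong') (auto simp: E_def)
    also have "\<dots> = (if j = 0 then A i 0 \<otimes>\<^bsub>D\<^esub> y else \<zero>\<^bsub>D\<^esub>)" using that Mc by (intro single) auto
    finally show ?thesis using d by (auto simp: matrix_ring_def)
  qed
  have EE: "E y \<otimes>\<^bsub>?M\<^esub> E z = E (y \<otimes>\<^bsub>D\<^esub> z)" if "y \<in> carrier D" "z \<in> carrier D" for y z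
    using EA[OF that(1) Ec[OF that(2)]] d that by (auto simp: E_def fun_eq_iff)
  obtain e where e: "e \<in> carrier R" "f e = E \<one>\<^bsub>D\<^esub>" using surj[OF Ec[OF D.one_closed]] by blast
  have ee: "e \<otimes> e = e" using e EE[of "\<one>\<^bsub>D\<^esub>" "\<one>\<^bsub>D\<^esub>"] by (intro inj) (auto simp: fh)
  have fE: "f x = E (f x 0 0)" if "x \<in> carrier (corner R e)" for x
  proof (intro ext)
    fix i j
    have x: "x \<in> carrier R" "e \<otimes> x = x" "x \<otimes> e = x" using that by auto
    have "f x = E \<one>\<^bsub>D\<^esub> \<otimes>\<^bsub>?M\<^esub> f x" using fh(2)[OF e(1) x(1)] x e by simp
    then have 1: "f x i j = (if i = 0 \<and> j < d then \<one>\<^bsub>D\<^esub> \<otimes>\<^bsub>D\<^esub> f x 0 j else \<zero>\<^bsub>D\<^esub>)"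
      using EA[OF D.one_closed fh(1)[OF x(1)]] by metis
    have "f x = f x \<otimes>\<^bsub>?M\<^esub> E \<one>\<^bsub>D\<^esub>" using fh(2)[OF x(1) e(1)] x e by simp
    then have "f x i j = (if j = 0 \<and> i < d then f x i 0 \<otimes>\<^bsub>D\<^esub> \<one>\<^bsub>D\<^esub> else \<zero>\<^bsub>D\<^esub>)"
      using AE[OF D.one_closed fh(1)[OF x(1)]] by metis
    then show "f x i j = E (f x 0 0) i j" using 1 by (auto simp: E_def split: if_splits)
  qed
  have "(\<lambda>x. f x 0 0) \<in> ring_iso (corner R e) D"
  proof (rule ring_iso_memI)
    fix x assume x: "x \<in> carrier (corner R e)"
    then show c: "f x 0 0 \<in> carrier D" using Mc fh(1) by simp
    fix y assume y: "y \<in> carrier (corner R e)"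
    have cy: "f y 0 0 \<in> carrier D" using y Mc fh(1) by simp
    have "f (x \<otimes> y) = E (f x 0 0) \<otimes>\<^bsub>?M\<^esub> E (f y 0 0)" using fE[OF x] fE[OF y] fh(2) x y by simp
    then show "f (x \<otimes>\<^bsub>corner R e\<^esub> y) 0 0 = f x 0 0 \<otimes>\<^bsub>D\<^esub> f y 0 0" using c cy by (simp add: EE) (simp add: E_def)
    show "f (x \<oplus>\<^bsub>corner R e\<^esub> y) 0 0 = f x 0 0 \<oplus>\<^bsub>D\<^esub> f y 0 0" using x y d by (simp add: fh(3)) (simp add: matrix_ring_def)
  next
    show "f \<one>\<^bsub>corner R e\<^esub> 0 0 = \<one>\<^bsub>D\<^esub>" using e by (simp add: E_def)
    have "inj_on (\<lambda>x. f x 0 0) (carrier (corner R e))"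
    proof (rule inj_onI)
      fix x y assume "x \<in> carrier (corner R e)" "y \<in> carrier (corner R e)" "f x 0 0 = f y 0 0"
      then show "x = y" using fE[of x] fE[of y] by (intro inj) auto
    qed
    moreover have "z \<in> (\<lambda>x. f x 0 0) ` carrier (corner R e)" if z: "z \<in> carrier D" for z
    proof -
      obtain x where x: "x \<in> carrier R" "f x = E z" using surj[OF Ec[OF z]] by blast
      have "e \<otimes> x = x" "x \<otimes> e = x" using x e z by (auto intro!: inj simp: fh EE)
      then show ?thesis using x by (auto intro!: image_eqI[of _ _ x] simp: E_def)
    qed
    moreover have "(\<lambda>x. f x 0 0) ` carrier (corner R e) \<subseteq> carrier D" using Mc fh(1) by auto
    ultimately show "bij_betw (\<lambda>x. f x 0 0) (carrier (corner R e)) (carrier D)"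
      by (auto simp: bij_betw_def)
  qed
  then show thesis using that e ee by (auto simp: is_ring_iso_def)
qed

end

subsection \<open>Wedderburn's theorem\<close>

lemma simple_artinian_simple_module:
  assumes "simple_ring R" "left_artinian R"
  shows "\<exists>V :: ('r, 'r set) module. simple_module (R :: ('r, 'b) ring_scheme) V"
proof -
  interpret R: ring R using assms by (simp add: simple_ring_def)
  obtain e where "simple_module R (lmod R (principal_left R e))"
    using R.primitive_idempotent[OF assms] by blast
  then show ?thesis using simple_module_representative by blast
qed

text \<open>For an arbitrary matrix decomposition of R over a division ring D, the idempotent of the
  first matrix unit has corner D, so it generates a simple left ideal. That ideal is isomorphic to
  V, and its endomorphisms, written on the right, form the corner.\<close>

lemma End_of_simple_module:
  assumes R: "simple_ring R" and V: "simple_module R V" and D: "is_division_ring D" and iso: "R \<simeq> matrix_ring d D"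
  shows "module_End R V \<simeq> D"
proof -
  interpret R: ring R using R by (simp add: simple_ring_def)
  obtain e where e: "e \<in> carrier R" "e \<otimes>\<^bsub>R\<^esub> e = e" and eD: "corner R e \<simeq> D"
    using R.matrix_ring_iso_corner[OF R D iso] by blast
  have C: "is_division_ring (corner R e)" by (rule is_division_ring_iso[OF D R.corner_ring[OF e] eD])
  note S = R.division_corner_imp_simple[OF R e C]
  have "module_isomorphic R (lmod R (principal_left R e)) V"
    by (rule simple_ring_unique_simple[OF R R.principal_left_ideal[OF e(1)] S V])
  then have "corner R e \<simeq> module_End R V"
    using V by (intro module_End_corner[OF R.ring_axioms e]) (simp add: simple_module_def)
  then have "module_End R V \<simeq> corner R e" by (rule ring_iso_sym[OF R.corner_ring[OF e]])
  then show ?thesis using eD by (rule ring_iso_trans)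
qed

lemma wedderburn:
  fixes R :: "('r, 'b) ring_scheme"
  assumes "simple_ring R" "left_artinian R"
  obtains d and D :: "'r ring" where "is_division_ring D" "R \<simeq> matrix_ring d D"
proof -
  interpret R: ring R using assms by (simp add: simple_ring_def)
  obtain e where e: "e \<in> carrier R" "e \<otimes>\<^bsub>R\<^esub> e = e" and S: "simple_module R (lmod R (principal_left R e))"
    using R.primitive_idempotent[OF assms] by blast
  note D = R.simple_imp_division_corner(2)[OF e S]
  from R.ring_iso_matrix_corner[OF assms(1) e D] show thesis using that D by blast
qed

text \<open>If \<open>c\<close> is regular then the chain \<open>Rc \<supseteq> Rc\<^sup>2 \<supseteq> \<dots>\<close> becomes stationary, so \<open>c\<^sup>k = bc\<^sup>k\<^sup>+\<^sup>1\<close>.\<close>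

lemma regular_unit:
  assumes "ring R" "left_artinian R" and c: "c \<in> regular_elements R"
  shows "c \<in> Units R"
proof -
  interpret R: ring R by fact
  obtain \<mu> :: "'a set \<Rightarrow> nat" where \<mu>: "\<And>L L'. left_ideal R L \<Longrightarrow> left_ideal R L' \<Longrightarrow> L \<subset> L' \<Longrightarrow> \<mu> L < \<mu> L'"
    using assms(2) by (auto simp: left_artinian_def)
  have cc: "c \<in> carrier R" and reg: "\<And>r. r \<in> carrier R \<Longrightarrow> r \<otimes>\<^bsub>R\<^esub> c = \<zero>\<^bsub>R\<^esub> \<Longrightarrow> r = \<zero>\<^bsub>R\<^esub>"
    using c unfolding regular_elements_def by blast+
  let ?L = "\<lambda>k::nat. principal_left R (c [^]\<^bsub>R\<^esub> k)"
  have L: "left_ideal R (?L k)" for k using cc by (intro R.principal_left_ideal) auto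
  obtain k where k: "\<And>k'. \<mu> (?L k) \<le> \<mu> (?L k')" using ex_has_least_nat[of "\<lambda>_. True" 0 "\<lambda>k. \<mu> (?L k)"] by auto
  have "?L (Suc k) \<subseteq> ?L k"
  proof (rule R.principal_left_sub[OF L])
    show "c [^]\<^bsub>R\<^esub> Suc k \<in> ?L k" unfolding principal_left_def
      using cc R.nat_pow_Suc2[OF cc] by (intro image_eqI[of _ _ c]) auto
  qed
  then have "?L (Suc k) = ?L k" using \<mu>[OF L[of "Suc k"] L[of k]] k[of "Suc k"] by (metis leD psubsetI)
  then have "c [^]\<^bsub>R\<^esub> k \<in> ?L (Suc k)" using cc R.principal_left_self[of "c [^]\<^bsub>R\<^esub> k"] by simp
  then obtain b where b: "b \<in> carrier R" "c [^]\<^bsub>R\<^esub> k = b \<otimes>\<^bsub>R\<^esub> c [^]\<^bsub>R\<^esub> Suc k" unfolding principal_left_def by blast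
  \<comment> \<open>Right cancellation passes from c to its powers. Applied to (1 - bc) c^k = 0 it
    gives bc = 1; then (cb - 1)c = c(bc) - c = 0 gives cb = 1.\<close>
  have cancel: "x = \<zero>\<^bsub>R\<^esub>" if "x \<in> carrier R" "x \<otimes>\<^bsub>R\<^esub> c [^]\<^bsub>R\<^esub> j = \<zero>\<^bsub>R\<^esub>" for x and j :: nat
    using that
  proof (induction j)
    case (Suc j)
    then have "x \<otimes>\<^bsub>R\<^esub> c [^]\<^bsub>R\<^esub> j \<otimes>\<^bsub>R\<^esub> c = \<zero>\<^bsub>R\<^esub>" using cc by (simp add: R.m_assoc)
    then have "x \<otimes>\<^bsub>R\<^esub> c [^]\<^bsub>R\<^esub> j = \<zero>\<^bsub>R\<^esub>"
      by (rule reg[rotated]) (use Suc.prems(1) cc in auto)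
    then show ?case using Suc by blast
  qed (use cc in simp)
  have minus0: "x = y" if "x \<oplus>\<^bsub>R\<^esub> \<ominus>\<^bsub>R\<^esub> y = \<zero>\<^bsub>R\<^esub>" "x \<in> carrier R" "y \<in> carrier R" for x y
    using that by (metis R.a_inv_closed R.minus_equality R.minus_minus)
  have "(\<one>\<^bsub>R\<^esub> \<oplus>\<^bsub>R\<^esub> \<ominus>\<^bsub>R\<^esub> (b \<otimes>\<^bsub>R\<^esub> c)) \<otimes>\<^bsub>R\<^esub> c [^]\<^bsub>R\<^esub> k = c [^]\<^bsub>R\<^esub> k \<oplus>\<^bsub>R\<^esub> \<ominus>\<^bsub>R\<^esub> (b \<otimes>\<^bsub>R\<^esub> c [^]\<^bsub>R\<^esub> Suc k)"
    using b(1) cc R.nat_pow_Suc2[OF cc] by (simp add: R.l_distr R.l_minus R.m_assoc)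
  also have "\<dots> = \<zero>\<^bsub>R\<^esub>" using b cc by (metis R.nat_pow_closed R.r_neg)
  finally have bc: "b \<otimes>\<^bsub>R\<^esub> c = \<one>\<^bsub>R\<^esub>" 
    by (rule minus0[OF cancel, symmetric, rotated]) (use b(1) cc in auto)
  have "(c \<otimes>\<^bsub>R\<^esub> b \<oplus>\<^bsub>R\<^esub> \<ominus>\<^bsub>R\<^esub> \<one>\<^bsub>R\<^esub>) \<otimes>\<^bsub>R\<^esub> c = c \<otimes>\<^bsub>R\<^esub> (b \<otimes>\<^bsub>R\<^esub> c) \<oplus>\<^bsub>R\<^esub> \<ominus>\<^bsub>R\<^esub> c"
    using b(1) cc by (simp add: R.l_distr R.l_minus R.m_assoc)
  also have "\<dots> = \<zero>\<^bsub>R\<^esub>" using bc cc by (simp add: R.r_neg)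
  finally have "c \<otimes>\<^bsub>R\<^esub> b = \<one>\<^bsub>R\<^esub>" 
    by (rule minus0[OF reg, rotated]) (use b(1) cc in auto)
  then show ?thesis using bc b(1) cc by (auto simp: Units_def)
qed

text \<open>Regular elements are already units, so the identity map inverts them, and every element
  is a fraction with denominator 1.\<close>

lemma localization_self:
  assumes R: "ring R" "left_artinian R"
  shows "is_localization R (regular_elements R) R (\<lambda>y. y)"
proof -
  interpret R: ring R by fact
  have one: "\<one>\<^bsub>R\<^esub> \<in> regular_elements R" by (simp add: regular_elements_def)
  have inv1: "inv\<^bsub>R\<^esub> \<one>\<^bsub>R\<^esub> = \<one>\<^bsub>R\<^esub>" by simp
  have "(\<lambda>y. y) \<in> ring_hom R R" by (auto simp: ring_hom_def)
  moreover have "\<exists>s\<in>regular_elements R. \<exists>r\<in>carrier R. y = inv\<^bsub>R\<^esub> s \<otimes>\<^bsub>R\<^esub> r"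
    "\<exists>s\<in>regular_elements R. \<exists>r\<in>carrier R. y = r \<otimes>\<^bsub>R\<^esub> inv\<^bsub>R\<^esub> s" if "y \<in> carrier R" for y
    using one that by (auto intro!: bexI[OF _ one] bexI[OF _ that])
  moreover have "r = \<zero>\<^bsub>R\<^esub> \<longleftrightarrow> (\<exists>s\<in>regular_elements R. s \<otimes>\<^bsub>R\<^esub> r = \<zero>\<^bsub>R\<^esub>)"
    "r = \<zero>\<^bsub>R\<^esub> \<longleftrightarrow> (\<exists>s\<in>regular_elements R. r \<otimes>\<^bsub>R\<^esub> s = \<zero>\<^bsub>R\<^esub>)" if "r \<in> carrier R" for r
    using bexI[OF _ one, of "\<lambda>s. s \<otimes>\<^bsub>R\<^esub> r = \<zero>\<^bsub>R\<^esub>"]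
      bexI[OF _ one, of "\<lambda>s. r \<otimes>\<^bsub>R\<^esub> s = \<zero>\<^bsub>R\<^esub>"] R.l_one[OF that] R.r_one[OF that] that
    unfolding regular_elements_def by blast+
  moreover have "regular_elements R \<subseteq> carrier R" by (auto simp: regular_elements_def)
  ultimately show ?thesis
    using R regular_unit[OF R] by (simp add: is_localization_def)
qed

section \<open>Quotients and bases of algebras\<close>

lemma additive_finsum:
  assumes "abelian_monoid A" "abelian_monoid B"
    and g: "\<And>x. x \<in> carrier A \<Longrightarrow> g x \<in> carrier B" "g \<zero>\<^bsub>A\<^esub> = \<zero>\<^bsub>B\<^esub>"
      "\<And>x y. x \<in> carrier A \<Longrightarrow> y \<in> carrier A \<Longrightarrow> g (x \<oplus>\<^bsub>A\<^esub> y) = g x \<oplus>\<^bsub>B\<^esub> g y"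
    and "finite I" "\<And>i. i \<in> I \<Longrightarrow> h i \<in> carrier A"
  shows "g (finsum A h I) = (\<Oplus>\<^bsub>B\<^esub>i\<in>I. g (h i))"
proof -
  interpret A: abelian_monoid A by fact
  interpret B: abelian_monoid B by fact
  show ?thesis using assms(6,7)
  proof (induction I)
    case empty then show ?case using g by simp
  next
    case (insert a I)
    then have "h \<in> I \<rightarrow> carrier A" "(\<lambda>i. g (h i)) \<in> I \<rightarrow> carrier B" "h a \<in> carrier A" "g (h a) \<in> carrier B"
      using g by auto
    then show ?case using insert g(3) A.finsum_closed by simp
  qed
qed

lemma ring_hom_finsum:
  assumes "ring A" "ring B" "f \<in> ring_hom A B" "finite I" "\<And>i. i \<in> I \<Longrightarrow> h i \<in> carrier A"
  shows "f (finsum A h I) = (\<Oplus>\<^bsub>B\<^esub>i\<in>I. f (h i))"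
proof -
  interpret A: ring A by fact
  interpret B: ring B by fact
  show ?thesis
    by (rule additive_finsum[OF A.abelian_monoid_axioms B.abelian_monoid_axioms _ _ _ assms(4,5)])
      (use assms in \<open>auto simp: ring_hom_closed ring_hom_add ring_hom_zero\<close>)
qed

lemma quot_surj:
  assumes "Y0 \<in> carrier (R Quot I)"
  obtains x where "x \<in> carrier R" "Y0 = I +>\<^bsub>R\<^esub> x"
  using assms by (auto simp: FactRing_def A_RCOSETS_def')

lemma (in ideal) quot_zero_iff: "x \<in> carrier R \<Longrightarrow> I +>\<^bsub>R\<^esub> x = \<zero>\<^bsub>R Quot I\<^esub> \<longleftrightarrow> x \<in> I"
  using a_rcos_const a_rcos_self by (auto simp: FactRing_def)

lemma quot_hom_lift:
  assumes "ring A" "ideal I P" "f \<in> ring_hom P A" "\<And>x. x \<in> I \<Longrightarrow> f x = \<zero>\<^bsub>A\<^esub>"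
  obtains g where "g \<in> ring_hom (P Quot I) A" "\<And>x. x \<in> carrier P \<Longrightarrow> g (I +>\<^bsub>P\<^esub> x) = f x"
proof -
  interpret I: ideal I P by fact
  interpret A: ring A by fact
  interpret Q: ring "P Quot I" by (rule I.quotient_is_ring)
  note \<pi> = I.rcos_ring_hom
  interpret f: ring_hom_ring P A f by (rule ring_hom_ringI2) (use assms in \<open>auto simp: I.ring_axioms\<close>)
  have well: "f x = f y" if "x \<in> carrier P" "y \<in> carrier P" "I +>\<^bsub>P\<^esub> x = I +>\<^bsub>P\<^esub> y" for x y
  proof -
    have "x \<ominus>\<^bsub>P\<^esub> y \<in> I" using that I.quotient_eq_iff_same_a_r_cos[OF I.ideal_axioms] by blast
    then have "f (x \<ominus>\<^bsub>P\<^esub> y) = \<zero>\<^bsub>A\<^esub>" by (rule assms(4))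
    then have "f x \<oplus>\<^bsub>A\<^esub> \<ominus>\<^bsub>A\<^esub> f y = \<zero>\<^bsub>A\<^esub>" using that by (simp add: I.minus_eq)
    then show ?thesis using that by (metis A.a_inv_closed A.minus_equality A.minus_minus f.hom_closed)
  qed
  define g where "g Y0 = f (SOME x. x \<in> carrier P \<and> Y0 = I +>\<^bsub>P\<^esub> x)" for Y0
  have g: "g (I +>\<^bsub>P\<^esub> x) = f x" if "x \<in> carrier P" for x
  proof -
    let ?y = "SOME y. y \<in> carrier P \<and> I +>\<^bsub>P\<^esub> x = I +>\<^bsub>P\<^esub> y"
    have "?y \<in> carrier P \<and> I +>\<^bsub>P\<^esub> x = I +>\<^bsub>P\<^esub> ?y" by (rule someI[of _ x]) (simp add: that)
    then show ?thesis unfolding g_def using well that by metis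
  qed
  have "g \<in> ring_hom (P Quot I) A"
  proof (rule ring_hom_memI)
    fix Y0 assume "Y0 \<in> carrier (P Quot I)"
    then obtain x where x: "x \<in> carrier P" "Y0 = I +>\<^bsub>P\<^esub> x" by (rule quot_surj)
    then show "g Y0 \<in> carrier A" by (simp add: g)
    fix Y assume "Y \<in> carrier (P Quot I)"
    then obtain y where y: "y \<in> carrier P" "Y = I +>\<^bsub>P\<^esub> y" by (rule quot_surj)
    show "g (Y0 \<otimes>\<^bsub>P Quot I\<^esub> Y) = g Y0 \<otimes>\<^bsub>A\<^esub> g Y"
      using x y by (simp add: g flip: ring_hom_mult[OF \<pi>])
    show "g (Y0 \<oplus>\<^bsub>P Quot I\<^esub> Y) = g Y0 \<oplus>\<^bsub>A\<^esub> g Y"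
      using x y by (simp add: g flip: ring_hom_add[OF \<pi>])
  next
    show "g \<one>\<^bsub>P Quot I\<^esub> = \<one>\<^bsub>A\<^esub>" by (simp add: g flip: ring_hom_one[OF \<pi>])
  qed
  then show thesis using g that by blast
qed

text \<open>The kernel of f is an ideal, so it contains the ideal generated by \<open>Y0\<close> as
  soon as it contains \<open>Y0\<close>. All maps out of presented rings are checked on relators in
  this way.\<close>

lemma genideal_hom_lift:
  assumes "ring P" "ring A" "f \<in> ring_hom P A" "Y0 \<subseteq> carrier P" "\<And>x. x \<in> Y0 \<Longrightarrow> f x = \<zero>\<^bsub>A\<^esub>"
  obtains g where "g \<in> ring_hom (P Quot genideal P Y0) A"
    "\<And>x. x \<in> carrier P \<Longrightarrow> g (genideal P Y0 +>\<^bsub>P\<^esub> x) = f x"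
proof -
  interpret f: ring_hom_ring P A f by (rule ring_hom_ringI2[OF assms(1-3)])
  have "Y0 \<subseteq> a_kernel P A f" unfolding a_kernel_def' using assms(4,5) by blast
  then have "genideal P Y0 \<subseteq> a_kernel P A f"
    by (rule f.R.genideal_minimal[OF f.kernel_is_ideal])
  then have k: "f x = \<zero>\<^bsub>A\<^esub>" if "x \<in> genideal P Y0" for x
    using that unfolding a_kernel_def' by blast
  show thesis
    by (rule quot_hom_lift[OF assms(2) f.R.genideal_ideal[OF assms(4)] assms(3) k]) (assumption, rule that)
qed

section \<open>Finite spans and bases over a central field\<close>

definition lincomb :: "('r, 'c) ring_scheme \<Rightarrow> ('f \<Rightarrow> 'r) \<Rightarrow> 'i set \<Rightarrow> ('i \<Rightarrow> 'r) \<Rightarrow> ('i \<Rightarrow> 'f) \<Rightarrow> 'r" where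
  "lincomb A \<phi> I b c = (\<Oplus>\<^bsub>A\<^esub>p\<in>I. \<phi> (c p) \<otimes>\<^bsub>A\<^esub> b p)"

definition lspan :: "('f, 'b) ring_scheme \<Rightarrow> ('r, 'c) ring_scheme \<Rightarrow> ('f \<Rightarrow> 'r) \<Rightarrow> 'i set \<Rightarrow> ('i \<Rightarrow> 'r) \<Rightarrow> 'r set" where
  "lspan F A \<phi> I b = {lincomb A \<phi> I b c | c. c \<in> I \<rightarrow> carrier F}"

definition lindep :: "('f, 'b) ring_scheme \<Rightarrow> ('r, 'c) ring_scheme \<Rightarrow> ('f \<Rightarrow> 'r) \<Rightarrow> 'i set \<Rightarrow> ('i \<Rightarrow> 'r) \<Rightarrow> bool" where
  "lindep F A \<phi> I b \<longleftrightarrow> (\<forall>c. c \<in> I \<rightarrow> carrier F \<longrightarrow> lincomb A \<phi> I b c = \<zero>\<^bsub>A\<^esub> \<longrightarrow> (\<forall>p\<in>I. c p = \<zero>\<^bsub>F\<^esub>))"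

text \<open>Scalars stay in F and enter A only through \<phi>. One family of coefficients can
  therefore be used in two algebras at once, which is how independence is carried from one to the
  other.\<close>

locale falgebra = F: field F + A?: ring A for F :: "('f, 'b) ring_scheme" and A :: "('r, 'c) ring_scheme" (structure) +
  fixes \<phi> :: "'f \<Rightarrow> 'r"
  assumes \<phi>_hom: "\<phi> \<in> ring_hom F A"
    and \<phi>_central: "c \<in> carrier F \<Longrightarrow> a \<in> carrier A \<Longrightarrow> \<phi> c \<otimes> a = a \<otimes> \<phi> c"
begin

lemma \<phi>_simps [simp]: "c \<in> carrier F \<Longrightarrow> \<phi> c \<in> carrier A" "\<phi> \<zero>\<^bsub>F\<^esub> = \<zero>" "\<phi> \<one>\<^bsub>F\<^esub> = \<one>"
  using \<phi>_hom ring_hom_zero[OF \<phi>_hom F.ring_axioms A.ring_axioms] by (auto simp: ring_hom_def)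

lemma \<phi>_mult: "c \<in> carrier F \<Longrightarrow> d \<in> carrier F \<Longrightarrow> \<phi> (c \<otimes>\<^bsub>F\<^esub> d) = \<phi> c \<otimes> \<phi> d"
  and \<phi>_add: "c \<in> carrier F \<Longrightarrow> d \<in> carrier F \<Longrightarrow> \<phi> (c \<oplus>\<^bsub>F\<^esub> d) = \<phi> c \<oplus> \<phi> d"
  using \<phi>_hom by (auto simp: ring_hom_def)

lemma \<phi>_minus: "c \<in> carrier F \<Longrightarrow> \<phi> (\<ominus>\<^bsub>F\<^esub> c) = \<ominus> \<phi> c"
  by (metis A.minus_equality F.a_inv_closed F.l_neg \<phi>_add \<phi>_simps(1,2))

lemma left_commute_\<phi>: "c \<in> carrier F \<Longrightarrow> a \<in> carrier A \<Longrightarrow> y \<in> carrier A \<Longrightarrow> a \<otimes> (\<phi> c \<otimes> y) = \<phi> c \<otimes> (a \<otimes> y)"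
  by (metis \<phi>_central \<phi>_simps(1) m_assoc)

lemma lincomb_closed: "b \<in> I \<rightarrow> carrier A \<Longrightarrow> c \<in> I \<rightarrow> carrier F \<Longrightarrow> lincomb A \<phi> I b c \<in> carrier A"
  unfolding lincomb_def by (intro finsum_closed) (auto simp: Pi_iff)

lemma lincomb_add:
  assumes "b \<in> I \<rightarrow> carrier A" "c \<in> I \<rightarrow> carrier F" "d \<in> I \<rightarrow> carrier F"
  shows "lincomb A \<phi> I b c \<oplus> lincomb A \<phi> I b d = lincomb A \<phi> I b (\<lambda>p. c p \<oplus>\<^bsub>F\<^esub> d p)"
proof -
  have "lincomb A \<phi> I b (\<lambda>p. c p \<oplus>\<^bsub>F\<^esub> d p) = (\<Oplus>p\<in>I. \<phi> (c p) \<otimes> b p \<oplus> \<phi> (d p) \<otimes> b p)"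
    unfolding lincomb_def using assms by (intro finsum_cong') (auto simp: \<phi>_add l_distr Pi_iff)
  also have "\<dots> = lincomb A \<phi> I b c \<oplus> lincomb A \<phi> I b d"
    unfolding lincomb_def using assms by (intro finsum_addf) (auto simp: Pi_iff)
  finally show ?thesis by simp
qed

lemma lincomb_smult:
  assumes "finite I" "b \<in> I \<rightarrow> carrier A" "c \<in> I \<rightarrow> carrier F" "r \<in> carrier F"
  shows "\<phi> r \<otimes> lincomb A \<phi> I b c = lincomb A \<phi> I b (\<lambda>p. r \<otimes>\<^bsub>F\<^esub> c p)"
proof -
  have "\<phi> r \<otimes> lincomb A \<phi> I b c = (\<Oplus>p\<in>I. \<phi> r \<otimes> (\<phi> (c p) \<otimes> b p))"
    unfolding lincomb_def using assms by (intro finsum_rdistr) (auto simp: Pi_iff)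
  also have "\<dots> = lincomb A \<phi> I b (\<lambda>p. r \<otimes>\<^bsub>F\<^esub> c p)"
    unfolding lincomb_def using assms by (intro finsum_cong') (auto simp: \<phi>_mult m_assoc Pi_iff)
  finally show ?thesis .
qed

lemma lincomb_mult_left:
  assumes "finite I" "b \<in> I \<rightarrow> carrier A" "c \<in> I \<rightarrow> carrier F" "a \<in> carrier A"
  shows "a \<otimes> lincomb A \<phi> I b c = lincomb A \<phi> I (\<lambda>p. a \<otimes> b p) c"
proof -
  have "a \<otimes> lincomb A \<phi> I b c = (\<Oplus>p\<in>I. a \<otimes> (\<phi> (c p) \<otimes> b p))"
    unfolding lincomb_def using assms by (intro finsum_rdistr) (auto simp: Pi_iff)
  also have "\<dots> = lincomb A \<phi> I (\<lambda>p. a \<otimes> b p) c"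
    unfolding lincomb_def using assms by (intro finsum_cong') (auto simp: left_commute_\<phi> Pi_iff)
  finally show ?thesis .
qed

lemma lincomb_insert:
  assumes "finite I" "p \<notin> I" "b \<in> insert p I \<rightarrow> carrier A" "c \<in> insert p I \<rightarrow> carrier F"
  shows "lincomb A \<phi> (insert p I) b c = \<phi> (c p) \<otimes> b p \<oplus> lincomb A \<phi> I b c"
  unfolding lincomb_def using assms by (intro finsum_insert) (auto simp: Pi_iff)

lemma lincomb_cong:
  assumes "b \<in> I \<rightarrow> carrier A" "c \<in> I \<rightarrow> carrier F" "\<And>p. p \<in> I \<Longrightarrow> c p = c' p" "\<And>p. p \<in> I \<Longrightarrow> b p = b' p"
  shows "lincomb A \<phi> I b c = lincomb A \<phi> I b' c'"
  unfolding lincomb_def using assms by (intro finsum_cong') (auto simp: Pi_iff)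

lemma lincomb_single:
  assumes "finite I" "b \<in> I \<rightarrow> carrier A" "q \<in> I" "r \<in> carrier F"
  shows "lincomb A \<phi> I b (\<lambda>p. if p = q then r else \<zero>\<^bsub>F\<^esub>) = \<phi> r \<otimes> b q"
proof -
  have "lincomb A \<phi> I b (\<lambda>p. if p = q then r else \<zero>\<^bsub>F\<^esub>) = (\<Oplus>p\<in>I. if p = q then \<phi> r \<otimes> b p else \<zero>)"
    unfolding lincomb_def using assms by (intro finsum_cong') (auto simp: Pi_iff)
  also have "\<dots> = \<phi> r \<otimes> b q" using assms by (intro add.finprod_singleton_swap) (auto simp: Pi_iff)
  finally show ?thesis .
qed

lemma lspanI: "c \<in> I \<rightarrow> carrier F \<Longrightarrow> lincomb A \<phi> I b c \<in> lspan F A \<phi> I b"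
  by (auto simp: lspan_def)

context
  fixes I :: "'i set" and b :: "'i \<Rightarrow> 'r"
  assumes fin: "finite I" and b: "b \<in> I \<rightarrow> carrier A"
begin

lemma lspan_closed: "y \<in> lspan F A \<phi> I b \<Longrightarrow> y \<in> carrier A"
  using lincomb_closed[OF b] by (auto simp: lspan_def)

lemma lspan_zero: "\<zero> \<in> lspan F A \<phi> I b"
proof -
  have "lincomb A \<phi> I b (\<lambda>_. \<zero>\<^bsub>F\<^esub>) = \<zero>" unfolding lincomb_def
    using b by (intro add.finprod_one_eqI) (auto simp: Pi_iff)
  then show ?thesis using lspanI[of "\<lambda>_. \<zero>\<^bsub>F\<^esub>" I b] by auto
qed

lemma lspan_add: "y \<in> lspan F A \<phi> I b \<Longrightarrow> z \<in> lspan F A \<phi> I b \<Longrightarrow> y \<oplus> z \<in> lspan F A \<phi> I b"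
proof -
  assume "y \<in> lspan F A \<phi> I b" "z \<in> lspan F A \<phi> I b"
  then obtain c d where c: "c \<in> I \<rightarrow> carrier F" "y = lincomb A \<phi> I b c"
    and d: "d \<in> I \<rightarrow> carrier F" "z = lincomb A \<phi> I b d" unfolding lspan_def by blast
  then show ?thesis unfolding c(2) d(2) lincomb_add[OF b c(1) d(1)] by (intro lspanI) auto
qed

lemma lspan_smult: "y \<in> lspan F A \<phi> I b \<Longrightarrow> r \<in> carrier F \<Longrightarrow> \<phi> r \<otimes> y \<in> lspan F A \<phi> I b"
proof -
  assume "y \<in> lspan F A \<phi> I b" and r: "r \<in> carrier F"
  then obtain c where c: "c \<in> I \<rightarrow> carrier F" "y = lincomb A \<phi> I b c" unfolding lspan_def by blast
  then show ?thesis unfolding c(2) lincomb_smult[OF fin b c(1) r] using r by (intro lspanI) auto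
qed

lemma lspan_base: "p \<in> I \<Longrightarrow> b p \<in> lspan F A \<phi> I b"
  using lincomb_single[OF fin b, of p "\<one>\<^bsub>F\<^esub>"] lspanI[of "\<lambda>q. if q = p then \<one>\<^bsub>F\<^esub> else \<zero>\<^bsub>F\<^esub>" I b] b
  by (auto simp: Pi_iff)

lemma lspan_lincomb:
  assumes "finite J" "b' \<in> J \<rightarrow> lspan F A \<phi> I b" "c \<in> J \<rightarrow> carrier F"
  shows "lincomb A \<phi> J b' c \<in> lspan F A \<phi> I b"
  using assms
proof (induction J)
  case empty then show ?case using lspan_zero by (simp add: lincomb_def)
next
  case (insert p J)
  then show ?case using lspan_closed
    by (subst lincomb_insert) (auto simp: Pi_iff intro!: lspan_add lspan_smult)
qed

lemma lspan_mult_left: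
  assumes "a \<in> carrier A" "\<And>p. p \<in> I \<Longrightarrow> a \<otimes> b p \<in> lspan F A \<phi> I b" "y \<in> lspan F A \<phi> I b"
  shows "a \<otimes> y \<in> lspan F A \<phi> I b"
proof -
  obtain c where c: "c \<in> I \<rightarrow> carrier F" "y = lincomb A \<phi> I b c" using assms(3) by (auto simp: lspan_def)
  show ?thesis unfolding c(2) lincomb_mult_left[OF fin b c(1) assms(1)]
    using assms(2) c(1) by (intro lspan_lincomb[OF fin]) auto
qed

lemma lincomb_minus_zero:
  assumes "c \<in> I \<rightarrow> carrier F" "d \<in> I \<rightarrow> carrier F" "lincomb A \<phi> I b c = lincomb A \<phi> I b d"
  shows "lincomb A \<phi> I b (\<lambda>p. c p \<oplus>\<^bsub>F\<^esub> \<ominus>\<^bsub>F\<^esub> \<one>\<^bsub>F\<^esub> \<otimes>\<^bsub>F\<^esub> d p) = \<zero>"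
proof -
  have "lincomb A \<phi> I b (\<lambda>p. c p \<oplus>\<^bsub>F\<^esub> \<ominus>\<^bsub>F\<^esub> \<one>\<^bsub>F\<^esub> \<otimes>\<^bsub>F\<^esub> d p)
      = lincomb A \<phi> I b c \<oplus> \<phi> (\<ominus>\<^bsub>F\<^esub> \<one>\<^bsub>F\<^esub>) \<otimes> lincomb A \<phi> I b d"
    using assms(1,2) by (subst lincomb_smult[OF fin b]) (auto simp: lincomb_add[OF b] Pi_iff)
  also have "\<dots> = \<zero>" using assms lincomb_closed[OF b] by (simp add: \<phi>_minus l_minus r_neg)
  finally show ?thesis .
qed

lemma lindep_eq:
  assumes "lindep F A \<phi> I b" "c \<in> I \<rightarrow> carrier F" "d \<in> I \<rightarrow> carrier F" "lincomb A \<phi> I b c = lincomb A \<phi> I b d"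
    and "p \<in> I"
  shows "c p = d p"
proof -
  have cd: "c p \<in> carrier F" "d p \<in> carrier F" using assms by auto
  have "c p \<oplus>\<^bsub>F\<^esub> \<ominus>\<^bsub>F\<^esub> \<one>\<^bsub>F\<^esub> \<otimes>\<^bsub>F\<^esub> d p = \<zero>\<^bsub>F\<^esub>"
    using assms(1)[unfolded lindep_def, rule_format, OF _ lincomb_minus_zero[OF assms(2-4)] assms(5)] assms(2,3)
    by (auto simp: Pi_iff)
  then have "c p \<oplus>\<^bsub>F\<^esub> \<ominus>\<^bsub>F\<^esub> d p = \<zero>\<^bsub>F\<^esub>" using cd by (simp add: F.l_minus)
  then show ?thesis using cd by (metis F.a_inv_closed F.minus_equality F.minus_minus)
qed

lemma basis_unique:
  assumes "lindep F A \<phi> I b" "y \<in> lspan F A \<phi> I b"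
  shows "\<exists>!c. c \<in> I \<rightarrow>\<^sub>E carrier F \<and> y = lincomb A \<phi> I b c"
proof -
  obtain c where c: "c \<in> I \<rightarrow> carrier F" "y = lincomb A \<phi> I b c" using assms(2) by (auto simp: lspan_def)
  show ?thesis
  proof (rule ex1I[of _ "restrict c I"])
    have "lincomb A \<phi> I b c = lincomb A \<phi> I b (restrict c I)"
      using b c(1) by (intro lincomb_cong) auto
    then show "restrict c I \<in> I \<rightarrow>\<^sub>E carrier F \<and> y = lincomb A \<phi> I b (restrict c I)" using c by auto
    fix d assume d: "d \<in> I \<rightarrow>\<^sub>E carrier F \<and> y = lincomb A \<phi> I b d"
    then have "d p = c p" if "p \<in> I" for p using lindep_eq[OF assms(1), of d c p] c that by (auto simp: PiE_def)
    then show "d = restrict c I" using d by (auto simp: PiE_def extensional_def fun_eq_iff)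
  qed
qed

end

lemma lspan_insert:
  assumes "finite I" "p \<notin> I" "b \<in> insert p I \<rightarrow> carrier A"
  shows "lspan F A \<phi> (insert p I) b = {\<phi> r \<otimes> b p \<oplus> y | r y. r \<in> carrier F \<and> y \<in> lspan F A \<phi> I b}"
proof (intro equalityI subsetI)
  fix z assume "z \<in> lspan F A \<phi> (insert p I) b"
  then obtain c where c: "c \<in> insert p I \<rightarrow> carrier F" "z = lincomb A \<phi> (insert p I) b c" by (auto simp: lspan_def)
  then show "z \<in> {\<phi> r \<otimes> b p \<oplus> y | r y. r \<in> carrier F \<and> y \<in> lspan F A \<phi> I b}"
    using lincomb_insert[OF assms c(1)] lspanI[of c I b] by (auto simp: Pi_iff)
next
  fix z assume "z \<in> {\<phi> r \<otimes> b p \<oplus> y | r y. r \<in> carrier F \<and> y \<in> lspan F A \<phi> I b}"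
  then obtain r c where c: "r \<in> carrier F" "c \<in> I \<rightarrow> carrier F" "z = \<phi> r \<otimes> b p \<oplus> lincomb A \<phi> I b c"
    by (auto simp: lspan_def)
  let ?c = "\<lambda>q. if q = p then r else c q"
  have "lincomb A \<phi> (insert p I) b ?c = \<phi> (?c p) \<otimes> b p \<oplus> lincomb A \<phi> I b ?c"
    using c assms by (intro lincomb_insert) auto
  also have "lincomb A \<phi> I b ?c = lincomb A \<phi> I b c"
    using c assms by (intro lincomb_cong) auto
  finally have "z = lincomb A \<phi> (insert p I) b ?c" using c by simp
  then show "z \<in> lspan F A \<phi> (insert p I) b" using c by (auto intro!: lspanI)
qed

lemma lindep_insert_notin:
  assumes "finite I" "p \<notin> I" "b \<in> insert p I \<rightarrow> carrier A" "lindep F A \<phi> (insert p I) b"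
  shows "b p \<notin> lspan F A \<phi> I b" "lindep F A \<phi> I b"
proof -
  have b: "b \<in> I \<rightarrow> carrier A" using assms by auto
  show "b p \<notin> lspan F A \<phi> I b"
  proof
    assume "b p \<in> lspan F A \<phi> I b"
    then obtain c where c: "c \<in> I \<rightarrow> carrier F" "b p = lincomb A \<phi> I b c" by (auto simp: lspan_def)
    let ?c = "\<lambda>q. if q = p then \<ominus>\<^bsub>F\<^esub> \<one>\<^bsub>F\<^esub> else c q"
    have c': "?c \<in> insert p I \<rightarrow> carrier F" using c by auto
    have "lincomb A \<phi> I b ?c = b p" unfolding c(2) using c assms by (intro lincomb_cong) auto
    then have "lincomb A \<phi> (insert p I) b ?c = \<zero>"
      using lincomb_insert[OF assms(1-3) c'] assms(3) by (simp add: \<phi>_minus l_minus l_neg)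
    then have "?c p = \<zero>\<^bsub>F\<^esub>" using assms(4) c' unfolding lindep_def by blast
    then show False using F.one_not_zero F.a_inv_closed F.one_closed F.minus_minus F.minus_zero by (metis (full_types))
  qed
  show "lindep F A \<phi> I b" unfolding lindep_def
  proof (intro allI impI ballI)
    fix c p' assume c: "c \<in> I \<rightarrow> carrier F" "lincomb A \<phi> I b c = \<zero>" "p' \<in> I"
    let ?c = "\<lambda>q. if q = p then \<zero>\<^bsub>F\<^esub> else c q"
    have c': "?c \<in> insert p I \<rightarrow> carrier F" using c by auto
    have "lincomb A \<phi> I b ?c = lincomb A \<phi> I b c" using c assms by (intro lincomb_cong) auto
    then have "lincomb A \<phi> (insert p I) b ?c = \<zero>"
      using lincomb_insert[OF assms(1-3) c'] assms(3) c(2) by simp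
    then have "?c p' = \<zero>\<^bsub>F\<^esub>" using assms(4) c' c(3) unfolding lindep_def by blast
    then show "c p' = \<zero>\<^bsub>F\<^esub>" using c(3) assms(2) by (auto split: if_splits)
  qed
qed

lemma lspan_dimension:
  assumes "finite I" "b \<in> I \<rightarrow> carrier A" "lindep F A \<phi> I b"
  shows "dimension (card I) (\<phi> ` carrier F) (lspan F A \<phi> I b)"
  using assms
proof (induction I)
  case empty
  have "lspan F A \<phi> {} b = {\<zero>}" by (auto simp: lspan_def lincomb_def)
  then show ?case by (simp add: zero_dim)
next
  case (insert p I)
  note l = lindep_insert_notin[OF insert(1,2,4,5)]
  have "lspan F A \<phi> (insert p I) b = line_extension (\<phi> ` carrier F) (b p) (lspan F A \<phi> I b)"
    unfolding lspan_insert[OF insert(1,2,4)] by (auto simp: line_extension_mem_iff) blast+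
  moreover have "dimension (card I) (\<phi> ` carrier F) (lspan F A \<phi> I b)" using insert l(2) by auto
  moreover have "b p \<in> carrier A" using insert(4) by auto
  ultimately show ?case using Suc_dim[of "b p" "lspan F A \<phi> I b" "card I"] l(1) insert(1,2) by simp
qed

section \<open>Chains of subspaces and the Artinian property\<close>

definition fsubspace :: "'r set \<Rightarrow> bool" where
  "fsubspace L \<longleftrightarrow> L \<subseteq> carrier A \<and> \<zero> \<in> L \<and> (\<forall>x\<in>L. \<forall>y\<in>L. x \<oplus> y \<in> L) \<and> (\<forall>r\<in>carrier F. \<forall>x\<in>L. \<phi> r \<otimes> x \<in> L)"

text \<open>The length counts the steps of the flag spanned by b at which the intersection with L
  grows: with V the span of the earlier generators, one is added if L is not inside V. If L and L'
  meet V alike and L has an element outside V, then every element of L' can be moved into V by a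
  multiple of it, so L' is contained in L.\<close>

lemma fsubspace_chain:
  assumes "finite I" "b \<in> I \<rightarrow> carrier A"
  shows "\<exists>\<mu> :: 'r set \<Rightarrow> nat. \<forall>L L'. fsubspace L \<longrightarrow> fsubspace L' \<longrightarrow> L \<subset> L' \<longrightarrow> L' \<subseteq> lspan F A \<phi> I b \<longrightarrow> \<mu> L < \<mu> L'"
  using assms
proof (induction I)
  case empty
  have "lspan F A \<phi> {} b = {\<zero>}" by (auto simp: lspan_def lincomb_def)
  then show ?case by (auto simp: fsubspace_def)
next
  case (insert p I)
  let ?V = "lspan F A \<phi> I b"
  have b: "b \<in> I \<rightarrow> carrier A" "b p \<in> carrier A" using insert by auto
  obtain \<mu> :: "'r set \<Rightarrow> nat" where \<mu>: "\<And>L L'. fsubspace L \<Longrightarrow> fsubspace L' \<Longrightarrow> L \<subset> L' \<Longrightarrow> L' \<subseteq> ?V \<Longrightarrow> \<mu> L < \<mu> L'"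
    using insert b by blast
  have VV: "fsubspace ?V"
    using lspan_closed[OF insert(1) b(1)] lspan_zero[OF insert(1) b(1)] lspan_add[OF insert(1) b(1)] lspan_smult[OF insert(1) b(1)]
    by (auto simp: fsubspace_def)
  have cap: "fsubspace (L \<inter> ?V)" if "fsubspace L" for L using that VV by (auto simp: fsubspace_def)
  let ?\<mu> = "\<lambda>L. \<mu> (L \<inter> ?V) + (if L \<subseteq> ?V then 0 else 1)"
  have "?\<mu> L < ?\<mu> L'" if L: "fsubspace L" "fsubspace L'" "L \<subset> L'" "L' \<subseteq> lspan F A \<phi> (insert p I) b" for L L'
  proof (cases "L \<inter> ?V = L' \<inter> ?V")
    case False
    then have "\<mu> (L \<inter> ?V) < \<mu> (L' \<inter> ?V)" using \<mu>[OF cap[OF L(1)] cap[OF L(2)]] L(3) by blast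
    then show ?thesis using L(3) by auto
  next
    case True
    have "L \<subseteq> ?V"
    proof (rule ccontr)
      assume "\<not> L \<subseteq> ?V"
      then obtain l where l: "l \<in> L" "l \<notin> ?V" by blast
      then have "l \<in> lspan F A \<phi> (insert p I) b" using L by blast
      then obtain r v where rv: "r \<in> carrier F" "v \<in> ?V" "l = \<phi> r \<otimes> b p \<oplus> v" unfolding lspan_insert[OF insert(1,2,4)] by auto
      have vc: "v \<in> carrier A" using rv(2) lspan_closed[OF insert(1) b(1)] by blast
      have r0: "r \<noteq> \<zero>\<^bsub>F\<^esub>" using l(2) rv b vc by auto
      have "L' \<subseteq> L"
      proof
        fix l' assume l': "l' \<in> L'"
        then obtain r' v' where rv': "r' \<in> carrier F" "v' \<in> ?V" "l' = \<phi> r' \<otimes> b p \<oplus> v'"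
          using L(4) unfolding lspan_insert[OF insert(1,2,4)] by auto
        have vc': "v' \<in> carrier A" using rv'(2) lspan_closed[OF insert(1) b(1)] by blast
        \<comment> \<open>This s makes the coefficients of l' and of s l at the new generator agree,
          so that l' - s l falls into V, where L and L' coincide.\<close>
        define s where "s = r' \<otimes>\<^bsub>F\<^esub> inv\<^bsub>F\<^esub> r"
        have ri: "inv\<^bsub>F\<^esub> r \<in> carrier F" "inv\<^bsub>F\<^esub> r \<otimes>\<^bsub>F\<^esub> r = \<one>\<^bsub>F\<^esub>"
          using r0 rv(1) F.field_Units by (auto intro: F.Units_inv_closed F.Units_l_inv)
        have s: "s \<in> carrier F" "s \<otimes>\<^bsub>F\<^esub> r = r'" using ri rv(1) rv'(1) by (auto simp: s_def F.m_assoc)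
        have ms: "\<ominus>\<^bsub>F\<^esub> s \<in> carrier F" using s by simp
        have "l' \<oplus> \<phi> (\<ominus>\<^bsub>F\<^esub> s) \<otimes> l = (\<phi> r' \<otimes> b p \<oplus> v') \<oplus> (\<phi> (\<ominus>\<^bsub>F\<^esub> s \<otimes>\<^bsub>F\<^esub> r) \<otimes> b p \<oplus> \<phi> (\<ominus>\<^bsub>F\<^esub> s) \<otimes> v)"
          using rv rv' s b vc vc' ms by (simp add: \<phi>_mult r_distr m_assoc del: F.add.inv_closed)
        also have "\<phi> (\<ominus>\<^bsub>F\<^esub> s \<otimes>\<^bsub>F\<^esub> r) = \<ominus> \<phi> r'" using s rv(1) rv'(1) by (simp add: F.l_minus \<phi>_minus)
        also have "(\<phi> r' \<otimes> b p \<oplus> v') \<oplus> (\<ominus> \<phi> r' \<otimes> b p \<oplus> \<phi> (\<ominus>\<^bsub>F\<^esub> s) \<otimes> v) = v' \<oplus> \<phi> (\<ominus>\<^bsub>F\<^esub> s) \<otimes> v"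
        proof -
          have "\<phi> r' \<in> carrier A" "\<phi> (\<ominus>\<^bsub>F\<^esub> s) \<in> carrier A" using rv'(1) ms by auto
          then show ?thesis using b(2) vc vc' by algebra
        qed
        finally have eq: "l' \<oplus> \<phi> (\<ominus>\<^bsub>F\<^esub> s) \<otimes> l = v' \<oplus> \<phi> (\<ominus>\<^bsub>F\<^esub> s) \<otimes> v" .
        have lL': "l \<in> L'" using l L by blast
        have "l' \<oplus> \<phi> (\<ominus>\<^bsub>F\<^esub> s) \<otimes> l \<in> L'" using L(2) l' lL' ms unfolding fsubspace_def by blast
        moreover have "v' \<oplus> \<phi> (\<ominus>\<^bsub>F\<^esub> s) \<otimes> v \<in> ?V" using VV rv(2) rv'(2) ms unfolding fsubspace_def by blast
        ultimately have "l' \<oplus> \<phi> (\<ominus>\<^bsub>F\<^esub> s) \<otimes> l \<in> L" using eq True by auto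
        moreover have "\<phi> s \<otimes> l \<in> L" using L(1) l(1) s(1) unfolding fsubspace_def by blast
        ultimately have "(l' \<oplus> \<phi> (\<ominus>\<^bsub>F\<^esub> s) \<otimes> l) \<oplus> \<phi> s \<otimes> l \<in> L" using L(1) unfolding fsubspace_def by blast
        moreover have "(l' \<oplus> \<phi> (\<ominus>\<^bsub>F\<^esub> s) \<otimes> l) \<oplus> \<phi> s \<otimes> l = l'"
        proof -
          have "l \<in> carrier A" "l' \<in> carrier A" "\<phi> s \<in> carrier A" using L l l' s by (auto simp: fsubspace_def)
          then show ?thesis unfolding \<phi>_minus[OF s(1)] by algebra
        qed
        ultimately show "l' \<in> L" by simp
      qed
      then show False using L(3) by blast
    qed
    moreover have "\<not> L' \<subseteq> ?V" using True L(3) calculation by blast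
    ultimately show ?thesis using True by simp
  qed
  then show ?case by (intro exI[of _ ?\<mu>]) blast
qed

text \<open>Scalars act by left multiplication with elements of A, so left ideals are subspaces and
  inherit the length function.\<close>

lemma spanned_left_artinian:
  assumes "finite I" "b \<in> I \<rightarrow> carrier A" "lspan F A \<phi> I b = carrier A"
  shows "left_artinian A"
proof -
  have "fsubspace L" if "left_ideal A L" for L using left_idealD[OF that] by (auto simp: fsubspace_def)
  moreover obtain \<mu> :: "'r set \<Rightarrow> nat" where "\<forall>L L'. fsubspace L \<longrightarrow> fsubspace L' \<longrightarrow> L \<subset> L' \<longrightarrow> L' \<subseteq> carrier A \<longrightarrow> \<mu> L < \<mu> L'"
    using fsubspace_chain[OF assms(1,2)] unfolding assms(3) by blast
  moreover have "L \<subseteq> carrier A" if "left_ideal A L" for L using left_idealD(1)[OF that] by blast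
  ultimately show ?thesis unfolding left_artinian_def by (intro exI[of _ \<mu>]) blast
qed

end

section \<open>Homomorphisms between algebras with finite spanning families\<close>

lemma lincomb_hom:
  assumes S: "falgebra F S \<phi>" and A: "falgebra F A \<phi>'" and f: "f \<in> ring_hom S A"
    and f\<phi>: "\<And>c. c \<in> carrier F \<Longrightarrow> f (\<phi> c) = \<phi>' c" and fb: "\<And>p. p \<in> I \<Longrightarrow> f (b p) = b' p"
    and I: "finite I" "b \<in> I \<rightarrow> carrier S" "c \<in> I \<rightarrow> carrier F"
  shows "f (lincomb S \<phi> I b c) = lincomb A \<phi>' I b' c"
proof -
  interpret S: falgebra F S \<phi> by fact
  interpret A: falgebra F A \<phi>' by fact
  have "f (lincomb S \<phi> I b c) = (\<Oplus>\<^bsub>A\<^esub>p\<in>I. f (\<phi> (c p) \<otimes>\<^bsub>S\<^esub> b p))"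
    unfolding lincomb_def using I by (intro ring_hom_finsum[OF S.ring_axioms A.ring_axioms f]) (auto simp: Pi_iff)
  also have "\<dots> = lincomb A \<phi>' I b' c"
    unfolding lincomb_def
  proof (intro A.finsum_cong')
    fix p assume p: "p \<in> I"
    then have "b' p \<in> carrier A" using fb[OF p] ring_hom_closed[OF f, of "b p"] I(2) by auto
    then show "f (\<phi> (c p) \<otimes>\<^bsub>S\<^esub> b p) = \<phi>' (c p) \<otimes>\<^bsub>A\<^esub> b' p"
      using p I f\<phi> fb by (auto simp: ring_hom_mult[OF f] Pi_iff)
  next
    show "(\<lambda>p. \<phi>' (c p) \<otimes>\<^bsub>A\<^esub> b' p) \<in> I \<rightarrow> carrier A"
      using fb I ring_hom_closed[OF f] by (auto simp: Pi_iff simp flip: fb)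
  qed simp
  finally show ?thesis .
qed

text \<open>An element of S is a combination of the spanning family b, and its coefficients can be
  read off in A, where the images are independent. This gives injectivity of f and independence of b
  together; it is how a ring known only by relations acquires a basis.\<close>

lemma hom_inj_of_lindep:
  assumes S: "falgebra F S \<phi>" and A: "falgebra F A \<phi>'" and f: "f \<in> ring_hom S A"
    and f\<phi>: "\<And>c. c \<in> carrier F \<Longrightarrow> f (\<phi> c) = \<phi>' c" and fb: "\<And>p. p \<in> I \<Longrightarrow> f (b p) = b' p"
    and I: "finite I" "b \<in> I \<rightarrow> carrier S"
    and span: "carrier S \<subseteq> lspan F S \<phi> I b" and ind: "lindep F A \<phi>' I b'"
  shows "inj_on f (carrier S)" "lindep F S \<phi> I b"
proof -
  interpret S: falgebra F S \<phi> by fact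
  interpret A: falgebra F A \<phi>' by fact
  have hom: "f (lincomb S \<phi> I b c) = lincomb A \<phi>' I b' c" if "c \<in> I \<rightarrow> carrier F" for c
    by (rule lincomb_hom[OF S A f]) (simp_all add: f\<phi> fb I that)
  have b': "b' \<in> I \<rightarrow> carrier A" using fb I(2) ring_hom_closed[OF f] by (metis PiE Pi_I)
  show "inj_on f (carrier S)"
  proof (rule inj_onI)
    fix x y assume xy: "x \<in> carrier S" "y \<in> carrier S" "f x = f y"
    obtain c where c: "c \<in> I \<rightarrow> carrier F" "x = lincomb S \<phi> I b c"
      using subsetD[OF span xy(1)] by (auto simp: lspan_def)
    obtain d where d: "d \<in> I \<rightarrow> carrier F" "y = lincomb S \<phi> I b d"
      using subsetD[OF span xy(2)] by (auto simp: lspan_def)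
    have "lincomb A \<phi>' I b' c = lincomb A \<phi>' I b' d" using xy(3) hom[OF c(1)] hom[OF d(1)] c d by simp
    then have "c p = d p" if "p \<in> I" for p using A.lindep_eq[OF I(1) b' ind c(1) d(1)] that by blast
    then show "x = y" unfolding c(2) d(2) using c(1) I(2) by (intro S.lincomb_cong) auto
  qed
  show "lindep F S \<phi> I b" unfolding lindep_def
  proof (intro allI impI)
    fix c assume c: "c \<in> I \<rightarrow> carrier F" "lincomb S \<phi> I b c = \<zero>\<^bsub>S\<^esub>"
    then have "lincomb A \<phi>' I b' c = \<zero>\<^bsub>A\<^esub>"
      using hom[OF c(1)] ring_hom_zero[OF f S.ring_axioms A.ring_axioms] by simp
    then show "\<forall>p\<in>I. c p = \<zero>\<^bsub>F\<^esub>" using ind c(1) unfolding lindep_def by blast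
  qed
qed

lemma hom_surj_of_lspan:
  assumes S: "falgebra F S \<phi>" and A: "falgebra F A \<phi>'" and f: "f \<in> ring_hom S A"
    and f\<phi>: "\<And>c. c \<in> carrier F \<Longrightarrow> f (\<phi> c) = \<phi>' c" and fb: "\<And>p. p \<in> I \<Longrightarrow> f (b p) = b' p"
    and I: "finite I" "b \<in> I \<rightarrow> carrier S"
    and span: "carrier A \<subseteq> lspan F A \<phi>' I b'"
  shows "f ` carrier S = carrier A"
proof (intro equalityI subsetI)
  interpret S: falgebra F S \<phi> by fact
  fix y assume "y \<in> carrier A"
  then obtain c where c: "c \<in> I \<rightarrow> carrier F" "y = lincomb A \<phi>' I b' c" using span by (auto simp: lspan_def)
  moreover have "f (lincomb S \<phi> I b c) = lincomb A \<phi>' I b' c"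
    by (rule lincomb_hom[OF S A f]) (simp_all add: f\<phi> fb I c)
  ultimately have "y = f (lincomb S \<phi> I b c)" by simp
  then show "y \<in> f ` carrier S" using S.lincomb_closed[OF I(2) c(1)] by blast
qed (use ring_hom_closed[OF f] in auto)

lemma alg_iso_of_basis:
  assumes S: "falgebra F S \<phi>" and A: "falgebra F A \<phi>'" and f: "f \<in> ring_hom S A"
    and f\<phi>: "\<And>c. c \<in> carrier F \<Longrightarrow> f (\<phi> c) = \<phi>' c" and fb: "\<And>p. p \<in> I \<Longrightarrow> f (b p) = b' p"
    and I: "finite I" "b \<in> I \<rightarrow> carrier S"
    and "carrier S \<subseteq> lspan F S \<phi> I b" "lindep F A \<phi>' I b'" "carrier A \<subseteq> lspan F A \<phi>' I b'"
  shows "f \<in> alg_iso F S \<phi> A \<phi>'"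
proof -
  have "inj_on f (carrier S)" by (rule hom_inj_of_lindep(1)[OF S A f, where b = b and b' = b']) (use assms in auto)
  moreover have "f ` carrier S = carrier A" by (rule hom_surj_of_lspan[OF S A f, where b = b and b' = b']) (use assms in auto)
  ultimately show ?thesis using f f\<phi> by (simp add: alg_iso_def ring_iso_def bij_betw_def)
qed

lemma alg_iso_sym:
  assumes S: "falgebra F S \<phi>" and f: "f \<in> alg_iso F S \<phi> A \<phi>'"
  shows "inv_into (carrier S) f \<in> alg_iso F A \<phi>' S \<phi>"
proof -
  interpret S: falgebra F S \<phi> by fact
  have iso: "f \<in> ring_iso S A" and f\<phi>: "\<And>c. c \<in> carrier F \<Longrightarrow> f (\<phi> c) = \<phi>' c" using f by (auto simp: alg_iso_def)
  have "inj_on f (carrier S)" using ring_iso_memE(5)[OF iso] by (simp add: bij_betw_def)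
  then have "inv_into (carrier S) f (\<phi>' c) = \<phi> c" if "c \<in> carrier F" for c
    using that by (simp flip: f\<phi>)
  then show ?thesis using ring_iso_set_sym[OF S.ring_axioms iso] by (simp add: alg_iso_def)
qed

section \<open>The quantum torus\<close>

lemma integer_group_sel [simp]:
  "carrier integer_group = UNIV" "a \<otimes>\<^bsub>integer_group\<^esub> b = a + b" "\<one>\<^bsub>integer_group\<^esub> = 0"
  by (simp_all add: integer_group_def)

locale qtorus = field K for K :: "('a, 'z) ring_scheme" (structure) +
  fixes q :: 'a and n :: nat
  assumes prim: "primitive_root_of_unity K n q" and n2: "2 \<le> n"
begin

abbreviation "L \<equiv> laurent K"
abbreviation "B \<equiv> qt K q"

lemma n_pos [simp]: "0 < n" using n2 by simp

definition qp :: "int \<Rightarrow> 'a" where "qp i = q [^] i"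

lemma q_unit: "q \<in> Units K" "q \<in> carrier K" "q [^] n = \<one>"
proof -
  show q: "q \<in> carrier K" "q [^] n = \<one>" using prim by (auto simp: primitive_root_of_unity_def)
  have "q \<noteq> \<zero>" using q n2 by (metis n_pos nat_pow_zero one_not_zero gr_implies_not0)
  then show "q \<in> Units K" using q field_Units by blast
qed

text \<open>The exponent laws for negative powers are those of the group of units, to which q
  belongs.\<close>

lemma qp_units_of: "qp i = q [^]\<^bsub>units_of K\<^esub> i"
  unfolding qp_def int_pow_def2 units_of_pow[OF q_unit(1)] units_of_inv[OF Units_pow_closed[OF q_unit(1)]] ..

lemma qp_closed [simp]: "qp i \<in> carrier K"
  and qp_add: "qp (i + j) = qp i \<otimes> qp j"
  and qp_0 [simp]: "qp 0 = \<one>" and qp_1 [simp]: "qp 1 = q"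
proof -
  interpret U: group "units_of K" by (rule units_group)
  have q: "q \<in> carrier (units_of K)" using q_unit by (simp add: units_of_def)
  show "qp i \<in> carrier K" using U.int_pow_closed[OF q, of i] by (simp add: qp_units_of units_of_def Units_def)
  show "qp (i + j) = qp i \<otimes> qp j" using U.int_pow_mult[OF q, of i j] by (simp add: qp_units_of units_of_def)
  show "qp 0 = \<one>" by (simp add: qp_def)
  show "qp 1 = q" using U.int_pow_1[OF q] by (simp add: qp_units_of)
qed

lemma qp_neg [simp]: "qp (- i) \<otimes> qp i = \<one>" "qp i \<otimes> qp (- i) = \<one>"
  by (simp_all flip: qp_add)

lemma qp_nonzero [simp]: "qp i \<noteq> \<zero>"
  using qp_neg(1)[of i] by (metis one_not_zero qp_closed r_null)

lemma qp_int: "qp (int m) = q [^] m" by (simp add: qp_def int_pow_int)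

lemma qp_eq_one: "qp i = \<one> \<longleftrightarrow> int n dvd i"
proof -
  have m: "qp (int n * k) = \<one>" for k
  proof (induction k rule: int_induct[where k = 0])
    case (step1 i)
    have "qp (int n * (i + 1)) = qp (int n * i) \<otimes> qp (int n)" by (simp add: algebra_simps flip: qp_add)
    then show ?case using step1 q_unit by (simp add: qp_int)
  next
    case (step2 i)
    have "qp (int n * i) = qp (int n * (i - 1)) \<otimes> qp (int n)" by (simp add: algebra_simps flip: qp_add)
    then show ?case using step2 q_unit by (simp add: qp_int)
  qed simp
  have "qp i = qp (int n * (i div int n)) \<otimes> qp (i mod int n)" by (simp flip: qp_add)
  then have i: "qp i = qp (i mod int n)" by (simp add: m)
  obtain r where r: "i mod int n = int r" using n_pos by (metis of_nat_0_less_iff pos_mod_sign zero_le_imp_eq_int)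
  have "r < n" using pos_mod_bound[of "int n" i] r by simp
  moreover have "qp i = q [^] r" using i r by (simp add: qp_int)
  ultimately have "qp i = \<one> \<longleftrightarrow> r = 0"
    using prim by (auto simp: primitive_root_of_unity_def)
  also have "\<dots> \<longleftrightarrow> int n dvd i" using r by (simp add: dvd_eq_mod_eq_0)
  finally show ?thesis .
qed

lemma qp_dvd [simp]: "int n dvd i \<Longrightarrow> qp i = \<one>" by (simp add: qp_eq_one)

sublocale L: skew_monoid K integer_group "\<lambda>g r. r"
  rewrites "skew_monoid_ring K integer_group (\<lambda>g r. r) = laurent K"
  by (auto simp: laurent_def intro!: monoid_ring_locale ring_axioms group.is_monoid)

sublocale L: cring L
  by (rule L.S_cring) (auto intro: is_cring comm_group.axioms(1) abelian_integer_group)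

text \<open>The power \<sigma>^j, sending h^i to q^(ij) h^i, for all integers j at once. It replaces
  the \<open>inv_into\<close> inside \<open>aut_power\<close> by a formula.\<close>

definition twist :: "int \<Rightarrow> (int \<Rightarrow> 'a) \<Rightarrow> int \<Rightarrow> 'a" where
  "twist j f = (\<lambda>i. qp (i * j) \<otimes> f i)"

lemma twist_closed: "f \<in> carrier L \<Longrightarrow> twist j f \<in> carrier L"
  by (auto simp: twist_def L.S_carrier elim!: rev_finite_subset)

lemma twist_twist: "f \<in> carrier L \<Longrightarrow> twist j (twist k f) = twist (j + k) f"
  by (auto simp: twist_def qp_add distrib_left m_assoc)

lemma twist_0: "f \<in> carrier L \<Longrightarrow> twist 0 f = f"
  by (auto simp: twist_def)

lemma twist_term: "c \<in> carrier K \<Longrightarrow> twist j (term_of K c i) = term_of K (qp (i * j) \<otimes> c) i"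
  by (auto simp: twist_def term_of_def)

text \<open>The universal property provides a homomorphism that fixes K and sends h^g to q^(gj) h^g.
  It agrees with the twist on terms, hence everywhere, so no convolution has to be computed.\<close>

lemma twist_hom: "twist j \<in> ring_hom L L"
proof -
  obtain F where F: "F \<in> ring_hom L L"
    "\<And>r g. r \<in> carrier K \<Longrightarrow> F (term_of K r g) = term_of K r 0 \<otimes>\<^bsub>L\<^esub> term_of K (qp (g * j)) g"
  proof (rule L.S_ext[OF L.ring_axioms, where \<phi> = "\<lambda>r. term_of K r 0" and \<psi> = "\<lambda>g. term_of K (qp (g * j)) g"])
    show "(\<lambda>r. term_of K r 0) \<in> ring_hom K L"
      by (rule ring_hom_memI) (auto simp: L.T_mult L.T_add L.S_one)
  qed (auto simp: L.S_one L.T_mult qp_add distrib_right m_comm)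
  have "F f = twist j f" if "f \<in> carrier L" for f
    using that
  proof (induction f rule: L.S_term_induct)
    case zero
    have "twist j \<zero>\<^bsub>L\<^esub> = \<zero>\<^bsub>L\<^esub>" by (auto simp: twist_def L.S_zero)
    then show ?case using ring_hom_zero[OF F(1) L.ring_axioms L.ring_axioms] by simp
  next
    case (add r g f)
    then have "F (term_of K r g \<oplus>\<^bsub>L\<^esub> f) = twist j (term_of K r g) \<oplus>\<^bsub>L\<^esub> twist j f"
      by (simp add: ring_hom_add[OF F(1)] F(2) L.T_mult twist_term m_comm)
    also have "\<dots> = twist j (term_of K r g \<oplus>\<^bsub>L\<^esub> f)"
      using add by (auto simp: L.S_add twist_def term_of_def r_distr)
    finally show ?case .
  qed
  then show ?thesis using L.ring_hom_restrict[OF F(1)] by blast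
qed

lemma sigma_twist: "laurent_sigma K q = twist 1"
  by (auto simp: laurent_sigma_def twist_def qp_def)

lemma inv_sigma:
  assumes "f \<in> carrier L" shows "inv_into (carrier L) (twist 1) f = twist (- 1) f"
proof (rule inv_into_f_eq)
  show "inj_on (twist 1) (carrier L)"
    by (rule inj_on_inverseI[of _ "twist (- 1)"]) (simp add: twist_twist twist_0)
qed (use assms in \<open>auto simp: twist_closed twist_twist twist_0\<close>)

lemma aut_power_twist:
  assumes "f \<in> carrier L" shows "aut_power L (laurent_sigma K q) j f = twist j f"
proof -
  have pos: "(twist 1 ^^ m) f = twist (int m) f" for m
    by (induction m) (auto simp: twist_0 twist_twist assms)
  have neg: "(inv_into (carrier L) (twist 1) ^^ m) f = twist (- int m) f" for m
    by (induction m) (auto simp: twist_0 inv_sigma twist_closed twist_twist assms)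
  show ?thesis using pos[of "nat j"] neg[of "nat (- j)"] by (auto simp: aut_power_def sigma_twist)
qed

sublocale B: skew_monoid L integer_group "aut_power L (laurent_sigma K q)"
  rewrites "skew_monoid_ring L integer_group (aut_power L (laurent_sigma K q)) = qt K q"
proof -
  show "skew_monoid L integer_group (aut_power L (laurent_sigma K q))"
  proof (intro skew_monoid.intro skew_monoid_axioms.intro)
    show "aut_power L (laurent_sigma K q) g \<in> ring_hom L L" for g
      by (rule L.ring_hom_restrict[OF twist_hom[of g]]) (simp add: aut_power_twist)
  qed (auto simp: aut_power_twist twist_0 twist_twist twist_closed L.ring_axioms group.is_monoid)
qed (simp add: qt_def skew_laurent_def)

sublocale B: ring B by (rule B.S_ring)

text \<open>The monomial \<open>c h\<^sup>i x\<^sup>j\<close>. In an element \<open>f\<close> of \<open>B\<close> its coefficient is \<open>f j i\<close>, with the exponent of \<open>x\<close> first.\<close>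

definition mon :: "'a \<Rightarrow> int \<Rightarrow> int \<Rightarrow> 'a qt" where
  "mon c i j = term_of L (term_of K c i) j"

lemma mon_closed [simp]: "c \<in> carrier K \<Longrightarrow> mon c i j \<in> carrier B"
  by (simp add: mon_def)

lemma mon_coeff: "mon c i j l k = (if l = j \<and> k = i then c else \<zero>)"
  by (auto simp: mon_def term_of_def L.S_zero)

lemma mon_mult:
  assumes "c \<in> carrier K" "d \<in> carrier K"
  shows "mon c i j \<otimes>\<^bsub>B\<^esub> mon d k l = mon (c \<otimes> d \<otimes> qp (k * j)) (i + k) (j + l)"
  using assms by (simp add: mon_def B.T_mult aut_power_twist twist_term L.T_mult m_assoc m_comm)

lemma B_one: "\<one>\<^bsub>B\<^esub> = mon \<one> 0 0" and B_scalar: "qt_scalar K c = mon c 0 0"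
  and B_h: "qt_h K = mon \<one> 1 0" and B_x: "qt_x K = mon \<one> 0 1"
  by (simp_all add: B.S_one L.S_one mon_def qt_scalar_def qt_h_def qt_x_def)

lemma B_add: "(f \<oplus>\<^bsub>B\<^esub> g) j i = f j i \<oplus> g j i" and B_zero: "\<zero>\<^bsub>B\<^esub> j i = \<zero>"
  by (simp_all add: B.S_add L.S_add B.S_zero L.S_zero)

lemma mon_add: "c \<in> carrier K \<Longrightarrow> d \<in> carrier K \<Longrightarrow> mon (c \<oplus> d) i j = mon c i j \<oplus>\<^bsub>B\<^esub> mon d i j"
  by (intro ext) (simp add: B_add mon_coeff)

lemma mon_zero: "mon \<zero> i j = \<zero>\<^bsub>B\<^esub>"
  by (intro ext) (simp add: B_zero mon_coeff)

lemma B_coeff [simp]: "f \<in> carrier B \<Longrightarrow> f j i \<in> carrier K"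
  by simp

lemma qt_induct [consumes 1, case_names zero add]:
  assumes "f \<in> carrier B" and zero: "P \<zero>\<^bsub>B\<^esub>"
    and step: "\<And>c i j f. \<lbrakk>c \<in> carrier K; c \<noteq> \<zero>; f \<in> carrier B; f j i = \<zero>; P f\<rbrakk> \<Longrightarrow> P (mon c i j \<oplus>\<^bsub>B\<^esub> f)"
  shows "P f"
  using assms(1)
proof (induction f rule: B.S_term_induct)
  case (add r g f)
  have "P (term_of L r g \<oplus>\<^bsub>B\<^esub> f)" if "r \<in> carrier L" for r
    using that
  proof (induction r rule: L.S_term_induct)
    case zero
    then show ?case using add by (simp add: B.T_zero)
  next
    case a2: (add c i r)
    have "term_of L (term_of K c i \<oplus>\<^bsub>L\<^esub> r) g \<oplus>\<^bsub>B\<^esub> f = mon c i g \<oplus>\<^bsub>B\<^esub> (term_of L r g \<oplus>\<^bsub>B\<^esub> f)"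
      using add a2 by (simp add: B.T_add mon_def B.a_assoc)
    moreover have "(term_of L r g \<oplus>\<^bsub>B\<^esub> f) g i = \<zero>"
      using add a2 by (simp add: B_add term_of_def L.S_zero)
    ultimately show ?case using a2 add by (auto intro!: step)
  qed
  then show ?case using add by blast
qed (rule zero)

text \<open>A monomial factor shifts the exponents and rescales by the power of q from moving x^j
  past a power of h. Together with the right-hand version this turns identities with monomial
  factors into coefficientwise ones.\<close>

lemma mon_mult_coeff:
  assumes "c \<in> carrier K" "f \<in> carrier B"
  shows "(mon c i j \<otimes>\<^bsub>B\<^esub> f) l k = c \<otimes> qp ((k - i) * j) \<otimes> f (l - j) (k - i)"
  using assms(2)
proof (induction f rule: qt_induct)
  case zero
  have "mon c i j \<otimes>\<^bsub>B\<^esub> \<zero>\<^bsub>B\<^esub> = \<zero>\<^bsub>B\<^esub>" using assms by simp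
  then show ?case using assms(1) by (elim ssubst) (simp add: B_zero)
next
  case (add d a b f)
  have "(mon c i j \<otimes>\<^bsub>B\<^esub> mon d a b) l k = c \<otimes> qp ((k - i) * j) \<otimes> mon d a b (l - j) (k - i)"
    using assms add by (auto simp: mon_mult mon_coeff m_ac)
  moreover have "mon c i j \<otimes>\<^bsub>B\<^esub> (mon d a b \<oplus>\<^bsub>B\<^esub> f) = mon c i j \<otimes>\<^bsub>B\<^esub> mon d a b \<oplus>\<^bsub>B\<^esub> mon c i j \<otimes>\<^bsub>B\<^esub> f"
    using add assms by (simp add: B.r_distr)
  ultimately show ?case using add assms by (simp only: B_add[of _ _ l k]) (simp add: B_add r_distr)
qed

lemma mult_mon_coeff:
  assumes "c \<in> carrier K" "f \<in> carrier B"
  shows "(f \<otimes>\<^bsub>B\<^esub> mon c i j) l k = c \<otimes> qp (i * (l - j)) \<otimes> f (l - j) (k - i)"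
  using assms(2)
proof (induction f rule: qt_induct)
  case zero
  have "\<zero>\<^bsub>B\<^esub> \<otimes>\<^bsub>B\<^esub> mon c i j = \<zero>\<^bsub>B\<^esub>" using assms by simp
  then show ?case using assms(1) by (elim ssubst) (simp add: B_zero)
next
  case (add d a b f)
  have "(mon d a b \<otimes>\<^bsub>B\<^esub> mon c i j) l k = c \<otimes> qp (i * (l - j)) \<otimes> mon d a b (l - j) (k - i)"
    using assms add by (auto simp: mon_mult mon_coeff m_ac)
  moreover have "(mon d a b \<oplus>\<^bsub>B\<^esub> f) \<otimes>\<^bsub>B\<^esub> mon c i j = mon d a b \<otimes>\<^bsub>B\<^esub> mon c i j \<oplus>\<^bsub>B\<^esub> f \<otimes>\<^bsub>B\<^esub> mon c i j"
    using add assms by (simp add: B.l_distr)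
  ultimately show ?case using add assms by (simp only: B_add[of _ _ l k]) (simp add: B_add r_distr)
qed

subsection \<open>Reweighting the coefficients\<close>

text \<open>A diagonal operator in the basis of monomials. Conjugation by h or by x has this form,
  and so has the projection onto the centre.\<close>

definition wt :: "(int \<Rightarrow> int \<Rightarrow> 'a) \<Rightarrow> 'a qt \<Rightarrow> 'a qt" where
  "wt w f = (\<lambda>j i. w j i \<otimes> f j i)"

lemma wt_closed:
  assumes "f \<in> carrier B" "\<And>j i. w j i \<in> carrier K"
  shows "wt w f \<in> carrier B"
proof -
  have f: "\<And>j. f j \<in> carrier L" "finite {j. f j \<noteq> \<zero>\<^bsub>L\<^esub>}" using assms(1) by (auto simp: B.S_carrier)
  have "wt w f j \<in> carrier L" for j
    unfolding L.S_carrier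
  proof (intro conjI)
    show "finite {i. wt w f j i \<noteq> \<zero>}"
      by (rule finite_subset[OF _ L.S_finite[OF f(1)[of j]]]) (use assms in \<open>auto simp: wt_def\<close>)
  qed (use assms in \<open>auto simp: wt_def\<close>)
  moreover have "finite {j. wt w f j \<noteq> \<zero>\<^bsub>L\<^esub>}"
    by (rule finite_subset[OF _ f(2)]) (use assms in \<open>auto simp: wt_def L.S_zero\<close>)
  ultimately show ?thesis unfolding B.S_carrier by auto
qed

lemma wt_add: "f \<in> carrier B \<Longrightarrow> g \<in> carrier B \<Longrightarrow> (\<And>j i. w j i \<in> carrier K) \<Longrightarrow> wt w (f \<oplus>\<^bsub>B\<^esub> g) = wt w f \<oplus>\<^bsub>B\<^esub> wt w g"
  by (intro ext) (simp add: B_add wt_def r_distr)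

lemma wt_zero: "(\<And>j i. w j i \<in> carrier K) \<Longrightarrow> wt w \<zero>\<^bsub>B\<^esub> = \<zero>\<^bsub>B\<^esub>"
  by (intro ext) (simp add: B_zero wt_def)

lemma wt_mon: "(\<And>j i. w j i \<in> carrier K) \<Longrightarrow> wt w (mon c i j) = mon (w j i \<otimes> c) i j"
  by (intro ext) (simp add: mon_coeff wt_def)

lemma supp_finite:
  assumes "f \<in> carrier B" shows "finite {(i, j). f j i \<noteq> \<zero>}"
  using assms
proof (induction f rule: qt_induct)
  case zero
  then show ?case by (simp add: B_zero)
next
  case (add c i j f)
  show ?case
    by (rule finite_subset[of _ "insert (i, j) {(i, j). f j i \<noteq> \<zero>}"]) (use add in \<open>auto simp: B_add mon_coeff split: if_splits\<close>)
qed

subsection \<open>The centre\<close>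

abbreviation "Z \<equiv> ring_center B"

definition central_supp :: "'a qt \<Rightarrow> bool" where
  "central_supp z \<longleftrightarrow> (\<forall>j i. z j i \<noteq> \<zero> \<longrightarrow> int n dvd i \<and> int n dvd j)"

lemma central_mon:
  assumes "c \<in> carrier K" "int n dvd i" "int n dvd j" "f \<in> carrier B"
  shows "mon c i j \<otimes>\<^bsub>B\<^esub> f = f \<otimes>\<^bsub>B\<^esub> mon c i j"
  using assms by (intro ext) (simp add: mon_mult_coeff mult_mon_coeff)

text \<open>Since f vanishes at (i, j), the new term cannot cancel against f, so both inherit the
  condition on the support. This makes the condition usable in \<open>qt_induct\<close>.\<close>

lemma central_supp_add:
  assumes "central_supp (mon c i j \<oplus>\<^bsub>B\<^esub> f)" "c \<in> carrier K" "c \<noteq> \<zero>" "f j i = \<zero>" "f \<in> carrier B"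
  shows "int n dvd i" "int n dvd j" "central_supp f"
proof -
  have "(mon c i j \<oplus>\<^bsub>B\<^esub> f) j i \<noteq> \<zero>" using assms by (simp add: B_add mon_coeff)
  then show "int n dvd i" "int n dvd j" using assms(1) by (auto simp: central_supp_def)
  have "(mon c i j \<oplus>\<^bsub>B\<^esub> f) l k = f l k" if "f l k \<noteq> \<zero>" for l k
    using assms(2-) that by (auto simp: B_add mon_coeff)
  then show "central_supp f" using assms(1) unfolding central_supp_def by metis
qed

text \<open>A term h^i x^j of an element commuting with h satisfies q^j = 1, and of one commuting
  with x it satisfies q^i = 1. Conversely all twists by exponents divisible by n are
  trivial.\<close>

lemma center_iff: "z \<in> Z \<longleftrightarrow> z \<in> carrier B \<and> central_supp z"
proof
  assume "z \<in> Z"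
  then have z: "z \<in> carrier B" and comm: "\<And>r. r \<in> carrier B \<Longrightarrow> z \<otimes>\<^bsub>B\<^esub> r = r \<otimes>\<^bsub>B\<^esub> z"
    unfolding ring_center_def by blast+
  have "int n dvd i \<and> int n dvd j" if nz: "z j i \<noteq> \<zero>" for i j
  proof -
    have cancel: "a = \<one>" if "a \<otimes> z j i = z j i" "a \<in> carrier K" for a
      using that nz z by (metis B_coeff l_one m_rcancel one_closed)
    have "(z \<otimes>\<^bsub>B\<^esub> mon \<one> 1 0) j (i + 1) = (mon \<one> 1 0 \<otimes>\<^bsub>B\<^esub> z) j (i + 1)" by (simp add: comm)
    then have "qp j = \<one>" using z by (intro cancel) (simp_all add: mult_mon_coeff mon_mult_coeff)
    moreover have "(mon \<one> 0 1 \<otimes>\<^bsub>B\<^esub> z) (j + 1) i = (z \<otimes>\<^bsub>B\<^esub> mon \<one> 0 1) (j + 1) i" by (simp add: comm)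
    then have "qp i = \<one>" using z by (intro cancel) (simp_all add: mult_mon_coeff mon_mult_coeff)
    ultimately show ?thesis by (simp add: qp_eq_one)
  qed
  then show "z \<in> carrier B \<and> central_supp z" using z by (simp add: central_supp_def)
next
  assume z: "z \<in> carrier B \<and> central_supp z"
  have "central_supp z \<longrightarrow> (\<forall>r\<in>carrier B. z \<otimes>\<^bsub>B\<^esub> r = r \<otimes>\<^bsub>B\<^esub> z)"
    using z[THEN conjunct1]
  proof (induction z rule: qt_induct)
    case zero
    then show ?case by simp
  next
    case (add c i j f)
    show ?case
    proof (intro impI ballI)
      fix r assume cs: "central_supp (mon c i j \<oplus>\<^bsub>B\<^esub> f)" and r: "r \<in> carrier B"
      note c = central_supp_add[OF cs add(1,2,4,3)]
      have "f \<otimes>\<^bsub>B\<^esub> r = r \<otimes>\<^bsub>B\<^esub> f" using add(5) c r by blast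
      moreover have "mon c i j \<otimes>\<^bsub>B\<^esub> r = r \<otimes>\<^bsub>B\<^esub> mon c i j" using central_mon c add r by blast
      ultimately show "(mon c i j \<oplus>\<^bsub>B\<^esub> f) \<otimes>\<^bsub>B\<^esub> r = r \<otimes>\<^bsub>B\<^esub> (mon c i j \<oplus>\<^bsub>B\<^esub> f)"
        using add r by (simp add: B.l_distr B.r_distr)
    qed
  qed
  then show "z \<in> Z" using z by (simp add: ring_center_def)
qed

lemma center_closed [simp]: "z \<in> Z \<Longrightarrow> z \<in> carrier B" by (simp add: center_iff)

lemma center_comm: "z \<in> Z \<Longrightarrow> r \<in> carrier B \<Longrightarrow> z \<otimes>\<^bsub>B\<^esub> r = r \<otimes>\<^bsub>B\<^esub> z"
  unfolding ring_center_def by blast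

lemma mon_center: "c \<in> carrier K \<Longrightarrow> int n dvd i \<Longrightarrow> int n dvd j \<Longrightarrow> mon c i j \<in> Z"
  by (auto simp: center_iff central_supp_def mon_coeff)

text \<open>The projection of B onto its centre along the noncentral monomials.\<close>

definition E0 :: "'a qt \<Rightarrow> 'a qt" where
  "E0 = wt (\<lambda>j i. if int n dvd i \<and> int n dvd j then \<one> else \<zero>)"

lemma E0_center: "f \<in> carrier B \<Longrightarrow> E0 f \<in> Z"
  unfolding center_iff E0_def
proof
  assume f: "f \<in> carrier B"
  then show "wt (\<lambda>j i. if int n dvd i \<and> int n dvd j then \<one> else \<zero>) f \<in> carrier B" by (rule wt_closed) auto
  have "(if int n dvd i \<and> int n dvd j then \<one> else \<zero>) \<otimes> f j i = \<zero>" if "\<not> (int n dvd i \<and> int n dvd j)" for i j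
    using that f by auto
  then show "central_supp (wt (\<lambda>j i. if int n dvd i \<and> int n dvd j then \<one> else \<zero>) f)"
    unfolding central_supp_def wt_def by blast
qed

lemma E0_add: "f \<in> carrier B \<Longrightarrow> g \<in> carrier B \<Longrightarrow> E0 (f \<oplus>\<^bsub>B\<^esub> g) = E0 f \<oplus>\<^bsub>B\<^esub> E0 g"
  unfolding E0_def by (rule wt_add) auto

lemma E0_zero: "E0 \<zero>\<^bsub>B\<^esub> = \<zero>\<^bsub>B\<^esub>"
  unfolding E0_def by (rule wt_zero) auto

lemma E0_mon: "c \<in> carrier K \<Longrightarrow> E0 (mon c i j) = (if int n dvd i \<and> int n dvd j then mon c i j else \<zero>\<^bsub>B\<^esub>)"
  unfolding E0_def by (subst wt_mon) (auto simp: mon_zero)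

lemma E0_id: "z \<in> Z \<Longrightarrow> E0 z = z"
proof (intro ext)
  fix j i assume "z \<in> Z"
  then have "z \<in> carrier B" "\<not> (int n dvd i \<and> int n dvd j) \<Longrightarrow> z j i = \<zero>"
    unfolding center_iff central_supp_def by blast+
  then show "E0 z j i = z j i" by (cases "int n dvd i \<and> int n dvd j") (auto simp: E0_def wt_def)
qed

text \<open>Multiplication by a central monomial shifts exponents by multiples of n and so respects
  the condition defining the projection; additivity in z does the rest.\<close>

lemma E0_mult:
  assumes "z \<in> Z" "f \<in> carrier B"
  shows "E0 (z \<otimes>\<^bsub>B\<^esub> f) = z \<otimes>\<^bsub>B\<^esub> E0 f"
proof -
  have mon: "E0 (mon c i j \<otimes>\<^bsub>B\<^esub> f) = mon c i j \<otimes>\<^bsub>B\<^esub> E0 f"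
    if c: "c \<in> carrier K" "int n dvd i" "int n dvd j" for c i j
  proof (intro ext)
    fix l k
    have "int n dvd k \<longleftrightarrow> int n dvd (k - i)" "int n dvd l \<longleftrightarrow> int n dvd (l - j)"
      using c by (metis dvd_diff_right_iff dvd_diff dvd_add_right_iff diff_add_cancel dvd_add)+
    then show "E0 (mon c i j \<otimes>\<^bsub>B\<^esub> f) l k = (mon c i j \<otimes>\<^bsub>B\<^esub> E0 f) l k"
      using c(1) assms(2) E0_center[OF assms(2)]
      by (simp add: mon_mult_coeff) (simp add: E0_def wt_def mon_mult_coeff)
  qed
  have Ec: "E0 f \<in> carrier B" using E0_center[OF assms(2)] by simp
  have "central_supp z \<longrightarrow> E0 (z \<otimes>\<^bsub>B\<^esub> f) = z \<otimes>\<^bsub>B\<^esub> E0 f"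
    using center_closed[OF assms(1)]
  proof (induction z rule: qt_induct)
    case zero
    then show ?case using assms Ec by (simp add: E0_zero)
  next
    case (add c i j g)
    show ?case
    proof
      assume cs: "central_supp (mon c i j \<oplus>\<^bsub>B\<^esub> g)"
      note c = central_supp_add[OF cs add(1,2,4,3)]
      then show "E0 ((mon c i j \<oplus>\<^bsub>B\<^esub> g) \<otimes>\<^bsub>B\<^esub> f) = (mon c i j \<oplus>\<^bsub>B\<^esub> g) \<otimes>\<^bsub>B\<^esub> E0 f"
        using add assms Ec by (simp add: B.l_distr E0_add mon)
    qed
  qed
  then show ?thesis using assms center_iff by blast
qed

end

lemma (in ideal) finsum_mem:
  assumes "finite A" "\<And>i. i \<in> A \<Longrightarrow> f i \<in> I" shows "finsum R f A \<in> I"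
  using assms
proof (induction A)
  case empty then show ?case using zero_closed by simp
next
  case (insert a A)
  then have "f \<in> A \<rightarrow> carrier R" "f a \<in> carrier R" using a_Hcarr by auto
  then show ?case using insert by (simp add: a_closed)
qed

lemma ring_hom_pow:
  assumes "ring R" "ring S" "f \<in> ring_hom R S" "x \<in> carrier R"
  shows "f (x [^]\<^bsub>R\<^esub> (k::nat)) = f x [^]\<^bsub>S\<^esub> k"
proof -
  interpret R: ring R by fact
  interpret S: ring S by fact
  show ?thesis using assms(3,4) by (induction k) (simp_all add: ring_hom_one ring_hom_mult)
qed

lemma maximalideal_quot_simple:
  assumes "maximalideal I R" shows "simple_ring (R Quot I)"
proof -
  interpret maximalideal I R by fact
  interpret Q: ring "R Quot I" by (rule quotient_is_ring)
  note \<pi> = rcos_ring_hom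
  have "J = {\<zero>\<^bsub>R Quot I\<^esub>} \<or> J = carrier (R Quot I)" if J: "ideal J (R Quot I)" for J
  proof -
    interpret J: ideal J "R Quot I" by fact
    let ?P = "{x \<in> carrier R. I +>\<^bsub>R\<^esub> x \<in> J}"
    have "ideal ?P R"
      by (rule ideal_of_closed)
        (auto simp: ring_hom_add[OF \<pi>] ring_hom_mult[OF \<pi>] ring_hom_zero[OF \<pi> ring_axioms Q.ring_axioms]
          J.a_closed J.zero_closed J.I_l_closed J.I_r_closed ring_hom_closed[OF \<pi>])
    moreover have "I \<subseteq> ?P"
    proof
      fix x assume x: "x \<in> I"
      then have "I +>\<^bsub>R\<^esub> x = \<zero>\<^bsub>R Quot I\<^esub>" using quot_zero_iff[OF a_Hcarr[OF x]] by simp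
      then show "x \<in> ?P" using J.zero_closed a_Hcarr[OF x] by simp
    qed
    ultimately have "?P = I \<or> ?P = carrier R" using I_maximal by blast
    then show ?thesis
    proof
      assume P: "?P = I"
      have "y = \<zero>\<^bsub>R Quot I\<^esub>" if y: "y \<in> J" for y
      proof -
        obtain x where x: "x \<in> carrier R" "y = I +>\<^bsub>R\<^esub> x" using J.a_Hcarr[OF y] by (rule quot_surj)
        then have "x \<in> I" using y P by blast
        then show ?thesis using quot_zero_iff x by blast
      qed
      then show ?thesis using J.zero_closed by blast
    next
      assume P: "?P = carrier R"
      have "y \<in> J" if y: "y \<in> carrier (R Quot I)" for y
      proof -
        obtain x where "x \<in> carrier R" "y = I +>\<^bsub>R\<^esub> x" using y by (rule quot_surj)
        then show ?thesis using P by blast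
      qed
      then show ?thesis using J.a_Hcarr by blast
    qed
  qed
  moreover have "carrier (R Quot I) \<noteq> {\<zero>\<^bsub>R Quot I\<^esub>}"
  proof
    assume "carrier (R Quot I) = {\<zero>\<^bsub>R Quot I\<^esub>}"
    then have "I +>\<^bsub>R\<^esub> \<one>\<^bsub>R\<^esub> = \<zero>\<^bsub>R Quot I\<^esub>" using ring_hom_closed[OF \<pi>] by blast
    then have "\<one>\<^bsub>R\<^esub> \<in> I" using quot_zero_iff by simp
    then show False using one_imp_carrier I_notcarr by simp
  qed
  ultimately show ?thesis using Q.ring_axioms by (simp add: simple_ring_def)
qed

context qtorus begin

lemma center_zero: "\<zero>\<^bsub>B\<^esub> \<in> Z" and center_one: "\<one>\<^bsub>B\<^esub> \<in> Z"
  and center_add: "y \<in> Z \<Longrightarrow> z \<in> Z \<Longrightarrow> y \<oplus>\<^bsub>B\<^esub> z \<in> Z"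
  and center_mult: "y \<in> Z \<Longrightarrow> z \<in> Z \<Longrightarrow> y \<otimes>\<^bsub>B\<^esub> z \<in> Z"
  and center_minus: "z \<in> Z \<Longrightarrow> \<ominus>\<^bsub>B\<^esub> z \<in> Z"
proof -
  have I: "z \<in> Z" if "z \<in> carrier B" "\<And>r. r \<in> carrier B \<Longrightarrow> z \<otimes>\<^bsub>B\<^esub> r = r \<otimes>\<^bsub>B\<^esub> z" for z
    using that unfolding ring_center_def by blast
  show "\<zero>\<^bsub>B\<^esub> \<in> Z" "\<one>\<^bsub>B\<^esub> \<in> Z" by (auto intro!: I)
  show "y \<oplus>\<^bsub>B\<^esub> z \<in> Z" if yz: "y \<in> Z" "z \<in> Z" for y z
  proof (rule I)
    fix r assume r: "r \<in> carrier B"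
    show "(y \<oplus>\<^bsub>B\<^esub> z) \<otimes>\<^bsub>B\<^esub> r = r \<otimes>\<^bsub>B\<^esub> (y \<oplus>\<^bsub>B\<^esub> z)"
      using yz r center_comm[OF yz(1) r] center_comm[OF yz(2) r] by (simp add: B.l_distr B.r_distr)
  qed (use yz in auto)
  show "\<ominus>\<^bsub>B\<^esub> z \<in> Z" if z: "z \<in> Z" for z
  proof (rule I)
    fix r assume r: "r \<in> carrier B"
    show "(\<ominus>\<^bsub>B\<^esub> z) \<otimes>\<^bsub>B\<^esub> r = r \<otimes>\<^bsub>B\<^esub> (\<ominus>\<^bsub>B\<^esub> z)"
      using z r center_comm[OF z r] by (simp add: B.l_minus B.r_minus)
  qed (use z in auto)
  show "y \<otimes>\<^bsub>B\<^esub> z \<in> Z" if yz: "y \<in> Z" "z \<in> Z" for y z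
  proof (rule I)
    fix r assume r: "r \<in> carrier B"
    note c = center_closed[OF yz(1)] center_closed[OF yz(2)] r
    have "y \<otimes>\<^bsub>B\<^esub> z \<otimes>\<^bsub>B\<^esub> r = y \<otimes>\<^bsub>B\<^esub> (z \<otimes>\<^bsub>B\<^esub> r)" using c by (simp only: B.m_assoc)
    also have "\<dots> = (y \<otimes>\<^bsub>B\<^esub> r) \<otimes>\<^bsub>B\<^esub> z" using c by (simp only: center_comm[OF yz(2) r] B.m_assoc)
    also have "\<dots> = r \<otimes>\<^bsub>B\<^esub> (y \<otimes>\<^bsub>B\<^esub> z)" using c by (simp only: center_comm[OF yz(1) r] B.m_assoc)
    finally show "y \<otimes>\<^bsub>B\<^esub> z \<otimes>\<^bsub>B\<^esub> r = r \<otimes>\<^bsub>B\<^esub> (y \<otimes>\<^bsub>B\<^esub> z)" .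
  qed (use yz in auto)
qed

lemma qtZ_sel [simp]: "carrier (qtZ K q) = Z" "y \<oplus>\<^bsub>qtZ K q\<^esub> z = y \<oplus>\<^bsub>B\<^esub> z" "y \<otimes>\<^bsub>qtZ K q\<^esub> z = y \<otimes>\<^bsub>B\<^esub> z"
  "\<one>\<^bsub>qtZ K q\<^esub> = \<one>\<^bsub>B\<^esub>" "\<zero>\<^bsub>qtZ K q\<^esub> = \<zero>\<^bsub>B\<^esub>"
  by (simp_all add: qtZ_def)

lemma qtZ_cring: "cring (qtZ K q)"
proof (rule cringI)
  show "abelian_group (qtZ K q)"
  proof (rule abelian_groupI)
    fix z assume "z \<in> carrier (qtZ K q)"
    then show "\<exists>y\<in>carrier (qtZ K q). y \<oplus>\<^bsub>qtZ K q\<^esub> z = \<zero>\<^bsub>qtZ K q\<^esub>"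
      using center_minus by (auto simp: B.l_neg intro!: bexI[of _ "\<ominus>\<^bsub>B\<^esub> z"])
  qed (auto simp: center_add center_zero B.a_ac)
  show "comm_monoid (qtZ K q)"
    by (rule comm_monoidI) (auto simp: center_mult center_one B.m_assoc intro: center_comm)
qed (auto simp: B.l_distr)

subsection \<open>Two-sided ideals are generated by central elements\<close>

text \<open>Composing the operators \<open>f \<mapsto> ufu' - q\<^sup>r f\<close> for \<open>0 < r < n\<close> and normalizing kills all components but the invariant one.\<close>

lemma E0_in_ideal_weights:
  assumes I: "ideal I B" and f: "f \<in> I" and r: "1 \<le> r" "r \<le> n"
    and conj: "\<And>g. g \<in> carrier B \<Longrightarrow> wt (\<lambda>l k. qp (d l k)) g = u \<otimes>\<^bsub>B\<^esub> g \<otimes>\<^bsub>B\<^esub> u'" "u \<in> carrier B" "u' \<in> carrier B"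
  shows "\<exists>w. (\<forall>j. w j \<in> carrier K \<and> (int n dvd j \<longrightarrow> w j = \<one>) \<and> (j mod int n \<in> {1..<int r} \<longrightarrow> w j = \<zero>)) \<and>
     wt (\<lambda>l k. w (d l k)) f \<in> I"
  using r
proof (induction r rule: nat_induct_at_least)
  case base
  have "wt (\<lambda>l k. \<one>) f = f" using f ideal.Icarr[OF I] by (auto simp: wt_def)
  then show ?case using f by (intro exI[of _ "\<lambda>_. \<one>"]) auto
next
  case (Suc r)
  then obtain w where w: "\<And>j. w j \<in> carrier K" "\<And>j. int n dvd j \<Longrightarrow> w j = \<one>"
    "\<And>j. j mod int n \<in> {1..<int r} \<Longrightarrow> w j = \<zero>" and g: "wt (\<lambda>l k. w (d l k)) f \<in> I" by auto
  let ?g = "wt (\<lambda>l k. w (d l k)) f" and ?r = "qp (int r)"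
  interpret I: ideal I B by fact
  have fB: "f \<in> carrier B" "?g \<in> carrier B" using f g I.Icarr by auto
  have "\<not> int n dvd int r" using Suc.hyps Suc.prems by (auto dest!: dvd_imp_le)
  then have nz: "\<one> \<oplus> \<ominus> ?r \<noteq> \<zero>" using qp_eq_one[of "int r"] by (metis minus_equality minus_minus one_closed qp_closed a_inv_closed)
  \<comment> \<open>The factor q^j - q^r kills the components of residue r but multiplies the
    invariant ones by 1 - q^r. This is nonzero for 0 < r < n, and dividing by it restores the weight
    1.\<close>
  define u0 where "u0 = inv (\<one> \<oplus> \<ominus> ?r)"
  have u0: "u0 \<in> carrier K" "u0 \<otimes> (\<one> \<oplus> \<ominus> ?r) = \<one>"
    using nz field_Units by (auto simp: u0_def intro: Units_inv_closed Units_l_inv)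
  define w' where "w' j = u0 \<otimes> (qp j \<oplus> \<ominus> ?r) \<otimes> w j" for j
  have gg: "mon u0 0 0 \<otimes>\<^bsub>B\<^esub> (u \<otimes>\<^bsub>B\<^esub> ?g \<otimes>\<^bsub>B\<^esub> u' \<oplus>\<^bsub>B\<^esub> mon (\<ominus> ?r) 0 0 \<otimes>\<^bsub>B\<^esub> ?g) \<in> I"
    using g conj(2,3) u0 by (intro I.I_l_closed I.a_closed I.I_r_closed) auto
  have "mon u0 0 0 \<otimes>\<^bsub>B\<^esub> (wt (\<lambda>l k. qp (d l k)) ?g \<oplus>\<^bsub>B\<^esub> mon (\<ominus> ?r) 0 0 \<otimes>\<^bsub>B\<^esub> ?g) = wt (\<lambda>l k. w' (d l k)) f"
  proof (intro ext)
    fix l k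
    have c: "wt (\<lambda>l k. qp (d l k)) ?g \<oplus>\<^bsub>B\<^esub> mon (\<ominus> ?r) 0 0 \<otimes>\<^bsub>B\<^esub> ?g \<in> carrier B"
      using fB by (auto intro!: wt_closed)
    have fc: "f l k \<in> carrier K" using fB by simp
    have "(mon u0 0 0 \<otimes>\<^bsub>B\<^esub> (wt (\<lambda>l k. qp (d l k)) ?g \<oplus>\<^bsub>B\<^esub> mon (\<ominus> ?r) 0 0 \<otimes>\<^bsub>B\<^esub> ?g)) l k
       = u0 \<otimes> (qp (d l k) \<otimes> (w (d l k) \<otimes> f l k) \<oplus> \<ominus> ?r \<otimes> (w (d l k) \<otimes> f l k))"
      unfolding mon_mult_coeff[OF u0(1) c] B_add mon_mult_coeff[OF a_inv_closed[OF qp_closed] fB(2)]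
      using u0 by (simp add: wt_def)
    also have "\<dots> = w' (d l k) \<otimes> f l k"
      unfolding w'_def using u0(1) w(1) fc by (simp add: l_distr r_distr m_assoc)
    finally show "(mon u0 0 0 \<otimes>\<^bsub>B\<^esub> (wt (\<lambda>l k. qp (d l k)) ?g \<oplus>\<^bsub>B\<^esub> mon (\<ominus> ?r) 0 0 \<otimes>\<^bsub>B\<^esub> ?g)) l k = wt (\<lambda>l k. w' (d l k)) f l k"
      by (simp add: wt_def)
  qed
  then have "wt (\<lambda>l k. w' (d l k)) f \<in> I" using gg conj(1)[OF fB(2)] by simp
  moreover have "w' j \<in> carrier K" for j using u0 w by (simp add: w'_def)
  moreover have "w' j = \<one>" if "int n dvd j" for j using u0 w(2)[OF that] that by (simp add: w'_def)
  moreover have "w' j = \<zero>" if j: "j mod int n \<in> {1..<int (Suc r)}" for j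
  proof (cases "j mod int n = int r")
    case True
    have "qp j = qp (int n * (j div int n)) \<otimes> qp (j mod int n)"
      by (simp only: qp_add[symmetric] mult_div_mod_eq)
    then have "qp j = ?r" using True by simp
    then show ?thesis using u0 w by (simp add: w'_def r_neg)
  next
    case False
    then show ?thesis using j w(3)[of j] u0 by (simp add: w'_def)
  qed
  ultimately show ?case by blast
qed

lemma E0_in_ideal:
  assumes I: "ideal I B" and f: "f \<in> I" shows "E0 f \<in> I"
proof -
  \<comment> \<open>Conjugation by h sees only the exponent of x, and conjugation by x only that of
    h. One pass with each leaves the monomials with both exponents divisible by n.\<close>
  have conj_h: "wt (\<lambda>l k. qp l) g = mon \<one> (- 1) 0 \<otimes>\<^bsub>B\<^esub> g \<otimes>\<^bsub>B\<^esub> mon \<one> 1 0" if "g \<in> carrier B" for g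
    using that by (intro ext) (simp add: wt_def mult_mon_coeff, simp add: mon_mult_coeff)
  have conj_x: "wt (\<lambda>l k. qp k) g = mon \<one> 0 1 \<otimes>\<^bsub>B\<^esub> g \<otimes>\<^bsub>B\<^esub> mon \<one> 0 (- 1)" if "g \<in> carrier B" for g
    using that by (intro ext) (simp add: wt_def mult_mon_coeff, simp add: mon_mult_coeff)
  have "\<exists>w. (\<forall>j. w j \<in> carrier K \<and> (int n dvd j \<longrightarrow> w j = \<one>) \<and> (j mod int n \<in> {1..<int n} \<longrightarrow> w j = \<zero>)) \<and>
     wt (\<lambda>l k. w l) f \<in> I"
    by (rule E0_in_ideal_weights[OF I f _ order.refl, where u = "mon \<one> (- 1) 0" and u' = "mon \<one> 1 0"]) (use n2 in \<open>auto simp: conj_h\<close>)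
  then obtain w where w: "\<And>j. w j \<in> carrier K" "\<And>j. int n dvd j \<Longrightarrow> w j = \<one>"
    "\<And>j. j mod int n \<in> {1..<int n} \<Longrightarrow> w j = \<zero>" and g: "wt (\<lambda>l k. w l) f \<in> I" by blast
  have "\<exists>v. (\<forall>j. v j \<in> carrier K \<and> (int n dvd j \<longrightarrow> v j = \<one>) \<and> (j mod int n \<in> {1..<int n} \<longrightarrow> v j = \<zero>)) \<and>
     wt (\<lambda>l k. v k) (wt (\<lambda>l k. w l) f) \<in> I"
    by (rule E0_in_ideal_weights[OF I g _ order.refl, where u = "mon \<one> 0 1" and u' = "mon \<one> 0 (- 1)"]) (use n2 in \<open>auto simp: conj_x\<close>)
  then obtain v where v: "\<And>j. v j \<in> carrier K" "\<And>j. int n dvd j \<Longrightarrow> v j = \<one>"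
    "\<And>j. j mod int n \<in> {1..<int n} \<Longrightarrow> v j = \<zero>" and h: "wt (\<lambda>l k. v k) (wt (\<lambda>l k. w l) f) \<in> I" by blast
  have mod: "j mod int n \<in> {1..<int n}" if "\<not> int n dvd j" for j
  proof -
    have "0 \<le> j mod int n" "j mod int n < int n" "j mod int n \<noteq> 0" using that by (simp_all add: dvd_eq_mod_eq_0)
    then show ?thesis unfolding atLeastLessThan_iff by linarith
  qed
  have ww: "w j = (if int n dvd j then \<one> else \<zero>)" "v j = (if int n dvd j then \<one> else \<zero>)" for j
    using w v mod by auto
  have fB: "f \<in> carrier B" using f ideal.Icarr[OF I] by auto
  have "wt (\<lambda>l k. v k) (wt (\<lambda>l k. w l) f) = E0 f"
    using fB by (intro ext) (simp add: wt_def E0_def ww)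
  then show ?thesis using h by simp
qed

text \<open>The coefficient of f at h^a x^b over the centre, up to a power of q: the class of
  exponents congruent to (a, b) modulo n is shifted into the centre, and the other classes are
  projected away.\<close>

definition cmp :: "int \<Rightarrow> int \<Rightarrow> 'a qt \<Rightarrow> 'a qt" where
  "cmp a b f = E0 (f \<otimes>\<^bsub>B\<^esub> mon \<one> (- a) (- b))"

abbreviation "I2 \<equiv> {..<n} \<times> {..<n}"

lemma cmp_center: "f \<in> carrier B \<Longrightarrow> cmp a b f \<in> Z"
  unfolding cmp_def by (simp add: E0_center)

text \<open>Every pair of exponents has exactly one representative modulo n in the square. The
  factor q^(ab) undoes the scalars: h^i x^j h^(-a) x^(-b) = q^(-aj) h^(i-a) x^(j-b), and multiplying
  back by h^a x^b contributes q^(a(j-b)).\<close>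

lemma cmp_decomposition:
  assumes "f \<in> carrier B"
  shows "f = (\<Oplus>\<^bsub>B\<^esub>p\<in>I2. cmp (int (fst p)) (int (snd p)) f \<otimes>\<^bsub>B\<^esub> mon (qp (int (fst p) * int (snd p))) (int (fst p)) (int (snd p)))"
    (is "f = finsum B (\<lambda>p. ?g p f) I2")
  using assms
proof (induction f rule: qt_induct)
  case zero
  have "?g p \<zero>\<^bsub>B\<^esub> = \<zero>\<^bsub>B\<^esub>" for p by (simp add: cmp_def E0_zero)
  then show ?case by (simp add: B.finsum_zero)
next
  case (add c i j f)
  have gc: "?g p f \<in> carrier B" if "f \<in> carrier B" for p f
    using cmp_center[OF that] by simp
  have "?g p (mon c i j) = (if p = (nat (i mod int n), nat (j mod int n)) then mon c i j else \<zero>\<^bsub>B\<^esub>)" if p: "p \<in> I2" for p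
  proof -
    obtain a b where ab: "p = (a, b)" "a < n" "b < n" using p by auto
    have md: "int n dvd (i - int a) \<longleftrightarrow> a = nat (i mod int n)" if "a < n" for i a
    proof -
      have "int n dvd (i - int a) \<longleftrightarrow> i mod int n = int a mod int n" by (simp add: mod_eq_dvd_iff)
      also have "\<dots> \<longleftrightarrow> i mod int n = int a" using that by simp
      also have "\<dots> \<longleftrightarrow> a = nat (i mod int n)" using n_pos by auto
      finally show ?thesis .
    qed
    have E: "cmp (int a) (int b) (mon c i j) = (if int n dvd (i - int a) \<and> int n dvd (j - int b)
      then mon (c \<otimes> qp (- int a * j)) (i - int a) (j - int b) else \<zero>\<^bsub>B\<^esub>)"
      using add(1) by (simp add: cmp_def mon_mult E0_mon)
    show ?thesis
    proof (cases "int n dvd (i - int a) \<and> int n dvd (j - int b)")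
      case True
      have "qp (- int a * j) \<otimes> (qp (int a * int b) \<otimes> qp (int a * (j - int b))) = qp (- int a * j + (int a * int b + int a * (j - int b)))"
        by (simp only: qp_add)
      also have "\<dots> = \<one>" by (simp add: algebra_simps)
      finally have "c \<otimes> qp (- int a * j) \<otimes> qp (int a * int b) \<otimes> qp (int a * (j - int b)) = c"
        using add(1) by (simp add: m_assoc)
      then have "?g p (mon c i j) = mon c i j" using True add(1) ab by (simp add: E mon_mult)
      then show ?thesis using True md[OF ab(2), of i] md[OF ab(3), of j] ab(1) by simp
    next
      case False
      then show ?thesis using md[OF ab(2), of i] md[OF ab(3), of j] ab(1) by (auto simp: E)
    qed
  qed
  then have "finsum B (\<lambda>p. ?g p (mon c i j)) I2 = (\<Oplus>\<^bsub>B\<^esub>p\<in>I2. if p = (nat (i mod int n), nat (j mod int n)) then mon c i j else \<zero>\<^bsub>B\<^esub>)"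
    using add(1) by (intro B.finsum_cong') auto
  also have "\<dots> = mon c i j"
  proof (rule B.add.finprod_singleton_swap)
    have "nat (i mod int n) < n" for i using pos_mod_bound[of "int n" i] pos_mod_sign[of "int n" i] n2 by linarith
    then show "(nat (i mod int n), nat (j mod int n)) \<in> I2" by auto
  qed (use add(1) in auto)
  finally have 1: "finsum B (\<lambda>p. ?g p (mon c i j)) I2 = mon c i j" .
  have "finsum B (\<lambda>p. ?g p (mon c i j \<oplus>\<^bsub>B\<^esub> f)) I2 = (\<Oplus>\<^bsub>B\<^esub>p\<in>I2. ?g p (mon c i j) \<oplus>\<^bsub>B\<^esub> ?g p f)"
  proof (rule B.finsum_cong')
    show "?g p (mon c i j \<oplus>\<^bsub>B\<^esub> f) = ?g p (mon c i j) \<oplus>\<^bsub>B\<^esub> ?g p f" for p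
      using add(1,3) cmp_center[of "mon c i j"] cmp_center[of f]
      by (simp add: cmp_def B.l_distr E0_add)
  qed (use gc add(1,3) in auto)
  also have "\<dots> = mon c i j \<oplus>\<^bsub>B\<^esub> f"
    using gc add by (subst B.finsum_addf) (auto simp: 1)
  finally show ?case by simp
qed

lemma qtBm_induct [consumes 1, case_names prod sum]:
  assumes "f \<in> qtBm K q J" "\<And>b z. b \<in> carrier B \<Longrightarrow> z \<in> J \<Longrightarrow> P (b \<otimes>\<^bsub>B\<^esub> z)"
    "\<And>f g. f \<in> qtBm K q J \<Longrightarrow> g \<in> qtBm K q J \<Longrightarrow> P f \<Longrightarrow> P g \<Longrightarrow> P (f \<oplus>\<^bsub>B\<^esub> g)"
  shows "P f"
  using assms(1) unfolding qtBm_def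
  by (induction rule: ideal_prod.induct) (use assms(2,3) in \<open>auto simp: qtBm_def\<close>)

lemma qtBm_prod: "b \<in> carrier B \<Longrightarrow> z \<in> J \<Longrightarrow> b \<otimes>\<^bsub>B\<^esub> z \<in> qtBm K q J"
  and qtBm_sum: "f \<in> qtBm K q J \<Longrightarrow> g \<in> qtBm K q J \<Longrightarrow> f \<oplus>\<^bsub>B\<^esub> g \<in> qtBm K q J"
  unfolding qtBm_def by (auto intro: ideal_prod.intros)

context
  fixes J assumes J: "ideal J (qtZ K q)"
begin

lemma J_center: "z \<in> J \<Longrightarrow> z \<in> Z"
  using ideal.Icarr[OF J] by simp

lemma J_closed: "\<zero>\<^bsub>B\<^esub> \<in> J" "y \<in> J \<Longrightarrow> z \<in> J \<Longrightarrow> y \<oplus>\<^bsub>B\<^esub> z \<in> J" "y \<in> Z \<Longrightarrow> z \<in> J \<Longrightarrow> y \<otimes>\<^bsub>B\<^esub> z \<in> J"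
  using additive_subgroup.zero_closed[OF ideal.axioms(1)[OF J]] additive_subgroup.a_closed[OF ideal.axioms(1)[OF J], of y z]
    ideal.I_l_closed[OF J, of z y] by simp_all

lemma qtBm_ideal: "ideal (qtBm K q J) B"
proof (rule B.ideal_of_closed)
  show "qtBm K q J \<subseteq> carrier B"
  proof
    fix f assume "f \<in> qtBm K q J"
    then show "f \<in> carrier B" by (induction rule: qtBm_induct) (auto dest: J_center)
  qed
  then have c: "f \<in> carrier B" if "f \<in> qtBm K q J" for f using that by blast
  show "\<zero>\<^bsub>B\<^esub> \<in> qtBm K q J" using qtBm_prod[OF B.zero_closed J_closed(1)] by simp
  fix r f assume r: "r \<in> carrier B" and f: "f \<in> qtBm K q J"
  from f show "r \<otimes>\<^bsub>B\<^esub> f \<in> qtBm K q J"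
  proof (induction rule: qtBm_induct)
    case (prod b z)
    then show ?case using r qtBm_prod[of "r \<otimes>\<^bsub>B\<^esub> b" z J] J_center[of z] by (simp add: B.m_assoc)
  next
    case (sum f g)
    then show ?case using r c by (simp add: B.r_distr qtBm_sum)
  qed
  from f show "f \<otimes>\<^bsub>B\<^esub> r \<in> qtBm K q J"
  proof (induction rule: qtBm_induct)
    case (prod b z)
    then show ?case using r qtBm_prod[of "b \<otimes>\<^bsub>B\<^esub> r" z J] J_center[of z] center_comm[of z r] by (simp add: B.m_assoc)
  next
    case (sum f g)
    then show ?case using r c by (simp add: B.l_distr qtBm_sum)
  qed
qed (rule qtBm_sum)

lemma J_sub_qtBm: "z \<in> J \<Longrightarrow> z \<in> qtBm K q J"
  using qtBm_prod[OF B.one_closed, of z J] J_center[of z] by simp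

text \<open>The projection is linear over the centre, so the components of bz are z times those of
  b. For a central element the component at (0, 0) is the element itself, which gives BJ \<inter> Z
  = J in \<open>qtBm_center\<close>.\<close>

lemma qtBm_cmp: "f \<in> qtBm K q J \<Longrightarrow> cmp a b f \<in> J"
proof (induction rule: qtBm_induct)
  case (prod c z)
  note z = J_center[OF prod(2)]
  have "c \<otimes>\<^bsub>B\<^esub> z \<otimes>\<^bsub>B\<^esub> mon \<one> (- a) (- b) = z \<otimes>\<^bsub>B\<^esub> (c \<otimes>\<^bsub>B\<^esub> mon \<one> (- a) (- b))"
    using z prod(1) center_comm[OF z prod(1)] by (simp flip: B.m_assoc)
  then have "cmp a b (c \<otimes>\<^bsub>B\<^esub> z) = E0 (c \<otimes>\<^bsub>B\<^esub> mon \<one> (- a) (- b)) \<otimes>\<^bsub>B\<^esub> z"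
    using z prod(1) by (simp add: cmp_def E0_mult center_comm E0_center)
  then show ?case using J_closed(3)[OF E0_center prod(2)] prod(1) by simp
next
  case (sum f g)
  then have "f \<in> carrier B" "g \<in> carrier B" using ideal.Icarr[OF qtBm_ideal] by auto
  then have "cmp a b (f \<oplus>\<^bsub>B\<^esub> g) = cmp a b f \<oplus>\<^bsub>B\<^esub> cmp a b g" by (simp add: cmp_def B.l_distr E0_add)
  then show ?case using J_closed(2) sum by simp
qed

lemma qtBm_center: "z \<in> qtBm K q J \<Longrightarrow> z \<in> Z \<Longrightarrow> z \<in> J"
  using qtBm_cmp[of z 0 0] by (simp add: cmp_def E0_id flip: B_one)

end

text \<open>The components of f are central projections of multiples of f, so they lie in I by
  \<open>E0_in_ideal\<close>. The decomposition of f over the centre then exhibits f as an element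
  of the ideal generated by I \<inter> Z.\<close>

lemma ideal_contraction:
  assumes "ideal I B" shows "ideal (I \<inter> Z) (qtZ K q)" "I = qtBm K q (I \<inter> Z)"
proof -
  interpret I: ideal I B by fact
  interpret Z: cring "qtZ K q" by (rule qtZ_cring)
  show J: "ideal (I \<inter> Z) (qtZ K q)"
    by (rule Z.ideal_of_closed) (auto simp: center_add center_mult center_zero I.zero_closed I.a_closed I.I_l_closed I.I_r_closed)
  interpret J: ideal "qtBm K q (I \<inter> Z)" B by (rule qtBm_ideal[OF J])
  show "I = qtBm K q (I \<inter> Z)"
  proof (intro equalityI subsetI)
    fix f assume f: "f \<in> I"
    then have fB: "f \<in> carrier B" by (rule I.a_Hcarr)
    have "cmp a b f \<in> I \<inter> Z" for a b
      using cmp_center[OF fB] E0_in_ideal[OF assms I.I_r_closed[OF f]] by (simp add: cmp_def)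
    then have "cmp a b f \<otimes>\<^bsub>B\<^esub> g \<in> qtBm K q (I \<inter> Z)" if "g \<in> carrier B" for a b g
      using J.I_r_closed[OF J_sub_qtBm[OF J] that] by blast
    then show "f \<in> qtBm K q (I \<inter> Z)"
      by (subst cmp_decomposition[OF fB]) (intro J.finsum_mem, auto)
  next
    fix f assume "f \<in> qtBm K q (I \<inter> Z)"
    then show "f \<in> I"
      by (induction rule: qtBm_induct) (auto intro: I.I_l_closed I.a_closed)
  qed
qed

lemma qtBm_maximal:
  assumes m: "maximalideal m (qtZ K q)" shows "maximalideal (qtBm K q m) B"
proof -
  interpret m: maximalideal m "qtZ K q" by fact
  note mi = m.ideal_axioms
  interpret Bm: ideal "qtBm K q m" B by (rule qtBm_ideal[OF mi])
  show ?thesis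
  proof (rule maximalidealI[OF Bm.ideal_axioms])
    show "carrier B \<noteq> qtBm K q m"
    proof
      assume "carrier B = qtBm K q m"
      then have "\<one>\<^bsub>B\<^esub> \<in> m" using qtBm_center[OF mi _ center_one] B.one_closed by blast
      then show False using m.one_imp_carrier m.I_notcarr by simp
    qed
    fix J assume J: "ideal J B" "qtBm K q m \<subseteq> J" "J \<subseteq> carrier B"
    note c = ideal_contraction[OF J(1)]
    have "m \<subseteq> J \<inter> Z" using J(2) J_sub_qtBm[OF mi] J_center[OF mi] by blast
    then have "J \<inter> Z = m \<or> J \<inter> Z = Z" using m.I_maximal[OF c(1)] by simp
    then show "J = qtBm K q m \<or> J = carrier B"
    proof
      assume "J \<inter> Z = Z"
      then have "\<one>\<^bsub>B\<^esub> \<in> J" using center_one by blast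
      then show ?thesis using ideal.one_imp_carrier[OF J(1)] by simp
    qed (use c(2) in simp)
  qed
qed

lemma maximal_contraction:
  assumes I: "maximalideal I B" shows "maximalideal (I \<inter> Z) (qtZ K q)" "I = qtBm K q (I \<inter> Z)"
proof -
  interpret I: maximalideal I B by fact
  note c = ideal_contraction[OF I.ideal_axioms]
  show "I = qtBm K q (I \<inter> Z)" by (rule c(2))
  show "maximalideal (I \<inter> Z) (qtZ K q)"
  proof (rule maximalidealI[OF c(1)])
    show "carrier (qtZ K q) \<noteq> I \<inter> Z"
      using I.one_imp_carrier I.I_notcarr center_one by auto
    fix J assume J: "ideal J (qtZ K q)" "I \<inter> Z \<subseteq> J" "J \<subseteq> carrier (qtZ K q)"
    note BJ = qtBm_ideal[OF J(1)]
    have "I \<subseteq> qtBm K q J"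
    proof
      fix f assume "f \<in> I"
      then have "f \<in> qtBm K q (I \<inter> Z)" using c(2) by simp
      then show "f \<in> qtBm K q J" by (induction rule: qtBm_induct) (use J(2) in \<open>auto intro: qtBm_prod qtBm_sum\<close>)
    qed
    then have "qtBm K q J = I \<or> qtBm K q J = carrier B"
      using I.I_maximal[OF BJ] ideal.Icarr[OF BJ] by blast
    then show "J = I \<inter> Z \<or> J = carrier (qtZ K q)"
      using J_sub_qtBm[OF J(1)] J_center[OF J(1)] qtBm_center[OF J(1)] J(2) by auto
  qed
qed

lemma MaxIdeals_qt: "MaxIdeals B = qtBm K q ` MaxIdeals (qtZ K q)"
  using qtBm_maximal maximal_contraction unfolding MaxIdeals_def by blast

lemma qtBm_inj: "inj_on (qtBm K q) (MaxIdeals (qtZ K q))"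
proof (rule inj_onI)
  fix m m' assume mm: "m \<in> MaxIdeals (qtZ K q)" "m' \<in> MaxIdeals (qtZ K q)" "qtBm K q m = qtBm K q m'"
  have eq: "J = qtBm K q J \<inter> Z" if "J \<in> MaxIdeals (qtZ K q)" for J
  proof -
    have J: "ideal J (qtZ K q)" using that unfolding MaxIdeals_def by (auto intro: maximalideal.axioms)
    show ?thesis using J_sub_qtBm[OF J] J_center[OF J] qtBm_center[OF J] by blast
  qed
  show "m = m'" using eq[OF mm(1)] eq[OF mm(2)] mm(3) by simp
qed

end

section \<open>The factor algebras at maximal ideals of the centre\<close>

locale qtmax = qtorus K q n for K :: "('a, 'z) ring_scheme" (structure) and q n +
  fixes m :: "'a qt set"
  assumes m: "maximalideal m (qtZ K q)"
begin

abbreviation "k \<equiv> residue_field K q m"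
abbreviation "A \<equiv> qt_factor K q m"
abbreviation "\<phi> \<equiv> factor_scalar K q m"
abbreviation "res \<equiv> residue K q m"
abbreviation "proj \<equiv> qt_proj K q m"

lemma m_ideal: "ideal m (qtZ K q)" using m by (rule maximalideal.axioms)

sublocale k: field k
  unfolding residue_field_def by (rule maximalideal.quotient_is_field[OF m qtZ_cring])

sublocale Bm: ideal "qtBm K q m" B by (rule qtBm_ideal[OF m_ideal])

sublocale A: ring A unfolding qt_factor_def by (rule Bm.quotient_is_ring)

lemma res_hom: "res \<in> ring_hom (qtZ K q) k"
proof -
  have "res = (+>\<^bsub>qtZ K q\<^esub>) m" by (auto simp: residue_def)
  then show ?thesis unfolding residue_field_def using ideal.rcos_ring_hom[OF m_ideal] by simp
qed

lemma proj_hom: "proj \<in> ring_hom B A"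
proof -
  have "proj = (+>\<^bsub>B\<^esub>) (qtBm K q m)" by (auto simp: qt_proj_def)
  then show ?thesis unfolding qt_factor_def using Bm.rcos_ring_hom by simp
qed

lemma res_simps [simp]: "z \<in> Z \<Longrightarrow> res z \<in> carrier k" "y \<in> Z \<Longrightarrow> z \<in> Z \<Longrightarrow> res (y \<oplus>\<^bsub>B\<^esub> z) = res y \<oplus>\<^bsub>k\<^esub> res z"
  "y \<in> Z \<Longrightarrow> z \<in> Z \<Longrightarrow> res (y \<otimes>\<^bsub>B\<^esub> z) = res y \<otimes>\<^bsub>k\<^esub> res z" "res \<one>\<^bsub>B\<^esub> = \<one>\<^bsub>k\<^esub>"
  using ring_hom_closed[OF res_hom] ring_hom_add[OF res_hom] ring_hom_mult[OF res_hom] ring_hom_one[OF res_hom] by auto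

lemma proj_simps [simp]: "f \<in> carrier B \<Longrightarrow> proj f \<in> carrier A"
  "f \<in> carrier B \<Longrightarrow> g \<in> carrier B \<Longrightarrow> proj (f \<oplus>\<^bsub>B\<^esub> g) = proj f \<oplus>\<^bsub>A\<^esub> proj g"
  "f \<in> carrier B \<Longrightarrow> g \<in> carrier B \<Longrightarrow> proj (f \<otimes>\<^bsub>B\<^esub> g) = proj f \<otimes>\<^bsub>A\<^esub> proj g" "proj \<one>\<^bsub>B\<^esub> = \<one>\<^bsub>A\<^esub>"
  using ring_hom_closed[OF proj_hom] ring_hom_add[OF proj_hom] ring_hom_mult[OF proj_hom] ring_hom_one[OF proj_hom] by auto

lemma res_zero_iff: "z \<in> Z \<Longrightarrow> res z = \<zero>\<^bsub>k\<^esub> \<longleftrightarrow> z \<in> m"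
  using ideal.quot_zero_iff[OF m_ideal] by (simp add: residue_def residue_field_def)

lemma proj_zero_iff: "f \<in> carrier B \<Longrightarrow> proj f = \<zero>\<^bsub>A\<^esub> \<longleftrightarrow> f \<in> qtBm K q m"
  using Bm.quot_zero_iff by (simp add: qt_proj_def qt_factor_def)

lemma res_surj: "c \<in> carrier k \<Longrightarrow> \<exists>z\<in>Z. c = res z"
  unfolding residue_field_def residue_def by (elim quot_surj) auto

lemma proj_surj: "y \<in> carrier A \<Longrightarrow> \<exists>f\<in>carrier B. y = proj f"
  unfolding qt_factor_def qt_proj_def by (elim quot_surj) auto

lemma proj_image: "proj ` carrier B = carrier A"
  using proj_surj by auto

text \<open>\<open>factor_scalar\<close> is a sum of subsets of B. Since m lies in Bm, adding the
  coset m + z to Bm gives the same set as adding z alone.\<close>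

lemma \<phi>_res: assumes z: "z \<in> Z" shows "\<phi> (res z) = proj z"
proof -
  have zB: "z \<in> carrier B" using z by simp
  have "x \<in> qtBm K q m \<Longrightarrow> y \<in> m \<Longrightarrow> \<exists>h\<in>qtBm K q m. x \<oplus>\<^bsub>B\<^esub> (y \<oplus>\<^bsub>B\<^esub> z) = h \<oplus>\<^bsub>B\<^esub> z" for x y
    using J_sub_qtBm[OF m_ideal, of y] Bm.a_Hcarr zB
    by (intro bexI[of _ "x \<oplus>\<^bsub>B\<^esub> y"]) (auto simp: B.a_assoc Bm.a_closed)
  moreover have "\<exists>x\<in>qtBm K q m. \<exists>y\<in>m. h \<oplus>\<^bsub>B\<^esub> z = x \<oplus>\<^bsub>B\<^esub> (y \<oplus>\<^bsub>B\<^esub> z)" if "h \<in> qtBm K q m" for h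
    using J_closed(1)[OF m_ideal] that zB by (intro bexI[of _ h] bexI[of _ "\<zero>\<^bsub>B\<^esub>"]) auto
  ultimately show ?thesis
    by (auto simp: factor_scalar_def residue_def qt_proj_def set_add_def' a_r_coset_def')
qed

sublocale A: falgebra k A \<phi>
proof
  show "\<phi> \<in> ring_hom k A"
  proof (rule ring_hom_memI)
    fix c assume "c \<in> carrier k"
    then obtain y where y: "y \<in> Z" "c = res y" using res_surj by blast
    then show "\<phi> c \<in> carrier A" by (simp add: \<phi>_res)
    fix d assume "d \<in> carrier k"
    then obtain z where z: "z \<in> Z" "d = res z" using res_surj by blast
    show "\<phi> (c \<otimes>\<^bsub>k\<^esub> d) = \<phi> c \<otimes>\<^bsub>A\<^esub> \<phi> d"
      using y z center_mult by (simp add: \<phi>_res flip: res_simps(3))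
    show "\<phi> (c \<oplus>\<^bsub>k\<^esub> d) = \<phi> c \<oplus>\<^bsub>A\<^esub> \<phi> d"
      using y z center_add by (simp add: \<phi>_res flip: res_simps(2))
  next
    show "\<phi> \<one>\<^bsub>k\<^esub> = \<one>\<^bsub>A\<^esub>" using \<phi>_res[OF center_one] by simp
  qed
  fix c a assume "c \<in> carrier k" "a \<in> carrier A"
  then obtain z f where "z \<in> Z" "c = res z" "f \<in> carrier B" "a = proj f" using res_surj proj_surj by meson
  then show "\<phi> c \<otimes>\<^bsub>A\<^esub> a = a \<otimes>\<^bsub>A\<^esub> \<phi> c"
    by (simp add: \<phi>_res center_comm flip: proj_simps(3))
qed

definition bas :: "nat \<times> nat \<Rightarrow> 'a qt set" where
  "bas p = proj (mon \<one> (int (fst p)) (int (snd p)))"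

lemma bas_closed: "bas \<in> I2 \<rightarrow> carrier A"
  by (auto simp: bas_def)

text \<open>The decomposition over the centre, reduced modulo m. The power q^(ab) is a central
  scalar and is absorbed into the coefficient.\<close>

lemma A_span: "lspan k A \<phi> I2 bas = carrier A"
proof (intro equalityI subsetI)
  fix y assume "y \<in> lspan k A \<phi> I2 bas"
  then show "y \<in> carrier A" using A.lspan_closed[OF _ bas_closed] by simp
next
  fix y assume "y \<in> carrier A"
  then obtain f where f: "f \<in> carrier B" "y = proj f" using proj_surj by blast
  define c where "c p = res (cmp (int (fst p)) (int (snd p)) f \<otimes>\<^bsub>B\<^esub> mon (qp (int (fst p) * int (snd p))) 0 0)" for p
  have zc: "cmp a b f \<otimes>\<^bsub>B\<^esub> mon (qp (a * b)) 0 0 \<in> Z" for a b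
    using cmp_center[OF f(1)] by (intro center_mult mon_center) auto
  have "y = (\<Oplus>\<^bsub>A\<^esub>p\<in>I2. proj (cmp (int (fst p)) (int (snd p)) f \<otimes>\<^bsub>B\<^esub> mon (qp (int (fst p) * int (snd p))) (int (fst p)) (int (snd p))))"
    unfolding f(2) using cmp_center[OF f(1)]
    by (subst cmp_decomposition[OF f(1)], subst ring_hom_finsum[OF B.ring_axioms A.ring_axioms proj_hom]) auto
  also have "\<dots> = lincomb A \<phi> I2 bas c"
    unfolding lincomb_def
  proof (rule A.finsum_cong')
    fix p
    let ?a = "int (fst p)" and ?b = "int (snd p)"
    have "cmp ?a ?b f \<otimes>\<^bsub>B\<^esub> mon (qp (?a * ?b)) ?a ?b = (cmp ?a ?b f \<otimes>\<^bsub>B\<^esub> mon (qp (?a * ?b)) 0 0) \<otimes>\<^bsub>B\<^esub> mon \<one> ?a ?b"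
      using cmp_center[OF f(1)] by (simp add: B.m_assoc mon_mult)
    then have "proj (cmp ?a ?b f \<otimes>\<^bsub>B\<^esub> mon (qp (?a * ?b)) ?a ?b) = proj (cmp ?a ?b f \<otimes>\<^bsub>B\<^esub> mon (qp (?a * ?b)) 0 0) \<otimes>\<^bsub>A\<^esub> proj (mon \<one> ?a ?b)"
      using zc[of ?a ?b] by simp
    then show "proj (cmp ?a ?b f \<otimes>\<^bsub>B\<^esub> mon (qp (?a * ?b)) ?a ?b) = \<phi> (c p) \<otimes>\<^bsub>A\<^esub> bas p"
      by (simp add: c_def bas_def \<phi>_res[OF zc])
  qed (use zc in \<open>auto simp: c_def bas_def intro!: A.m_closed A.\<phi>_simps\<close>)
  finally show "y \<in> lspan k A \<phi> I2 bas" using zc by (auto simp: c_def intro!: A.lspanI)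
qed

text \<open>Numbers below n are congruent modulo n only if equal, so exactly the term at r survives
  the projection. The remaining scalar stems from h^a x^b h^(-a) x^(-b) = q^(-ab).\<close>

lemma cmp_finsum:
  assumes "\<And>p. p \<in> I2 \<Longrightarrow> z p \<in> Z" "r \<in> I2"
  shows "cmp (int (fst r)) (int (snd r)) (\<Oplus>\<^bsub>B\<^esub>p\<in>I2. z p \<otimes>\<^bsub>B\<^esub> mon \<one> (int (fst p)) (int (snd p)))
    = z r \<otimes>\<^bsub>B\<^esub> mon (qp (- int (fst r) * int (snd r))) 0 0"
proof -
  let ?a = "int (fst r)" and ?b = "int (snd r)"
  have "cmp ?a ?b (\<Oplus>\<^bsub>B\<^esub>p\<in>I2. z p \<otimes>\<^bsub>B\<^esub> mon \<one> (int (fst p)) (int (snd p))) =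
    (\<Oplus>\<^bsub>B\<^esub>p\<in>I2. cmp ?a ?b (z p \<otimes>\<^bsub>B\<^esub> mon \<one> (int (fst p)) (int (snd p))))"
    by (rule additive_finsum[OF B.abelian_monoid_axioms B.abelian_monoid_axioms])
      (use assms in \<open>auto simp: cmp_def E0_zero B.l_distr E0_add intro!: center_closed[OF E0_center]\<close>)
  also have "\<dots> = (\<Oplus>\<^bsub>B\<^esub>p\<in>I2. if p = r then z p \<otimes>\<^bsub>B\<^esub> mon (qp (- ?a * ?b)) 0 0 else \<zero>\<^bsub>B\<^esub>)"
  proof (rule B.finsum_cong')
    fix p assume p: "p \<in> I2"
    let ?i = "int (fst p)" and ?j = "int (snd p)"
    have "cmp ?a ?b (z p \<otimes>\<^bsub>B\<^esub> mon \<one> ?i ?j) = z p \<otimes>\<^bsub>B\<^esub> E0 (mon (qp (- ?a * ?j)) (?i - ?a) (?j - ?b))"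
      using assms(1)[OF p] by (simp add: cmp_def B.m_assoc mon_mult E0_mult)
    moreover have "int n dvd (?i - ?a) \<and> int n dvd (?j - ?b) \<longleftrightarrow> p = r"
    proof -
      have md: "int n dvd (int i - int a) \<longleftrightarrow> i = a" if "i < n" "a < n" for i a
        using that by (simp flip: mod_eq_dvd_iff)
      show ?thesis using p assms(2) md by (auto simp: prod_eq_iff)
    qed
    ultimately show "cmp ?a ?b (z p \<otimes>\<^bsub>B\<^esub> mon \<one> ?i ?j) = (if p = r then z p \<otimes>\<^bsub>B\<^esub> mon (qp (- ?a * ?b)) 0 0 else \<zero>\<^bsub>B\<^esub>)"
      using assms(1)[OF p] by (auto simp: E0_mon)
  qed (use assms in auto)
  also have "\<dots> = z r \<otimes>\<^bsub>B\<^esub> mon (qp (- ?a * ?b)) 0 0"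
    using assms by (intro B.add.finprod_singleton_swap) auto
  finally show ?thesis .
qed

text \<open>Lifting the coefficients to the centre turns a relation in B/Bm into an element of Bm,
  whose components lie in m by \<open>qtBm_cmp\<close>. Up to a power of q, a unit, these components
  are the lifts, so the coefficients vanish in k(m).\<close>

lemma A_indep: "lindep k A \<phi> I2 bas"
  unfolding lindep_def
proof (intro allI impI ballI)
  fix c r assume c: "c \<in> I2 \<rightarrow> carrier k" and 0: "lincomb A \<phi> I2 bas c = \<zero>\<^bsub>A\<^esub>" and r: "r \<in> I2"
  have "\<forall>p\<in>I2. \<exists>z. z \<in> Z \<and> c p = res z" using c res_surj by blast
  then obtain z where z: "\<And>p. p \<in> I2 \<Longrightarrow> z p \<in> Z" "\<And>p. p \<in> I2 \<Longrightarrow> c p = res (z p)" by metis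
  let ?f = "\<Oplus>\<^bsub>B\<^esub>p\<in>I2. z p \<otimes>\<^bsub>B\<^esub> mon \<one> (int (fst p)) (int (snd p))"
  have fB: "?f \<in> carrier B" using z(1) by (intro B.finsum_closed) auto
  have "proj ?f = (\<Oplus>\<^bsub>A\<^esub>p\<in>I2. proj (z p \<otimes>\<^bsub>B\<^esub> mon \<one> (int (fst p)) (int (snd p))))"
    using z(1) by (intro ring_hom_finsum[OF B.ring_axioms A.ring_axioms proj_hom]) auto
  also have "\<dots> = lincomb A \<phi> I2 bas c" unfolding lincomb_def
    using z c bas_closed by (intro A.finsum_cong') (auto simp: bas_def \<phi>_res Pi_iff)
  finally have "?f \<in> qtBm K q m" using proj_zero_iff[OF fB] 0 by simp
  then have "cmp (int (fst r)) (int (snd r)) ?f \<in> m" by (rule qtBm_cmp[OF m_ideal])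
  then have zr: "z r \<otimes>\<^bsub>B\<^esub> mon (qp (- int (fst r) * int (snd r))) 0 0 \<in> m" using cmp_finsum[of z r] z(1) r by simp
  have "mon (qp (int (fst r) * int (snd r))) 0 0 \<otimes>\<^bsub>B\<^esub> (z r \<otimes>\<^bsub>B\<^esub> mon (qp (- int (fst r) * int (snd r))) 0 0) \<in> m"
    by (rule J_closed(3)[OF m_ideal mon_center zr]) auto
  also have "mon (qp (int (fst r) * int (snd r))) 0 0 \<otimes>\<^bsub>B\<^esub> (z r \<otimes>\<^bsub>B\<^esub> mon (qp (- int (fst r) * int (snd r))) 0 0)
     = z r \<otimes>\<^bsub>B\<^esub> (mon (qp (int (fst r) * int (snd r))) 0 0 \<otimes>\<^bsub>B\<^esub> mon (qp (- int (fst r) * int (snd r))) 0 0)"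
    using z(1)[OF r] center_comm[OF z(1)[OF r], of "mon (qp (int (fst r) * int (snd r))) 0 0"] by (simp flip: B.m_assoc)
  also have "\<dots> = z r" using z(1)[OF r] by (simp add: mon_mult flip: B_one)
  finally show "c r = \<zero>\<^bsub>k\<^esub>" using res_zero_iff z r by simp
qed

lemma mon_h_pow: "mon \<one> 1 0 [^]\<^bsub>B\<^esub> i = mon \<one> (int i) 0" and mon_x_pow: "mon \<one> 0 1 [^]\<^bsub>B\<^esub> i = mon \<one> 0 (int i)" for i :: nat
  by (induction i) (simp_all add: B_one mon_mult algebra_simps)

abbreviation "hA \<equiv> proj (qt_h K)"
abbreviation "xA \<equiv> proj (qt_x K)"

lemma h_pow: "hA [^]\<^bsub>A\<^esub> i = proj (mon \<one> (int i) 0)" and x_pow: "xA [^]\<^bsub>A\<^esub> i = proj (mon \<one> 0 (int i))" for i :: nat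
  by (simp_all add: B_h B_x flip: ring_hom_pow[OF B.ring_axioms A.ring_axioms proj_hom] mon_h_pow mon_x_pow)

lemma bas_hx: "bas p = hA [^]\<^bsub>A\<^esub> fst p \<otimes>\<^bsub>A\<^esub> xA [^]\<^bsub>A\<^esub> snd p"
  by (simp add: bas_def h_pow x_pow mon_mult flip: proj_simps(3))

lemma s_eq: "residue_s K q n m = res (mon \<one> (int n) 0)" and t_eq: "residue_t K q n m = res (mon \<one> 0 (int n))"
  and q_eq: "residue_q K q m = res (mon q 0 0)"
  by (simp_all add: B_h B_x B_scalar mon_h_pow mon_x_pow)

lemma A_simple: "simple_ring A"
  unfolding qt_factor_def by (rule maximalideal_quot_simple[OF qtBm_maximal[OF m]])

lemma A_artinian: "left_artinian A"
  by (rule A.spanned_left_artinian[OF _ bas_closed A_span]) auto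

section \<open>The centre of the factor algebra\<close>

definition \<kappa> :: "'a \<Rightarrow> 'a qt set" where "\<kappa> c = res (mon c 0 0)"

lemma \<kappa>_hom: "\<kappa> \<in> ring_hom K k"
proof (rule ring_hom_memI)
  show "\<kappa> \<one> = \<one>\<^bsub>k\<^esub>" by (simp add: \<kappa>_def flip: B_one)
  fix c d assume "c \<in> carrier K" "d \<in> carrier K"
  then show "\<kappa> (c \<otimes> d) = \<kappa> c \<otimes>\<^bsub>k\<^esub> \<kappa> d" "\<kappa> (c \<oplus> d) = \<kappa> c \<oplus>\<^bsub>k\<^esub> \<kappa> d"
    by (simp_all add: \<kappa>_def mon_center mon_mult mon_add flip: res_simps)
qed (simp add: \<kappa>_def mon_center)

lemma \<kappa>_nonzero: assumes "c \<in> carrier K" "c \<noteq> \<zero>" shows "\<kappa> c \<noteq> \<zero>\<^bsub>k\<^esub>"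
proof
  assume 0: "\<kappa> c = \<zero>\<^bsub>k\<^esub>"
  have c: "inv c \<in> carrier K" "inv c \<otimes> c = \<one>" using assms field_Units by auto
  then have "\<kappa> (inv c) \<otimes>\<^bsub>k\<^esub> \<kappa> c = \<one>\<^bsub>k\<^esub>"
    using assms(1) ring_hom_mult[OF \<kappa>_hom, of "inv c" c] ring_hom_one[OF \<kappa>_hom] by simp
  then show False using 0 c ring_hom_closed[OF \<kappa>_hom, of "inv c"] k.one_not_zero by simp
qed

text \<open>A homomorphism of fields is injective, so q keeps its order n in k(m).\<close>

lemma \<kappa>_eq_one: assumes "c \<in> carrier K" "\<kappa> c = \<one>\<^bsub>k\<^esub>" shows "c = \<one>"
proof -
  interpret \<kappa>: ring_hom_ring K k \<kappa> by (rule ring_hom_ringI2[OF ring_axioms k.ring_axioms \<kappa>_hom])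
  have "\<kappa> (c \<oplus> \<ominus> \<one>) = \<zero>\<^bsub>k\<^esub>" using assms by (simp add: k.r_neg)
  then have "c \<oplus> \<ominus> \<one> = \<zero>" using \<kappa>_nonzero[of "c \<oplus> \<ominus> \<one>"] assms(1) by auto
  then show ?thesis using assms(1) by (metis a_inv_closed minus_equality minus_minus one_closed)
qed

text \<open>g stands for h or x, which commutes with each monomial up to a power of q. Cancelling g
  from gy = yg by means of g' and comparing coefficients in the basis gives c_p q^e = c_p in k(m),
  so q^e = 1 wherever c_p is nonzero.\<close>

lemma central_coeff:
  assumes y: "y \<in> ring_center A" "c \<in> I2 \<rightarrow> carrier k" "y = lincomb A \<phi> I2 bas c"
    and g: "g \<in> carrier B" "g' \<in> carrier B" "g' \<otimes>\<^bsub>B\<^esub> g = \<one>\<^bsub>B\<^esub>"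
    and comm: "\<And>i j. mon \<one> i j \<otimes>\<^bsub>B\<^esub> g = mon (qp (e i j)) 0 0 \<otimes>\<^bsub>B\<^esub> g \<otimes>\<^bsub>B\<^esub> mon \<one> i j"
    and p: "p \<in> I2" "c p \<noteq> \<zero>\<^bsub>k\<^esub>"
  shows "int n dvd e (int (fst p)) (int (snd p))"
proof -
  let ?e = "\<lambda>p. qp (e (int (fst p)) (int (snd p)))"
  have g1: "proj g' \<otimes>\<^bsub>A\<^esub> proj g = \<one>\<^bsub>A\<^esub>" using g by (simp flip: proj_simps(3))
  have yc: "y \<in> carrier A" and ycomm: "proj g \<otimes>\<^bsub>A\<^esub> y = y \<otimes>\<^bsub>A\<^esub> proj g"
    using y(1) g(1) proj_simps(1) unfolding ring_center_def by (blast, fastforce)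
  have \<kappa>c: "\<kappa> (?e p) \<in> carrier k" for p using ring_hom_closed[OF \<kappa>_hom] by simp
  have d: "(\<lambda>p. c p \<otimes>\<^bsub>k\<^esub> \<kappa> (?e p)) \<in> I2 \<rightarrow> carrier k" using y(2) \<kappa>c by auto
  have "y \<otimes>\<^bsub>A\<^esub> proj g = (\<Oplus>\<^bsub>A\<^esub>p\<in>I2. \<phi> (c p) \<otimes>\<^bsub>A\<^esub> bas p \<otimes>\<^bsub>A\<^esub> proj g)"
    unfolding y(3) lincomb_def using y(2) bas_closed g(1) by (intro A.finsum_ldistr) (auto simp: Pi_iff)
  also have "\<dots> = lincomb A \<phi> I2 (\<lambda>p. proj g \<otimes>\<^bsub>A\<^esub> bas p) (\<lambda>p. c p \<otimes>\<^bsub>k\<^esub> \<kappa> (?e p))"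
    unfolding lincomb_def
  proof (rule A.finsum_cong')
    fix p assume p: "p \<in> I2"
    have "bas p \<otimes>\<^bsub>A\<^esub> proj g = proj (mon (?e p) 0 0) \<otimes>\<^bsub>A\<^esub> proj g \<otimes>\<^bsub>A\<^esub> bas p"
      using g(1) by (simp add: bas_def comm flip: proj_simps(3))
    moreover have "proj (mon (?e p) 0 0) = \<phi> (\<kappa> (?e p))" by (simp add: \<kappa>_def \<phi>_res mon_center)
    ultimately show "\<phi> (c p) \<otimes>\<^bsub>A\<^esub> bas p \<otimes>\<^bsub>A\<^esub> proj g = \<phi> (c p \<otimes>\<^bsub>k\<^esub> \<kappa> (?e p)) \<otimes>\<^bsub>A\<^esub> (proj g \<otimes>\<^bsub>A\<^esub> bas p)"
      using y(2) p \<kappa>c bas_closed g(1) by (auto simp: A.\<phi>_mult A.m_assoc Pi_iff)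
  qed (use d bas_closed g(1) in \<open>auto simp: Pi_iff\<close>)
  also have "\<dots> = proj g \<otimes>\<^bsub>A\<^esub> lincomb A \<phi> I2 bas (\<lambda>p. c p \<otimes>\<^bsub>k\<^esub> \<kappa> (?e p))"
    using d bas_closed g(1) by (intro A.lincomb_mult_left[symmetric]) auto
  finally have "proj g' \<otimes>\<^bsub>A\<^esub> (proj g \<otimes>\<^bsub>A\<^esub> y) = proj g' \<otimes>\<^bsub>A\<^esub> (proj g \<otimes>\<^bsub>A\<^esub> lincomb A \<phi> I2 bas (\<lambda>p. c p \<otimes>\<^bsub>k\<^esub> \<kappa> (?e p)))"
    using ycomm by simp
  then have "y = lincomb A \<phi> I2 bas (\<lambda>p. c p \<otimes>\<^bsub>k\<^esub> \<kappa> (?e p))"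
    using g1 g yc A.lincomb_closed[OF bas_closed d] by (simp flip: A.m_assoc)
  then have "c p = c p \<otimes>\<^bsub>k\<^esub> \<kappa> (?e p)"
    using A.lindep_eq[OF _ bas_closed A_indep y(2) d _ p(1)] y(3) by simp
  moreover have cp: "c p \<in> carrier k" using y(2) p(1) by blast
  ultimately have "c p \<otimes>\<^bsub>k\<^esub> \<kappa> (?e p) = c p \<otimes>\<^bsub>k\<^esub> \<one>\<^bsub>k\<^esub>" by simp
  then have "\<kappa> (?e p) = \<one>\<^bsub>k\<^esub>" using k.m_lcancel[OF p(2) cp \<kappa>c k.one_closed] by simp
  then have "?e p = \<one>" by (rule \<kappa>_eq_one[OF qp_closed])
  then show ?thesis by (simp add: qp_eq_one)
qed

lemma A_center: "\<phi> ` carrier k = ring_center A"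
proof (intro equalityI subsetI)
  fix y assume "y \<in> \<phi> ` carrier k"
  then show "y \<in> ring_center A" unfolding ring_center_def using A.\<phi>_simps(1) A.\<phi>_central by blast
next
  fix y assume y: "y \<in> ring_center A"
  then have "y \<in> lspan k A \<phi> I2 bas" unfolding A_span ring_center_def by blast
  then obtain c where c: "c \<in> I2 \<rightarrow> carrier k" "y = lincomb A \<phi> I2 bas c" by (auto simp: lspan_def)
  have h: "int n dvd int (snd p)" if "p \<in> I2" "c p \<noteq> \<zero>\<^bsub>k\<^esub>" for p
    by (rule central_coeff[OF y c _ _ _ _ that, where g = "mon \<one> 1 0" and g' = "mon \<one> (- 1) 0"])
      (auto simp: mon_mult B_one add.commute)
  have x: "int n dvd - int (fst p)" if "p \<in> I2" "c p \<noteq> \<zero>\<^bsub>k\<^esub>" for p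
    by (rule central_coeff[OF y c _ _ _ _ that, where g = "mon \<one> 0 1" and g' = "mon \<one> 0 (- 1)"])
      (auto simp: mon_mult B_one add.commute)
  have c0: "c p = \<zero>\<^bsub>k\<^esub>" if "p \<in> I2" "p \<noteq> (0, 0)" for p
  proof (rule ccontr)
    assume "c p \<noteq> \<zero>\<^bsub>k\<^esub>"
    then have "n dvd snd p" "n dvd fst p" using h[OF that(1)] x[OF that(1)] by auto
    then show False using that by (auto dest!: dvd_imp_le simp: prod_eq_iff)
  qed
  have z: "(0, 0) \<in> I2" by simp
  have "y = lincomb A \<phi> I2 bas (\<lambda>p. if p = (0, 0) then c (0, 0) else \<zero>\<^bsub>k\<^esub>)"
    unfolding c(2) using c(1) c0 bas_closed by (intro A.lincomb_cong) auto
  also have "\<dots> = \<phi> (c (0, 0)) \<otimes>\<^bsub>A\<^esub> bas (0, 0)"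
    using c(1) bas_closed z by (intro A.lincomb_single) auto
  also have "bas (0, 0) = \<one>\<^bsub>A\<^esub>" by (simp add: bas_def flip: B_one)
  finally have "y = \<phi> (c (0, 0))" using c(1) z by (simp add: Pi_iff)
  then show "y \<in> \<phi> ` carrier k" using c(1) z by blast
qed

lemma A_central_simple: "central_simple_algebra k \<phi> A (n\<^sup>2)"
  unfolding central_simple_algebra_def
  using k.field_axioms A_simple A.\<phi>_hom A_center A.lspan_dimension[OF _ bas_closed A_indep] A_span
  by (simp add: power2_eq_square)

lemma A_basis:
  assumes "y \<in> carrier A"
  shows "\<exists>!c. c \<in> I2 \<rightarrow>\<^sub>E carrier k \<and> y = (\<Oplus>\<^bsub>A\<^esub>p\<in>I2. \<phi> (c p) \<otimes>\<^bsub>A\<^esub> (hA [^]\<^bsub>A\<^esub> fst p \<otimes>\<^bsub>A\<^esub> xA [^]\<^bsub>A\<^esub> snd p))"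
  using A.basis_unique[OF _ bas_closed A_indep, of y] assms A_span unfolding lincomb_def by (simp add: bas_hx)

end

section \<open>Presentations of the factor algebra\<close>

text \<open>Left multiplication by h or x sends each h^i x^j to a scalar multiple of another one: x
  passes h^i at the cost of Q^i, and an exponent that reaches n folds back through h^n = s or x^n =
  t. An algebra generated by such h and x is therefore spanned by n^2 monomials.\<close>

lemma (in falgebra) cyclic_lspan:
  fixes n :: nat
  assumes hx: "h \<in> carrier A" "x \<in> carrier A" and c: "Q \<in> carrier F" "s \<in> carrier F" "t \<in> carrier F" and n: "0 < n"
    and rel: "x \<otimes> h = \<phi> Q \<otimes> (h \<otimes> x)" "h [^] n = \<phi> s" "x [^] n = \<phi> t"
  defines "V \<equiv> lspan F A \<phi> ({..<n} \<times> {..<n}) (\<lambda>p. h [^] fst p \<otimes> x [^] snd p)"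
  shows "y \<in> V \<Longrightarrow> h \<otimes> y \<in> V" "y \<in> V \<Longrightarrow> x \<otimes> y \<in> V" "\<one> \<in> V"
proof -
  let ?I = "{..<n} \<times> {..<n}" and ?b = "\<lambda>p. h [^] fst p \<otimes> x [^] snd p"
  have b: "?b \<in> ?I \<rightarrow> carrier A" using hx by auto
  have base: "h [^] i \<otimes> x [^] j \<in> V" if "i < n" "j < n" for i j
    using lspan_base[OF _ b, of "(i, j)"] that by (simp add: V_def)
  have smult: "\<phi> r \<otimes> y \<in> V" if "r \<in> carrier F" "y \<in> V" for r y
    using lspan_smult[OF _ b _ that(1)] that(2) by (simp add: V_def)
  show "\<one> \<in> V" using base[of 0 0] n by simp
  show "h \<otimes> y \<in> V" if "y \<in> V" unfolding V_def
  proof (rule lspan_mult_left[OF _ b hx(1)])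
    fix p assume "p \<in> ?I"
    then obtain i j where p: "p = (i, j)" "i < n" "j < n" by auto
    have "h \<otimes> ?b p = (h \<otimes> h [^] i) \<otimes> x [^] j" using hx by (simp add: p m_assoc)
    then have eq: "h \<otimes> ?b p = h [^] Suc i \<otimes> x [^] j" using nat_pow_Suc2[OF hx(1), of i] by simp
    show "h \<otimes> ?b p \<in> lspan F A \<phi> ?I ?b"
    proof (cases "Suc i < n")
      case True
      then show ?thesis unfolding eq using base[of "Suc i" j] p by (simp add: V_def)
    next
      case False
      then have "Suc i = n" using p by simp
      then show ?thesis unfolding eq using smult[OF c(2) base[of 0 j]] p n rel(2) hx by (simp add: V_def)
    qed
  qed (use that V_def in auto)
  have xh: "x \<otimes> h [^] i = \<phi> (Q [^]\<^bsub>F\<^esub> i) \<otimes> (h [^] i \<otimes> x)" for i :: nat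
  proof (induction i)
    case 0
    then show ?case using hx by simp
  next
    case (Suc i)
    have "x \<otimes> h [^] Suc i = (x \<otimes> h [^] i) \<otimes> h" using hx by (simp add: m_assoc)
    also have "\<dots> = \<phi> (Q [^]\<^bsub>F\<^esub> i) \<otimes> (h [^] i \<otimes> (x \<otimes> h))" unfolding Suc using hx c by (simp add: m_assoc)
    also have "\<dots> = \<phi> (Q [^]\<^bsub>F\<^esub> i) \<otimes> (\<phi> Q \<otimes> (h [^] i \<otimes> (h \<otimes> x)))" 
      unfolding rel(1) using hx c left_commute_\<phi>[OF c(1), of "h [^] i" "h \<otimes> x"] by simp
    also have "\<dots> = \<phi> (Q [^]\<^bsub>F\<^esub> Suc i) \<otimes> (h [^] Suc i \<otimes> x)" using hx c by (simp add: \<phi>_mult m_assoc)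
    finally show ?case .
  qed
  show "x \<otimes> y \<in> V" if "y \<in> V" unfolding V_def
  proof (rule lspan_mult_left[OF _ b hx(2)])
    fix p assume "p \<in> ?I"
    then obtain i j where p: "p = (i, j)" "i < n" "j < n" by auto
    have "x \<otimes> ?b p = (x \<otimes> h [^] i) \<otimes> x [^] j" using hx by (simp add: p m_assoc)
    also have "\<dots> = \<phi> (Q [^]\<^bsub>F\<^esub> i) \<otimes> (h [^] i \<otimes> x [^] Suc j)"
      unfolding xh using hx c nat_pow_Suc2[OF hx(2), of j] by (simp add: m_assoc del: nat_pow_Suc)
    finally have eq: "x \<otimes> ?b p = \<phi> (Q [^]\<^bsub>F\<^esub> i) \<otimes> (h [^] i \<otimes> x [^] Suc j)" .
    have "h [^] i \<otimes> x [^] Suc j \<in> V"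
    proof (cases "Suc j < n")
      case True
      then show ?thesis using base p by blast
    next
      case False
      then have "Suc j = n" using p by simp
      then have "h [^] i \<otimes> x [^] Suc j = \<phi> t \<otimes> h [^] i" using rel(3) hx c \<phi>_central by simp
      then show ?thesis using smult[OF c(3) base[of i 0]] p n hx by simp
    qed
    then show "x \<otimes> ?b p \<in> lspan F A \<phi> ?I ?b" unfolding eq using smult c by (simp add: V_def)
  qed (use that V_def in auto)
qed

lemma quot_eqI:
  assumes "ideal I R" "x \<in> carrier R" "y \<in> carrier R" "x \<ominus>\<^bsub>R\<^esub> y \<in> I"
  shows "I +>\<^bsub>R\<^esub> x = I +>\<^bsub>R\<^esub> y"
proof -
  interpret ideal I R by fact
  show ?thesis using quotient_eq_iff_same_a_r_cos[OF assms(1)] assms(2-4) by blast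
qed

lemma ring_hom_minus_zero:
  assumes "ring R" "ring S" "f \<in> ring_hom R S" "x \<in> carrier R" "y \<in> carrier R" "f x = f y"
  shows "f (x \<ominus>\<^bsub>R\<^esub> y) = \<zero>\<^bsub>S\<^esub>"
proof -
  interpret ring_hom_ring R S f by (rule ring_hom_ringI2[OF assms(1-3)])
  show ?thesis using assms(4-6) by (simp add: R.minus_eq S.r_neg)
qed

lemma word_monoid_sel [simp]: "carrier word_monoid = UNIV" "u \<otimes>\<^bsub>word_monoid\<^esub> v = u @ v" "\<one>\<^bsub>word_monoid\<^esub> = []"
  by (simp_all add: word_monoid_def)

lemma word_monoid_monoid: "monoid word_monoid"
  by (rule monoidI) auto

definition word_val :: "('r, 'c) ring_scheme \<Rightarrow> 'r \<Rightarrow> 'r \<Rightarrow> gen list \<Rightarrow> 'r" where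
  "word_val R h x w = foldr (\<lambda>g y. (case g of Gen_h \<Rightarrow> h | Gen_x \<Rightarrow> x) \<otimes>\<^bsub>R\<^esub> y) w \<one>\<^bsub>R\<^esub>"

lemma word_val_simps [simp]: "word_val R h x [] = \<one>\<^bsub>R\<^esub>"
  "word_val R h x (Gen_h # w) = h \<otimes>\<^bsub>R\<^esub> word_val R h x w" "word_val R h x (Gen_x # w) = x \<otimes>\<^bsub>R\<^esub> word_val R h x w"
  by (simp_all add: word_val_def)

context
  fixes R :: "('r, 'c) ring_scheme" and h x :: 'r
  assumes R: "ring R" and hx: "h \<in> carrier R" "x \<in> carrier R"
begin

interpretation R: ring R by (rule R)

lemma word_val_closed: "word_val R h x w \<in> carrier R"
proof (induction w)
  case (Cons g w) then show ?case using hx by (cases g) auto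
qed simp

lemma word_val_append: "word_val R h x (u @ v) = word_val R h x u \<otimes>\<^bsub>R\<^esub> word_val R h x v"
proof (induction u)
  case Nil then show ?case using word_val_closed by simp
next
  case (Cons g w) then show ?case using hx word_val_closed by (cases g) (simp_all add: R.m_assoc)
qed

lemma word_val_replicate: "word_val R h x (replicate i Gen_h) = h [^]\<^bsub>R\<^esub> i" "word_val R h x (replicate i Gen_x) = x [^]\<^bsub>R\<^esub> i"
proof (induction i)
  case (Suc i)
  { case 1 then show ?case using Suc(1) R.nat_pow_Suc2[OF hx(1), of i] by (simp del: R.nat_pow_Suc)
  next case 2 then show ?case using Suc(2) R.nat_pow_Suc2[OF hx(2), of i] by (simp del: R.nat_pow_Suc) }
qed simp_all

end

text \<open>The parameters are arbitrary, and for some of them the algebra collapses: the relations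
  imply (1 - Q^n) s x = 0. So this locale only provides a spanning set and the universal property;
  independence is imported from B/Bm.\<close>

locale cyclic_presentation = F: field F for F :: "('f, 'b) ring_scheme" +
  fixes n :: nat and Q s t :: 'f
  assumes Q: "Q \<in> carrier F" and s: "s \<in> carrier F" and t: "t \<in> carrier F" and n: "0 < n"
begin

abbreviation "Fr \<equiv> free_algebra F"
abbreviation "TF \<equiv> term_of F :: 'f \<Rightarrow> gen list \<Rightarrow> _"
abbreviation "CI \<equiv> cyclic_ideal F n Q s t"
abbreviation "C \<equiv> cyclic_algebra F n Q s t"
abbreviation "csc \<equiv> cyclic_scalar F n Q s t"
abbreviation "hC \<equiv> cyclic_gen F n Q s t Gen_h"
abbreviation "xC \<equiv> cyclic_gen F n Q s t Gen_x"

sublocale Fr: skew_monoid F word_monoid "\<lambda>g r. r"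
  rewrites "skew_monoid_ring F word_monoid (\<lambda>g r. r) = free_algebra F"
  by (auto simp: free_algebra_def intro!: monoid_ring_locale F.ring_axioms word_monoid_monoid)

sublocale Fr: ring Fr by (rule Fr.S_ring)

definition relators :: "(gen list \<Rightarrow> 'f) set" where "relators =
     {TF \<one>\<^bsub>F\<^esub> [Gen_x, Gen_h] \<ominus>\<^bsub>Fr\<^esub> TF Q [Gen_h, Gen_x], TF \<one>\<^bsub>F\<^esub> (replicate n Gen_h) \<ominus>\<^bsub>Fr\<^esub> TF s [],
      TF \<one>\<^bsub>F\<^esub> (replicate n Gen_x) \<ominus>\<^bsub>Fr\<^esub> TF t []}"

lemma CI_eq: "CI = genideal Fr relators"
  by (simp add: cyclic_ideal_def relators_def)

lemma relators_closed: "relators \<subseteq> carrier Fr"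
  unfolding relators_def using Q s t by auto

sublocale CI: ideal CI Fr
  unfolding CI_eq by (rule Fr.genideal_ideal[OF relators_closed])

sublocale C: ring C
  unfolding cyclic_algebra_def by (rule CI.quotient_is_ring)

definition cproj :: "(gen list \<Rightarrow> 'f) \<Rightarrow> (gen list \<Rightarrow> 'f) set" where "cproj f = CI +>\<^bsub>Fr\<^esub> f"

lemma cproj_hom: "cproj \<in> ring_hom Fr C"
proof -
  have "cproj = (+>\<^bsub>Fr\<^esub>) CI" by (auto simp: cproj_def)
  then show ?thesis unfolding cyclic_algebra_def using CI.rcos_ring_hom by simp
qed

lemma cproj_simps: "f \<in> carrier Fr \<Longrightarrow> cproj f \<in> carrier C"
  "f \<in> carrier Fr \<Longrightarrow> g \<in> carrier Fr \<Longrightarrow> cproj (f \<oplus>\<^bsub>Fr\<^esub> g) = cproj f \<oplus>\<^bsub>C\<^esub> cproj g"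
  "f \<in> carrier Fr \<Longrightarrow> g \<in> carrier Fr \<Longrightarrow> cproj (f \<otimes>\<^bsub>Fr\<^esub> g) = cproj f \<otimes>\<^bsub>C\<^esub> cproj g" "cproj \<one>\<^bsub>Fr\<^esub> = \<one>\<^bsub>C\<^esub>"
  "cproj \<zero>\<^bsub>Fr\<^esub> = \<zero>\<^bsub>C\<^esub>"
  using ring_hom_closed[OF cproj_hom] ring_hom_add[OF cproj_hom] ring_hom_mult[OF cproj_hom] ring_hom_one[OF cproj_hom]
    ring_hom_zero[OF cproj_hom Fr.ring_axioms C.ring_axioms] by auto

lemma C_gens: "csc c = cproj (TF c [])" "hC = cproj (TF \<one>\<^bsub>F\<^esub> [Gen_h])" "xC = cproj (TF \<one>\<^bsub>F\<^esub> [Gen_x])"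
  by (simp_all add: cproj_def cyclic_scalar_def cyclic_gen_def)

lemma C_gens_closed [simp]: "hC \<in> carrier C" "xC \<in> carrier C"
  by (simp_all add: C_gens cproj_simps)

lemma C_surj: "y \<in> carrier C \<Longrightarrow> \<exists>f\<in>carrier Fr. y = cproj f"
  unfolding cyclic_algebra_def cproj_def by (elim quot_surj) auto

lemma TF_central:
  assumes "c \<in> carrier F" "f \<in> carrier Fr" shows "TF c [] \<otimes>\<^bsub>Fr\<^esub> f = f \<otimes>\<^bsub>Fr\<^esub> TF c []"
  using assms(2)
proof (induction f rule: Fr.S_term_induct)
  case zero then show ?case using assms by simp
next
  case (add r g f)
  then show ?case using assms by (simp add: Fr.l_distr Fr.r_distr Fr.T_mult F.m_comm)
qed

sublocale C: falgebra F C csc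
proof
  show "csc \<in> ring_hom F C"
    by (rule ring_hom_memI)
      (simp_all add: C_gens cproj_simps Fr.T_mult Fr.T_add Fr.S_one flip: cproj_simps(2-4))
  fix c a assume c: "c \<in> carrier F" and "a \<in> carrier C"
  then obtain f where "f \<in> carrier Fr" "a = cproj f" using C_surj by blast
  then show "csc c \<otimes>\<^bsub>C\<^esub> a = a \<otimes>\<^bsub>C\<^esub> csc c" using c TF_central by (simp add: C_gens flip: cproj_simps(3))
qed

lemma cproj_word: "r \<in> carrier F \<Longrightarrow> cproj (TF r w) = csc r \<otimes>\<^bsub>C\<^esub> word_val C hC xC w"
proof (induction w arbitrary: r)
  case Nil
  then show ?case by (simp add: C_gens(1) cproj_simps)
next
  case (Cons g w)
  have "cproj (TF r (g # w)) = cproj (TF r [] \<otimes>\<^bsub>Fr\<^esub> (TF \<one>\<^bsub>F\<^esub> [g] \<otimes>\<^bsub>Fr\<^esub> TF \<one>\<^bsub>F\<^esub> w))"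
    using Cons.prems by (simp add: Fr.T_mult)
  also have "\<dots> = csc r \<otimes>\<^bsub>C\<^esub> (cproj (TF \<one>\<^bsub>F\<^esub> [g]) \<otimes>\<^bsub>C\<^esub> cproj (TF \<one>\<^bsub>F\<^esub> w))"
    using Cons.prems by (simp add: cproj_simps C_gens(1))
  also have "cproj (TF \<one>\<^bsub>F\<^esub> w) = word_val C hC xC w"
    using Cons.IH[of "\<one>\<^bsub>F\<^esub>"] word_val_closed[OF C.ring_axioms C_gens_closed] by simp
  also have "cproj (TF \<one>\<^bsub>F\<^esub> [g]) \<otimes>\<^bsub>C\<^esub> word_val C hC xC w = word_val C hC xC (g # w)"
    by (cases g) (simp_all add: C_gens)
  finally show ?case .
qed

lemma cproj_eq: "f \<in> carrier Fr \<Longrightarrow> g \<in> carrier Fr \<Longrightarrow> f \<ominus>\<^bsub>Fr\<^esub> g \<in> relators \<Longrightarrow> cproj f = cproj g"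
  unfolding cproj_def using Fr.genideal_self[OF relators_closed]
  by (intro quot_eqI[OF CI.ideal_axioms]) (auto simp: CI_eq)

lemma C_relations: "xC \<otimes>\<^bsub>C\<^esub> hC = csc Q \<otimes>\<^bsub>C\<^esub> (hC \<otimes>\<^bsub>C\<^esub> xC)" "hC [^]\<^bsub>C\<^esub> n = csc s" "xC [^]\<^bsub>C\<^esub> n = csc t"
proof -
  note wv = word_val_closed[OF C.ring_axioms C_gens_closed] word_val_replicate[OF C.ring_axioms C_gens_closed]
  have "cproj (TF \<one>\<^bsub>F\<^esub> [Gen_x, Gen_h]) = cproj (TF Q [Gen_h, Gen_x])"
    using Q by (intro cproj_eq) (auto simp: relators_def)
  then show "xC \<otimes>\<^bsub>C\<^esub> hC = csc Q \<otimes>\<^bsub>C\<^esub> (hC \<otimes>\<^bsub>C\<^esub> xC)" using Q by (simp add: cproj_word)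
  have "cproj (TF \<one>\<^bsub>F\<^esub> (replicate n Gen_h)) = cproj (TF s [])"
    using s by (intro cproj_eq) (auto simp: relators_def)
  then show "hC [^]\<^bsub>C\<^esub> n = csc s" using s wv by (simp add: cproj_word)
  have "cproj (TF \<one>\<^bsub>F\<^esub> (replicate n Gen_x)) = cproj (TF t [])"
    using t by (intro cproj_eq) (auto simp: relators_def)
  then show "xC [^]\<^bsub>C\<^esub> n = csc t" using t wv by (simp add: cproj_word)
qed

definition basC :: "nat \<times> nat \<Rightarrow> (gen list \<Rightarrow> 'f) set" where
  "basC p = hC [^]\<^bsub>C\<^esub> fst p \<otimes>\<^bsub>C\<^esub> xC [^]\<^bsub>C\<^esub> snd p"

lemma basC_closed: "basC \<in> {..<n} \<times> {..<n} \<rightarrow> carrier C"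
  by (auto simp: basC_def)

lemma C_span: "carrier C = lspan F C csc ({..<n} \<times> {..<n}) basC"
proof (intro equalityI subsetI)
  let ?V = "lspan F C csc ({..<n} \<times> {..<n}) basC"
  note cl = C.cyclic_lspan[OF C_gens_closed Q s t n C_relations, folded basC_def]
  note V = C.lspan_zero[OF _ basC_closed] C.lspan_add[OF _ basC_closed] C.lspan_smult[OF _ basC_closed]
  fix y assume "y \<in> carrier C"
  then obtain f where f: "f \<in> carrier Fr" "y = cproj f" using C_surj by blast
  have w: "word_val C hC xC w \<in> ?V" for w
  proof (induction w)
    case (Cons g w) then show ?case using cl by (cases g) simp_all
  qed (use cl in simp)
  from f(1) have "cproj f \<in> ?V"
  proof (induction f rule: Fr.S_term_induct)
    case zero then show ?case using V by (simp add: cproj_simps)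
  next
    case (add r g f)
    then show ?case using V w by (simp add: cproj_simps cproj_word)
  qed
  then show "y \<in> ?V" using f(2) by simp
qed (use C.lspan_closed[OF _ basC_closed] in simp)

lemma C_lift:
  assumes S: "falgebra F S \<psi>" and hx: "h \<in> carrier S" "x \<in> carrier S"
    and rel: "x \<otimes>\<^bsub>S\<^esub> h = \<psi> Q \<otimes>\<^bsub>S\<^esub> (h \<otimes>\<^bsub>S\<^esub> x)" "h [^]\<^bsub>S\<^esub> n = \<psi> s" "x [^]\<^bsub>S\<^esub> n = \<psi> t"
  obtains f where "f \<in> ring_hom C S" "\<And>c. c \<in> carrier F \<Longrightarrow> f (csc c) = \<psi> c" "f hC = h" "f xC = x"
proof -
  interpret S: falgebra F S \<psi> by fact
  note wv = word_val_closed[OF S.ring_axioms hx] word_val_append[OF S.ring_axioms hx] word_val_replicate[OF S.ring_axioms hx]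
  obtain g where g: "g \<in> ring_hom Fr S" "\<And>r w. r \<in> carrier F \<Longrightarrow> g (TF r w) = \<psi> r \<otimes>\<^bsub>S\<^esub> word_val S h x w"
    by (rule Fr.S_ext[OF S.ring_axioms S.\<phi>_hom, where \<psi> = "word_val S h x"]) (simp_all add: wv S.\<phi>_central)
  have z: "g r = \<zero>\<^bsub>S\<^esub>" if "r \<in> relators" for r
    using that Q s t hx rel unfolding relators_def
    by (auto intro!: ring_hom_minus_zero[OF Fr.ring_axioms S.ring_axioms g(1)] simp: g(2) wv)
  obtain f where f: "f \<in> ring_hom (Fr Quot genideal Fr relators) S"
    "\<And>x. x \<in> carrier Fr \<Longrightarrow> f (genideal Fr relators +>\<^bsub>Fr\<^esub> x) = g x"
    using genideal_hom_lift[OF Fr.ring_axioms S.ring_axioms g(1) relators_closed z] by metis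
  have f2: "f (cproj x) = g x" if "x \<in> carrier Fr" for x using f(2) that by (simp add: cproj_def CI_eq)
  show thesis
  proof (rule that)
    show "f \<in> ring_hom C S" using f(1) by (simp add: cyclic_algebra_def CI_eq)
    show "f (csc c) = \<psi> c" if "c \<in> carrier F" for c using that by (simp add: C_gens f2 g(2))
    show "f hC = h" "f xC = x" using hx by (simp_all add: C_gens f2 g(2))
  qed
qed

end

section \<open>The factor algebra as cyclic algebra and as tensor product\<close>

context qtmax begin

abbreviation "kq \<equiv> residue_q K q m"
abbreviation "ks \<equiv> residue_s K q n m"
abbreviation "kt \<equiv> residue_t K q n m"

lemma kqst [simp]: "kq \<in> carrier k" "ks \<in> carrier k" "kt \<in> carrier k"
  unfolding q_eq s_eq t_eq using q_unit by (auto intro!: res_simps mon_center)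

sublocale C: cyclic_presentation k n kq ks kt
  by unfold_locales simp_all

abbreviation "EE \<equiv> qtE K q n m"
abbreviation "esc \<equiv> qtE_scalar K q n m"
abbreviation "hE \<equiv> qtE_gen K q n m Gen_h"
abbreviation "xE \<equiv> qtE_gen K q n m Gen_x"

lemma E_folds: "EE = C.C" "esc = C.csc" "hE = C.hC" "xE = C.xC"
  by (simp_all add: qtE_def qtE_scalar_def qtE_gen_def)

lemma hx_closed [simp]: "hA \<in> carrier A" "xA \<in> carrier A"
  by (simp_all add: B_h B_x)

lemma A_relations: "xA \<otimes>\<^bsub>A\<^esub> hA = \<phi> kq \<otimes>\<^bsub>A\<^esub> (hA \<otimes>\<^bsub>A\<^esub> xA)" "hA [^]\<^bsub>A\<^esub> n = \<phi> ks" "xA [^]\<^bsub>A\<^esub> n = \<phi> kt"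
proof -
  show "xA \<otimes>\<^bsub>A\<^esub> hA = \<phi> kq \<otimes>\<^bsub>A\<^esub> (hA \<otimes>\<^bsub>A\<^esub> xA)"
    using q_unit by (simp add: q_eq \<phi>_res mon_center B_h B_x mon_mult flip: proj_simps(3))
  show "hA [^]\<^bsub>A\<^esub> n = \<phi> ks" "xA [^]\<^bsub>A\<^esub> n = \<phi> kt"
    by (simp_all only: h_pow x_pow s_eq t_eq) (simp_all add: \<phi>_res mon_center)
qed

text \<open>h and x in B/Bm satisfy the defining relations of E(m), which gives the map. It sends
  the n^2 spanning monomials of E(m) to the basis of B/Bm, so it is an isomorphism and the monomials
  are independent in E(m).\<close>

lemma C_to_A: obtains f where "f \<in> alg_iso k EE esc A \<phi>" "f hE = hA" "f xE = xA"
    "lindep k EE esc I2 C.basC"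
proof -
  obtain f where f: "f \<in> ring_hom C.C A" "\<And>c. c \<in> carrier k \<Longrightarrow> f (C.csc c) = \<phi> c" "f C.hC = hA" "f C.xC = xA"
    by (rule C.C_lift[OF A.falgebra_axioms hx_closed A_relations], rule that)
  have fb: "f (C.basC p) = bas p" for p
    unfolding C.basC_def bas_hx
    by (simp add: ring_hom_mult[OF f(1)] ring_hom_pow[OF C.C.ring_axioms A.ring_axioms f(1)] f)
  have "f \<in> alg_iso k C.C C.csc A \<phi>"
    by (rule alg_iso_of_basis[OF C.C.falgebra_axioms A.falgebra_axioms f(1,2), where b = C.basC and b' = bas and I = I2])
      (use fb C.basC_closed A_indep in \<open>simp_all add: A_span flip: C.C_span\<close>)
  moreover have "lindep k C.C C.csc I2 C.basC"
    by (rule hom_inj_of_lindep(2)[OF C.C.falgebra_axioms A.falgebra_axioms f(1,2), where b = C.basC and b' = bas and I = I2])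
      (use fb C.basC_closed A_indep in \<open>simp_all flip: C.C_span\<close>)
  ultimately show thesis using that f unfolding E_folds by blast
qed

lemma canonical_isos_nonempty: "canonical_isos K q n m \<noteq> {}"
proof -
  obtain f where f: "f \<in> alg_iso k EE esc A \<phi>" "f hE = hA" "f xE = xA" by (rule C_to_A, rule that)
  have "falgebra k EE esc" using C.C.falgebra_axioms by (simp add: E_folds)
  from alg_iso_sym[OF this f(1)] have i: "inv_into (carrier EE) f \<in> alg_iso k A \<phi> EE esc" .
  have "bij_betw f (carrier EE) (carrier A)" using f(1) by (simp add: alg_iso_def ring_iso_def)
  then have inj: "inj_on f (carrier EE)" by (simp add: bij_betw_def)
  have "hE \<in> carrier EE" "xE \<in> carrier EE" by (simp_all add: E_folds)
  then have "inv_into (carrier EE) f hA = hE" "inv_into (carrier EE) f xA = xE"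
    using inj by (simp_all flip: f(2,3))
  then have "inv_into (carrier EE) f \<in> canonical_isos K q n m" using i by (simp add: canonical_isos_def)
  then show ?thesis by blast
qed

subsection \<open>The tensor product\<close>

abbreviation "kB \<equiv> k \<times>\<times> B"
abbreviation "PT \<equiv> monoid_ring \<Z> (k \<times>\<times> B)"
abbreviation "TI \<equiv> tensor_ideal (qtZ K q) k res B (\<lambda>z. z)"
abbreviation "TT \<equiv> tensor_algebra (qtZ K q) k res B (\<lambda>z. z)"
abbreviation "pt \<equiv> pure_tensor (qtZ K q) k res B (\<lambda>z. z)"
abbreviation "eT a b \<equiv> term_of \<Z> 1 (a, b)"

lemma kB_monoid: "monoid kB"
  by (rule DirProd_monoid) (auto intro: k.monoid_axioms B.monoid_axioms)

lemma kB_sel [simp]: "carrier kB = carrier k \<times> carrier B" "(a, b) \<otimes>\<^bsub>kB\<^esub> (a', b') = (a \<otimes>\<^bsub>k\<^esub> a', b \<otimes>\<^bsub>B\<^esub> b')"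
  "\<one>\<^bsub>kB\<^esub> = (\<one>\<^bsub>k\<^esub>, \<one>\<^bsub>B\<^esub>)"
  by (simp_all add: DirProd_def)

sublocale PT: skew_monoid "\<Z>" kB "\<lambda>g r. r"
  by (rule monoid_ring_locale[OF cring.axioms(1)[OF int_is_cring] kB_monoid])

sublocale PT: ring PT by (rule PT.S_ring)

definition tensor_relators :: "('a qt set \<times> 'a qt \<Rightarrow> int) set" where "tensor_relators =
      ({eT (a \<oplus>\<^bsub>k\<^esub> a') b \<ominus>\<^bsub>PT\<^esub> (eT a b \<oplus>\<^bsub>PT\<^esub> eT a' b) |
          a a' b. a \<in> carrier k \<and> a' \<in> carrier k \<and> b \<in> carrier B} \<union>
       {eT a (b \<oplus>\<^bsub>B\<^esub> b') \<ominus>\<^bsub>PT\<^esub> (eT a b \<oplus>\<^bsub>PT\<^esub> eT a b') |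
          a b b'. a \<in> carrier k \<and> b \<in> carrier B \<and> b' \<in> carrier B} \<union>
       {eT (a \<otimes>\<^bsub>k\<^esub> res z) b \<ominus>\<^bsub>PT\<^esub> eT a (z \<otimes>\<^bsub>B\<^esub> b) |
          a b z. a \<in> carrier k \<and> b \<in> carrier B \<and> z \<in> carrier (qtZ K q)})"

lemma TI_eq: "TI = genideal PT tensor_relators"
  unfolding tensor_ideal_def tensor_relators_def Let_def ..

lemma eT_closed [simp]: "a \<in> carrier k \<Longrightarrow> b \<in> carrier B \<Longrightarrow> eT a b \<in> carrier PT"
  by (rule PT.T_closed) auto

lemma tensor_relators_closed: "tensor_relators \<subseteq> carrier PT"
  unfolding tensor_relators_def
  by (auto intro!: PT.minus_closed PT.a_closed eT_closed)

sublocale TI: ideal TI PT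
  unfolding TI_eq by (rule PT.genideal_ideal[OF tensor_relators_closed])

sublocale TT: ring TT
  unfolding tensor_algebra_def by (rule TI.quotient_is_ring)

definition tproj :: "('a qt set \<times> 'a qt \<Rightarrow> int) \<Rightarrow> ('a qt set \<times> 'a qt \<Rightarrow> int) set" where "tproj f = TI +>\<^bsub>PT\<^esub> f"

lemma tproj_hom: "tproj \<in> ring_hom PT TT"
proof -
  have "tproj = (+>\<^bsub>PT\<^esub>) TI" by (auto simp: tproj_def)
  then show ?thesis unfolding tensor_algebra_def using TI.rcos_ring_hom by simp
qed

lemma tproj_simps: "f \<in> carrier PT \<Longrightarrow> tproj f \<in> carrier TT"
  "f \<in> carrier PT \<Longrightarrow> g \<in> carrier PT \<Longrightarrow> tproj (f \<oplus>\<^bsub>PT\<^esub> g) = tproj f \<oplus>\<^bsub>TT\<^esub> tproj g"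
  "f \<in> carrier PT \<Longrightarrow> g \<in> carrier PT \<Longrightarrow> tproj (f \<otimes>\<^bsub>PT\<^esub> g) = tproj f \<otimes>\<^bsub>TT\<^esub> tproj g" "tproj \<one>\<^bsub>PT\<^esub> = \<one>\<^bsub>TT\<^esub>"
  "tproj \<zero>\<^bsub>PT\<^esub> = \<zero>\<^bsub>TT\<^esub>"
  using ring_hom_closed[OF tproj_hom] ring_hom_add[OF tproj_hom] ring_hom_mult[OF tproj_hom] ring_hom_one[OF tproj_hom]
    ring_hom_zero[OF tproj_hom PT.ring_axioms TT.ring_axioms] by auto

lemma pt_eq: "pt a b = tproj (eT a b)"
  by (simp add: pure_tensor_def tproj_def)

lemma TT_surj: "y \<in> carrier TT \<Longrightarrow> \<exists>f\<in>carrier PT. y = tproj f"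
  unfolding tensor_algebra_def tproj_def by (elim quot_surj) auto

lemma tproj_eq: "f \<in> carrier PT \<Longrightarrow> g \<in> carrier PT \<Longrightarrow> f \<ominus>\<^bsub>PT\<^esub> g \<in> tensor_relators \<Longrightarrow> tproj f = tproj g"
  unfolding tproj_def using PT.genideal_self[OF tensor_relators_closed]
  by (intro quot_eqI[OF TI.ideal_axioms]) (auto simp: TI_eq)

lemma pt_closed [simp]: "a \<in> carrier k \<Longrightarrow> b \<in> carrier B \<Longrightarrow> pt a b \<in> carrier TT"
  by (simp add: pt_eq tproj_simps)

lemma pt_add_left: "a \<in> carrier k \<Longrightarrow> a' \<in> carrier k \<Longrightarrow> b \<in> carrier B \<Longrightarrow> pt (a \<oplus>\<^bsub>k\<^esub> a') b = pt a b \<oplus>\<^bsub>TT\<^esub> pt a' b"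
  and pt_add_right: "a \<in> carrier k \<Longrightarrow> b \<in> carrier B \<Longrightarrow> b' \<in> carrier B \<Longrightarrow> pt a (b \<oplus>\<^bsub>B\<^esub> b') = pt a b \<oplus>\<^bsub>TT\<^esub> pt a b'"
  and pt_balanced: "a \<in> carrier k \<Longrightarrow> b \<in> carrier B \<Longrightarrow> z \<in> Z \<Longrightarrow> pt (a \<otimes>\<^bsub>k\<^esub> res z) b = pt a (z \<otimes>\<^bsub>B\<^esub> b)"
  unfolding pt_eq
proof -
  show "tproj (eT (a \<oplus>\<^bsub>k\<^esub> a') b) = tproj (eT a b) \<oplus>\<^bsub>TT\<^esub> tproj (eT a' b)"
    if a: "a \<in> carrier k" "a' \<in> carrier k" "b \<in> carrier B"
  proof -
    have "eT (a \<oplus>\<^bsub>k\<^esub> a') b \<ominus>\<^bsub>PT\<^esub> (eT a b \<oplus>\<^bsub>PT\<^esub> eT a' b) \<in> tensor_relators"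
      unfolding tensor_relators_def using a by blast
    then have "tproj (eT (a \<oplus>\<^bsub>k\<^esub> a') b) = tproj (eT a b \<oplus>\<^bsub>PT\<^esub> eT a' b)"
      by (rule tproj_eq[rotated 2]) (use a in simp_all)
    then show ?thesis using a by (simp add: tproj_simps)
  qed
  show "tproj (eT a (b \<oplus>\<^bsub>B\<^esub> b')) = tproj (eT a b) \<oplus>\<^bsub>TT\<^esub> tproj (eT a b')"
    if a: "a \<in> carrier k" "b \<in> carrier B" "b' \<in> carrier B"
  proof -
    have "eT a (b \<oplus>\<^bsub>B\<^esub> b') \<ominus>\<^bsub>PT\<^esub> (eT a b \<oplus>\<^bsub>PT\<^esub> eT a b') \<in> tensor_relators"
      unfolding tensor_relators_def using a by blast
    then have "tproj (eT a (b \<oplus>\<^bsub>B\<^esub> b')) = tproj (eT a b \<oplus>\<^bsub>PT\<^esub> eT a b')"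
      by (rule tproj_eq[rotated 2]) (use a in simp_all)
    then show ?thesis using a by (simp add: tproj_simps)
  qed
  show "tproj (eT (a \<otimes>\<^bsub>k\<^esub> res z) b) = tproj (eT a (z \<otimes>\<^bsub>B\<^esub> b))"
    if a: "a \<in> carrier k" "b \<in> carrier B" "z \<in> Z"
  proof -
    have "eT (a \<otimes>\<^bsub>k\<^esub> res z) b \<ominus>\<^bsub>PT\<^esub> eT a (z \<otimes>\<^bsub>B\<^esub> b) \<in> tensor_relators"
      unfolding tensor_relators_def qtZ_sel using a by blast
    then show ?thesis by (rule tproj_eq[rotated 2]) (use a in simp_all)
  qed
qed

lemma pt_mult: "a \<in> carrier k \<Longrightarrow> a' \<in> carrier k \<Longrightarrow> b \<in> carrier B \<Longrightarrow> b' \<in> carrier B \<Longrightarrow>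
    pt a b \<otimes>\<^bsub>TT\<^esub> pt a' b' = pt (a \<otimes>\<^bsub>k\<^esub> a') (b \<otimes>\<^bsub>B\<^esub> b')"
  unfolding pt_eq by (subst tproj_simps(3)[symmetric]) (auto simp: PT.T_mult)

lemma pt_one: "pt \<one>\<^bsub>k\<^esub> \<one>\<^bsub>B\<^esub> = \<one>\<^bsub>TT\<^esub>"
  by (simp add: pt_eq PT.S_one flip: tproj_simps(4))

sublocale TT: falgebra k TT "\<lambda>c. pt c \<one>\<^bsub>B\<^esub>"
proof
  show "(\<lambda>c. pt c \<one>\<^bsub>B\<^esub>) \<in> ring_hom k TT"
    by (rule ring_hom_memI) (simp_all add: pt_mult pt_add_left pt_one)
  fix c a assume c: "c \<in> carrier k" and "a \<in> carrier TT"
  then obtain f where f: "f \<in> carrier PT" "a = tproj f" using TT_surj by blast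
  from f(1) have "eT c \<one>\<^bsub>B\<^esub> \<otimes>\<^bsub>PT\<^esub> f = f \<otimes>\<^bsub>PT\<^esub> eT c \<one>\<^bsub>B\<^esub>"
  proof (induction f rule: PT.S_term_induct)
    case zero then show ?case using c by simp
  next
    case (add r g f)
    then show ?case using c by (cases g) (simp add: PT.l_distr PT.r_distr PT.T_mult k.m_comm)
  qed
  then show "pt c \<one>\<^bsub>B\<^esub> \<otimes>\<^bsub>TT\<^esub> a = a \<otimes>\<^bsub>TT\<^esub> pt c \<one>\<^bsub>B\<^esub>"
    using f c by (simp add: pt_eq flip: tproj_simps(3))
qed

definition basT :: "nat \<times> nat \<Rightarrow> ('a qt set \<times> 'a qt \<Rightarrow> int) set" where
  "basT p = pt \<one>\<^bsub>k\<^esub> (mon \<one> (int (fst p)) (int (snd p)))"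

lemma basT_closed: "basT \<in> I2 \<rightarrow> carrier TT"
  by (auto simp: basT_def)

lemma TT_span: "carrier TT \<subseteq> lspan k TT (\<lambda>c. pt c \<one>\<^bsub>B\<^esub>) I2 basT"
proof
  let ?V = "lspan k TT (\<lambda>c. pt c \<one>\<^bsub>B\<^esub>) I2 basT"
  have V: "\<zero>\<^bsub>TT\<^esub> \<in> ?V" "\<And>y z. y \<in> ?V \<Longrightarrow> z \<in> ?V \<Longrightarrow> y \<oplus>\<^bsub>TT\<^esub> z \<in> ?V"
    "\<And>r y. y \<in> ?V \<Longrightarrow> r \<in> carrier k \<Longrightarrow> pt r \<one>\<^bsub>B\<^esub> \<otimes>\<^bsub>TT\<^esub> y \<in> ?V" "\<And>p. p \<in> I2 \<Longrightarrow> basT p \<in> ?V"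
    using TT.lspan_zero[OF _ basT_closed] TT.lspan_add[OF _ basT_closed] TT.lspan_smult[OF _ basT_closed] TT.lspan_base[OF _ basT_closed]
    by auto
  have mon: "pt a (mon c i j) \<in> ?V" if a: "a \<in> carrier k" and c: "c \<in> carrier K" for a c i j
  proof -
    \<comment> \<open>Both exponents are split at multiples of n. The central factor crosses the
      tensor sign into k(m), and one of the n^2 basis monomials remains; no power of q appears
      because n divides j0.\<close>
    define i0 j0 i1 j1 where ij: "i0 = int n * (i div int n)" "j0 = int n * (j div int n)" "i1 = i mod int n" "j1 = j mod int n"
    have e: "i = i0 + i1" "j = j0 + j1" by (simp_all add: ij)
    have "0 \<le> i1" "i1 < int n" "0 \<le> j1" "j1 < int n" by (simp_all add: ij)
    then obtain p where p: "p \<in> I2" "int (fst p) = i1" "int (snd p) = j1" by (intro that[of "(nat i1, nat j1)"]) auto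
    have z: "mon c i0 j0 \<in> Z" using c by (intro mon_center) (auto simp: ij)
    have "mon c i j = mon c i0 j0 \<otimes>\<^bsub>B\<^esub> mon \<one> i1 j1"
      using c by (simp add: mon_mult e) (simp add: ij)
    then have "pt a (mon c i j) = pt (a \<otimes>\<^bsub>k\<^esub> res (mon c i0 j0)) (mon \<one> i1 j1)"
      using z a by (simp add: pt_balanced)
    also have "\<dots> = pt (a \<otimes>\<^bsub>k\<^esub> res (mon c i0 j0)) \<one>\<^bsub>B\<^esub> \<otimes>\<^bsub>TT\<^esub> basT p"
      using z a p by (simp add: basT_def pt_mult)
    finally show ?thesis using V(3)[OF V(4)[OF p(1)], of "a \<otimes>\<^bsub>k\<^esub> res (mon c i0 j0)"] z a by simp
  qed
  have pt: "pt a b \<in> ?V" if a: "a \<in> carrier k" and b: "b \<in> carrier B" for a b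
    using b
  proof (induction b rule: qt_induct)
    case zero
    have "pt a \<zero>\<^bsub>B\<^esub> = pt a \<zero>\<^bsub>B\<^esub> \<oplus>\<^bsub>TT\<^esub> pt a \<zero>\<^bsub>B\<^esub>" using a pt_add_right[of a "\<zero>\<^bsub>B\<^esub>" "\<zero>\<^bsub>B\<^esub>"] by simp
    then have "pt a \<zero>\<^bsub>B\<^esub> = \<zero>\<^bsub>TT\<^esub>" using a pt_closed[OF a B.zero_closed] by (metis TT.add.l_cancel_one')
    then show ?case using V by simp
  next
    case (add c i j f)
    then show ?case using V(2) mon[OF a] a by (simp add: pt_add_right)
  qed
  \<comment> \<open>Every integer coefficient is reached from 0 by adding or subtracting 1.
    Subtraction stays in the span because the negative of a tensor is its multiple by the scalar -1
    of k(m).\<close>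
  have T: "tproj (term_of \<Z> r g) \<in> ?V" if g: "g \<in> carrier kB" for r g
  proof (induction r rule: int_induct[where k = 0])
    case base
    then show ?case using V by (simp add: PT.T_zero[simplified] tproj_simps)
  next
    case (step1 r)
    have "term_of \<Z> (r + 1) g = term_of \<Z> r g \<oplus>\<^bsub>PT\<^esub> term_of \<Z> 1 g" using PT.T_add[of r 1 g] by simp
    then show ?case using step1 pt[of "fst g" "snd g"] V(2) g by (cases g) (simp add: tproj_simps pt_eq)
  next
    case (step2 r)
    have "term_of \<Z> r g = term_of \<Z> (r - 1) g \<oplus>\<^bsub>PT\<^esub> term_of \<Z> 1 g" using PT.T_add[of "r - 1" 1 g] by simp
    then have e: "tproj (term_of \<Z> r g) = tproj (term_of \<Z> (r - 1) g) \<oplus>\<^bsub>TT\<^esub> tproj (term_of \<Z> 1 g)"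
      using g by (simp add: tproj_simps)
    have c: "tproj (term_of \<Z> (r - 1) g) \<in> carrier TT" "tproj (term_of \<Z> 1 g) \<in> carrier TT"
      using g by (simp_all add: tproj_simps)
    have v: "tproj (term_of \<Z> 1 g) \<in> ?V" using pt[of "fst g" "snd g"] g by (cases g) (simp add: pt_eq)
    have "pt (\<ominus>\<^bsub>k\<^esub> \<one>\<^bsub>k\<^esub>) \<one>\<^bsub>B\<^esub> \<otimes>\<^bsub>TT\<^esub> tproj (term_of \<Z> 1 g) = \<ominus>\<^bsub>TT\<^esub> tproj (term_of \<Z> 1 g)"
      using TT.\<phi>_minus[OF k.one_closed] c(2) by (simp add: pt_one TT.l_minus)
    then have "\<ominus>\<^bsub>TT\<^esub> tproj (term_of \<Z> 1 g) \<in> ?V" using V(3)[OF v, of "\<ominus>\<^bsub>k\<^esub> \<one>\<^bsub>k\<^esub>"] by simp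
    then have "tproj (term_of \<Z> r g) \<oplus>\<^bsub>TT\<^esub> \<ominus>\<^bsub>TT\<^esub> tproj (term_of \<Z> 1 g) \<in> ?V" using V(2) step2 by blast
    then show ?case unfolding e using c by (simp add: TT.a_assoc TT.r_neg)
  qed
  fix y assume "y \<in> carrier TT"
  then obtain f where f: "f \<in> carrier PT" "y = tproj f" using TT_surj by blast
  from f(1) have "tproj f \<in> ?V"
  proof (induction f rule: PT.S_term_induct)
    case zero then show ?case using V by (simp add: tproj_simps)
  next
    case (add r g f)
    then show ?case using V(2) T by (simp add: tproj_simps)
  qed
  then show "y \<in> ?V" using f(2) by simp
qed

text \<open>The map is built from the presented side: the tensor of a and b goes to \<phi>(a) times
  the class of b. It respects the three kinds of relators and sends the spanning tensors of 1 with
  h^i x^j to the basis of B/Bm; the isomorphism sought is its inverse.\<close>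

lemma tensor_iso: "alg_iso k A \<phi> TT (\<lambda>c. pt c \<one>\<^bsub>B\<^esub>) \<noteq> {}"
proof -
  \<comment> \<open>The tensor product is a quotient of a monoid ring over the integers, so the
    extension also needs the homomorphism from the integers to the factor algebra.\<close>
  define \<iota> where "\<iota> r = [r] \<cdot>\<^bsub>A\<^esub> \<one>\<^bsub>A\<^esub>" for r :: int
  have \<iota>c: "\<iota> r \<in> carrier A" for r by (simp add: \<iota>_def)
  have \<iota>l: "\<iota> r \<otimes>\<^bsub>A\<^esub> y = [r] \<cdot>\<^bsub>A\<^esub> y" and \<iota>r: "y \<otimes>\<^bsub>A\<^esub> \<iota> r = [r] \<cdot>\<^bsub>A\<^esub> y" if "y \<in> carrier A" for r y
    using that A.add_pow_ldistr_int[of "\<one>\<^bsub>A\<^esub>" y r] A.add_pow_rdistr_int[of y "\<one>\<^bsub>A\<^esub>" r] by (simp_all add: \<iota>_def)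
  have \<iota>_hom: "\<iota> \<in> ring_hom \<Z> A"
  proof (rule ring_hom_memI)
    fix r s :: int
    show "\<iota> (r \<otimes>\<^bsub>\<Z>\<^esub> s) = \<iota> r \<otimes>\<^bsub>A\<^esub> \<iota> s" using \<iota>l[OF \<iota>c] A.add.int_pow_pow[of "\<one>\<^bsub>A\<^esub>" r s] by (simp add: \<iota>_def mult.commute)
    show "\<iota> (r \<oplus>\<^bsub>\<Z>\<^esub> s) = \<iota> r \<oplus>\<^bsub>A\<^esub> \<iota> s" using A.add.int_pow_mult[of "\<one>\<^bsub>A\<^esub>" r s] by (simp add: \<iota>_def)
  next
    show "\<iota> \<one>\<^bsub>\<Z>\<^esub> = \<one>\<^bsub>A\<^esub>" using A.add.int_pow_1[of "\<one>\<^bsub>A\<^esub>"] by (simp add: \<iota>_def)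
  qed (use \<iota>c in simp)
  define \<psi> where "\<psi> p = \<phi> (fst p) \<otimes>\<^bsub>A\<^esub> proj (snd p)" for p
  have \<psi>m: "\<psi> (g \<otimes>\<^bsub>kB\<^esub> g') = \<psi> g \<otimes>\<^bsub>A\<^esub> \<psi> g'" if gg: "g \<in> carrier kB" "g' \<in> carrier kB" for g g'
  proof -
    obtain a b a' b' where g: "g = (a, b)" "g' = (a', b')" "a \<in> carrier k" "b \<in> carrier B" "a' \<in> carrier k" "b' \<in> carrier B"
      using gg by auto
    have "\<psi> g \<otimes>\<^bsub>A\<^esub> \<psi> g' = \<phi> a \<otimes>\<^bsub>A\<^esub> (proj b \<otimes>\<^bsub>A\<^esub> (\<phi> a' \<otimes>\<^bsub>A\<^esub> proj b'))" using g by (simp add: \<psi>_def A.m_assoc)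
    also have "\<dots> = \<phi> a \<otimes>\<^bsub>A\<^esub> (\<phi> a' \<otimes>\<^bsub>A\<^esub> (proj b \<otimes>\<^bsub>A\<^esub> proj b'))"
      using g A.left_commute_\<phi>[of a' "proj b" "proj b'"] by simp
    also have "\<dots> = \<psi> (g \<otimes>\<^bsub>kB\<^esub> g')" using g by (simp add: \<psi>_def A.\<phi>_mult A.m_assoc)
    finally show ?thesis by simp
  qed
  have \<psi>c: "\<psi> g \<in> carrier A" if "g \<in> carrier kB" for g using that by (auto simp: \<psi>_def)
  obtain G where G: "G \<in> ring_hom PT A" "\<And>r g. r \<in> carrier \<Z> \<Longrightarrow> g \<in> carrier kB \<Longrightarrow> G (term_of \<Z> r g) = \<iota> r \<otimes>\<^bsub>A\<^esub> \<psi> g"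
  proof (rule PT.S_ext[OF A.ring_axioms \<iota>_hom, where \<psi> = \<psi>])
    show "\<psi> \<one>\<^bsub>kB\<^esub> = \<one>\<^bsub>A\<^esub>" by (simp add: \<psi>_def)
    show "\<psi> g \<otimes>\<^bsub>A\<^esub> \<iota> r = \<iota> r \<otimes>\<^bsub>A\<^esub> \<psi> g" if "g \<in> carrier kB" for g r using \<iota>l \<iota>r \<psi>c[OF that] by simp
  qed (use \<psi>c \<psi>m in auto)
  have Ge: "G (eT a b) = \<phi> a \<otimes>\<^bsub>A\<^esub> proj b" if "a \<in> carrier k" "b \<in> carrier B" for a b
    using G(2)[of 1 "(a, b)"] ring_hom_one[OF \<iota>_hom] that by (simp add: \<psi>_def)
  have z: "G r = \<zero>\<^bsub>A\<^esub>" if "r \<in> tensor_relators" for r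
    using that unfolding tensor_relators_def
  proof (elim UnE CollectE exE conjE)
    fix a a' b assume ab: "a \<in> carrier k" "a' \<in> carrier k" "b \<in> carrier B" "r = eT (a \<oplus>\<^bsub>k\<^esub> a') b \<ominus>\<^bsub>PT\<^esub> (eT a b \<oplus>\<^bsub>PT\<^esub> eT a' b)"
    show ?thesis unfolding ab(4) using ab(1-3)
      by (intro ring_hom_minus_zero[OF PT.ring_axioms A.ring_axioms G(1)])
        (simp_all add: ring_hom_add[OF G(1)] Ge A.\<phi>_add A.l_distr)
  next
    fix a b b' assume ab: "a \<in> carrier k" "b \<in> carrier B" "b' \<in> carrier B" "r = eT a (b \<oplus>\<^bsub>B\<^esub> b') \<ominus>\<^bsub>PT\<^esub> (eT a b \<oplus>\<^bsub>PT\<^esub> eT a b')"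
    show ?thesis unfolding ab(4) using ab(1-3)
      by (intro ring_hom_minus_zero[OF PT.ring_axioms A.ring_axioms G(1)])
        (simp_all add: ring_hom_add[OF G(1)] Ge A.r_distr)
  next
    fix a b z assume ab: "a \<in> carrier k" "b \<in> carrier B" "z \<in> carrier (qtZ K q)" "r = eT (a \<otimes>\<^bsub>k\<^esub> res z) b \<ominus>\<^bsub>PT\<^esub> eT a (z \<otimes>\<^bsub>B\<^esub> b)"
    show ?thesis unfolding ab(4) using ab(1-3)
      by (intro ring_hom_minus_zero[OF PT.ring_axioms A.ring_axioms G(1)])
        (simp_all add: Ge A.\<phi>_mult \<phi>_res A.m_assoc)
  qed
  obtain f where f: "f \<in> ring_hom (PT Quot genideal PT tensor_relators) A"
    "\<And>x. x \<in> carrier PT \<Longrightarrow> f (genideal PT tensor_relators +>\<^bsub>PT\<^esub> x) = G x"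
    using genideal_hom_lift[OF PT.ring_axioms A.ring_axioms G(1) tensor_relators_closed z] by metis
  have f1: "f \<in> ring_hom TT A" using f(1) by (simp add: tensor_algebra_def TI_eq)
  have fpt: "f (pt a b) = \<phi> a \<otimes>\<^bsub>A\<^esub> proj b" if "a \<in> carrier k" "b \<in> carrier B" for a b
    using f(2)[OF eT_closed[OF that]] Ge[OF that] by (simp add: pt_eq tproj_def TI_eq)
  have "f \<in> alg_iso k TT (\<lambda>c. pt c \<one>\<^bsub>B\<^esub>) A \<phi>"
    by (rule alg_iso_of_basis[OF TT.falgebra_axioms A.falgebra_axioms f1, where b = basT and b' = bas and I = I2])
      (use basT_closed TT_span A_indep in \<open>simp_all add: A_span fpt basT_def bas_def\<close>)
  from alg_iso_sym[OF TT.falgebra_axioms this] show ?thesis by blast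
qed

end

section \<open>Double sums, rescaled families and powers of h\<close>

lemma (in abelian_monoid) finsum_prod:
  assumes "finite I" "finite J" "\<And>i j. i \<in> I \<Longrightarrow> j \<in> J \<Longrightarrow> f (i, j) \<in> carrier G"
  shows "finsum G f (I \<times> J) = (\<Oplus>\<^bsub>G\<^esub>j\<in>J. \<Oplus>\<^bsub>G\<^esub>i\<in>I. f (i, j))"
  using assms(2,3)
proof (induction J)
  case empty then show ?case by simp
next
  case (insert j J)
  have e: "I \<times> insert j J = (\<lambda>i. (i, j)) ` I \<union> I \<times> J" by auto
  have c: "(\<lambda>i. f (i, j')) \<in> I \<rightarrow> carrier G" if "j' \<in> insert j J" for j' using insert.prems that by auto
  have "finsum G f (I \<times> insert j J) = finsum G f ((\<lambda>i. (i, j)) ` I) \<oplus>\<^bsub>G\<^esub> finsum G f (I \<times> J)"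
    unfolding e using assms(1) insert by (intro finsum_Un_disjoint) auto
  also have "finsum G f ((\<lambda>i. (i, j)) ` I) = (\<Oplus>\<^bsub>G\<^esub>i\<in>I. f (i, j))"
    using insert.prems by (intro finsum_reindex) (auto simp: inj_on_def)
  also have "finsum G f (I \<times> J) = (\<Oplus>\<^bsub>G\<^esub>j\<in>J. \<Oplus>\<^bsub>G\<^esub>i\<in>I. f (i, j))" using insert by auto
  also have "(\<Oplus>\<^bsub>G\<^esub>i\<in>I. f (i, j)) \<oplus>\<^bsub>G\<^esub> (\<Oplus>\<^bsub>G\<^esub>j\<in>J. \<Oplus>\<^bsub>G\<^esub>i\<in>I. f (i, j)) = (\<Oplus>\<^bsub>G\<^esub>j\<in>insert j J. \<Oplus>\<^bsub>G\<^esub>i\<in>I. f (i, j))"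
    using insert.hyps c by (intro finsum_insert[symmetric]) (auto intro!: finsum_closed)
  finally show ?case .
qed

context falgebra begin

lemma lincomb_scale:
  assumes "b \<in> I \<rightarrow> carrier A" "u \<in> I \<rightarrow> carrier F" "c \<in> I \<rightarrow> carrier F"
  shows "lincomb A \<phi> I (\<lambda>p. \<phi> (u p) \<otimes> b p) c = lincomb A \<phi> I b (\<lambda>p. c p \<otimes>\<^bsub>F\<^esub> u p)"
  unfolding lincomb_def using assms by (intro finsum_cong') (auto simp: Pi_iff \<phi>_mult m_assoc)

text \<open>Serves the automorphism \<sigma> of E(s), which multiplies h^i by q^i: nonzero factors
  can be moved into the coefficients without creating or destroying zeros.\<close>

lemma lindep_scale:
  assumes "b \<in> I \<rightarrow> carrier A" "u \<in> I \<rightarrow> carrier F" "\<And>p. p \<in> I \<Longrightarrow> u p \<noteq> \<zero>\<^bsub>F\<^esub>" "lindep F A \<phi> I b"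
  shows "lindep F A \<phi> I (\<lambda>p. \<phi> (u p) \<otimes> b p)"
  unfolding lindep_def
proof (intro allI impI ballI)
  fix c p assume c: "c \<in> I \<rightarrow> carrier F" and 0: "lincomb A \<phi> I (\<lambda>p. \<phi> (u p) \<otimes> b p) c = \<zero>" and p: "p \<in> I"
  have "(\<lambda>p. c p \<otimes>\<^bsub>F\<^esub> u p) \<in> I \<rightarrow> carrier F" using c assms(2) by auto
  then have "c p \<otimes>\<^bsub>F\<^esub> u p = \<zero>\<^bsub>F\<^esub>"
    using assms(4) 0 p unfolding lincomb_scale[OF assms(1,2) c] lindep_def by blast
  moreover have "c p \<in> carrier F" "u p \<in> carrier F" using c assms(2) p by auto
  ultimately show "c p = \<zero>\<^bsub>F\<^esub>" using F.integral assms(3)[OF p] by blast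
qed

lemma lspan_scale:
  assumes "finite I" "b \<in> I \<rightarrow> carrier A" "u \<in> I \<rightarrow> carrier F" "\<And>p. p \<in> I \<Longrightarrow> u p \<noteq> \<zero>\<^bsub>F\<^esub>"
  shows "lspan F A \<phi> I b \<subseteq> lspan F A \<phi> I (\<lambda>p. \<phi> (u p) \<otimes> b p)"
proof
  let ?b = "\<lambda>p. \<phi> (u p) \<otimes> b p"
  have b': "?b \<in> I \<rightarrow> carrier A" using assms(2,3) by (auto simp: Pi_iff)
  have "b p \<in> lspan F A \<phi> I ?b" if p: "p \<in> I" for p
  proof -
    have u: "u p \<in> carrier F" "inv\<^bsub>F\<^esub> u p \<in> carrier F" "inv\<^bsub>F\<^esub> u p \<otimes>\<^bsub>F\<^esub> u p = \<one>\<^bsub>F\<^esub>"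
    proof -
      have "u p \<in> carrier F" using assms(3) p by blast
      then show "u p \<in> carrier F" "inv\<^bsub>F\<^esub> u p \<in> carrier F" "inv\<^bsub>F\<^esub> u p \<otimes>\<^bsub>F\<^esub> u p = \<one>\<^bsub>F\<^esub>"
        using assms(4)[OF p] F.field_Units by auto
    qed
    have bp: "b p \<in> carrier A" using assms(2) p by blast
    have "\<phi> (inv\<^bsub>F\<^esub> u p) \<otimes> ?b p = (\<phi> (inv\<^bsub>F\<^esub> u p) \<otimes> \<phi> (u p)) \<otimes> b p" using u(1,2) bp by (simp add: m_assoc)
    also have "\<dots> = b p" using u bp by (simp flip: \<phi>_mult)
    finally show ?thesis using lspan_smult[OF assms(1) b' lspan_base[OF assms(1) b' p] u(2)] by simp
  qed
  then show "y \<in> lspan F A \<phi> I ?b" if "y \<in> lspan F A \<phi> I b" for y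
    using that lspan_lincomb[OF assms(1) b' assms(1), of b] unfolding lspan_def[of _ _ _ _ b] by auto
qed

text \<open>The powers of h are the members of the family with x-exponent 0. Extending coefficients
  by zero turns a relation among them into one of the whole family.\<close>

lemma lindep_row:
  fixes n :: nat
  assumes "h \<in> carrier A" "x \<in> carrier A" "0 < n" and l: "lindep F A \<phi> ({..<n} \<times> {..<n}) (\<lambda>p. h [^] fst p \<otimes> x [^] snd p)"
  shows "lindep F A \<phi> {..<n} (\<lambda>i. h [^] i)"
  unfolding lindep_def
proof (intro allI impI ballI)
  fix c i assume c: "c \<in> {..<n} \<rightarrow> carrier F" and 0: "lincomb A \<phi> {..<n} (\<lambda>i. h [^] i) c = \<zero>" and i: "i \<in> {..<n}"
  let ?c = "\<lambda>p :: nat \<times> nat. if snd p = 0 then c (fst p) else \<zero>\<^bsub>F\<^esub>"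
  let ?f = "\<lambda>p :: nat \<times> nat. \<phi> (?c p) \<otimes> (h [^] fst p \<otimes> x [^] snd p)"
  have c': "?c \<in> {..<n} \<times> {..<n} \<rightarrow> carrier F" using c by auto
  have "finsum A ?f ({..<n} \<times> {..<n}) = finsum A ?f ((\<lambda>i. (i, 0::nat)) ` {..<n})"
    by (rule add.finprod_mono_neutral_cong_left[symmetric]) (use assms c in \<open>auto simp: Pi_iff\<close>)
  also have "\<dots> = (\<Oplus>i\<in>{..<n}. ?f (i, 0))"
    using assms c by (intro finsum_reindex) (auto simp: inj_on_def Pi_iff)
  also have "\<dots> = \<zero>" using 0 assms c by (simp add: lincomb_def)
  finally have "lincomb A \<phi> ({..<n} \<times> {..<n}) (\<lambda>p. h [^] fst p \<otimes> x [^] snd p) ?c = \<zero>"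
    by (simp add: lincomb_def)
  then have "?c (i, 0) = \<zero>\<^bsub>F\<^esub>" using l c' i assms(3) unfolding lindep_def by blast
  then show "c i = \<zero>\<^bsub>F\<^esub>" by simp
qed

lemma pow_lspan:
  fixes n i :: nat
  assumes h: "h \<in> carrier A" "h [^] n = \<phi> s" "s \<in> carrier F" and n: "0 < n"
  shows "h [^] i \<in> lspan F A \<phi> {..<n} (\<lambda>i. h [^] i)"
proof -
  have b: "(\<lambda>i. h [^] i) \<in> {..<n} \<rightarrow> carrier A" using h by auto
  have s: "h [^] (n * d) = \<phi> (s [^]\<^bsub>F\<^esub> d)" for d
    using h by (simp add: ring_hom_pow[OF F.ring_axioms A.ring_axioms \<phi>_hom] flip: nat_pow_pow)
  have "h [^] i = h [^] (n * (i div n)) \<otimes> h [^] (i mod n)" using h(1) by (simp add: nat_pow_mult)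
  also have "\<dots> = \<phi> (s [^]\<^bsub>F\<^esub> (i div n)) \<otimes> h [^] (i mod n)" by (simp add: s)
  finally show ?thesis
    using lspan_smult[OF _ b lspan_base[OF _ b, of "i mod n"], of "s [^]\<^bsub>F\<^esub> (i div n)"] h n by simp
qed

end

text \<open>The condition \<open>s \<noteq> \<zero>\<close> reflects that h is a unit: with s = 0 a
  unit of the Laurent ring would become nilpotent and the Laurent quotient would vanish.\<close>

locale radical = F: field F for F :: "('f, 'b) ring_scheme" +
  fixes n :: nat and s :: 'f
  assumes s: "s \<in> carrier F" "s \<noteq> \<zero>\<^bsub>F\<^esub>" and n: "0 < n"
begin

subsection \<open>Laurent polynomials modulo \<open>h\<^sup>n - s\<close>\<close>

abbreviation "LF \<equiv> laurent F"
abbreviation "LI \<equiv> laurent_radical_ideal F n s"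
abbreviation "LA \<equiv> laurent_radical_algebra F n s"
abbreviation "lsc \<equiv> laurent_radical_scalar F n s"
abbreviation "lh \<equiv> laurent_radical_h F n s"
abbreviation "TL \<equiv> term_of F :: 'f \<Rightarrow> int \<Rightarrow> _"

sublocale LF: skew_monoid F integer_group "\<lambda>g r. r"
  rewrites "skew_monoid_ring F integer_group (\<lambda>g r. r) = laurent F"
  by (auto simp: laurent_def intro!: monoid_ring_locale F.ring_axioms group.is_monoid)

sublocale LF: cring LF
  by (rule LF.S_cring) (auto intro: F.is_cring comm_group.axioms(1) abelian_integer_group)

lemma LI_eq: "LI = genideal LF {TL \<one>\<^bsub>F\<^esub> (int n) \<ominus>\<^bsub>LF\<^esub> TL s 0}"
  by (simp add: laurent_radical_ideal_def)

lemma L_relator_closed: "{TL \<one>\<^bsub>F\<^esub> (int n) \<ominus>\<^bsub>LF\<^esub> TL s 0} \<subseteq> carrier LF"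
  using s by simp

sublocale LI: ideal LI LF
  unfolding LI_eq by (rule LF.genideal_ideal[OF L_relator_closed])

sublocale LA: cring LA
  unfolding laurent_radical_algebra_def by (rule LI.quotient_is_cring[OF LF.is_cring])

definition lproj :: "(int \<Rightarrow> 'f) \<Rightarrow> (int \<Rightarrow> 'f) set" where "lproj f = LI +>\<^bsub>LF\<^esub> f"

lemma lproj_hom: "lproj \<in> ring_hom LF LA"
proof -
  have "lproj = (+>\<^bsub>LF\<^esub>) LI" by (auto simp: lproj_def)
  then show ?thesis unfolding laurent_radical_algebra_def using LI.rcos_ring_hom by simp
qed

lemma lproj_simps: "f \<in> carrier LF \<Longrightarrow> lproj f \<in> carrier LA"
  "f \<in> carrier LF \<Longrightarrow> g \<in> carrier LF \<Longrightarrow> lproj (f \<oplus>\<^bsub>LF\<^esub> g) = lproj f \<oplus>\<^bsub>LA\<^esub> lproj g"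
  "f \<in> carrier LF \<Longrightarrow> g \<in> carrier LF \<Longrightarrow> lproj (f \<otimes>\<^bsub>LF\<^esub> g) = lproj f \<otimes>\<^bsub>LA\<^esub> lproj g" "lproj \<one>\<^bsub>LF\<^esub> = \<one>\<^bsub>LA\<^esub>"
  "lproj \<zero>\<^bsub>LF\<^esub> = \<zero>\<^bsub>LA\<^esub>"
  using ring_hom_closed[OF lproj_hom] ring_hom_add[OF lproj_hom] ring_hom_mult[OF lproj_hom] ring_hom_one[OF lproj_hom]
    ring_hom_zero[OF lproj_hom LF.ring_axioms LA.ring_axioms] by auto

lemma LA_gens: "lsc c = lproj (TL c 0)" "lh = lproj (TL \<one>\<^bsub>F\<^esub> 1)"
  by (simp_all add: lproj_def laurent_radical_scalar_def laurent_radical_h_def)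

lemma lh_closed [simp]: "lh \<in> carrier LA"
  by (simp add: LA_gens lproj_simps)

lemma LA_surj: "y \<in> carrier LA \<Longrightarrow> \<exists>f\<in>carrier LF. y = lproj f"
  unfolding laurent_radical_algebra_def lproj_def by (elim quot_surj) auto

sublocale LA: falgebra F LA lsc
proof
  show "lsc \<in> ring_hom F LA"
    by (rule ring_hom_memI)
      (simp_all add: LA_gens LF.T_mult LF.T_add LF.S_one lproj_simps flip: lproj_simps(2-4))
  then show "lsc c \<otimes>\<^bsub>LA\<^esub> a = a \<otimes>\<^bsub>LA\<^esub> lsc c" if "c \<in> carrier F" "a \<in> carrier LA" for c a
    using that by (intro LA.m_comm) (auto intro: ring_hom_closed)
qed

lemma lproj_term: "r \<in> carrier F \<Longrightarrow> lproj (TL r i) = lsc r \<otimes>\<^bsub>LA\<^esub> lproj (TL \<one>\<^bsub>F\<^esub> i)"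
  by (simp add: LA_gens LF.T_mult flip: lproj_simps(3))

lemma lproj_pow: "lproj (TL \<one>\<^bsub>F\<^esub> (int i)) = lh [^]\<^bsub>LA\<^esub> i"
proof (induction i)
  case 0 then show ?case by (simp add: LF.S_one flip: lproj_simps(4))
next
  case (Suc i)
  have "TL \<one>\<^bsub>F\<^esub> (int (Suc i)) = TL \<one>\<^bsub>F\<^esub> (int i) \<otimes>\<^bsub>LF\<^esub> TL \<one>\<^bsub>F\<^esub> 1" by (simp add: LF.T_mult add.commute)
  then show ?case using Suc by (simp add: lproj_simps LA_gens(2))
qed

lemma lproj_n: "lproj (TL \<one>\<^bsub>F\<^esub> (int n)) = lsc s" "lh [^]\<^bsub>LA\<^esub> n = lsc s"
proof -
  show "lproj (TL \<one>\<^bsub>F\<^esub> (int n)) = lsc s"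
    unfolding LA_gens lproj_def using LF.genideal_self[OF L_relator_closed] s
    by (intro quot_eqI[OF LI.ideal_axioms]) (auto simp: LI_eq)
  then show "lh [^]\<^bsub>LA\<^esub> n = lsc s" using lproj_pow by simp
qed

text \<open>The scalar is s^d. The induction runs in both directions, and the downward step divides
  by s.\<close>

lemma lproj_n_mult: "\<exists>u\<in>carrier F. lproj (TL \<one>\<^bsub>F\<^esub> (int n * d)) = lsc u"
proof (induction d rule: int_induct[where k = 0])
  case base
  then show ?case by (auto simp: LA_gens)
next
  case (step1 d)
  then obtain u where u: "u \<in> carrier F" "lproj (TL \<one>\<^bsub>F\<^esub> (int n * d)) = lsc u" by blast
  have "TL \<one>\<^bsub>F\<^esub> (int n * (d + 1)) = TL \<one>\<^bsub>F\<^esub> (int n * d) \<otimes>\<^bsub>LF\<^esub> TL \<one>\<^bsub>F\<^esub> (int n)"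
    by (simp add: LF.T_mult algebra_simps)
  then have "lproj (TL \<one>\<^bsub>F\<^esub> (int n * (d + 1))) = lsc (u \<otimes>\<^bsub>F\<^esub> s)"
    using u s by (simp add: lproj_simps lproj_n LA.\<phi>_mult)
  then show ?case using u s by blast
next
  case (step2 d)
  then obtain u where u: "u \<in> carrier F" "lproj (TL \<one>\<^bsub>F\<^esub> (int n * d)) = lsc u" by blast
  have si: "inv\<^bsub>F\<^esub> s \<in> carrier F" "s \<otimes>\<^bsub>F\<^esub> inv\<^bsub>F\<^esub> s = \<one>\<^bsub>F\<^esub>" using s F.field_Units by auto
  let ?y = "lproj (TL \<one>\<^bsub>F\<^esub> (int n * (d - 1)))"
  have y: "?y \<in> carrier LA" by (simp add: lproj_simps)
  have "TL \<one>\<^bsub>F\<^esub> (int n * d) = TL \<one>\<^bsub>F\<^esub> (int n * (d - 1)) \<otimes>\<^bsub>LF\<^esub> TL \<one>\<^bsub>F\<^esub> (int n)"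
    by (simp add: LF.T_mult algebra_simps)
  then have "lsc u = ?y \<otimes>\<^bsub>LA\<^esub> lsc s" using u(2) by (simp add: lproj_simps lproj_n)
  then have "lsc u \<otimes>\<^bsub>LA\<^esub> lsc (inv\<^bsub>F\<^esub> s) = ?y \<otimes>\<^bsub>LA\<^esub> (lsc s \<otimes>\<^bsub>LA\<^esub> lsc (inv\<^bsub>F\<^esub> s))"
    using y s si by (simp add: LA.m_assoc)
  then have "?y = lsc (u \<otimes>\<^bsub>F\<^esub> inv\<^bsub>F\<^esub> s)" using y s si u by (simp flip: LA.\<phi>_mult)
  then show ?case using u si by blast
qed

lemma lpow_closed: "(\<lambda>i. lh [^]\<^bsub>LA\<^esub> i) \<in> {..<n} \<rightarrow> carrier LA" by simp

lemma LA_span: "carrier LA \<subseteq> lspan F LA lsc {..<n} (\<lambda>i. lh [^]\<^bsub>LA\<^esub> i)"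
proof
  let ?V = "lspan F LA lsc {..<n} (\<lambda>i. lh [^]\<^bsub>LA\<^esub> i)"
  note V = LA.lspan_zero[OF _ lpow_closed] LA.lspan_add[OF _ lpow_closed] LA.lspan_smult[OF _ lpow_closed] LA.lspan_base[OF _ lpow_closed]
  have T: "lproj (TL r i) \<in> ?V" if r: "r \<in> carrier F" for r i
  proof -
    obtain u where u: "u \<in> carrier F" "lproj (TL \<one>\<^bsub>F\<^esub> (int n * (i div int n))) = lsc u" using lproj_n_mult by blast
    have "0 \<le> i mod int n" "i mod int n < int n" using n by simp_all
    then obtain l where l: "i mod int n = int l" "l < n" by (metis nonneg_int_cases of_nat_less_iff)
    have "TL \<one>\<^bsub>F\<^esub> i = TL \<one>\<^bsub>F\<^esub> (int n * (i div int n)) \<otimes>\<^bsub>LF\<^esub> TL \<one>\<^bsub>F\<^esub> (int l)"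
      by (simp add: LF.T_mult flip: l(1))
    then have "lproj (TL \<one>\<^bsub>F\<^esub> i) = lsc u \<otimes>\<^bsub>LA\<^esub> lh [^]\<^bsub>LA\<^esub> l" by (simp add: lproj_simps u(2) lproj_pow)
    then have "lproj (TL r i) = lsc r \<otimes>\<^bsub>LA\<^esub> (lsc u \<otimes>\<^bsub>LA\<^esub> lh [^]\<^bsub>LA\<^esub> l)" using lproj_term[OF r, of i] by simp
    then show ?thesis using V(3)[OF _ V(3)[OF _ V(4)[of l]]] u(1) r l(2) by simp
  qed
  fix y assume "y \<in> carrier LA"
  then obtain f where f: "f \<in> carrier LF" "y = lproj f" using LA_surj by blast
  from f(1) have "lproj f \<in> ?V"
  proof (induction f rule: LF.S_term_induct)
    case zero then show ?case using V by (simp add: lproj_simps)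
  next
    case (add r g f)
    then show ?case using V T by (simp add: lproj_simps)
  qed
  then show "y \<in> ?V" using f(2) by simp
qed

text \<open>p lists all integer powers of the image of h; prescribing them as a multiplicative
  function on the integers encodes that this image is invertible.\<close>

lemma LA_lift:
  assumes S: "falgebra F S \<psi>" and p: "\<And>i. p i \<in> carrier S" "p 0 = \<one>\<^bsub>S\<^esub>" "\<And>i j. p (i + j) = p i \<otimes>\<^bsub>S\<^esub> p j" "p (int n) = \<psi> s"
  obtains f where "f \<in> ring_hom LA S" "\<And>c. c \<in> carrier F \<Longrightarrow> f (lsc c) = \<psi> c" "f lh = p 1"
proof -
  interpret S: falgebra F S \<psi> by fact
  obtain g where g: "g \<in> ring_hom LF S" "\<And>r i. r \<in> carrier F \<Longrightarrow> i \<in> carrier integer_group \<Longrightarrow> g (TL r i) = \<psi> r \<otimes>\<^bsub>S\<^esub> p i"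
    by (rule LF.S_ext[OF S.ring_axioms S.\<phi>_hom, where \<psi> = p]) (simp_all add: p S.\<phi>_central)
  have z: "g r = \<zero>\<^bsub>S\<^esub>" if "r \<in> {TL \<one>\<^bsub>F\<^esub> (int n) \<ominus>\<^bsub>LF\<^esub> TL s 0}" for r
    using that s p by (auto intro!: ring_hom_minus_zero[OF LF.ring_axioms S.ring_axioms g(1)] simp: g(2))
  obtain f where f: "f \<in> ring_hom (LF Quot genideal LF {TL \<one>\<^bsub>F\<^esub> (int n) \<ominus>\<^bsub>LF\<^esub> TL s 0}) S"
    "\<And>x. x \<in> carrier LF \<Longrightarrow> f (genideal LF {TL \<one>\<^bsub>F\<^esub> (int n) \<ominus>\<^bsub>LF\<^esub> TL s 0} +>\<^bsub>LF\<^esub> x) = g x"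
    using genideal_hom_lift[OF LF.ring_axioms S.ring_axioms g(1) L_relator_closed z] by metis
  have f2: "f (lproj x) = g x" if "x \<in> carrier LF" for x using f(2) that by (simp add: lproj_def LI_eq)
  show thesis
  proof (rule that)
    show "f \<in> ring_hom LA S" using f(1) by (simp add: laurent_radical_algebra_def LI_eq)
    show "f (lsc c) = \<psi> c" if "c \<in> carrier F" for c using that p by (simp add: LA_gens f2 g(2))
    show "f lh = p 1" using p by (simp add: LA_gens f2 g(2))
  qed
qed

subsection \<open>Polynomials modulo \<open>h\<^sup>n - s\<close>\<close>

abbreviation "UF \<equiv> UP F"
abbreviation "RI \<equiv> radical_ideal F n s"
abbreviation "RA \<equiv> radical_algebra F n s"
abbreviation "rsc \<equiv> radical_scalar F n s"
abbreviation "rh \<equiv> radical_h F n s"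
abbreviation "mn \<equiv> up_ring.monom (UP F)"

sublocale UF: UP_cring F UF
  by (simp_all add: UP_cring_def F.is_cring)

lemma RI_eq: "RI = genideal UF {mn \<one>\<^bsub>F\<^esub> n \<ominus>\<^bsub>UF\<^esub> mn s 0}"
  by (simp add: radical_ideal_def)

lemma R_relator_closed: "{mn \<one>\<^bsub>F\<^esub> n \<ominus>\<^bsub>UF\<^esub> mn s 0} \<subseteq> carrier UF"
  using s by simp

sublocale RI: ideal RI UF
  unfolding RI_eq by (rule UF.P.genideal_ideal[OF R_relator_closed])

sublocale RA: cring RA
  unfolding radical_algebra_def by (rule RI.quotient_is_cring[OF UF.P.is_cring])

definition rproj :: "(nat \<Rightarrow> 'f) \<Rightarrow> (nat \<Rightarrow> 'f) set" where "rproj f = RI +>\<^bsub>UF\<^esub> f"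

lemma rproj_hom: "rproj \<in> ring_hom UF RA"
proof -
  have "rproj = (+>\<^bsub>UF\<^esub>) RI" by (auto simp: rproj_def)
  then show ?thesis unfolding radical_algebra_def using RI.rcos_ring_hom by simp
qed

lemma rproj_simps: "f \<in> carrier UF \<Longrightarrow> rproj f \<in> carrier RA"
  "f \<in> carrier UF \<Longrightarrow> g \<in> carrier UF \<Longrightarrow> rproj (f \<oplus>\<^bsub>UF\<^esub> g) = rproj f \<oplus>\<^bsub>RA\<^esub> rproj g"
  "f \<in> carrier UF \<Longrightarrow> g \<in> carrier UF \<Longrightarrow> rproj (f \<otimes>\<^bsub>UF\<^esub> g) = rproj f \<otimes>\<^bsub>RA\<^esub> rproj g" "rproj \<one>\<^bsub>UF\<^esub> = \<one>\<^bsub>RA\<^esub>"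
  "rproj \<zero>\<^bsub>UF\<^esub> = \<zero>\<^bsub>RA\<^esub>"
  using ring_hom_closed[OF rproj_hom] ring_hom_add[OF rproj_hom] ring_hom_mult[OF rproj_hom] ring_hom_one[OF rproj_hom]
    ring_hom_zero[OF rproj_hom UF.P.ring_axioms RA.ring_axioms] by auto

lemma RA_gens: "rsc c = rproj (mn c 0)" "rh = rproj (mn \<one>\<^bsub>F\<^esub> 1)"
  by (simp_all add: rproj_def radical_scalar_def radical_h_def)

lemma rh_closed [simp]: "rh \<in> carrier RA"
  by (simp add: RA_gens rproj_simps)

sublocale RA: falgebra F RA rsc
proof
  have "rsc = rproj \<circ> (\<lambda>c. mn c 0)" by (auto simp: RA_gens)
  then show "rsc \<in> ring_hom F RA" using ring_hom_trans[OF UF.const_ring_hom rproj_hom] by simp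
  then show "rsc c \<otimes>\<^bsub>RA\<^esub> a = a \<otimes>\<^bsub>RA\<^esub> rsc c" if "c \<in> carrier F" "a \<in> carrier RA" for c a
    using that by (intro RA.m_comm) (auto intro: ring_hom_closed)
qed

lemma rproj_monom: "r \<in> carrier F \<Longrightarrow> rproj (mn r i) = rsc r \<otimes>\<^bsub>RA\<^esub> rh [^]\<^bsub>RA\<^esub> i"
proof -
  assume r: "r \<in> carrier F"
  have "mn r i = mn r 0 \<otimes>\<^bsub>UF\<^esub> mn \<one>\<^bsub>F\<^esub> 1 [^]\<^bsub>UF\<^esub> i"
    using r UF.monom_pow[of "\<one>\<^bsub>F\<^esub>" 1 i] UF.monom_mult[of r "\<one>\<^bsub>F\<^esub>" 0 i] by simp
  then show ?thesis using r by (simp add: rproj_simps RA_gens ring_hom_pow[OF UF.P.ring_axioms RA.ring_axioms rproj_hom])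
qed

lemma rh_n: "rh [^]\<^bsub>RA\<^esub> n = rsc s"
proof -
  have "rproj (mn \<one>\<^bsub>F\<^esub> n) = rsc s"
    unfolding RA_gens(1) rproj_def using UF.P.genideal_self[OF R_relator_closed] s
    by (intro quot_eqI[OF RI.ideal_axioms]) (auto simp: RI_eq)
  then show ?thesis using rproj_monom[of "\<one>\<^bsub>F\<^esub>" n] by simp
qed

lemma RA_induct [consumes 1, case_names zero add monom]:
  assumes "y \<in> carrier RA" "P \<zero>\<^bsub>RA\<^esub>" "\<And>y z. y \<in> carrier RA \<Longrightarrow> z \<in> carrier RA \<Longrightarrow> P y \<Longrightarrow> P z \<Longrightarrow> P (y \<oplus>\<^bsub>RA\<^esub> z)"
    "\<And>r (i::nat). r \<in> carrier F \<Longrightarrow> P (rsc r \<otimes>\<^bsub>RA\<^esub> rh [^]\<^bsub>RA\<^esub> i)"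
  shows "P y"
proof -
  obtain f where f: "f \<in> carrier UF" "y = rproj f"
    using assms(1) unfolding radical_algebra_def rproj_def by (elim quot_surj) auto
  let ?t = "\<lambda>i. mn (up_ring.coeff UF f i) i"
  have t: "?t i \<in> carrier UF" for i using f(1) by simp
  have "P (rproj (finsum UF ?t {..d}))" for d
  proof (induction d)
    case 0
    then show ?case using t f(1) assms(4)[of "up_ring.coeff UF f 0" 0] by (simp add: rproj_monom)
  next
    case (Suc d)
    have "finsum UF ?t {..Suc d} = ?t (Suc d) \<oplus>\<^bsub>UF\<^esub> finsum UF ?t {..d}" using t by (intro UF.P.finsum_Suc) auto
    moreover have "finsum UF ?t {..d} \<in> carrier UF" using t by (intro UF.P.finsum_closed) auto
    ultimately show ?case using Suc t f(1) assms(4)[of "up_ring.coeff UF f (Suc d)" "Suc d"] assms(3)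
      by (simp add: rproj_simps rproj_monom del: UF.P.finsum_Suc)
  qed
  then show ?thesis using UF.up_repr[OF f(1)] f(2) by metis
qed

lemma rpow_closed: "(\<lambda>i. rh [^]\<^bsub>RA\<^esub> i) \<in> {..<n} \<rightarrow> carrier RA" by simp

lemma RA_span: "carrier RA \<subseteq> lspan F RA rsc {..<n} (\<lambda>i. rh [^]\<^bsub>RA\<^esub> i)"
proof
  note V = RA.lspan_zero[OF _ rpow_closed] RA.lspan_add[OF _ rpow_closed] RA.lspan_smult[OF _ rpow_closed]
  fix y assume "y \<in> carrier RA"
  then show "y \<in> lspan F RA rsc {..<n} (\<lambda>i. rh [^]\<^bsub>RA\<^esub> i)"
  proof (induction rule: RA_induct)
    case (monom r i)
    show ?case by (rule V(3)[OF _ RA.pow_lspan[OF rh_closed rh_n s(1) n] monom]) simp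
  qed (simp_all add: V(1,2))
qed

text \<open>Evaluation of polynomials is available for commutative targets. This reaches the Laurent
  quotient and E(s) itself, but not the noncommutative cyclic algebra.\<close>

lemma RA_lift:
  assumes S: "falgebra F S \<psi>" "cring S" and h: "h \<in> carrier S" "h [^]\<^bsub>S\<^esub> n = \<psi> s"
  obtains f where "f \<in> ring_hom RA S" "\<And>c. c \<in> carrier F \<Longrightarrow> f (rsc c) = \<psi> c" "f rh = h"
proof -
  interpret S: falgebra F S \<psi> by fact
  interpret S: cring S by fact
  interpret U: UP_pre_univ_prop F S \<psi> UF
    by (intro UP_pre_univ_prop.intro ring_hom_cring.intro ring_hom_cring_axioms.intro F.is_cring S.is_cring S.\<phi>_hom UF.UP_cring_axioms)
  let ?g = "eval F S \<psi> h"
  have g: "?g \<in> ring_hom UF S" by (rule U.eval_ring_hom[OF h(1)])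
  have gm: "?g (mn r i) = \<psi> r \<otimes>\<^bsub>S\<^esub> h [^]\<^bsub>S\<^esub> i" if "r \<in> carrier F" for r i using U.eval_monom[OF that h(1)] .
  have z: "?g r = \<zero>\<^bsub>S\<^esub>" if "r \<in> {mn \<one>\<^bsub>F\<^esub> n \<ominus>\<^bsub>UF\<^esub> mn s 0}" for r
    using that s h by (auto intro!: ring_hom_minus_zero[OF UF.P.ring_axioms S.ring_axioms g] simp: gm)
  obtain f where f: "f \<in> ring_hom (UF Quot genideal UF {mn \<one>\<^bsub>F\<^esub> n \<ominus>\<^bsub>UF\<^esub> mn s 0}) S"
    "\<And>x. x \<in> carrier UF \<Longrightarrow> f (genideal UF {mn \<one>\<^bsub>F\<^esub> n \<ominus>\<^bsub>UF\<^esub> mn s 0} +>\<^bsub>UF\<^esub> x) = ?g x"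
    using genideal_hom_lift[OF UF.P.ring_axioms S.ring_axioms g R_relator_closed z] by metis
  have f2: "f (rproj x) = ?g x" if "x \<in> carrier UF" for x using f(2) that by (simp add: rproj_def RI_eq)
  show thesis
  proof (rule that)
    show "f \<in> ring_hom RA S" using f(1) by (simp add: radical_algebra_def RI_eq)
    show "f (rsc c) = \<psi> c" if "c \<in> carrier F" for c using that h by (simp add: RA_gens f2 gm)
    show "f rh = h" using h by (simp add: RA_gens f2 gm)
  qed
qed

end

section \<open>E(s) inside the cyclic algebra\<close>

context qtmax begin

text \<open>h^n is a unit of the centre with inverse h^(-n), so its residue is a unit as
  well.\<close>

lemma ks_nonzero: "ks \<noteq> \<zero>\<^bsub>k\<^esub>"
proof
  assume 0: "ks = \<zero>\<^bsub>k\<^esub>"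
  have z: "mon \<one> (int n) 0 \<in> Z" "mon \<one> (- int n) 0 \<in> Z" by (simp_all add: mon_center)
  have "res (mon \<one> (- int n) 0) \<otimes>\<^bsub>k\<^esub> ks = res (mon \<one> (- int n) 0 \<otimes>\<^bsub>B\<^esub> mon \<one> (int n) 0)"
    using z by (simp only: s_eq res_simps)
  also have "\<dots> = \<one>\<^bsub>k\<^esub>" by (simp add: mon_mult flip: B_one)
  finally show False using 0 z k.one_not_zero by simp
qed

sublocale Rd: radical k n ks
  by unfold_locales (simp_all add: ks_nonzero)

lemma A_row_indep: "lindep k A \<phi> {..<n} (\<lambda>i. hA [^]\<^bsub>A\<^esub> i)"
proof -
  have "bas = (\<lambda>p. hA [^]\<^bsub>A\<^esub> fst p \<otimes>\<^bsub>A\<^esub> xA [^]\<^bsub>A\<^esub> snd p)" by (rule ext) (rule bas_hx)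
  then show ?thesis using A_indep A.lindep_row[OF hx_closed n_pos] by simp
qed

text \<open>h is invertible in B, so its integer powers have images in B/Bm. The first n powers are
  independent there and hence already in the Laurent quotient.\<close>

lemma LA_to_A:
  obtains g where "g \<in> ring_hom Rd.LA A" "\<And>c. c \<in> carrier k \<Longrightarrow> g (Rd.lsc c) = \<phi> c" "g Rd.lh = hA"
    "lindep k Rd.LA Rd.lsc {..<n} (\<lambda>i. Rd.lh [^]\<^bsub>Rd.LA\<^esub> i)"
proof -
  obtain g where g: "g \<in> ring_hom Rd.LA A" "\<And>c. c \<in> carrier k \<Longrightarrow> g (Rd.lsc c) = \<phi> c" "g Rd.lh = proj (mon \<one> 1 0)"
  proof (rule Rd.LA_lift[OF A.falgebra_axioms, where p = "\<lambda>i. proj (mon \<one> i 0)"])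
    show "proj (mon \<one> (int n) 0) = \<phi> ks" by (simp only: s_eq) (simp add: \<phi>_res mon_center)
  qed (simp_all add: mon_mult flip: proj_simps(3,4) B_one)
  have gh: "g Rd.lh = hA" using g(3) by (simp only: B_h)
  have l: "lindep k Rd.LA Rd.lsc {..<n} (\<lambda>i. Rd.lh [^]\<^bsub>Rd.LA\<^esub> i)"
    by (rule hom_inj_of_lindep(2)[OF Rd.LA.falgebra_axioms A.falgebra_axioms g(1,2), where b' = "\<lambda>i. hA [^]\<^bsub>A\<^esub> i" and I = "{..<n}"])
      (simp_all add: Rd.LA_span A_row_indep ring_hom_pow[OF Rd.LA.ring_axioms A.ring_axioms g(1)] gh)
  show thesis by (rule that[OF g(1) _ gh l]) (rule g(2))
qed

lemma RA_to_LA: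
  obtains f where "f \<in> alg_iso k Rd.RA Rd.rsc Rd.LA Rd.lsc" "f Rd.rh = Rd.lh"
proof -
  obtain f where f: "f \<in> ring_hom Rd.RA Rd.LA" "\<And>c. c \<in> carrier k \<Longrightarrow> f (Rd.rsc c) = Rd.lsc c" "f Rd.rh = Rd.lh"
    by (rule Rd.RA_lift[OF Rd.LA.falgebra_axioms Rd.LA.is_cring Rd.lh_closed Rd.lproj_n(2)], rule that)
  obtain g where "lindep k Rd.LA Rd.lsc {..<n} (\<lambda>i. Rd.lh [^]\<^bsub>Rd.LA\<^esub> i)"
    using LA_to_A by metis
  then have "f \<in> alg_iso k Rd.RA Rd.rsc Rd.LA Rd.lsc"
    by (intro alg_iso_of_basis[OF Rd.RA.falgebra_axioms Rd.LA.falgebra_axioms f(1,2),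
          where b = "\<lambda>i. Rd.rh [^]\<^bsub>Rd.RA\<^esub> i" and b' = "\<lambda>i. Rd.lh [^]\<^bsub>Rd.LA\<^esub> i" and I = "{..<n}"])
      (simp_all add: Rd.RA_span Rd.LA_span ring_hom_pow[OF Rd.RA.ring_axioms Rd.LA.ring_axioms f(1)] f(3))
  then show thesis using that f(3) by blast
qed

text \<open>The noncommutative target is reached through the Laurent quotient and B/Bm. The
  composite sends h^i to h^i, so independence of these powers in the cyclic algebra yields
  injectivity and their independence in E(s).\<close>

lemma RA_to_C:
  obtains \<iota> where "\<iota> \<in> ring_hom Rd.RA C.C" "\<And>c. c \<in> carrier k \<Longrightarrow> \<iota> (Rd.rsc c) = C.csc c" "\<iota> Rd.rh = C.hC"
    "inj_on \<iota> (carrier Rd.RA)" "lindep k Rd.RA Rd.rsc {..<n} (\<lambda>i. Rd.rh [^]\<^bsub>Rd.RA\<^esub> i)"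
proof -
  obtain \<psi> where \<psi>: "\<psi> \<in> canonical_isos K q n m" using canonical_isos_nonempty by blast
  then have \<psi>h: "\<psi> \<in> ring_hom A C.C" "\<And>c. c \<in> carrier k \<Longrightarrow> \<psi> (\<phi> c) = C.csc c" "\<psi> hA = C.hC"
    by (auto simp: canonical_isos_def alg_iso_def ring_iso_def E_folds)
  obtain f where f: "f \<in> alg_iso k Rd.RA Rd.rsc Rd.LA Rd.lsc" "f Rd.rh = Rd.lh" by (rule RA_to_LA)
  obtain g where g: "g \<in> ring_hom Rd.LA A" "\<And>c. c \<in> carrier k \<Longrightarrow> g (Rd.lsc c) = \<phi> c" "g Rd.lh = hA"
    by (rule LA_to_A, rule that)
  let ?i = "\<lambda>e. \<psi> (g (f e))"
  have fh: "f \<in> ring_hom Rd.RA Rd.LA" "\<And>c. c \<in> carrier k \<Longrightarrow> f (Rd.rsc c) = Rd.lsc c"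
    using f(1) by (auto simp: alg_iso_def ring_iso_def)
  have i: "?i \<in> ring_hom Rd.RA C.C"
    using ring_hom_trans[OF ring_hom_trans[OF fh(1) g(1)] \<psi>h(1)] by (simp add: comp_def)
  have ic: "?i (Rd.rsc c) = C.csc c" if "c \<in> carrier k" for c using that by (simp add: fh g \<psi>h)
  have ih: "?i Rd.rh = C.hC" by (simp add: f g \<psi>h)
  have l: "lindep k C.C C.csc I2 C.basC" using C_to_A by (metis E_folds(1,2))
  have "C.basC = (\<lambda>p. C.hC [^]\<^bsub>C.C\<^esub> fst p \<otimes>\<^bsub>C.C\<^esub> C.xC [^]\<^bsub>C.C\<^esub> snd p)" by (rule ext) (simp add: C.basC_def)
  then have row: "lindep k C.C C.csc {..<n} (\<lambda>i. C.hC [^]\<^bsub>C.C\<^esub> i)"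
    using l C.C.lindep_row[OF C.C_gens_closed n_pos] by simp
  have ip: "?i (Rd.rh [^]\<^bsub>Rd.RA\<^esub> j) = C.hC [^]\<^bsub>C.C\<^esub> j" for j :: nat
    using ring_hom_pow[OF Rd.RA.ring_axioms C.C.ring_axioms i Rd.rh_closed, of j] ih by simp
  note inj = hom_inj_of_lindep[OF Rd.RA.falgebra_axioms C.C.falgebra_axioms i ic,
      where b = "\<lambda>i. Rd.rh [^]\<^bsub>Rd.RA\<^esub> i" and b' = "\<lambda>i. C.hC [^]\<^bsub>C.C\<^esub> i" and I = "{..<n}"]
  have "inj_on ?i (carrier Rd.RA)" by (rule inj(1)) (simp_all add: ip row Rd.RA_span)
  moreover have "lindep k Rd.RA Rd.rsc {..<n} (\<lambda>i. Rd.rh [^]\<^bsub>Rd.RA\<^esub> i)" by (rule inj(2)) (simp_all add: ip row Rd.RA_span)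
  ultimately show thesis using that[OF i ic ih] by blast
qed

lemma kq_pow: "kq [^]\<^bsub>k\<^esub> n = \<one>\<^bsub>k\<^esub>" and kq_nonzero: "kq \<noteq> \<zero>\<^bsub>k\<^esub>"
proof -
  have "kq = \<kappa> q" by (simp add: q_eq \<kappa>_def)
  then show "kq [^]\<^bsub>k\<^esub> n = \<one>\<^bsub>k\<^esub>"
    using ring_hom_pow[OF ring_axioms k.ring_axioms \<kappa>_hom, of q n] q_unit ring_hom_one[OF \<kappa>_hom] by simp
  then show "kq \<noteq> \<zero>\<^bsub>k\<^esub>" using k.one_not_zero n_pos by (metis k.nat_pow_zero gr_implies_not0)
qed

text \<open>(qh)^n = q^n h^n = s, so h to qh extends to an endomorphism. On the basis of powers of h
  it acts by the nonzero factors q^i, hence bijectively.\<close>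

lemma RA_sigma:
  obtains \<sigma> where "\<sigma> \<in> alg_iso k Rd.RA Rd.rsc Rd.RA Rd.rsc" "\<sigma> Rd.rh = Rd.rsc kq \<otimes>\<^bsub>Rd.RA\<^esub> Rd.rh"
proof -
  let ?h = "Rd.rsc kq \<otimes>\<^bsub>Rd.RA\<^esub> Rd.rh"
  have hp: "?h [^]\<^bsub>Rd.RA\<^esub> i = Rd.rsc (kq [^]\<^bsub>k\<^esub> i) \<otimes>\<^bsub>Rd.RA\<^esub> Rd.rh [^]\<^bsub>Rd.RA\<^esub> i" for i :: nat
    using ring_hom_pow[OF k.ring_axioms Rd.RA.ring_axioms Rd.RA.\<phi>_hom, of kq i] by (simp add: Rd.RA.nat_pow_distrib)
  have "?h [^]\<^bsub>Rd.RA\<^esub> n = Rd.rsc ks" by (simp add: hp kq_pow Rd.rh_n)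
  then obtain \<sigma> where \<sigma>: "\<sigma> \<in> ring_hom Rd.RA Rd.RA" "\<And>c. c \<in> carrier k \<Longrightarrow> \<sigma> (Rd.rsc c) = Rd.rsc c" "\<sigma> Rd.rh = ?h"
    using Rd.RA_lift[OF Rd.RA.falgebra_axioms Rd.RA.is_cring, of ?h] by auto
  have l: "lindep k Rd.RA Rd.rsc {..<n} (\<lambda>i. Rd.rh [^]\<^bsub>Rd.RA\<^esub> i)" using RA_to_C by metis
  have u: "(\<lambda>i. kq [^]\<^bsub>k\<^esub> i) \<in> {..<n} \<rightarrow> carrier k" by simp
  have u0: "kq [^]\<^bsub>k\<^esub> i \<noteq> \<zero>\<^bsub>k\<^esub>" for i :: nat
  proof (induction i)
    case (Suc i) then show ?case using k.integral_iff kq_nonzero by simp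
  qed simp
  have "\<sigma> \<in> alg_iso k Rd.RA Rd.rsc Rd.RA Rd.rsc"
    by (rule alg_iso_of_basis[OF Rd.RA.falgebra_axioms Rd.RA.falgebra_axioms \<sigma>(1,2),
          where b = "\<lambda>i. Rd.rh [^]\<^bsub>Rd.RA\<^esub> i" and b' = "\<lambda>i. Rd.rsc (kq [^]\<^bsub>k\<^esub> i) \<otimes>\<^bsub>Rd.RA\<^esub> Rd.rh [^]\<^bsub>Rd.RA\<^esub> i" and I = "{..<n}"])
      (use Rd.RA_span Rd.RA.lspan_scale[OF _ Rd.rpow_closed u u0] Rd.RA.lindep_scale[OF Rd.rpow_closed u u0 l] in
        \<open>auto simp: ring_hom_pow[OF Rd.RA.ring_axioms Rd.RA.ring_axioms \<sigma>(1)] \<sigma>(3) hp\<close>)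
  then show thesis using that \<sigma>(3) by blast
qed

lemma cyclic_over_radical: "is_cyclic_over_radical k n kq ks kt"
proof -
  obtain \<sigma> where \<sigma>: "\<sigma> \<in> alg_iso k Rd.RA Rd.rsc Rd.RA Rd.rsc" "\<sigma> Rd.rh = Rd.rsc kq \<otimes>\<^bsub>Rd.RA\<^esub> Rd.rh" by (rule RA_sigma)
  have \<sigma>h: "\<sigma> \<in> ring_hom Rd.RA Rd.RA" "\<And>c. c \<in> carrier k \<Longrightarrow> \<sigma> (Rd.rsc c) = Rd.rsc c"
    using \<sigma>(1) by (auto simp: alg_iso_def ring_iso_def)
  obtain \<iota> where \<iota>: "\<iota> \<in> ring_hom Rd.RA C.C" "\<And>c. c \<in> carrier k \<Longrightarrow> \<iota> (Rd.rsc c) = C.csc c" "\<iota> Rd.rh = C.hC"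
    "inj_on \<iota> (carrier Rd.RA)" by (rule RA_to_C, rule that)
  have \<iota>c: "\<iota> e \<in> carrier C.C" "\<sigma> e \<in> carrier Rd.RA" if "e \<in> carrier Rd.RA" for e
    using that ring_hom_closed[OF \<iota>(1)] ring_hom_closed[OF \<sigma>h(1)] by auto
  \<comment> \<open>The elements e with x e = \<sigma>(e) x are closed under sums and products and
    contain the scalars and h, so they make up all of E(s).\<close>
  let ?W = "\<lambda>e. C.xC \<otimes>\<^bsub>C.C\<^esub> \<iota> e = \<iota> (\<sigma> e) \<otimes>\<^bsub>C.C\<^esub> C.xC"
  have Wm: "?W (e \<otimes>\<^bsub>Rd.RA\<^esub> e')" if e: "e \<in> carrier Rd.RA" "e' \<in> carrier Rd.RA" "?W e" "?W e'" for e e'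
  proof -
    have "C.xC \<otimes>\<^bsub>C.C\<^esub> \<iota> (e \<otimes>\<^bsub>Rd.RA\<^esub> e') = (C.xC \<otimes>\<^bsub>C.C\<^esub> \<iota> e) \<otimes>\<^bsub>C.C\<^esub> \<iota> e'"
      using e(1,2) \<iota>c by (simp add: ring_hom_mult[OF \<iota>(1)] C.C.m_assoc)
    also have "\<dots> = \<iota> (\<sigma> e) \<otimes>\<^bsub>C.C\<^esub> (C.xC \<otimes>\<^bsub>C.C\<^esub> \<iota> e')" unfolding e(3) using e(1,2) \<iota>c by (simp add: C.C.m_assoc)
    also have "\<dots> = \<iota> (\<sigma> (e \<otimes>\<^bsub>Rd.RA\<^esub> e')) \<otimes>\<^bsub>C.C\<^esub> C.xC" unfolding e(4) using e(1,2) \<iota>c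
      by (simp add: ring_hom_mult[OF \<iota>(1)] ring_hom_mult[OF \<sigma>h(1)] C.C.m_assoc)
    finally show ?thesis .
  qed
  have Wc: "?W (Rd.rsc c)" if "c \<in> carrier k" for c
    using that C.C.\<phi>_central[of c C.xC] by (simp add: \<iota> \<sigma>h)
  have Wh: "?W Rd.rh"
    using C.C_relations(1) by (simp add: \<iota> \<sigma>(2) ring_hom_mult[OF \<iota>(1)] C.C.m_assoc)
  have Wp: "?W (Rd.rh [^]\<^bsub>Rd.RA\<^esub> i)" for i :: nat
  proof (induction i)
    case 0
    then show ?case using Wc[of "\<one>\<^bsub>k\<^esub>"] by simp
  next
    case (Suc i)
    then show ?case using Wm[OF _ _ Suc Wh] by simp
  qed
  have W: "?W e" if "e \<in> carrier Rd.RA" for e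
    using that
  proof (induction rule: Rd.RA_induct)
    case zero then show ?case using Wc[of "\<zero>\<^bsub>k\<^esub>"] by simp
  next
    case (add y z)
    then show ?case using \<iota>c
      by (simp add: ring_hom_add[OF \<iota>(1)] ring_hom_add[OF \<sigma>h(1)] C.C.r_distr C.C.l_distr)
  next
    case (monom r i) then show ?case using Wm[OF _ _ Wc Wp] by simp
  qed
  have lC: "lindep k C.C C.csc I2 C.basC" using C_to_A by (metis E_folds(1,2))
  let ?sum = "\<lambda>e. \<Oplus>\<^bsub>C.C\<^esub>j\<in>{..<n}. \<iota> (e j) \<otimes>\<^bsub>C.C\<^esub> C.xC [^]\<^bsub>C.C\<^esub> j"
  \<comment> \<open>Grouping the n^2 terms by the power of x: the inner sum over powers of h is the
    image of an element of E(s). Coefficients in E(s) thus correspond to families of n coefficients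
    in k(m), and uniqueness of the former reduces to that of the latter.\<close>
  have dbl: "?sum e = lincomb C.C C.csc I2 C.basC c"
    if c: "c \<in> I2 \<rightarrow> carrier k" and e: "\<And>j. j < n \<Longrightarrow> e j = lincomb Rd.RA Rd.rsc {..<n} (\<lambda>i. Rd.rh [^]\<^bsub>Rd.RA\<^esub> i) (\<lambda>i. c (i, j))" for c e
  proof -
    have cc: "c (i, j) \<in> carrier k" if "i < n" "j < n" for i j using c that by auto
    have "lincomb C.C C.csc I2 C.basC c = (\<Oplus>\<^bsub>C.C\<^esub>j\<in>{..<n}. \<Oplus>\<^bsub>C.C\<^esub>i\<in>{..<n}. C.csc (c (i, j)) \<otimes>\<^bsub>C.C\<^esub> C.basC (i, j))"
      unfolding lincomb_def using cc by (intro C.C.finsum_prod) (auto simp: C.basC_def)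
    also have "\<dots> = ?sum e"
    proof (rule C.C.finsum_cong')
      fix j assume j: "j \<in> {..<n}"
      have "\<iota> (e j) = lincomb C.C C.csc {..<n} (\<lambda>i. C.hC [^]\<^bsub>C.C\<^esub> i) (\<lambda>i. c (i, j))"
        unfolding e[OF j[unfolded lessThan_iff]]
        by (rule lincomb_hom[OF Rd.RA.falgebra_axioms C.C.falgebra_axioms \<iota>(1,2)])
          (use cc j in \<open>auto simp: ring_hom_pow[OF Rd.RA.ring_axioms C.C.ring_axioms \<iota>(1)] \<iota>(3)\<close>)
      then have "\<iota> (e j) \<otimes>\<^bsub>C.C\<^esub> C.xC [^]\<^bsub>C.C\<^esub> j = (\<Oplus>\<^bsub>C.C\<^esub>i\<in>{..<n}. C.csc (c (i, j)) \<otimes>\<^bsub>C.C\<^esub> C.hC [^]\<^bsub>C.C\<^esub> i \<otimes>\<^bsub>C.C\<^esub> C.xC [^]\<^bsub>C.C\<^esub> j)"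
        unfolding lincomb_def using cc j by (simp add: C.C.finsum_ldistr Pi_def)
      also have "\<dots> = (\<Oplus>\<^bsub>C.C\<^esub>i\<in>{..<n}. C.csc (c (i, j)) \<otimes>\<^bsub>C.C\<^esub> C.basC (i, j))"
        using cc j by (intro C.C.finsum_cong') (auto simp: C.basC_def C.C.m_assoc)
      finally show "(\<Oplus>\<^bsub>C.C\<^esub>i\<in>{..<n}. C.csc (c (i, j)) \<otimes>\<^bsub>C.C\<^esub> C.basC (i, j)) = \<iota> (e j) \<otimes>\<^bsub>C.C\<^esub> C.xC [^]\<^bsub>C.C\<^esub> j" by simp
    next
      have "e j \<in> carrier Rd.RA" if "j < n" for j
        unfolding e[OF that] using cc that by (intro Rd.RA.lincomb_closed) auto
      then show "(\<lambda>j. \<iota> (e j) \<otimes>\<^bsub>C.C\<^esub> C.xC [^]\<^bsub>C.C\<^esub> j) \<in> {..<n} \<rightarrow> carrier C.C" using \<iota>c by auto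
    qed simp
    finally show ?thesis by simp
  qed
  have coef: "\<exists>c. c \<in> I2 \<rightarrow> carrier k \<and> (\<forall>j<n. e j = lincomb Rd.RA Rd.rsc {..<n} (\<lambda>i. Rd.rh [^]\<^bsub>Rd.RA\<^esub> i) (\<lambda>i. c (i, j)))"
    if e: "e \<in> {..<n} \<rightarrow>\<^sub>E carrier Rd.RA" for e
  proof -
    have "\<forall>j\<in>{..<n}. \<exists>c. c \<in> {..<n} \<rightarrow> carrier k \<and> e j = lincomb Rd.RA Rd.rsc {..<n} (\<lambda>i. Rd.rh [^]\<^bsub>Rd.RA\<^esub> i) c"
      using e Rd.RA_span unfolding lspan_def by blast
    then obtain c where "\<forall>j\<in>{..<n}. c j \<in> {..<n} \<rightarrow> carrier k \<and> e j = lincomb Rd.RA Rd.rsc {..<n} (\<lambda>i. Rd.rh [^]\<^bsub>Rd.RA\<^esub> i) (c j)"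
      by metis
    then show ?thesis by (intro exI[of _ "\<lambda>p. c (snd p) (fst p)"]) (auto simp: Pi_iff)
  qed
  have uniq: "\<exists>!e. e \<in> {..<n} \<rightarrow>\<^sub>E carrier Rd.RA \<and> y = ?sum e" if y: "y \<in> carrier C.C" for y
  proof -
    obtain c where c: "c \<in> I2 \<rightarrow> carrier k" "y = lincomb C.C C.csc I2 C.basC c"
      using y unfolding C.C_span lspan_def by blast
    define e where "e = (\<lambda>j\<in>{..<n}. lincomb Rd.RA Rd.rsc {..<n} (\<lambda>i. Rd.rh [^]\<^bsub>Rd.RA\<^esub> i) (\<lambda>i. c (i, j)))"
    let ?P = "\<lambda>e. e \<in> {..<n} \<rightarrow>\<^sub>E carrier Rd.RA \<and> y = ?sum e"
    have 1: "e \<in> {..<n} \<rightarrow>\<^sub>E carrier Rd.RA" using c(1) by (auto simp: e_def intro!: Rd.RA.lincomb_closed)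
    have 2: "?sum e = y" unfolding c(2) by (rule dbl[OF c(1)]) (simp add: e_def)
    have "e' = e" if e': "e' \<in> {..<n} \<rightarrow>\<^sub>E carrier Rd.RA" "y = ?sum e'" for e'
    proof -
      obtain c' where c': "c' \<in> I2 \<rightarrow> carrier k" "\<forall>j<n. e' j = lincomb Rd.RA Rd.rsc {..<n} (\<lambda>i. Rd.rh [^]\<^bsub>Rd.RA\<^esub> i) (\<lambda>i. c' (i, j))"
        using coef[OF e'(1)] by (elim exE conjE) (rule that)
      have sc': "?sum e' = lincomb C.C C.csc I2 C.basC c'"
        by (rule dbl[OF c'(1)]) (rule c'(2)[rule_format])
      have cc: "c' p = c p" if "p \<in> I2" for p
      proof (rule C.C.lindep_eq[OF _ C.basC_closed lC c'(1) c(1) _ that])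
        show "lincomb C.C C.csc I2 C.basC c' = lincomb C.C C.csc I2 C.basC c"
          by (rule trans[OF sc'[symmetric] trans[OF e'(2)[symmetric] c(2)]])
      qed simp
      have "e' j = e j" if "j < n" for j
      proof -
        have "lincomb Rd.RA Rd.rsc {..<n} (\<lambda>i. Rd.rh [^]\<^bsub>Rd.RA\<^esub> i) (\<lambda>i. c' (i, j))
            = lincomb Rd.RA Rd.rsc {..<n} (\<lambda>i. Rd.rh [^]\<^bsub>Rd.RA\<^esub> i) (\<lambda>i. c (i, j))"
          using cc c(1) that by (intro Rd.RA.lincomb_cong) auto
        then show ?thesis using that c'(2)[rule_format, OF that] by (simp add: e_def)
      qed
      moreover have "e' j = e j" if "\<not> j < n" for j
        using PiE_arb[OF e'(1), of j] that by (simp add: e_def)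
      ultimately show "e' = e" by blast
    qed
    then show "\<exists>!e. ?P e" by (intro ex1I[of ?P e] conjI[OF 1 2[symmetric]]) (elim conjE)
  qed
  show ?thesis unfolding is_cyclic_over_radical_def Let_def
    using \<sigma> \<iota> W C.C_relations(3) uniq by (intro exI[of _ \<sigma>] exI[of _ \<iota>] conjI ballI) auto
qed

end

section \<open>Simple modules over the quantum torus\<close>

context left_module begin

text \<open>Coefficients come from an arbitrary subset C of R, so that spans over the centre, over
  K[y, y^-1] and over the scalars can be compared inside one and the same module.\<close>

inductive_set cspan :: "'r set \<Rightarrow> 'u set \<Rightarrow> 'u set" for C S where
  zero: "\<zero>\<^bsub>M\<^esub> \<in> cspan C S"
| step: "c \<in> C \<Longrightarrow> v \<in> S \<Longrightarrow> u \<in> cspan C S \<Longrightarrow> c \<odot>\<^bsub>M\<^esub> v \<oplus>\<^bsub>M\<^esub> u \<in> cspan C S"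

context
  fixes C S assumes CS: "C \<subseteq> carrier R" "S \<subseteq> carrier M"
begin

lemma cspan_closed: "u \<in> cspan C S \<Longrightarrow> u \<in> carrier M"
  by (induction rule: cspan.induct) (use CS in \<open>auto intro!: M.a_closed smult_closed\<close>)

lemma cspan_base: "c \<in> C \<Longrightarrow> v \<in> S \<Longrightarrow> c \<odot>\<^bsub>M\<^esub> v \<in> cspan C S"
  using cspan.step[OF _ _ cspan.zero, of c C v S] CS smult_closed by (metis M.r_zero subsetD)

lemma cspan_add: "u \<in> cspan C S \<Longrightarrow> w \<in> cspan C S \<Longrightarrow> u \<oplus>\<^bsub>M\<^esub> w \<in> cspan C S"
proof (induction rule: cspan.induct)
  case zero
  then show ?case using cspan_closed by simp
next
  case (step c v u)
  have "c \<odot>\<^bsub>M\<^esub> v \<in> carrier M" using step CS smult_closed by auto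
  then have "c \<odot>\<^bsub>M\<^esub> v \<oplus>\<^bsub>M\<^esub> u \<oplus>\<^bsub>M\<^esub> w = c \<odot>\<^bsub>M\<^esub> v \<oplus>\<^bsub>M\<^esub> (u \<oplus>\<^bsub>M\<^esub> w)"
    using step cspan_closed by (simp add: M.a_assoc)
  then show ?case using step by (auto intro: cspan.step)
qed

lemma cspan_smult:
  assumes "\<And>c d. c \<in> C \<Longrightarrow> d \<in> C \<Longrightarrow> c \<otimes> d \<in> C" and d: "d \<in> C"
  shows "u \<in> cspan C S \<Longrightarrow> d \<odot>\<^bsub>M\<^esub> u \<in> cspan C S"
proof (induction rule: cspan.induct)
  case zero
  have "d \<in> carrier R" using d CS by auto
  then show ?case by (simp add: cspan.zero)
next
  case (step c v u)
  have "c \<in> carrier R" "d \<in> carrier R" "v \<in> carrier M" "u \<in> carrier M" using step CS d cspan_closed by auto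
  then have "d \<odot>\<^bsub>M\<^esub> (c \<odot>\<^bsub>M\<^esub> v \<oplus>\<^bsub>M\<^esub> u) = (d \<otimes> c) \<odot>\<^bsub>M\<^esub> v \<oplus>\<^bsub>M\<^esub> d \<odot>\<^bsub>M\<^esub> u"
    by (simp add: smult_r_distr smult_assoc1 smult_closed)
  then show ?case using step assms by (auto intro: cspan.step)
qed

end

lemma cspan_insert:
  assumes "C \<subseteq> carrier R" "insert v S \<subseteq> carrier M" "\<zero> \<in> C" "\<And>c d. c \<in> C \<Longrightarrow> d \<in> C \<Longrightarrow> c \<oplus> d \<in> C"
  shows "u \<in> cspan C (insert v S) \<Longrightarrow> \<exists>c\<in>C. \<exists>w\<in>cspan C S. u = c \<odot>\<^bsub>M\<^esub> v \<oplus>\<^bsub>M\<^esub> w"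
proof (induction rule: cspan.induct)
  case zero
  show ?case using assms by (intro bexI[of _ \<zero>] bexI[of _ "\<zero>\<^bsub>M\<^esub>"]) (auto intro: cspan.zero)
next
  case (step c y u)
  then obtain d w where d: "d \<in> C" "w \<in> cspan C S" "u = d \<odot>\<^bsub>M\<^esub> v \<oplus>\<^bsub>M\<^esub> w" by blast
  have w: "w \<in> carrier M" using cspan_closed[of C S] d assms by auto
  have cl: "c \<in> carrier R" "d \<in> carrier R" "y \<in> carrier M" "v \<in> carrier M" using step d assms by auto
  note cl = cl smult_closed[OF cl(1,3)] smult_closed[OF cl(1,4)] smult_closed[OF cl(2,4)]
  show ?case
  proof (cases "y = v")
    case True
    have "c \<odot>\<^bsub>M\<^esub> y \<oplus>\<^bsub>M\<^esub> u = (c \<oplus> d) \<odot>\<^bsub>M\<^esub> v \<oplus>\<^bsub>M\<^esub> w"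
      using cl w by (simp add: True d(3) smult_l_distr M.a_assoc)
    then show ?thesis using assms(4)[OF step(1) d(1)] d(2) by blast
  next
    case False
    have "c \<odot>\<^bsub>M\<^esub> y \<oplus>\<^bsub>M\<^esub> u = d \<odot>\<^bsub>M\<^esub> v \<oplus>\<^bsub>M\<^esub> (c \<odot>\<^bsub>M\<^esub> y \<oplus>\<^bsub>M\<^esub> w)"
      using cl w by (simp add: d(3) M.a_lcomm)
    moreover have "c \<odot>\<^bsub>M\<^esub> y \<oplus>\<^bsub>M\<^esub> w \<in> cspan C S" using step False d by (intro cspan.step) auto
    ultimately show ?thesis using d(1) by blast
  qed
qed

text \<open>In place of a determinant the generators are eliminated one at a time. The induction
  keeps an a for which 1 + az maps M into the span of the remaining generators; when none is left, 1
  + az kills M.\<close>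

lemma nakayama:
  assumes S: "finite S" "S \<subseteq> carrier M" and C: "C \<subseteq> ring_center R" "\<zero> \<in> C"
    and Ccl: "\<And>c d. c \<in> C \<Longrightarrow> d \<in> C \<Longrightarrow> c \<oplus> d \<in> C" "\<And>c d. c \<in> C \<Longrightarrow> d \<in> C \<Longrightarrow> c \<otimes> d \<in> C" "\<And>c. c \<in> C \<Longrightarrow> \<ominus> c \<in> C"
    and one: "\<one> \<in> C" and z: "z \<in> C" and zM: "\<And>u. u \<in> carrier M \<Longrightarrow> \<exists>w\<in>carrier M. u = z \<odot>\<^bsub>M\<^esub> w"
    and span: "carrier M \<subseteq> cspan C S"
  shows "\<exists>a\<in>C. \<one> \<oplus> a \<otimes> z \<in> annihilator R M"
proof -
  have CR: "C \<subseteq> carrier R" using C by (auto simp: ring_center_def)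
  have comm: "c \<otimes> d = d \<otimes> c" if "c \<in> C" "d \<in> C" for c d using that C CR by (auto simp: ring_center_def)
  \<comment> \<open>Generalized over a and over the generating set, since each elimination changes
    both; the start is a = 0.\<close>
  have claim: "\<exists>a\<in>C. \<one> \<oplus> a \<otimes> z \<in> annihilator R M"
    if "a \<in> C" "\<And>u. u \<in> carrier M \<Longrightarrow> (\<one> \<oplus> a \<otimes> z) \<odot>\<^bsub>M\<^esub> u \<in> cspan C S" for a
    using S that
  proof (induction S arbitrary: a)
    case empty
    have "u = \<zero>\<^bsub>M\<^esub>" if "u \<in> cspan C {}" for u using that by cases auto
    moreover have "a \<in> carrier R" "z \<in> carrier R" using empty CR z by auto
    ultimately show ?case using empty by (intro bexI[of _ a]) (auto simp: annihilator_def)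
  next
    case (insert v S)
    have v: "v \<in> carrier M" "insert v S \<subseteq> carrier M" "S \<subseteq> carrier M" using insert by auto
    obtain w where w: "w \<in> carrier M" "v = z \<odot>\<^bsub>M\<^esub> w" using zM v by blast
    let ?d = "\<one> \<oplus> a \<otimes> z"
    have dC: "?d \<in> C" "?d \<in> carrier R" using insert.prems one z Ccl CR by auto
    obtain c y where c: "c \<in> C" "y \<in> cspan C S" "?d \<odot>\<^bsub>M\<^esub> w = c \<odot>\<^bsub>M\<^esub> v \<oplus>\<^bsub>M\<^esub> y"
      using cspan_insert[OF CR v(2) C(2) Ccl(1) insert.prems(3)[OF w(1)]] by blast
    have y: "y \<in> carrier M" using cspan_closed[OF CR v(3) c(2)] .
    have cR: "c \<in> carrier R" "z \<in> carrier R" "a \<in> carrier R" using c z insert.prems CR by auto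
    \<comment> \<open>With d = 1 + az, v = zw and dw = cv + y one has dv = zcv + zy, so e = d - zc
      sends v into the span of S. As dM lies in the span of v and S, the product ed sends M into the
      span of S; it is again of the form 1 + a'z.\<close>
    let ?e = "\<one> \<oplus> (a \<oplus> \<ominus> c) \<otimes> z"
    have eC: "?e \<in> C" "?e \<in> carrier R" using insert.prems one z Ccl CR c(1) by auto
    have e_d: "?e = ?d \<oplus> \<ominus> (z \<otimes> c)" using cR comm[OF z c(1)] by (simp add: R.l_distr R.l_minus R.a_assoc)
    have "?d \<odot>\<^bsub>M\<^esub> v = z \<odot>\<^bsub>M\<^esub> (?d \<odot>\<^bsub>M\<^esub> w)"
      using comm[OF dC(1) z] dC cR w(1) by (simp add: w(2) flip: smult_assoc1)
    also have "\<dots> = (z \<otimes> c) \<odot>\<^bsub>M\<^esub> v \<oplus>\<^bsub>M\<^esub> z \<odot>\<^bsub>M\<^esub> y"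
      using cR v y by (simp add: c(3) smult_r_distr smult_assoc1 smult_closed)
    finally have dv: "?d \<odot>\<^bsub>M\<^esub> v = (z \<otimes> c) \<odot>\<^bsub>M\<^esub> v \<oplus>\<^bsub>M\<^esub> z \<odot>\<^bsub>M\<^esub> y" .
    have zy: "z \<odot>\<^bsub>M\<^esub> y \<in> cspan C S" by (rule cspan_smult[OF CR v(3) Ccl(2) z c(2)])
    have "?e \<odot>\<^bsub>M\<^esub> v = ?d \<odot>\<^bsub>M\<^esub> v \<oplus>\<^bsub>M\<^esub> \<ominus>\<^bsub>M\<^esub> ((z \<otimes> c) \<odot>\<^bsub>M\<^esub> v)"
      unfolding e_d using dC cR v by (simp add: smult_l_distr smult_l_minus del: R.l_distr)
    also have "\<dots> = z \<odot>\<^bsub>M\<^esub> y"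
      unfolding dv using cR v y smult_closed by (simp add: M.a_ac M.r_neg M.r_neg1 M.r_neg2)
    finally have ev: "?e \<odot>\<^bsub>M\<^esub> v \<in> cspan C S" using zy by simp
    let ?a = "(a \<oplus> \<ominus> c) \<oplus> (a \<oplus> (a \<oplus> \<ominus> c) \<otimes> (z \<otimes> a))"
    have aC: "?a \<in> C" using insert.prems z Ccl c(1) by auto
    have "?e \<otimes> ?d = \<one> \<oplus> ?a \<otimes> z"
      using cR by (simp add: R.l_distr R.r_distr R.m_assoc R.a_ac)
    moreover have "?e \<odot>\<^bsub>M\<^esub> (?d \<odot>\<^bsub>M\<^esub> u) \<in> cspan C S" if u: "u \<in> carrier M" for u
    proof -
      obtain c' y' where c': "c' \<in> C" "y' \<in> cspan C S" "?d \<odot>\<^bsub>M\<^esub> u = c' \<odot>\<^bsub>M\<^esub> v \<oplus>\<^bsub>M\<^esub> y'"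
        using cspan_insert[OF CR v(2) C(2) Ccl(1) insert.prems(3)[OF u]] by blast
      have y': "y' \<in> carrier M" using cspan_closed[OF CR v(3) c'(2)] .
      have c'R: "c' \<in> carrier R" using c' CR by auto
      have "?e \<odot>\<^bsub>M\<^esub> (?d \<odot>\<^bsub>M\<^esub> u) = c' \<odot>\<^bsub>M\<^esub> (?e \<odot>\<^bsub>M\<^esub> v) \<oplus>\<^bsub>M\<^esub> ?e \<odot>\<^bsub>M\<^esub> y'"
        unfolding c'(3) using c'R eC y' v comm[OF eC(1) c'(1)] 
        by (simp only: smult_r_distr smult_closed flip: smult_assoc1)
      then show ?thesis using cspan_add[OF CR v(3) cspan_smult[OF CR v(3) Ccl(2) c'(1) ev] cspan_smult[OF CR v(3) Ccl(2) eC(1) c'(2)]]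
        by simp
    qed
    ultimately have "(\<one> \<oplus> ?a \<otimes> z) \<odot>\<^bsub>M\<^esub> u \<in> cspan C S" if "u \<in> carrier M" for u
      using that eC(2) dC(2) by (metis smult_assoc1)
    then show ?case by (intro insert.IH[OF v(3) aC])
  qed
  show ?thesis
  proof (rule claim[OF C(2)])
    fix u assume u: "u \<in> carrier M"
    have "z \<in> carrier R" using CR z by auto
    then show "(\<one> \<oplus> \<zero> \<otimes> z) \<odot>\<^bsub>M\<^esub> u \<in> cspan C S" using span u by (auto simp: smult_one)
  qed
qed

lemma cspan_finsum:
  assumes "finite S" "S \<subseteq> carrier M" "u \<in> cspan (carrier R) S"
  shows "\<exists>c\<in>S \<rightarrow> carrier R. u = (\<Oplus>\<^bsub>M\<^esub>v\<in>S. c v \<odot>\<^bsub>M\<^esub> v)"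
  using assms(3)
proof (induction rule: cspan.induct)
  case zero
  have "(\<Oplus>\<^bsub>M\<^esub>v\<in>S. \<zero> \<odot>\<^bsub>M\<^esub> v) = \<zero>\<^bsub>M\<^esub>" using assms by (intro M.add.finprod_one_eqI) auto
  then show ?case by (intro bexI[of _ "\<lambda>_. \<zero>"]) auto
next
  case (step r w u)
  then obtain c where c: "c \<in> S \<rightarrow> carrier R" "u = (\<Oplus>\<^bsub>M\<^esub>v\<in>S. c v \<odot>\<^bsub>M\<^esub> v)" by blast
  have cl: "c v \<odot>\<^bsub>M\<^esub> v \<in> carrier M" if "v \<in> S" for v using that c assms smult_closed by auto
  have w: "w \<in> carrier M" "c w \<in> carrier R" using step assms c by auto
  have S: "S = insert w (S - {w})" using step by auto
  let ?c = "c(w := r \<oplus> c w)"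
  have fin: "finite (S - {w})" using assms by simp
  have "u = c w \<odot>\<^bsub>M\<^esub> w \<oplus>\<^bsub>M\<^esub> (\<Oplus>\<^bsub>M\<^esub>v\<in>S - {w}. c v \<odot>\<^bsub>M\<^esub> v)"
    unfolding c(2) by (subst S, rule M.finsum_insert) (use cl fin step in auto)
  moreover have "(\<Oplus>\<^bsub>M\<^esub>v\<in>S. ?c v \<odot>\<^bsub>M\<^esub> v) = ?c w \<odot>\<^bsub>M\<^esub> w \<oplus>\<^bsub>M\<^esub> (\<Oplus>\<^bsub>M\<^esub>v\<in>S - {w}. ?c v \<odot>\<^bsub>M\<^esub> v)"
    by (subst S, rule M.finsum_insert) (use cl fin step w smult_closed in auto)
  moreover have "(\<Oplus>\<^bsub>M\<^esub>v\<in>S - {w}. ?c v \<odot>\<^bsub>M\<^esub> v) = (\<Oplus>\<^bsub>M\<^esub>v\<in>S - {w}. c v \<odot>\<^bsub>M\<^esub> v)"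
    by (rule M.finsum_cong') (use cl in auto)
  moreover have "(\<Oplus>\<^bsub>M\<^esub>v\<in>S - {w}. c v \<odot>\<^bsub>M\<^esub> v) \<in> carrier M" using cl by (intro M.finsum_closed) auto
  ultimately have "r \<odot>\<^bsub>M\<^esub> w \<oplus>\<^bsub>M\<^esub> u = (\<Oplus>\<^bsub>M\<^esub>v\<in>S. ?c v \<odot>\<^bsub>M\<^esub> v)"
    using step(1) w smult_closed by (simp add: smult_l_distr M.a_assoc)
  moreover have "?c \<in> S \<rightarrow> carrier R" using c step(1) w by auto
  ultimately show ?case by blast
qed

end

section \<open>Monomial subrings of the quantum torus\<close>

context qtorus begin

text \<open>If \<Gamma> is closed under addition and contains (0, 0), this is the subring spanned by
  the monomials with exponents in \<Gamma>; it realizes K[y, y^-1] inside B. Pairs in \<Gamma> list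
  the exponent of h first, unlike the coefficients \<open>f j i\<close>.\<close>

definition supported :: "(int \<times> int) set \<Rightarrow> 'a qt set" where
  "supported \<Gamma> = {f \<in> carrier B. \<forall>j i. f j i \<noteq> \<zero> \<longrightarrow> (i, j) \<in> \<Gamma>}"

lemma supported_mon: "c \<in> carrier K \<Longrightarrow> (i, j) \<in> \<Gamma> \<Longrightarrow> mon c i j \<in> supported \<Gamma>"
  by (auto simp: supported_def mon_coeff)

lemma supported_add: "f \<in> supported \<Gamma> \<Longrightarrow> g \<in> supported \<Gamma> \<Longrightarrow> f \<oplus>\<^bsub>B\<^esub> g \<in> supported \<Gamma>"
  unfolding supported_def mem_Collect_eq
proof (intro conjI allI impI)
  fix j i assume fg: "f \<in> carrier B \<and> (\<forall>j i. f j i \<noteq> \<zero> \<longrightarrow> (i, j) \<in> \<Gamma>)" "g \<in> carrier B \<and> (\<forall>j i. g j i \<noteq> \<zero> \<longrightarrow> (i, j) \<in> \<Gamma>)"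
    and nz: "(f \<oplus>\<^bsub>B\<^esub> g) j i \<noteq> \<zero>"
  have "f j i \<noteq> \<zero> \<or> g j i \<noteq> \<zero>" using nz by (auto simp: B_add)
  then show "(i, j) \<in> \<Gamma>" using fg by blast
qed simp

lemma supported_zero: "\<zero>\<^bsub>B\<^esub> \<in> supported \<Gamma>"
  unfolding supported_def mem_Collect_eq by (intro conjI allI impI B.zero_closed) (simp add: B_zero)

lemma supported_induct [consumes 1, case_names zero add]:
  assumes "f \<in> supported \<Gamma>" and zero: "P \<zero>\<^bsub>B\<^esub>"
    and step: "\<And>c i j f. \<lbrakk>c \<in> carrier K; (i, j) \<in> \<Gamma>; f \<in> supported \<Gamma>; P f\<rbrakk> \<Longrightarrow> P (mon c i j \<oplus>\<^bsub>B\<^esub> f)"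
  shows "P f"
proof -
  have "f \<in> carrier B" using assms(1) by (simp add: supported_def)
  then have "f \<in> supported \<Gamma> \<longrightarrow> P f"
  proof (induction f rule: qt_induct)
    case zero
    then show ?case using assms(2) by simp
  next
    case (add c i j f)
    show ?case
    proof
      assume s: "mon c i j \<oplus>\<^bsub>B\<^esub> f \<in> supported \<Gamma>"
      have "(mon c i j \<oplus>\<^bsub>B\<^esub> f) j i \<noteq> \<zero>" using add by (simp add: B_add mon_coeff)
      then have "(i, j) \<in> \<Gamma>" using s unfolding supported_def mem_Collect_eq by blast
      moreover have "(mon c i j \<oplus>\<^bsub>B\<^esub> f) l k = f l k" if "f l k \<noteq> \<zero>" for l k
        using that add by (auto simp: B_add mon_coeff)
      then have "f \<in> supported \<Gamma>" using s add(3) unfolding supported_def mem_Collect_eq by metis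
      ultimately show "P (mon c i j \<oplus>\<^bsub>B\<^esub> f)" using step add(1,5) by blast
    qed
  qed
  then show ?thesis using assms(1) by blast
qed

lemma supported_mult:
  assumes \<Gamma>: "\<And>i j k l. (i, j) \<in> \<Gamma> \<Longrightarrow> (k, l) \<in> \<Gamma> \<Longrightarrow> (i + k, j + l) \<in> \<Gamma>"
    and f: "f \<in> supported \<Gamma>" and g: "g \<in> supported \<Gamma>"
  shows "f \<otimes>\<^bsub>B\<^esub> g \<in> supported \<Gamma>"
proof -
  have carr: "h \<in> carrier B" if "h \<in> supported \<Gamma>" for h using that by (simp add: supported_def)
  have mon: "mon c i j \<otimes>\<^bsub>B\<^esub> g \<in> supported \<Gamma>" if c: "c \<in> carrier K" "(i, j) \<in> \<Gamma>" for c i j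
    using g
  proof (induction g rule: supported_induct)
    case zero then show ?case using c supported_zero by simp
  next
    case (add d k l g)
    then show ?case using c carr
      by (simp add: B.r_distr mon_mult) (intro supported_add supported_mon \<Gamma>, auto)
  qed
  show ?thesis using f
  proof (induction f rule: supported_induct)
    case zero then show ?case using carr g supported_zero by simp
  next
    case (add d k l f)
    then show ?case using carr g by (simp add: B.l_distr) (intro supported_add mon)
  qed
qed

lemma supported_minus: "f \<in> supported \<Gamma> \<Longrightarrow> \<ominus>\<^bsub>B\<^esub> f \<in> supported \<Gamma>"
proof -
  assume f: "f \<in> supported \<Gamma>"
  then have c: "f \<in> carrier B" by (simp add: supported_def)
  have "\<ominus>\<^bsub>B\<^esub> f = mon (\<ominus> \<one>) 0 0 \<otimes>\<^bsub>B\<^esub> f"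
    by (rule B.minus_equality, subst (2) B.l_one[OF c, symmetric])
      (use c in \<open>simp_all add: B_one l_neg mon_zero flip: B.l_distr mon_add\<close>)
  moreover have "mon (\<ominus> \<one>) 0 0 \<otimes>\<^bsub>B\<^esub> f \<in> supported \<Gamma>" using f
  proof (induction f rule: supported_induct)
    case zero then show ?case using supported_zero by simp
  next
    case (add d k l f)
    moreover from this have "f \<in> carrier B" by (simp add: supported_def)
    ultimately show ?case by (simp add: B.r_distr mon_mult) (intro supported_add supported_mon, auto)
  qed
  ultimately show ?thesis by simp
qed

text \<open>Let b_t be the coefficient of a at y^t, where y = h^i x^j. If the sum vanished, then b_0
  + b_(-1) = -1 and b_t + b_(t-1) = 0 for all other t. So b_0 or b_(-1) is nonzero, and the
  recursion spreads this over all t \<ge> 0 or all t < 0, against finite support.\<close>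

lemma one_plus_multiple_nonzero:
  assumes a: "a \<in> carrier B" and d: "int n dvd i" "int n dvd j" "i \<noteq> 0"
  shows "\<one>\<^bsub>B\<^esub> \<oplus>\<^bsub>B\<^esub> a \<otimes>\<^bsub>B\<^esub> (\<one>\<^bsub>B\<^esub> \<oplus>\<^bsub>B\<^esub> mon \<one> i j) \<noteq> \<zero>\<^bsub>B\<^esub>"
proof
  assume 0: "\<one>\<^bsub>B\<^esub> \<oplus>\<^bsub>B\<^esub> a \<otimes>\<^bsub>B\<^esub> (\<one>\<^bsub>B\<^esub> \<oplus>\<^bsub>B\<^esub> mon \<one> i j) = \<zero>\<^bsub>B\<^esub>"
  define b where "b t = a (t * j) (t * i)" for t
  have b: "b t \<in> carrier K" for t using a by (simp add: b_def)
  have rec: "(if t = 0 then \<one> else \<zero>) \<oplus> (b t \<oplus> b (t - 1)) = \<zero>" for t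
  proof -
    have "(\<one>\<^bsub>B\<^esub> \<oplus>\<^bsub>B\<^esub> (a \<oplus>\<^bsub>B\<^esub> a \<otimes>\<^bsub>B\<^esub> mon \<one> i j)) (t * j) (t * i) = \<zero>\<^bsub>B\<^esub> (t * j) (t * i)"
      using 0 a by (simp add: B.r_distr)
    then show ?thesis using d a mult_mon_coeff[OF one_closed a, of i j "t * j" "t * i"]
      by (cases "t = 0") (simp_all add: B_add B_zero B_one mon_coeff b_def algebra_simps)
  qed
  have flip: "b t = \<zero> \<longleftrightarrow> b (t - 1) = \<zero>" if "t \<noteq> 0" for t
    using rec[of t] that b[of t] b[of "t - 1"] by (auto)
  have fin: "finite {t. b t \<noteq> \<zero>}"
  proof (rule finite_imageD[of "\<lambda>t. (t * i, t * j)"])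
    show "finite ((\<lambda>t. (t * i, t * j)) ` {t. b t \<noteq> \<zero>})"
      by (rule finite_subset[OF _ supp_finite[OF a]]) (auto simp: b_def)
    show "inj_on (\<lambda>t. (t * i, t * j)) {t. b t \<noteq> \<zero>}" using d(3) by (auto intro!: inj_onI)
  qed
  show False
  proof (cases "b (- 1) = \<zero>")
    case True
    have "b (int t) \<noteq> \<zero>" for t
    proof (induction t)
      case 0
      show ?case using rec[of 0] True by auto
    next
      case (Suc t)
      then show ?case using flip[of "int (Suc t)"] by simp
    qed
    then have "range int \<subseteq> {t. b t \<noteq> \<zero>}" by auto
    then show False using fin infinite_UNIV_nat by (metis finite_subset finite_imageD inj_of_nat)
  next
    case False
    have "b (- 1 - int t) \<noteq> \<zero>" for t
    proof (induction t)
      case 0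
      show ?case using False by simp
    next
      case (Suc t)
      then show ?case using flip[of "- 1 - int t"] by (simp add: algebra_simps)
    qed
    then have "range (\<lambda>t. - 1 - int t) \<subseteq> {t. b t \<noteq> \<zero>}" by auto
    moreover have "inj (\<lambda>t. - 1 - int t)" by (auto intro: injI)
    ultimately show False using fin infinite_UNIV_nat by (metis finite_subset finite_imageD)
  qed
qed

lemma qt_scalar_hom: "qt_scalar K \<in> ring_hom K B"
  by (rule ring_hom_memI) (simp_all add: B_scalar B_one mon_mult mon_add)

end

section \<open>The central annihilator of a simple module\<close>

locale simple_qt_module = qtorus +
  fixes M :: "('a qt, 'v, 'c) module_scheme"
  assumes simple: "simple_module (qt K q) M"
begin

sublocale M: left_module B M using simple by (simp add: simple_module_def)

abbreviation "\<aa> \<equiv> annihilator B M"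
abbreviation "p \<equiv> \<aa> \<inter> Z"

lemma p_act: "z \<in> p \<Longrightarrow> u \<in> carrier M \<Longrightarrow> z \<odot>\<^bsub>M\<^esub> u = \<zero>\<^bsub>M\<^esub>"
  by (simp add: annihilator_def)

text \<open>zM is a submodule because z is central, and it is nonzero because z does not annihilate
  M.\<close>

lemma central_surj:
  assumes z: "z \<in> Z" "z \<notin> \<aa>" and u: "u \<in> carrier M"
  shows "\<exists>w\<in>carrier M. u = z \<odot>\<^bsub>M\<^esub> w"
proof -
  let ?H = "(\<lambda>w. z \<odot>\<^bsub>M\<^esub> w) ` carrier M"
  have zB: "z \<in> carrier B" using z by simp
  have "submodule ?H B M"
  proof (rule M.submoduleI)
    show "?H \<subseteq> carrier M" using zB M.smult_closed by auto
    show "\<zero>\<^bsub>M\<^esub> \<in> ?H" using zB by (intro image_eqI[of _ _ "\<zero>\<^bsub>M\<^esub>"]) auto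
    show "y \<oplus>\<^bsub>M\<^esub> w \<in> ?H" if "y \<in> ?H" "w \<in> ?H" for y w
      using that zB by (auto simp flip: M.smult_r_distr)
    show "a \<odot>\<^bsub>M\<^esub> y \<in> ?H" if "a \<in> carrier B" "y \<in> ?H" for a y
    proof -
      obtain w where w: "w \<in> carrier M" "y = z \<odot>\<^bsub>M\<^esub> w" using \<open>y \<in> ?H\<close> by blast
      have "a \<odot>\<^bsub>M\<^esub> y = z \<odot>\<^bsub>M\<^esub> (a \<odot>\<^bsub>M\<^esub> w)"
        using w that(1) zB center_comm[OF z(1) that(1)] by (simp flip: M.smult_assoc1)
      then show ?thesis using w that(1) M.smult_closed by blast
    qed
  qed
  then have "?H = {\<zero>\<^bsub>M\<^esub>} \<or> ?H = carrier M" using simple unfolding simple_module_def by blast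
  moreover have "?H \<noteq> {\<zero>\<^bsub>M\<^esub>}" using z zB by (auto simp: annihilator_def)
  ultimately show ?thesis using u by blast
qed

definition v0 :: 'v where "v0 = (SOME v. v \<in> carrier M \<and> v \<noteq> \<zero>\<^bsub>M\<^esub>)"

lemma v0: "v0 \<in> carrier M" "v0 \<noteq> \<zero>\<^bsub>M\<^esub>"
proof -
  have "\<exists>v. v \<in> carrier M \<and> v \<noteq> \<zero>\<^bsub>M\<^esub>"
    using simple M.M.zero_closed unfolding simple_module_def by blast
  from someI_ex[OF this] show "v0 \<in> carrier M" "v0 \<noteq> \<zero>\<^bsub>M\<^esub>" by (auto simp: v0_def)
qed

lemma supported_act:
  assumes "\<zero>\<^bsub>M\<^esub> \<in> W" "\<And>u w. u \<in> W \<Longrightarrow> w \<in> W \<Longrightarrow> u \<oplus>\<^bsub>M\<^esub> w \<in> W"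
    and mon: "\<And>c i j. c \<in> carrier K \<Longrightarrow> (i, j) \<in> \<Gamma> \<Longrightarrow> mon c i j \<odot>\<^bsub>M\<^esub> v0 \<in> W" and f: "f \<in> supported \<Gamma>"
  shows "f \<odot>\<^bsub>M\<^esub> v0 \<in> W"
  using f
proof (induction f rule: supported_induct)
  case zero then show ?case using assms v0 by simp
next
  case (add c i j f)
  have "f \<in> carrier B" using add by (simp add: supported_def)
  then show ?case using add v0 assms by (simp add: M.smult_l_distr)
qed

text \<open>M = B v0, so a set that contains 0 and is closed under addition contains M once it
  contains all monomials applied to v0. Asking only this of W lets it be a span over any of the
  coefficient sets.\<close>

lemma generated:
  assumes "\<zero>\<^bsub>M\<^esub> \<in> W" "\<And>u w. u \<in> W \<Longrightarrow> w \<in> W \<Longrightarrow> u \<oplus>\<^bsub>M\<^esub> w \<in> W"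
    and mon: "\<And>c i j. c \<in> carrier K \<Longrightarrow> mon c i j \<odot>\<^bsub>M\<^esub> v0 \<in> W"
  shows "carrier M \<subseteq> W"
proof
  fix u assume "u \<in> carrier M"
  then obtain f where f: "f \<in> carrier B" "u = f \<odot>\<^bsub>M\<^esub> v0" using simple_cyclic[OF simple v0] by blast
  have "f \<in> supported UNIV" using f by (simp add: supported_def)
  from supported_act[OF assms(1,2) mon this] show "u \<in> W" using f by simp
qed

lemma Z_spanning: "\<exists>S. finite S \<and> S \<subseteq> carrier M \<and> carrier M \<subseteq> M.cspan Z S"
proof -
  let ?S = "(\<lambda>(i, j). mon \<one> (int i) (int j) \<odot>\<^bsub>M\<^esub> v0) ` I2"
  have S: "finite ?S" "?S \<subseteq> carrier M" using v0 M.smult_closed by auto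
  have ZB: "Z \<subseteq> carrier B" by auto
  have "carrier M \<subseteq> M.cspan Z ?S"
  proof (rule generated)
    fix c i j assume c: "c \<in> carrier K"
    let ?i = "i mod int n" and ?j = "j mod int n"
    have ij: "0 \<le> ?i" "?i < int n" "0 \<le> ?j" "?j < int n" by simp_all
    then have "mon \<one> ?i ?j \<odot>\<^bsub>M\<^esub> v0 \<in> ?S"
      by (intro image_eqI[of _ _ "(nat ?i, nat ?j)"]) (auto simp: nat_less_iff)
    then have "mon c (i - ?i) (j - ?j) \<odot>\<^bsub>M\<^esub> (mon \<one> ?i ?j \<odot>\<^bsub>M\<^esub> v0) \<in> M.cspan Z ?S"
      using c by (intro M.cspan_base[OF ZB S(2)] mon_center) (auto simp: minus_mod_eq_mult_div)
    moreover have "mon c (i - ?i) (j - ?j) \<otimes>\<^bsub>B\<^esub> mon \<one> ?i ?j = mon c i j"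
      using c by (simp add: mon_mult minus_mod_eq_mult_div)
    ultimately show "mon c i j \<odot>\<^bsub>M\<^esub> v0 \<in> M.cspan Z ?S"
      using c v0 by (simp flip: M.smult_assoc1)
  qed (auto intro: M.cspan.zero M.cspan_add[OF ZB S(2)])
  then show ?thesis using S by blast
qed

text \<open>An ideal J strictly above p contains some z that does not kill M, so zM = M. Nakayama's
  lemma over the centre puts some 1 + az into p, hence into J; as az is also in J, so is 1.\<close>

lemma p_maximal: "maximalideal p (qtZ K q)"
proof -
  have p: "ideal p (qtZ K q)" by (rule ideal_contraction(1)[OF M.annihilator_ideal])
  have one: "\<one>\<^bsub>B\<^esub> \<notin> \<aa>" using v0 by (auto simp: annihilator_def M.smult_one)
  obtain S where S: "finite S" "S \<subseteq> carrier M" and span: "carrier M \<subseteq> M.cspan Z S" using Z_spanning by blast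
  interpret Zr: cring "qtZ K q" by (rule qtZ_cring)
  show ?thesis
  proof (rule maximalidealI[OF p])
    show "carrier (qtZ K q) \<noteq> p" using one center_one by auto
    fix J assume J: "ideal J (qtZ K q)" "p \<subseteq> J" "J \<subseteq> carrier (qtZ K q)"
    show "J = p \<or> J = carrier (qtZ K q)"
    proof (rule ccontr)
      assume n: "\<not> (J = p \<or> J = carrier (qtZ K q))"
      then obtain z where z: "z \<in> J" "z \<notin> p" using J by blast
      then have zZ: "z \<in> Z" using J by auto
      have "\<exists>a\<in>Z. \<one>\<^bsub>B\<^esub> \<oplus>\<^bsub>B\<^esub> a \<otimes>\<^bsub>B\<^esub> z \<in> \<aa>"
        by (rule M.nakayama[OF S _ _ _ _ _ _ _ _ span])
          (use zZ z central_surj center_zero center_one center_add center_mult center_minus in auto)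
      then obtain a where a: "a \<in> Z" "\<one>\<^bsub>B\<^esub> \<oplus>\<^bsub>B\<^esub> a \<otimes>\<^bsub>B\<^esub> z \<in> J"
        using J(2) zZ center_one center_add center_mult by blast
      interpret J: ideal J "qtZ K q" by (rule J(1))
      have az: "a \<otimes>\<^bsub>B\<^esub> z \<in> J" using J.I_l_closed[of z a] a z by simp
      have "(\<one>\<^bsub>B\<^esub> \<oplus>\<^bsub>B\<^esub> a \<otimes>\<^bsub>B\<^esub> z) \<oplus>\<^bsub>B\<^esub> (\<ominus>\<^bsub>qtZ K q\<^esub> (a \<otimes>\<^bsub>B\<^esub> z)) \<in> J"
        using J.a_closed[OF a(2) J.a_inv_closed[OF az]] by simp
      also have "\<ominus>\<^bsub>qtZ K q\<^esub> (a \<otimes>\<^bsub>B\<^esub> z) = \<ominus>\<^bsub>B\<^esub> (a \<otimes>\<^bsub>B\<^esub> z)"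
        using a zZ center_mult center_minus B.l_neg by (intro Zr.minus_equality) auto
      finally have "\<one>\<^bsub>B\<^esub> \<in> J" using a zZ by (simp add: B.a_assoc B.r_neg)
      then show False using J.one_imp_carrier n by simp
    qed
  qed
qed

end

section \<open>Finite dimension over K by rewriting\<close>

context simple_qt_module begin

text \<open>P kills M and may be multiplied by any monomial. Moving its term at (i0, j0) to (i, j)
  expresses h^i x^j v0 through the other terms of P, shifted by the same amount.\<close>

lemma reduction_step:
  assumes W: "\<zero>\<^bsub>M\<^esub> \<in> W" "\<And>u w. u \<in> W \<Longrightarrow> w \<in> W \<Longrightarrow> u \<oplus>\<^bsub>M\<^esub> w \<in> W"
    and P: "P \<in> p" "P j0 i0 \<noteq> \<zero>" and c: "c \<in> carrier K"
    and other: "\<And>k l d. P l k \<noteq> \<zero> \<Longrightarrow> (k, l) \<noteq> (i0, j0) \<Longrightarrow> d \<in> carrier K \<Longrightarrow>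
      mon d (i - i0 + k) (j - j0 + l) \<odot>\<^bsub>M\<^esub> v0 \<in> W"
  shows "mon c i j \<odot>\<^bsub>M\<^esub> v0 \<in> W"
proof -
  have PB: "P \<in> carrier B" using P by simp
  \<comment> \<open>The power of q comes from moving x^(j-j0) past h^i0. With this u the coefficient
    e = -c/u makes the term of the product at (i, j) exactly -c.\<close>
  define u where "u = qp (i0 * (j - j0)) \<otimes> P j0 i0"
  have u: "u \<in> carrier K" "u \<noteq> \<zero>" "u \<in> Units K" using PB P(2) integral_iff[of "qp (i0 * (j - j0))" "P j0 i0"] by (auto simp: u_def field_Units)
  define e where "e = \<ominus> c \<otimes> inv u"
  have e: "e \<in> carrier K" "e \<otimes> u = \<ominus> c" using u c by (simp_all add: e_def m_assoc)
  define f where "f = mon e (i - i0) (j - j0) \<otimes>\<^bsub>B\<^esub> P"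
  have f: "f \<in> carrier B" using e PB by (simp add: f_def)
  have coeff: "f l k = e \<otimes> qp ((k - (i - i0)) * (j - j0)) \<otimes> P (l - (j - j0)) (k - (i - i0))" for l k
    using e PB by (simp add: f_def mon_mult_coeff)
  define \<Gamma> where "\<Gamma> = {(i - i0 + k, j - j0 + l) | k l. P l k \<noteq> \<zero> \<and> (k, l) \<noteq> (i0, j0)}"
  have sup: "f \<oplus>\<^bsub>B\<^esub> mon c i j \<in> supported \<Gamma>"
    unfolding supported_def mem_Collect_eq
  proof (intro conjI allI impI)
    fix l k assume nz: "(f \<oplus>\<^bsub>B\<^esub> mon c i j) l k \<noteq> \<zero>"
    show "(k, l) \<in> \<Gamma>"
    proof (cases "(k, l) = (i, j)")
      case True
      have "f j i = \<ominus> c" using e u PB by (simp add: coeff m_assoc flip: u_def)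
      then show ?thesis using nz True c by (simp add: B_add mon_coeff l_neg)
    next
      case False
      then have "f l k \<noteq> \<zero>" using nz f c by (auto simp: B_add mon_coeff split: if_splits)
      then have "P (l - (j - j0)) (k - (i - i0)) \<noteq> \<zero>" using e PB by (auto simp: coeff)
      then show ?thesis using False unfolding \<Gamma>_def
        by (intro CollectI exI[of _ "k - (i - i0)"] exI[of _ "l - (j - j0)"]) auto
    qed
  qed (use f c in simp)
  have "(f \<oplus>\<^bsub>B\<^esub> mon c i j) \<odot>\<^bsub>M\<^esub> v0 \<in> W"
    by (rule supported_act[OF W _ sup]) (use other in \<open>auto simp: \<Gamma>_def\<close>)
  moreover have "f \<odot>\<^bsub>M\<^esub> v0 = \<zero>\<^bsub>M\<^esub>"
    using e PB v0 p_act[OF P(1) v0(1)] by (simp add: f_def M.smult_assoc1)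
  ultimately show ?thesis using f c v0 M.smult_closed by (simp add: M.smult_l_distr)
qed

text \<open>\<open>P\<close> rewrites every monomial, applied to \<open>v0\<close>, into the strip of height \<open>N\<close>. The set \<open>\<Gamma>\<close> of exponents
  that may occur on the way is a parameter because the second rewriting has to stay in the first strip.\<close>

definition reduces :: "'a qt \<Rightarrow> int \<Rightarrow> int \<Rightarrow> int \<Rightarrow> bool" where
  "reduces P \<alpha> \<beta> N \<longleftrightarrow> (\<forall>W \<Gamma>. \<zero>\<^bsub>M\<^esub> \<in> W \<longrightarrow> (\<forall>u\<in>W. \<forall>w\<in>W. u \<oplus>\<^bsub>M\<^esub> w \<in> W) \<longrightarrow>
    (\<forall>i j k l k' l'. (i, j) \<in> \<Gamma> \<longrightarrow> P l k \<noteq> \<zero> \<longrightarrow> P l' k' \<noteq> \<zero> \<longrightarrow> (i - k + k', j - l + l') \<in> \<Gamma>) \<longrightarrow>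
    (\<forall>c\<in>carrier K. \<forall>(i, j)\<in>\<Gamma>. 0 \<le> \<alpha> * i + \<beta> * j \<and> \<alpha> * i + \<beta> * j < N \<longrightarrow> mon c i j \<odot>\<^bsub>M\<^esub> v0 \<in> W) \<longrightarrow>
    (\<forall>c\<in>carrier K. \<forall>(i, j)\<in>\<Gamma>. mon c i j \<odot>\<^bsub>M\<^esub> v0 \<in> W))"

lemma reducesD:
  assumes "reduces P \<alpha> \<beta> N" "\<zero>\<^bsub>M\<^esub> \<in> W" "\<And>u w. u \<in> W \<Longrightarrow> w \<in> W \<Longrightarrow> u \<oplus>\<^bsub>M\<^esub> w \<in> W"
    "\<And>i j k l k' l'. (i, j) \<in> \<Gamma> \<Longrightarrow> P l k \<noteq> \<zero> \<Longrightarrow> P l' k' \<noteq> \<zero> \<Longrightarrow> (i - k + k', j - l + l') \<in> \<Gamma>"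
    "\<And>c i j. c \<in> carrier K \<Longrightarrow> (i, j) \<in> \<Gamma> \<Longrightarrow> 0 \<le> \<alpha> * i + \<beta> * j \<Longrightarrow> \<alpha> * i + \<beta> * j < N \<Longrightarrow> mon c i j \<odot>\<^bsub>M\<^esub> v0 \<in> W"
    "c \<in> carrier K" "(i, j) \<in> \<Gamma>"
  shows "mon c i j \<odot>\<^bsub>M\<^esub> v0 \<in> W"
proof -
  have "\<forall>c\<in>carrier K. \<forall>(i, j)\<in>\<Gamma>. mon c i j \<odot>\<^bsub>M\<^esub> v0 \<in> W"
    by (rule assms(1)[unfolded reduces_def, THEN spec, THEN spec, THEN mp, THEN mp, THEN mp, THEN mp])
      (use assms(2-5) in auto)
  then show ?thesis using assms(6,7) by blast
qed

text \<open>The linear form separates the exponents of P, so P has a single term of greatest and a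
  single term of least height. Solving for the former lowers monomials above the strip, solving for
  the latter raises those below it.\<close>

lemma reduction:
  fixes \<alpha> \<beta> :: int
  assumes P: "P \<in> p" "P \<noteq> \<zero>\<^bsub>B\<^esub>"
    and inj: "\<And>i j k l. P j i \<noteq> \<zero> \<Longrightarrow> P l k \<noteq> \<zero> \<Longrightarrow> \<alpha> * i + \<beta> * j = \<alpha> * k + \<beta> * l \<Longrightarrow> i = k \<and> j = l"
  shows "\<exists>N. reduces P \<alpha> \<beta> N"
proof -
  define ht where "ht i j = \<alpha> * i + \<beta> * j" for i j
  have lin: "ht (i - i0 + k) (j - j0 + l) = ht i j - ht i0 j0 + ht k l" for i i0 k j j0 l
    by (simp add: ht_def algebra_simps)
  have PB: "P \<in> carrier B" using P by simp
  let ?S = "{(i, j). P j i \<noteq> \<zero>}"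
  let ?V = "(\<lambda>(i, j). ht i j) ` ?S"
  have fin: "finite ?V" using supp_finite[OF PB] by simp
  have ne: "?V \<noteq> {}"
  proof
    assume "?V = {}"
    then have "P j i = \<zero>\<^bsub>B\<^esub> j i" for j i by (auto simp: B_zero)
    then show False using P(2) by blast
  qed
  obtain i1 j1 where 1: "P j1 i1 \<noteq> \<zero>" "ht i1 j1 = Max ?V" using Max_in[OF fin ne] by auto
  obtain i2 j2 where 2: "P j2 i2 \<noteq> \<zero>" "ht i2 j2 = Min ?V" using Min_in[OF fin ne] by auto
  have bounds: "ht k l \<le> ht i1 j1" "ht i2 j2 \<le> ht k l" if "P l k \<noteq> \<zero>" for k l
    using that Max_ge[OF fin, of "ht k l"] Min_le[OF fin, of "ht k l"] 1 2 by force+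
  have strict: "ht k l < ht i1 j1" if "P l k \<noteq> \<zero>" "(k, l) \<noteq> (i1, j1)" for k l
    using bounds(1)[OF that(1)] inj[OF that(1) 1(1)] that(2) by (fastforce simp: ht_def)
  have strict': "ht i2 j2 < ht k l" if "P l k \<noteq> \<zero>" "(k, l) \<noteq> (i2, j2)" for k l
    using bounds(2)[OF that(1)] inj[OF that(1) 2(1)] that(2) by (fastforce simp: ht_def)
  \<comment> \<open>The spread of heights in P. Lowering decreases the height by at least 1 and at
    most N, so from height N or more it terminates without dropping below 0.\<close>
  let ?N = "ht i1 j1 - ht i2 j2"
  show ?thesis unfolding reduces_def
  proof (intro exI[of _ ?N] allI impI)
    fix W \<Gamma>
    assume W: "\<zero>\<^bsub>M\<^esub> \<in> W" "\<forall>u\<in>W. \<forall>w\<in>W. u \<oplus>\<^bsub>M\<^esub> w \<in> W"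
      and \<Gamma>: "\<forall>i j k l k' l'. (i, j) \<in> \<Gamma> \<longrightarrow> P l k \<noteq> \<zero> \<longrightarrow> P l' k' \<noteq> \<zero> \<longrightarrow> (i - k + k', j - l + l') \<in> \<Gamma>"
      and base: "\<forall>c\<in>carrier K. \<forall>(i, j)\<in>\<Gamma>. 0 \<le> \<alpha> * i + \<beta> * j \<and> \<alpha> * i + \<beta> * j < ?N \<longrightarrow> mon c i j \<odot>\<^bsub>M\<^esub> v0 \<in> W"
    note W' = W(1) W(2)[rule_format]
    have pos: "mon c i j \<odot>\<^bsub>M\<^esub> v0 \<in> W" if "c \<in> carrier K" "(i, j) \<in> \<Gamma>" "0 \<le> ht i j" for c i j
      using that
    proof (induction "nat (ht i j)" arbitrary: c i j rule: less_induct)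
      case less
      show ?case
      proof (cases "ht i j < ?N")
        case True
        then show ?thesis using base less.prems by (auto simp: ht_def)
      next
        case False
        show ?thesis
        proof (rule reduction_step[OF W' P(1) 1(1) less.prems(1)])
          fix k l d assume kl: "P l k \<noteq> \<zero>" "(k, l) \<noteq> (i1, j1)" and d: "d \<in> carrier K"
          show "mon d (i - i1 + k) (j - j1 + l) \<odot>\<^bsub>M\<^esub> v0 \<in> W"
          proof (rule less.hyps[OF _ d])
            show "(i - i1 + k, j - j1 + l) \<in> \<Gamma>" using \<Gamma> less.prems(2) 1(1) kl(1) by blast
            show "0 \<le> ht (i - i1 + k) (j - j1 + l)" "nat (ht (i - i1 + k) (j - j1 + l)) < nat (ht i j)"
              using lin[of i i1 k j j1 l] strict[OF kl] bounds(2)[OF kl(1)] False less.prems(3) by linarith+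
          qed
        qed
      qed
    qed
    \<comment> \<open>Raising may overshoot the strip; the resulting monomial then has nonnegative
      height and is covered by \<open>pos\<close>.\<close>
    have "mon c i j \<odot>\<^bsub>M\<^esub> v0 \<in> W" if "c \<in> carrier K" "(i, j) \<in> \<Gamma>" for c i j
      using that
    proof (induction "nat (- ht i j)" arbitrary: c i j rule: less_induct)
      case less
      show ?case
      proof (cases "0 \<le> ht i j")
        case True
        then show ?thesis using pos less.prems by blast
      next
        case False
        show ?thesis
        proof (rule reduction_step[OF W' P(1) 2(1) less.prems(1)])
          fix k l d assume kl: "P l k \<noteq> \<zero>" "(k, l) \<noteq> (i2, j2)" and d: "d \<in> carrier K"
          show "mon d (i - i2 + k) (j - j2 + l) \<odot>\<^bsub>M\<^esub> v0 \<in> W"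
          proof (rule less.hyps[OF _ d])
            show "(i - i2 + k, j - j2 + l) \<in> \<Gamma>" using \<Gamma> less.prems(2) 2(1) kl(1) by blast
            show "nat (- ht (i - i2 + k) (j - j2 + l)) < nat (- ht i j)"
              using lin[of i i2 k j j2 l] strict'[OF kl] False by linarith
          qed
        qed
      qed
    qed
    then show "\<forall>c\<in>carrier K. \<forall>(i, j)\<in>\<Gamma>. mon c i j \<odot>\<^bsub>M\<^esub> v0 \<in> W" by blast
  qed
qed

text \<open>With y the given monomial, either 1 + y itself kills M, or it maps M onto M and
  Nakayama's lemma over C yields an element 1 + a(1 + y) of C that kills M and is nonzero. Taking
  for C the whole centre shows that p is nonzero; taking K[y, y^-1] supplies the second
  relation.\<close>

lemma p_meets_subring:
  assumes C: "C \<subseteq> Z" "\<zero>\<^bsub>B\<^esub> \<in> C" "\<one>\<^bsub>B\<^esub> \<in> C" "\<And>c d. c \<in> C \<Longrightarrow> d \<in> C \<Longrightarrow> c \<oplus>\<^bsub>B\<^esub> d \<in> C"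
      "\<And>c d. c \<in> C \<Longrightarrow> d \<in> C \<Longrightarrow> c \<otimes>\<^bsub>B\<^esub> d \<in> C" "\<And>c. c \<in> C \<Longrightarrow> \<ominus>\<^bsub>B\<^esub> c \<in> C"
    and mon: "mon \<one> i j \<in> C" "int n dvd i" "int n dvd j" "i \<noteq> 0"
    and S: "finite S" "S \<subseteq> carrier M" "carrier M \<subseteq> M.cspan C S"
  shows "\<exists>P\<in>p \<inter> C. P \<noteq> \<zero>\<^bsub>B\<^esub>"
proof -
  let ?z = "\<one>\<^bsub>B\<^esub> \<oplus>\<^bsub>B\<^esub> mon \<one> i j"
  have z: "?z \<in> C" using C mon by blast
  show ?thesis
  proof (cases "?z \<in> \<aa>")
    case True
    have "?z (0) (0) = \<one>" using mon(4) by (simp add: B_add B_one mon_coeff)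
    then have "?z \<noteq> \<zero>\<^bsub>B\<^esub>" by (metis B_zero one_not_zero)
    then show ?thesis using True z C(1) by blast
  next
    case False
    have "\<exists>a\<in>C. \<one>\<^bsub>B\<^esub> \<oplus>\<^bsub>B\<^esub> a \<otimes>\<^bsub>B\<^esub> ?z \<in> \<aa>"
      by (rule M.nakayama[OF S(1,2) C(1,2,4,5,6,3) z _ S(3)]) (use central_surj z False C(1) in blast)+
    then obtain a where a: "a \<in> C" "\<one>\<^bsub>B\<^esub> \<oplus>\<^bsub>B\<^esub> a \<otimes>\<^bsub>B\<^esub> ?z \<in> \<aa>" by blast
    have "\<one>\<^bsub>B\<^esub> \<oplus>\<^bsub>B\<^esub> a \<otimes>\<^bsub>B\<^esub> ?z \<in> C" using C z a(1) by blast
    moreover have "\<one>\<^bsub>B\<^esub> \<oplus>\<^bsub>B\<^esub> a \<otimes>\<^bsub>B\<^esub> ?z \<noteq> \<zero>\<^bsub>B\<^esub>" using a(1) C(1) mon by (intro one_plus_multiple_nonzero) auto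
    ultimately show ?thesis using a C(1) by blast
  qed
qed

lemma scalars_spanning: "\<exists>S. finite S \<and> S \<subseteq> carrier M \<and> carrier M \<subseteq> M.cspan (qt_scalar K ` carrier K) S"
proof -
  obtain S0 where "finite S0" "S0 \<subseteq> carrier M" "carrier M \<subseteq> M.cspan Z S0" using Z_spanning by blast
  then have "\<exists>P\<in>p \<inter> Z. P \<noteq> \<zero>\<^bsub>B\<^esub>"
    by (intro p_meets_subring[of Z "int n" 0 S0]) (auto intro: center_zero center_one center_add center_mult center_minus mon_center)
  then obtain P where P: "P \<in> p" "P \<noteq> \<zero>\<^bsub>B\<^esub>" by blast
  let ?S = "{(i, j). P j i \<noteq> \<zero>}"
  have "finite ((\<lambda>(i, j). \<bar>j\<bar>) ` ?S)" using supp_finite[of P] P by auto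
  then obtain m where m: "\<And>y. y \<in> (\<lambda>(i, j). \<bar>j\<bar>) ` ?S \<Longrightarrow> y \<le> m"
    by (metis Max_ge)
  \<comment> \<open>Exponents of x in P are at most m in absolute value, so two of them differ by
    less than k. Then ki + j determines i and j, as in an expansion to base k.\<close>
  define k where "k = 2 * \<bar>m\<bar> + 1"
  have mk: "\<bar>j\<bar> \<le> m" if "P j i \<noteq> \<zero>" for i j using that by (intro m) force
  have inj: "i = i' \<and> j = j'" if "P j i \<noteq> \<zero>" "P j' i' \<noteq> \<zero>" "k * i + 1 * j = k * i' + 1 * j'" for i j i' j'
  proof -
    have "k * (i - i') = j' - j" using that(3) by (simp add: algebra_simps)
    moreover have "\<bar>j' - j\<bar> < \<bar>k\<bar>" using mk[OF that(1)] mk[OF that(2)] by (auto simp: k_def)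
    ultimately have "\<bar>k\<bar> * \<bar>i - i'\<bar> < \<bar>k\<bar>" by (simp flip: abs_mult)
    then have "\<bar>i - i'\<bar> < 1" using mult_left_mono[of 1 "\<bar>i - i'\<bar>" "\<bar>k\<bar>"] by fastforce
    then have "i = i'" by simp
    then show ?thesis using that(3) by simp
  qed
  obtain N where N: "reduces P k 1 N" using reduction[OF P inj] by blast
  have all: "carrier M \<subseteq> W"
    if W: "\<zero>\<^bsub>M\<^esub> \<in> W" "\<And>u w. u \<in> W \<Longrightarrow> w \<in> W \<Longrightarrow> u \<oplus>\<^bsub>M\<^esub> w \<in> W"
      and strip: "\<And>c i j. c \<in> carrier K \<Longrightarrow> 0 \<le> k * i + j \<Longrightarrow> k * i + j < N \<Longrightarrow> mon c i j \<odot>\<^bsub>M\<^esub> v0 \<in> W" for W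
  proof (rule generated[OF W])
    fix c i j assume c: "c \<in> carrier K"
    show "mon c i j \<odot>\<^bsub>M\<^esub> v0 \<in> W" by (rule reducesD[OF N W _ _ c, where \<Gamma> = UNIV]) (auto intro: strip)
  qed
  \<comment> \<open>The exponents of the powers of y = h^n x^(-nk). The form ki + j vanishes on
    them, so multiplication by y moves monomials within a line of constant height.\<close>
  define \<Lambda> where "\<Lambda> = {(int n * l, - (int n * k * l)) | l. True}"
  define C where "C = supported \<Lambda>"
  have \<Lambda>I: "(int n * l, - (int n * k * l)) \<in> \<Lambda>" for l by (auto simp: \<Lambda>_def)
  have \<Lambda>_add: "(i + i', j + j') \<in> \<Lambda>" if "(i, j) \<in> \<Lambda>" "(i', j') \<in> \<Lambda>" for i j i' j'
  proof -
    obtain l l' where "i = int n * l" "j = - (int n * k * l)" "i' = int n * l'" "j' = - (int n * k * l')"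
      using \<open>(i, j) \<in> \<Lambda>\<close> \<open>(i', j') \<in> \<Lambda>\<close> by (auto simp: \<Lambda>_def)
    then show ?thesis using \<Lambda>I[of "l + l'"] by (simp add: distrib_left)
  qed
  have CZ: "C \<subseteq> Z"
  proof
    fix f assume f: "f \<in> C"
    have "int n dvd i \<and> int n dvd j" if "f j i \<noteq> \<zero>" for i j
      using f that unfolding C_def supported_def \<Lambda>_def by force
    then show "f \<in> Z" using f unfolding C_def supported_def center_iff central_supp_def by blast
  qed
  then have CB: "C \<subseteq> carrier B" by auto
  \<comment> \<open>A pair (i, r) names the monomial of height r with h-exponent i. Splitting off a
    power of y reduces i modulo n and keeps r, so n N monomials generate M over K[y, y^-1].\<close>
  let ?S1 = "(\<lambda>(i, r). mon \<one> i (r - k * i) \<odot>\<^bsub>M\<^esub> v0) ` ({0..<int n} \<times> {0..<N})"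
  have S1: "finite ?S1" "?S1 \<subseteq> carrier M" using v0 M.smult_closed by auto
  have span1: "carrier M \<subseteq> M.cspan C ?S1"
  proof (rule all)
    fix c i j assume c: "c \<in> carrier K" and r: "0 \<le> k * i + j" "k * i + j < N"
    let ?i = "i mod int n" and ?l = "i div int n"
    let ?r = "k * i + j"
    have "mon \<one> ?i (?r - k * ?i) \<odot>\<^bsub>M\<^esub> v0 \<in> ?S1" using r by (intro image_eqI[of _ _ "(?i, ?r)"]) auto
    then have "mon c (int n * ?l) (- (int n * k * ?l)) \<odot>\<^bsub>M\<^esub> (mon \<one> ?i (?r - k * ?i) \<odot>\<^bsub>M\<^esub> v0) \<in> M.cspan C ?S1"
      using c unfolding C_def by (intro M.cspan_base[OF CB[unfolded C_def] S1(2)] supported_mon \<Lambda>I)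
    moreover have "mon c (int n * ?l) (- (int n * k * ?l)) \<otimes>\<^bsub>B\<^esub> mon \<one> ?i (?r - k * ?i) = mon c i j"
    proof -
      have "k * i = k * (int n * ?l + ?i)" by simp
      then have j: "- (int n * k * ?l) + (?r - k * ?i) = j" by (simp only: distrib_left) (simp add: algebra_simps)
      have "mon c (int n * ?l) (- (int n * k * ?l)) \<otimes>\<^bsub>B\<^esub> mon \<one> ?i (?r - k * ?i)
          = mon c (int n * ?l + ?i) (- (int n * k * ?l) + (?r - k * ?i))"
        using c by (simp add: mon_mult)
      then show ?thesis unfolding j by simp
    qed
    ultimately show "mon c i j \<odot>\<^bsub>M\<^esub> v0 \<in> M.cspan C ?S1"
      using c v0 by (simp flip: M.smult_assoc1)
  qed (auto intro: M.cspan.zero M.cspan_add[OF CB S1(2)])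
  have "(0, 0) \<in> \<Lambda>" using \<Lambda>I[of 0] by simp
  then have "\<exists>Q\<in>p \<inter> C. Q \<noteq> \<zero>\<^bsub>B\<^esub>"
    using supported_mult[OF \<Lambda>_add] \<Lambda>I[of 1]
    by (intro p_meets_subring[OF CZ _ _ _ _ _ _ _ _ _ S1 span1, of "int n" "- (int n * k)"])
      (auto simp: C_def B_one intro: supported_zero supported_add supported_minus supported_mon)
  then obtain Q where Q: "Q \<in> p" "Q \<in> supported \<Lambda>" "Q \<noteq> \<zero>\<^bsub>B\<^esub>" unfolding C_def by blast
  have Q\<Lambda>: "\<exists>l. i = int n * l \<and> j = - (int n * k * l)" if "Q j i \<noteq> \<zero>" for i j
    using Q(2) that by (auto simp: supported_def \<Lambda>_def)
  \<comment> \<open>On \<Lambda> the exponent of h determines that of x, so the coordinate i alone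
    can serve as the linear form for Q.\<close>
  have injQ: "i = i' \<and> j = j'" if "Q j i \<noteq> \<zero>" "Q j' i' \<noteq> \<zero>" "1 * i + 0 * j = 1 * i' + 0 * j'" for i j i' j'
    using Q\<Lambda>[OF that(1)] Q\<Lambda>[OF that(2)] that(3) n_pos by auto
  obtain N' where N': "reduces Q 1 0 N'" using reduction[OF Q(1,3) injQ] by blast
  let ?F = "qt_scalar K ` carrier K"
  let ?S2 = "(\<lambda>(i, r). mon \<one> i (r - k * i) \<odot>\<^bsub>M\<^esub> v0) ` ({0..<N'} \<times> {0..<N})"
  have S2: "finite ?S2" "?S2 \<subseteq> carrier M" using v0 M.smult_closed by auto
  have FB: "?F \<subseteq> carrier B" by (auto simp: B_scalar)
  \<comment> \<open>The first strip. All exponents of Q have ki + j = 0, so rewriting by Q stays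
    inside it while bounding i; finitely many monomials satisfy both bounds.\<close>
  let ?\<Gamma> = "{(i, j). 0 \<le> k * i + j \<and> k * i + j < N}"
  have W: "\<zero>\<^bsub>M\<^esub> \<in> M.cspan ?F ?S2" "\<And>u w. u \<in> M.cspan ?F ?S2 \<Longrightarrow> w \<in> M.cspan ?F ?S2 \<Longrightarrow> u \<oplus>\<^bsub>M\<^esub> w \<in> M.cspan ?F ?S2"
    by (auto intro: M.cspan.zero M.cspan_add[OF FB S2(2)])
  have "mon c i j \<odot>\<^bsub>M\<^esub> v0 \<in> M.cspan ?F ?S2" if c: "c \<in> carrier K" and ij: "(i, j) \<in> ?\<Gamma>" for c i j
  proof (rule reducesD[OF N' W _ _ c ij])
    fix i j a l a' l' assume ij: "(i, j) \<in> ?\<Gamma>" and nz: "Q l a \<noteq> \<zero>" "Q l' a' \<noteq> \<zero>"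
    have "k * a + l = 0" "k * a' + l' = 0" using Q\<Lambda>[OF nz(1)] Q\<Lambda>[OF nz(2)] by auto
    then have "k * (i - a + a') + (j - l + l') = k * i + j" by (simp add: algebra_simps)
    then show "(i - a + a', j - l + l') \<in> ?\<Gamma>" using ij by auto
  next
    fix c i j assume c: "c \<in> carrier K" and r: "(i, j) \<in> ?\<Gamma>" "0 \<le> 1 * i + 0 * j" "1 * i + 0 * j < N'"
    have "mon \<one> i j \<odot>\<^bsub>M\<^esub> v0 \<in> ?S2" using r by (intro image_eqI[of _ _ "(i, k * i + j)"]) auto
    then have "qt_scalar K c \<odot>\<^bsub>M\<^esub> (mon \<one> i j \<odot>\<^bsub>M\<^esub> v0) \<in> M.cspan ?F ?S2"
      using c by (intro M.cspan_base[OF FB S2(2)]) auto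
    then show "mon c i j \<odot>\<^bsub>M\<^esub> v0 \<in> M.cspan ?F ?S2"
      using c v0 by (simp add: B_scalar mon_mult flip: M.smult_assoc1)
  qed
  then have "carrier M \<subseteq> M.cspan ?F ?S2" by (intro all W) auto
  then show ?thesis using S2 by blast
qed

lemma finite_dim: "finite_dimensional K (restrict_scalars (qt_scalar K) M)"
proof -
  let ?V = "restrict_scalars (qt_scalar K) M"
  interpret V: left_module K ?V
    by (rule restrict_left_module[OF ring_axioms qt_scalar_hom M.left_module_axioms])
  obtain S where S: "finite S" "S \<subseteq> carrier M" "carrier M \<subseteq> M.cspan (qt_scalar K ` carrier K) S"
    using scalars_spanning by blast
  have "u \<in> V.cspan (carrier K) S" if "u \<in> M.cspan (qt_scalar K ` carrier K) S" for u
    using that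
  proof (induction rule: M.cspan.induct)
    case zero
    show ?case using V.cspan.zero by simp
  next
    case (step c v u)
    then show ?case using V.cspan.step[of _ "carrier K" v S u] by auto
  qed
  then have "u \<in> V.cspan (carrier K) S" if "u \<in> carrier ?V" for u using that S(3) by auto
  then show ?thesis unfolding finite_dimensional_def
    using S V.cspan_finsum[of S] by (intro exI[of _ S]) auto
qed

end

section \<open>Simple modules over the factor algebras\<close>

lemma simple_ring_iso:
  assumes R: "simple_ring R" and S: "ring S" and f: "f \<in> ring_iso R S"
  shows "simple_ring S"
proof -
  interpret R: ring R using R by (simp add: simple_ring_def)
  interpret S: ring S by fact
  have fh: "f \<in> ring_hom R S" and bij: "bij_betw f (carrier R) (carrier S)" using f by (auto simp: ring_iso_def)
  interpret f: ring_hom_ring R S f by (rule ring_hom_ringI2[OF R.ring_axioms S.ring_axioms fh])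
  have im: "f ` carrier R = carrier S" using bij by (simp add: bij_betw_def)
  have "J = {\<zero>\<^bsub>S\<^esub>} \<or> J = carrier S" if J: "ideal J S" for J
  proof -
    let ?I = "{r \<in> carrier R. f r \<in> J}"
    have JS: "J \<subseteq> carrier S" using ideal.Icarr[OF J] by blast
    have fI: "f ` ?I = J"
    proof (intro equalityI subsetI)
      fix y assume y: "y \<in> J"
      then obtain r where "r \<in> carrier R" "y = f r" using JS im by (metis imageE subsetD)
      then show "y \<in> f ` ?I" using y by blast
    qed blast
    have "?I = {\<zero>\<^bsub>R\<^esub>} \<or> ?I = carrier R" using R f.ideal_vimage[OF J] by (simp add: simple_ring_def)
    then show ?thesis
    proof
      assume "?I = {\<zero>\<^bsub>R\<^esub>}"
      then have "f ` ?I = {\<zero>\<^bsub>S\<^esub>}" by (simp only: image_insert image_empty f.hom_zero)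
      then show ?thesis unfolding fI ..
    next
      assume "?I = carrier R"
      then have "f ` ?I = carrier S" by (simp only: im)
      then show ?thesis unfolding fI ..
    qed
  qed
  moreover have "carrier S \<noteq> {\<zero>\<^bsub>S\<^esub>}"
  proof
    assume S0: "carrier S = {\<zero>\<^bsub>S\<^esub>}"
    have "r = \<zero>\<^bsub>R\<^esub>" if "r \<in> carrier R" for r
    proof (rule inj_onD[of f "carrier R"])
      show "inj_on f (carrier R)" using bij by (simp add: bij_betw_def)
      show "f r = f \<zero>\<^bsub>R\<^esub>" using f.hom_closed[OF that] S0 by simp
    qed (use that in auto)
    then show False using R R.zero_closed unfolding simple_ring_def by blast
  qed
  ultimately show ?thesis using S by (simp add: simple_ring_def)
qed

lemma simple_ring_annihilator:
  assumes R: "simple_ring R" and V: "simple_module R V"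
  shows "annihilator R V = {\<zero>\<^bsub>R\<^esub>}"
proof -
  interpret V: left_module R V using V by (simp add: simple_module_def)
  have "annihilator R V \<noteq> carrier R"
  proof
    assume "annihilator R V = carrier R"
    then have "\<one>\<^bsub>R\<^esub> \<odot>\<^bsub>V\<^esub> v = \<zero>\<^bsub>V\<^esub>" if "v \<in> carrier V" for v using that V.R.one_closed by (auto simp: annihilator_def)
    then have "carrier V \<subseteq> {\<zero>\<^bsub>V\<^esub>}" using V.smult_one by auto
    then show False using V V.M.zero_closed unfolding simple_module_def by blast
  qed
  then show ?thesis using R V.annihilator_ideal unfolding simple_ring_def by blast
qed

context qtmax begin

lemma EE_ring: "ring EE" using C.C.ring_axioms by (simp add: E_folds)

lemma EE_simple: "simple_ring EE"
proof -
  obtain \<psi> where "\<psi> \<in> canonical_isos K q n m" using canonical_isos_nonempty by blast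
  then have "\<psi> \<in> ring_iso A EE" by (simp add: canonical_isos_def alg_iso_def)
  then show ?thesis by (rule simple_ring_iso[OF A_simple EE_ring])
qed

lemma EE_artinian: "left_artinian EE"
  using C.C.spanned_left_artinian[OF _ C.basC_closed C.C_span[symmetric]] by (simp add: E_folds)

context
  fixes \<psi> and V :: "((gen list \<Rightarrow> 'a qt set) set, 'u, 'c) module_scheme"
  assumes \<psi>: "\<psi> \<in> canonical_isos K q n m" and V: "simple_module EE V"
begin

lemma \<psi>_hom: "\<psi> \<in> ring_hom A EE" and \<psi>_bij: "bij_betw \<psi> (carrier A) (carrier EE)"
  using \<psi> by (auto simp: canonical_isos_def alg_iso_def ring_iso_def)

lemma \<rho>_hom: "(\<lambda>b. \<psi> (proj b)) \<in> ring_hom B EE"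
  using ring_hom_trans[OF proj_hom \<psi>_hom] by (simp add: comp_def)

lemma \<rho>_image: "(\<lambda>b. \<psi> (proj b)) ` carrier B = carrier EE"
  using \<psi>_bij proj_image by (simp add: bij_betw_def flip: image_image)

lemma \<rho>_zero_iff: "b \<in> carrier B \<Longrightarrow> \<psi> (proj b) = \<zero>\<^bsub>EE\<^esub> \<longleftrightarrow> b \<in> qtBm K q m"
proof -
  assume b: "b \<in> carrier B"
  have "\<psi> \<zero>\<^bsub>A\<^esub> = \<zero>\<^bsub>EE\<^esub>" using ring_hom_zero[OF \<psi>_hom A.ring_axioms EE_ring] .
  then have "\<psi> (proj b) = \<zero>\<^bsub>EE\<^esub> \<longleftrightarrow> proj b = \<zero>\<^bsub>A\<^esub>"
    using inj_onD[OF bij_betw_imp_inj_on[OF \<psi>_bij], of "proj b" "\<zero>\<^bsub>A\<^esub>"] b by auto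
  then show ?thesis using proj_zero_iff[OF b] by simp
qed

lemma as_qt_module_simple: "simple_module B (as_qt_module K q m \<psi> V)"
  unfolding as_qt_module_def by (rule restrict_simple[OF B.ring_axioms \<rho>_hom \<rho>_image V])

lemma as_qt_module_annihilator: "annihilator B (as_qt_module K q m \<psi> V) = qtBm K q m"
  unfolding as_qt_module_def restrict_annihilator[OF B.ring_axioms \<rho>_hom \<rho>_image]
    simple_ring_annihilator[OF EE_simple V] singleton_iff
  using \<rho>_zero_iff Bm.a_Hcarr by blast

lemma as_qt_module_End: "module_End B (as_qt_module K q m \<psi> V) = module_End EE V"
  unfolding as_qt_module_def by (rule restrict_module_End[OF B.ring_axioms \<rho>_hom \<rho>_image])

text \<open>The annihilator Bm is the kernel of the map from B onto E(m), so M descends to a simple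
  E(m)-module. All of these are isomorphic, and restriction preserves the isomorphism.\<close>

lemma as_qt_module_unique:
  fixes M :: "('a qt, 'v, 'd) module_scheme"
  assumes M: "simple_module B M" "annihilator B M = qtBm K q m"
  shows "module_isomorphic B M (as_qt_module K q m \<psi> V)"
proof -
  obtain N :: "((gen list \<Rightarrow> 'a qt set) set, 'v) module"
    where N: "simple_module EE N" "module_isomorphic B M (restrict_scalars (\<lambda>b. \<psi> (proj b)) N)"
    by (rule descend_module[OF B.ring_axioms \<rho>_hom \<rho>_image M(1) _ EE_ring])
      (use \<rho>_zero_iff M(2) in auto)
  have "module_isomorphic EE N V" by (rule simple_modules_isomorphic[OF EE_simple EE_artinian N(1) V])
  then have "module_isomorphic B (restrict_scalars (\<lambda>b. \<psi> (proj b)) N) (restrict_scalars (\<lambda>b. \<psi> (proj b)) V)"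
    unfolding module_isomorphic_def restrict_module_hom[OF B.ring_axioms \<rho>_hom \<rho>_image] by simp
  then show ?thesis unfolding as_qt_module_def by (rule module_isomorphic_trans[OF N(2)])
qed

end

lemma ex_as_qt_module:
  obtains \<psi> and V :: "((gen list \<Rightarrow> 'a qt set) set, (gen list \<Rightarrow> 'a qt set) set set) module"
  where "\<psi> \<in> canonical_isos K q n m" "simple_module EE V"
  using canonical_isos_nonempty simple_artinian_simple_module[OF EE_simple EE_artinian] by blast

end

section \<open>Isomorphism classes of simple modules and their annihilators\<close>

context qtorus begin

lemma qtmaxI: "m \<in> MaxIdeals (qtZ K q) \<Longrightarrow> qtmax K q n m"
  by (simp add: qtmax_def qtmax_axioms_def MaxIdeals_def qtorus_axioms)

lemma simple_annihilator:
  assumes "simple_module B M"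
  shows "\<exists>m\<in>MaxIdeals (qtZ K q). annihilator B M = qtBm K q m"
proof -
  interpret simple_qt_module K q n M
    using assms by (simp add: simple_qt_module_def simple_qt_module_axioms_def qtorus_axioms)
  show ?thesis using p_maximal ideal_contraction(2)[OF M.annihilator_ideal] by (auto simp: MaxIdeals_def)
qed

lemma Prim_qt: "Prim B = qtBm K q ` MaxIdeals (qtZ K q)"
proof (intro equalityI subsetI)
  fix I assume "I \<in> Prim B"
  then show "I \<in> qtBm K q ` MaxIdeals (qtZ K q)" using simple_annihilator by (auto simp: Prim_def)
next
  fix I assume "I \<in> qtBm K q ` MaxIdeals (qtZ K q)"
  then obtain m where mM: "m \<in> MaxIdeals (qtZ K q)" "I = qtBm K q m" by blast
  interpret qtmax K q n m by (rule qtmaxI[OF mM(1)])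
  obtain \<psi> and V :: "((gen list \<Rightarrow> 'a qt set) set, (gen list \<Rightarrow> 'a qt set) set set) module"
    where V: "\<psi> \<in> canonical_isos K q n m" "simple_module EE V" by (rule ex_as_qt_module)
  \<comment> \<open>\<open>Prim\<close> refers to modules whose elements are subsets of B, while
    U(m) lives over another type; an isomorphic copy with the same annihilator takes its
    place.\<close>
  obtain N :: "('a qt, 'a qt set) module" where "simple_module B N"
    "annihilator B (as_qt_module K q m \<psi> V) = annihilator B N"
    using iso_class_nonempty[OF as_qt_module_simple[OF V]] by metis
  then show "I \<in> Prim B" using mM(2) as_qt_module_annihilator[OF V] by (auto simp: Prim_def)
qed

context
  fixes \<Psi> :: "'a qt set \<Rightarrow> 'a qt set \<Rightarrow> (gen list \<Rightarrow> 'a qt set) set"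
    and U :: "'a qt set \<Rightarrow> ((gen list \<Rightarrow> 'a qt set) set, 'u) module"
  assumes U: "\<forall>m\<in>MaxIdeals (qtZ K q). \<Psi> m \<in> canonical_isos K q n m \<and> simple_module (qtE K q n m) (U m)"
begin

abbreviation "UB m \<equiv> as_qt_module K q m (\<Psi> m) (U m)"

lemma UB_facts:
  assumes "m \<in> MaxIdeals (qtZ K q)"
  shows "simple_module B (UB m)" "annihilator B (UB m) = qtBm K q m" "module_End B (UB m) = module_End (qtE K q n m) (U m)"
    "class_annihilator B (iso_class B (UB m)) = qtBm K q m"
proof -
  interpret qtmax K q n m by (rule qtmaxI[OF assms])
  have u: "\<Psi> m \<in> canonical_isos K q n m" "simple_module (qtE K q n m) (U m)" using U assms by auto
  show s: "simple_module B (UB m)" by (rule as_qt_module_simple[OF u])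
  show a: "annihilator B (UB m) = qtBm K q m" by (rule as_qt_module_annihilator[OF u])
  show "module_End B (UB m) = module_End (qtE K q n m) (U m)" by (rule as_qt_module_End[OF u])
  show "class_annihilator B (iso_class B (UB m)) = qtBm K q m" using class_annihilator_eq[OF s] a by simp
qed

lemma simple_module_UB:
  fixes M :: "('a qt, 'v, 'd) module_scheme"
  assumes "simple_module B M"
  shows "\<exists>m\<in>MaxIdeals (qtZ K q). module_isomorphic B M (UB m)"
proof -
  obtain m where mM: "m \<in> MaxIdeals (qtZ K q)" "annihilator B M = qtBm K q m" using simple_annihilator[OF assms] by blast
  interpret qtmax K q n m by (rule qtmaxI[OF mM(1)])
  have "module_isomorphic B M (UB m)" using U mM(1) by (intro as_qt_module_unique[OF _ _ assms mM(2)]) auto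
  then show ?thesis using mM(1) by blast
qed

lemma simple_classes_UB: "simple_classes B = (\<lambda>m. iso_class B (UB m)) ` MaxIdeals (qtZ K q)"
proof (intro equalityI subsetI)
  fix c assume "c \<in> simple_classes B"
  then obtain M :: "('a qt, 'a qt set) module" where M: "simple_module B M" "c = iso_class B M" by (auto simp: simple_classes_def)
  obtain m where mM: "m \<in> MaxIdeals (qtZ K q)" "module_isomorphic B M (UB m)" using simple_module_UB[OF M(1)] by blast
  have "iso_class B M = iso_class B (UB m)"
    using iso_class_eq[OF _ _ mM(2)] M(1) UB_facts(1)[OF mM(1)] by (simp add: simple_module_def)
  then show "c \<in> (\<lambda>m. iso_class B (UB m)) ` MaxIdeals (qtZ K q)" using M(2) mM(1) by blast
next
  fix c assume "c \<in> (\<lambda>m. iso_class B (UB m)) ` MaxIdeals (qtZ K q)"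
  then obtain m where mM: "m \<in> MaxIdeals (qtZ K q)" "c = iso_class B (UB m)" by blast
  obtain N :: "('a qt, 'a qt set) module" where "simple_module B N" "iso_class B (UB m) = iso_class B N"
    using iso_class_nonempty[OF UB_facts(1)[OF mM(1)]] by metis
  then show "c \<in> simple_classes B" using mM(2) by (auto simp: simple_classes_def)
qed

text \<open>The injective map from m to Bm factors through the class of U(m). As every class has
  this form, the annihilator is injective on classes; its image was computed in
  \<open>Prim_qt\<close>.\<close>

lemma class_annihilator_bij: "bij_betw (class_annihilator B) (simple_classes B) (Prim B)"
proof -
  have eq: "(class_annihilator B \<circ> (\<lambda>m. iso_class B (UB m))) m = qtBm K q m" if "m \<in> MaxIdeals (qtZ K q)" for m
    using UB_facts(4)[OF that] by simp
  have "inj_on (class_annihilator B \<circ> (\<lambda>m. iso_class B (UB m))) (MaxIdeals (qtZ K q))"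
    using qtBm_inj by (subst inj_on_cong[OF eq])
  then have "inj_on (class_annihilator B) (simple_classes B)"
    unfolding simple_classes_UB by (rule inj_on_imageI)
  moreover have "class_annihilator B ` simple_classes B = Prim B"
    unfolding simple_classes_UB Prim_qt image_image using UB_facts(4) by (intro image_cong) auto
  ultimately show ?thesis by (simp add: bij_betw_def)
qed

lemma inv_class_annihilator:
  assumes mM: "m \<in> MaxIdeals (qtZ K q)"
  shows "inv_into (simple_classes B) (class_annihilator B) (qtBm K q m) = iso_class B (UB m)"
proof (rule inv_into_f_eq)
  show "inj_on (class_annihilator B) (simple_classes B)" using class_annihilator_bij by (simp add: bij_betw_def)
  show "iso_class B (UB m) \<in> simple_classes B" unfolding simple_classes_UB using mM by blast
qed (rule UB_facts(4)[OF mM])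

lemma End_UB:
  assumes mM: "m \<in> MaxIdeals (qtZ K q)" and D: "is_division_ring D" "qtE K q n m \<simeq> matrix_ring d D"
  shows "module_End B (UB m) \<simeq> D"
proof -
  interpret qtmax K q n m by (rule qtmaxI[OF mM])
  show ?thesis unfolding UB_facts(3)[OF mM] using U mM by (intro End_of_simple_module[OF EE_simple _ D]) auto
qed

end

end

text \<open>The identifications \<Psi> and the modules U are universally quantified, so the
  bijection and the endomorphism rings are described for every choice of U(m) and of the isomorphism
  from B/Bm to E(m). Given simple modules and division rings may live over arbitrary types, while
  \<open>simple_classes\<close> and \<open>Prim\<close> use the fixed universe.\<close>

theorem corollary4p3:
  fixes K :: "('a, 'z) ring_scheme" and q :: 'a and n :: nat
  assumes "field K" and "primitive_root_of_unity K n q" and "2 \<le> n"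
  shows
    "Prim (qt K q) = MaxIdeals (qt K q) \<and>
     MaxIdeals (qt K q) = qtBm K q ` MaxIdeals (qtZ K q)

     \<and> (\<forall>m\<in>MaxIdeals (qtZ K q).
          let k = residue_field K q m; A = qt_factor K q m; \<phi> = factor_scalar K q m;
              h = qt_proj K q m (qt_h K); x = qt_proj K q m (qt_x K);
              s = residue_s K q n m
          in
          is_localization A (regular_elements A) A (\<lambda>y. y) \<and>
          (\<forall>y\<in>carrier A. \<exists>!c. c \<in> {..<n} \<times> {..<n} \<rightarrow>\<^sub>E carrier k \<and>
             y = (\<Oplus>\<^bsub>A\<^esub>p\<in>{..<n} \<times> {..<n}.
                    \<phi> (c p) \<otimes>\<^bsub>A\<^esub> (h [^]\<^bsub>A\<^esub> fst p \<otimes>\<^bsub>A\<^esub> x [^]\<^bsub>A\<^esub> snd p))) \<and>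
          alg_iso k A \<phi>
            (tensor_algebra (qtZ K q) k (residue K q m) (qt K q) (\<lambda>z. z))
            (\<lambda>c. pure_tensor (qtZ K q) k (residue K q m) (qt K q) (\<lambda>z. z) c \<one>\<^bsub>qt K q\<^esub>) \<noteq> {} \<and>
          central_simple_algebra k \<phi> A (n\<^sup>2) \<and>
          canonical_isos K q n m \<noteq> {} \<and>
          (\<exists>f\<in>alg_iso k (radical_algebra k n s) (radical_scalar k n s)
                 (laurent_radical_algebra k n s) (laurent_radical_scalar k n s).
             f (radical_h k n s) = laurent_radical_h k n s) \<and>
          is_cyclic_over_radical k n (residue_q K q m) s (residue_t K q n m) \<and>
          (\<exists>V :: ((gen list \<Rightarrow> 'a qt set) set, (gen list \<Rightarrow> 'a qt set) set set) module.
             simple_module (qtE K q n m) V) \<and>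
          (\<forall>(V :: ((gen list \<Rightarrow> 'a qt set) set, 'u) module)
            (W :: ((gen list \<Rightarrow> 'a qt set) set, 'v) module).
             simple_module (qtE K q n m) V \<and> simple_module (qtE K q n m) W \<longrightarrow>
             module_isomorphic (qtE K q n m) V W))

     \<and> (\<forall>M :: ('a qt, 'v) module. simple_module (qt K q) M \<longrightarrow>
          finite_dimensional K (restrict_scalars (qt_scalar K) M))

     \<and> (\<forall>(\<Psi> :: 'a qt set \<Rightarrow> 'a qt set \<Rightarrow> (gen list \<Rightarrow> 'a qt set) set)
         (U :: 'a qt set \<Rightarrow> ((gen list \<Rightarrow> 'a qt set) set, 'u) module).
          (\<forall>m\<in>MaxIdeals (qtZ K q).
             \<Psi> m \<in> canonical_isos K q n m \<and> simple_module (qtE K q n m) (U m)) \<longrightarrow>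
          (let UB = (\<lambda>m. as_qt_module K q m (\<Psi> m) (U m)) in
           simple_classes (qt K q) = (\<lambda>m. iso_class (qt K q) (UB m)) ` MaxIdeals (qtZ K q) \<and>
           (\<forall>M :: ('a qt, 'v) module. simple_module (qt K q) M \<longrightarrow>
              (\<exists>m\<in>MaxIdeals (qtZ K q). module_isomorphic (qt K q) M (UB m)))

           \<and> (\<forall>M :: ('a qt, 'v) module. simple_module (qt K q) M \<longrightarrow>
                class_annihilator (qt K q) (iso_class (qt K q) M) = annihilator (qt K q) M) \<and>
           bij_betw (class_annihilator (qt K q)) (simple_classes (qt K q)) (Prim (qt K q)) \<and>
           (\<forall>m\<in>MaxIdeals (qtZ K q).
              inv_into (simple_classes (qt K q)) (class_annihilator (qt K q)) (qtBm K q m) =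
              iso_class (qt K q) (UB m))

           \<and> (\<forall>m\<in>MaxIdeals (qtZ K q).
                (\<exists>d (D :: (gen list \<Rightarrow> 'a qt set) set ring). is_division_ring D \<and>
                   qtE K q n m \<simeq> matrix_ring d D \<and> module_End (qt K q) (UB m) \<simeq> D) \<and>
                (\<forall>d (D :: 'd ring). is_division_ring D \<and>
                   qtE K q n m \<simeq> matrix_ring d D \<longrightarrow> module_End (qt K q) (UB m) \<simeq> D))))"
proof -
  interpret qtorus K q n
    using assms by (simp add: qtorus_def qtorus_axioms_def)
  let "_ \<and> _ \<and> (\<forall>m\<in>_. ?F m) \<and> _ \<and> (\<forall>\<Psi> U. _ \<longrightarrow> ?G \<Psi> U)" = ?thesis
  have PM: "Prim (qt K q) = MaxIdeals (qt K q)" unfolding Prim_qt MaxIdeals_qt ..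
  have F: "?F m" if mM: "m \<in> MaxIdeals (qtZ K q)" for m
  proof -
    interpret qtmax K q n m by (rule qtmaxI[OF mM])
    obtain f where "f \<in> alg_iso k Rd.RA Rd.rsc Rd.LA Rd.lsc" "f Rd.rh = Rd.lh" by (rule RA_to_LA)
    then have f: "\<exists>f\<in>alg_iso k Rd.RA Rd.rsc Rd.LA Rd.lsc. f Rd.rh = Rd.lh" by blast
    have V: "\<exists>V :: ((gen list \<Rightarrow> 'a qt set) set, (gen list \<Rightarrow> 'a qt set) set set) module. simple_module EE V"
      by (rule simple_artinian_simple_module[OF EE_simple EE_artinian])
    have VW: "\<forall>(V :: ((gen list \<Rightarrow> 'a qt set) set, 'u) module) (W :: ((gen list \<Rightarrow> 'a qt set) set, 'v) module).
        simple_module EE V \<and> simple_module EE W \<longrightarrow> module_isomorphic EE V W"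
      using simple_modules_isomorphic[OF EE_simple EE_artinian] by blast
    show ?thesis unfolding Let_def
      by (intro conjI ballI localization_self[OF A.ring_axioms A_artinian] A_basis tensor_iso A_central_simple
          canonical_isos_nonempty f cyclic_over_radical V VW)
  qed
  have fd: "finite_dimensional K (restrict_scalars (qt_scalar K) M)" if "simple_module (qt K q) M"
    for M :: "('a qt, 'v) module"
  proof -
    interpret simple_qt_module K q n M using that by (simp add: simple_qt_module_def simple_qt_module_axioms_def qtorus_axioms)
    show ?thesis by (rule finite_dim)
  qed
  have G: "?G \<Psi> U"
    if U: "\<forall>m\<in>MaxIdeals (qtZ K q). \<Psi> m \<in> canonical_isos K q n m \<and> simple_module (qtE K q n m) (U m)" for \<Psi> U
  proof -
    have D: "\<exists>d (D :: (gen list \<Rightarrow> 'a qt set) set ring). is_division_ring D \<and> qtE K q n m \<simeq> matrix_ring d D \<and>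
        module_End (qt K q) (UB \<Psi> U m) \<simeq> D" if mM: "m \<in> MaxIdeals (qtZ K q)" for m
    proof -
      interpret qtmax K q n m by (rule qtmaxI[OF mM])
      obtain d and D :: "(gen list \<Rightarrow> 'a qt set) set ring" where D: "is_division_ring D" "EE \<simeq> matrix_ring d D"
        by (rule wedderburn[OF EE_simple EE_artinian])
      show ?thesis using D End_UB[OF U mM D] by blast
    qed
    have E: "\<forall>d (D :: 'd ring). is_division_ring D \<and> qtE K q n m \<simeq> matrix_ring d D \<longrightarrow>
        module_End (qt K q) (UB \<Psi> U m) \<simeq> D" if "m \<in> MaxIdeals (qtZ K q)" for m
      using End_UB[OF U that] by blast
    have S: "\<forall>M :: ('a qt, 'v) module. simple_module (qt K q) M \<longrightarrow>
        (\<exists>m\<in>MaxIdeals (qtZ K q). module_isomorphic (qt K q) M (UB \<Psi> U m))"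
      "\<forall>M :: ('a qt, 'v) module. simple_module (qt K q) M \<longrightarrow>
        class_annihilator (qt K q) (iso_class (qt K q) M) = annihilator (qt K q) M"
      using simple_module_UB[OF U] class_annihilator_eq by blast+
    show ?thesis unfolding Let_def
      by (intro conjI ballI simple_classes_UB[OF U] S class_annihilator_bij[OF U] inv_class_annihilator[OF U] D E)
  qed
  have 1: "\<forall>m\<in>MaxIdeals (qtZ K q). ?F m" by (rule ballI) (rule F)
  have 2: "\<forall>M :: ('a qt, 'v) module. simple_module (qt K q) M \<longrightarrow>
      finite_dimensional K (restrict_scalars (qt_scalar K) M)" using fd by blast
  have 3: "\<forall>\<Psi> U. (\<forall>m\<in>MaxIdeals (qtZ K q). \<Psi> m \<in> canonical_isos K q n m \<and> simple_module (qtE K q n m) (U m)) \<longrightarrow> ?G \<Psi> U"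
    by (intro allI impI) (rule G)
  show ?thesis by (rule conjI[OF PM conjI[OF MaxIdeals_qt conjI[OF 1 conjI[OF 2 3]]]])
qed

end
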